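(* Let $a>0$, $b>0$ and $0<t<1$. Then there is a unique minimizer $(\mu_1,\mu_2,\mu_3)$ of the energy functional $E$ among all triples $(\nu_1,\nu_2,\nu_3)$ satisfying (E1), (E2), (E3). The minimizing measures satisfy: (a) The support of $\mu_1$ is $(-\infty,0]$ and there exists $r_1\ge 0$ such that $\operatorname{supp}(\rho_1-\mu_1)=(-\infty,-r_1]$. If $r_1>0$, the density of $\rho_1-\mu_1$ vanishes like a square root at $-r_1$. (b) The support of $\mu_2$ is bounded and there exist $0\le p<q$ such that $\operatorname{supp}(\mu_2)=[p,q]$; $\mu_2$ has a density which is real analytic in $(p,q)$ and vanishes like a square root at $q$, and also at $p$ if $p>0$. (c) The support of $\mu_3$ is $(-\infty,0]$ and there exists $r_3\ge 0$ such that $\operatorname{supp}(\rho_3-\mu_3)=(-\infty,-r_3]$. If $r_3>0$, the density of $\rho_3-\mu_3$ vanishes like a square root at $-r_3$.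
   Context: For finite positive Borel measures on $\mathbb R$ write $I(\mu)=\iint\log\frac{1}{|x-y|}\,d\mu(x)d\mu(y)$ and $I(\mu,\nu)=\iint\log\frac{1}{|x-y|}\,d\mu(x)d\nu(y)$. Fix $a>0$, $b>0$, $0<t<1$, and let $V(x)=\frac{x}{t(1-t)}-\frac{2\sqrt{ax}}{t}-\frac{2\sqrt{bx}}{1-t}$ for $x\ge 0$. Let $\rho_1$ and $\rho_3$ be the measures on $\mathbb R^-=(-\infty,0]$ with densities $\frac{d\rho_1}{dx}=\frac{\sqrt a}{\pi t}|x|^{-1/2}$ and $\frac{d\rho_3}{dx}=\frac{\sqrt b}{\pi(1-t)}|x|^{-1/2}$. The energy functional is $E(\nu_1,\nu_2,\nu_3)=I(\nu_1)+I(\nu_2)+I(\nu_3)-I(\nu_1,\nu_2)-I(\nu_2,\nu_3)+\int V\,d\nu_2$. The admissibility conditions are: (E1) $\nu_1$ is a positive measure on $\mathbb R^-$ of total mass $1/2$ with $\nu_1\le\rho_1$; (E2) $\nu_2$ is a probability measure on $\mathbb R^+=[0,\infty)$; (E3) $\nu_3$ is a positive measure on $\mathbb R^-$ of total mass $1/2$ with $\nu_3\le\rho_3$. *)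

theory Defs
  imports "HOL-Analysis.Analysis"
begin

definition borel_meas :: "real measure \<Rightarrow> bool" where
  "borel_meas \<mu> \<longleftrightarrow> sets \<mu> = sets borel"

definition logker :: "real \<times> real \<Rightarrow> real" where
  "logker p = ln (1 / \<bar>fst p - snd p\<bar>)"

text \<open>The mutual logarithmic energy I(mu,nu) is well defined (finite): the kernel is
  absolutely integrable w.r.t. the product measure and the diagonal (where the kernel is
  +infinity) is a null set.\<close>
definition log_finite :: "real measure \<Rightarrow> real measure \<Rightarrow> bool" where
  "log_finite \<mu> \<nu> \<longleftrightarrow> integrable (\<mu> \<Otimes>\<^sub>M \<nu>) logker
      \<and> emeasure (\<mu> \<Otimes>\<^sub>M \<nu>) {p. fst p = snd p} = 0"

definition logI :: "real measure \<Rightarrow> real measure \<Rightarrow> real" where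
  "logI \<mu> \<nu> = (\<integral>p. logker p \<partial>(\<mu> \<Otimes>\<^sub>M \<nu>))"

definition extV :: "real \<Rightarrow> real \<Rightarrow> real \<Rightarrow> real \<Rightarrow> real" where
  "extV a b t x = x / (t * (1 - t)) - 2 * sqrt (a * x) / t - 2 * sqrt (b * x) / (1 - t)"

definition rho :: "real \<Rightarrow> real measure" where
  "rho c = density lborel (\<lambda>x. ennreal (indicator {..0} x * (c / pi) * \<bar>x\<bar> powr (-1/2)))"

definition rho1 :: "real \<Rightarrow> real \<Rightarrow> real measure" where
  "rho1 a t = rho (sqrt a / t)"

definition rho3 :: "real \<Rightarrow> real \<Rightarrow> real measure" where
  "rho3 b t = rho (sqrt b / (1 - t))"

definition energy :: "real \<Rightarrow> real \<Rightarrow> real \<Rightarrow> real measure \<Rightarrow> real measure \<Rightarrow> real measure \<Rightarrow> real" where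
  "energy a b t \<nu>1 \<nu>2 \<nu>3 = logI \<nu>1 \<nu>1 + logI \<nu>2 \<nu>2 + logI \<nu>3 \<nu>3 - logI \<nu>1 \<nu>2 - logI \<nu>2 \<nu>3
      + (\<integral>x. extV a b t x \<partial>\<nu>2)"

definition finite_energy :: "real \<Rightarrow> real \<Rightarrow> real \<Rightarrow> real measure \<Rightarrow> real measure \<Rightarrow> real measure \<Rightarrow> bool" where
  "finite_energy a b t \<nu>1 \<nu>2 \<nu>3 \<longleftrightarrow> log_finite \<nu>1 \<nu>1 \<and> log_finite \<nu>2 \<nu>2 \<and> log_finite \<nu>3 \<nu>3
      \<and> log_finite \<nu>1 \<nu>2 \<and> log_finite \<nu>2 \<nu>3 \<and> integrable \<nu>2 (extV a b t)"

definition cond_neg :: "real measure \<Rightarrow> real measure \<Rightarrow> bool" where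
  "cond_neg \<rho> \<nu> \<longleftrightarrow> borel_meas \<nu> \<and> emeasure \<nu> {0<..} = 0 \<and> emeasure \<nu> UNIV = ennreal (1/2)
      \<and> (\<forall>A \<in> sets borel. emeasure \<nu> A \<le> emeasure \<rho> A)"

definition cond_pos :: "real measure \<Rightarrow> bool" where
  "cond_pos \<nu> \<longleftrightarrow> borel_meas \<nu> \<and> emeasure \<nu> {..<0} = 0 \<and> emeasure \<nu> UNIV = 1"

definition admissible :: "real \<Rightarrow> real \<Rightarrow> real \<Rightarrow> real measure \<Rightarrow> real measure \<Rightarrow> real measure \<Rightarrow> bool" where
  "admissible a b t \<nu>1 \<nu>2 \<nu>3 \<longleftrightarrow> cond_neg (rho1 a t) \<nu>1 \<and> cond_pos \<nu>2 \<and> cond_neg (rho3 b t) \<nu>3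
      \<and> finite_energy a b t \<nu>1 \<nu>2 \<nu>3"

definition is_minimizer :: "real \<Rightarrow> real \<Rightarrow> real \<Rightarrow> real measure \<Rightarrow> real measure \<Rightarrow> real measure \<Rightarrow> bool" where
  "is_minimizer a b t \<mu>1 \<mu>2 \<mu>3 \<longleftrightarrow> admissible a b t \<mu>1 \<mu>2 \<mu>3 \<and>
     (\<forall>\<nu>1 \<nu>2 \<nu>3. admissible a b t \<nu>1 \<nu>2 \<nu>3 \<longrightarrow> energy a b t \<mu>1 \<mu>2 \<mu>3 \<le> energy a b t \<nu>1 \<nu>2 \<nu>3)"

definition supp_of :: "(real set \<Rightarrow> ennreal) \<Rightarrow> real set" where
  "supp_of m = {x. \<forall>e>0. m (ball x e) > 0}"

definition is_density :: "(real \<Rightarrow> real) \<Rightarrow> (real set \<Rightarrow> ennreal) \<Rightarrow> bool" where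
  "is_density g m \<longleftrightarrow> g \<in> borel_measurable borel \<and> (\<forall>x. g x \<ge> 0) \<and>
     (\<forall>A \<in> sets borel. m A = (\<integral>\<^sup>+ x. ennreal (g x) * indicator A x \<partial>lborel))"

definition real_analytic_on :: "(real \<Rightarrow> real) \<Rightarrow> real set \<Rightarrow> bool" where
  "real_analytic_on f S \<longleftrightarrow> (\<forall>x0 \<in> S. \<exists>d>0. \<exists>c :: nat \<Rightarrow> real.
      \<forall>x. \<bar>x - x0\<bar> < d \<longrightarrow> (\<lambda>n. c n * (x - x0) ^ n) sums f x)"

end

theory Submission
  imports Defs "HOL-Probability.Probability" "HOL-Complex_Analysis.Complex_Analysis" "HOL-Real_Asymp.Real_Asymp"
begin

text \<open>The minimizer is written down explicitly. The equilibrium problem lives on a four-sheeted genus 0 surface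
  \<open>z = f \<tau>\<close>, with \<open>f\<close> a Laurent polynomial of degree 2, and a rational function \<open>s\<close> on it provides the candidate
  densities as imaginary parts of its branches over the real line. A Nevanlinna-type reconstruction from boundary values turns the
  branches into Stieltjes transforms, which gives the masses, the positivity and the potentials; the Euler--Lagrange
  (in)equalities become the monotonicity of the real part of a primitive of \<open>s f'\<close> along the real branches. The inversion
  \<open>\<tau> \<mapsto> 1 / \<tau>\<close> exchanges the two constrained measures, so only one of them needs to be analysed. Finally
  \<open>ln |x|\<close> is a superposition of Gaussians, so the quadratic part of the energy is positive definite on differences of
  equal mass, and the Euler--Lagrange conditions yield minimality and uniqueness.\<close>

section \<open>Positive definiteness of the logarithmic kernel\<close>

text \<open>The function \<open>s\<close> on the curve encodes the measures: on sheet 1 it is the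
  Stieltjes transform of \<open>\<mu>1\<close> minus \<alpha>/sqrt z, and the sum over sheets 1 and
  2 is the transform of \<open>\<mu>2\<close>. Since \<open>s\<close> maps the upper half plane to
  itself, the slack of the constraint and the density of \<open>\<mu>2\<close> are visibly positive.
  The obstacle is the other half of the constraint, positivity of \<open>\<mu>1\<close> itself: its
  density is a difference of two terms of equal order. It is obtained from a second function,
  \<open>csqrt z * (xi 1 z - xi 2 z) + 2 * \<alpha>\<close>, whose boundary imaginary part is
  nonnegative. The choice of curve depends on the parameters. If 2\<alpha>\<beta> < \<gamma>,
  \<open>s\<close> has one pole, at 1, and according to whether 1 is the critical point
  \<open>c1\<close>, \<open>c2\<close> or \<open>c3\<close> the edge r1, p or r3 is 0. If \<gamma>
  \<le> 2\<alpha>\<beta>, the poles are at \<open>c1\<close> and \<open>c3\<close>, both lying over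
  0, and f is a perfect square; these poles merge exactly when \<alpha> = \<beta> and \<gamma> =
  2\<alpha>^2. In each case \<open>s\<close> determines \<open>f\<close> through the relation
  \<open>sq\<close>.\<close>

lemma nn_frullani:
  fixes a b :: real
  assumes "0 < a" "a \<le> b"
  shows "(\<integral>\<^sup>+u. ennreal (indicator {0<..} u * ((exp (-(u*a)) - exp (-(u*b))) / u)) \<partial>lborel) = ennreal (ln b - ln a)"
proof -
  have "(\<integral>\<^sup>+u. ennreal (indicator {0<..} u * ((exp (-(u*a)) - exp (-(u*b))) / u)) \<partial>lborel)
      = (\<integral>\<^sup>+u. (\<integral>\<^sup>+s. ennreal (exp (-(u * s))) * indicator {a..b} s * indicator {0..} u \<partial>lborel) \<partial>lborel)"
  proof (rule nn_integral_cong_AE)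
    have "AE u in lborel. u \<noteq> (0::real)" by (rule AE_lborel_singleton)
    then show "AE u in lborel. ennreal (indicator {0<..} u * ((exp (-(u*a)) - exp (-(u*b))) / u))
        = (\<integral>\<^sup>+s. ennreal (exp (-(u * s))) * indicator {a..b} s * indicator {0..} u \<partial>lborel)"
    proof eventually_elim
      case (elim u)
      show ?case
      proof (cases "u > 0")
        case True
        have "(\<integral>\<^sup>+s. ennreal (exp (-(u * s))) * indicator {a..b} s \<partial>lborel)
            = ennreal ((\<lambda>s. - exp (-(u * s)) / u) b - (\<lambda>s. - exp (-(u * s)) / u) a)"
          by (rule nn_integral_FTC_Icc) (use assms True in \<open>auto intro!: derivative_eq_intros\<close>)
        then show ?thesis using True by (simp add: field_simps)
      qed (use elim in auto)
    qed
  qed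
  \<comment> \<open>Tonelli: the difference quotient has been written as the integral of
    \<open>exp (-(u * s))\<close> over \<open>s\<close> in \<open>{a..b}\<close>; integrating in
    \<open>u\<close> first leaves \<open>1/s\<close>.\<close>
  also have "\<dots> = (\<integral>\<^sup>+s. (\<integral>\<^sup>+u. ennreal (exp (-(u * s))) * indicator {a..b} s * indicator {0..} u \<partial>lborel) \<partial>lborel)"
    by (rule lborel_pair.Fubini') measurable
  also have "\<dots> = (\<integral>\<^sup>+s. ennreal (1/s) * indicator {a..b} s \<partial>lborel)"
  proof (rule nn_integral_cong)
    fix s :: real
    show "(\<integral>\<^sup>+u. ennreal (exp (-(u * s))) * indicator {a..b} s * indicator {0..} u \<partial>lborel) = ennreal (1/s) * indicator {a..b} s"
    proof (cases "s \<in> {a..b}")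
      case True
      then have s: "s > 0" using assms by auto
      have "(\<integral>\<^sup>+u. ennreal (exp (-(u * s))) * indicator {0..} u \<partial>lborel) = ennreal (0 - (\<lambda>u. - exp (-(u * s)) / s) 0)"
      proof (rule nn_integral_FTC_atLeast)
        show "((\<lambda>u. - exp (-(u * s)) / s) \<longlongrightarrow> 0) at_top" using s by real_asymp
      qed (use s in \<open>auto intro!: derivative_eq_intros\<close>)
      then show ?thesis using True by simp
    qed simp
  qed
  also have "\<dots> = ennreal (ln b - ln a)"
    by (rule nn_integral_FTC_Icc) (use assms in \<open>auto intro!: derivative_eq_intros\<close>)
  finally show ?thesis .
qed

text \<open>Frullani integrand for \<open>ln X\<close>. It will be used with X = (x - y)^2, where
  \<open>exp (-(u * X))\<close> becomes a Gaussian.\<close>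

definition frul :: "real \<Rightarrow> real \<Rightarrow> real" where
  "frul u X = indicator {0<..} u * ((exp (-u) - exp (-(u*X))) / u)"

lemma frul_measurable [measurable]: "case_prod frul \<in> borel_measurable (borel \<Otimes>\<^sub>M borel)"
  unfolding frul_def by measurable

text \<open>For fixed \<open>X\<close> the integrand has one sign in \<open>u\<close>, nonnegative
  for X \<ge> 1 and nonpositive below. Its absolute value therefore integrates exactly to |ln X|,
  which is what Fubini asks for later.\<close>

lemma frul_integral:
  assumes "X > 0"
  shows "integrable lborel (\<lambda>u. frul u X)" "(\<integral>u. frul u X \<partial>lborel) = ln X"
    "(\<integral>u. norm (frul u X) \<partial>lborel) = \<bar>ln X\<bar>"
proof -
  have A: "has_bochner_integral lborel (\<lambda>u. frul u X) (ln X) \<and> (\<integral>u. norm (frul u X) \<partial>lborel) = \<bar>ln X\<bar>"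
  proof (cases "X \<ge> 1")
    case True
    have nn: "frul u X \<ge> 0" for u
      using True by (auto simp: frul_def indicator_def field_simps)
    have "has_bochner_integral lborel (\<lambda>u. frul u X) (ln X)"
    proof (rule has_bochner_integral_nn_integral)
      show "(\<integral>\<^sup>+u. ennreal (frul u X) \<partial>lborel) = ennreal (ln X)"
        using nn_frullani[of 1 X] True by (simp add: frul_def)
    qed (use True nn in auto)
    then show ?thesis using nn True by (simp add: has_bochner_integral_iff)
  next
    case False
    have nn: "- frul u X \<ge> 0" for u
      using False by (auto simp: frul_def indicator_def field_simps)
    have "has_bochner_integral lborel (\<lambda>u. - frul u X) (- ln X)"
    proof (rule has_bochner_integral_nn_integral)
      have "(\<integral>\<^sup>+u. ennreal (- frul u X) \<partial>lborel)
         = (\<integral>\<^sup>+u. ennreal (indicator {0<..} u * ((exp (-(u*X)) - exp (-(u*1))) / u)) \<partial>lborel)"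
        by (rule nn_integral_cong) (auto simp: frul_def indicator_def diff_divide_distrib)
      then show "(\<integral>\<^sup>+u. ennreal (- frul u X) \<partial>lborel) = ennreal (- ln X)"
        using nn_frullani[of X 1] False assms by simp
    qed (use False nn assms in auto)
    then have B: "has_bochner_integral lborel (\<lambda>u. frul u X) (ln X)"
      using has_bochner_integral_minus by fastforce
    have "norm (frul u X) = - frul u X" for u using nn[of u] by simp
    then show ?thesis using B False assms by (simp add: has_bochner_integral_iff)
  qed
  show "integrable lborel (\<lambda>u. frul u X)" "(\<integral>u. frul u X \<partial>lborel) = ln X"
    "(\<integral>u. norm (frul u X) \<partial>lborel) = \<bar>ln X\<bar>"
    using A by (auto simp: has_bochner_integral_iff)
qed

lemma logker_eq: "fst p \<noteq> snd p \<Longrightarrow> ln ((fst p - snd p)\<^sup>2) = - 2 * logker p"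
proof -
  assume "fst p \<noteq> snd p"
  then have "ln (\<bar>fst p - snd p\<bar>\<^sup>2) = 2 * ln \<bar>fst p - snd p\<bar>" by (subst ln_realpow) auto
  then show ?thesis using \<open>fst p \<noteq> snd p\<close> by (simp add: logker_def ln_div)
qed

lemma logker_measurable [measurable]: "logker \<in> borel_measurable (borel \<Otimes>\<^sub>M borel)"
  unfolding logker_def[abs_def] by measurable

section \<open>The logarithmic energy as a superposition of Gaussian energies\<close>

definition gaussG :: "real measure \<Rightarrow> real measure \<Rightarrow> real \<Rightarrow> real" where
  "gaussG \<mu> \<nu> u = (\<integral>p. exp (-(u * (fst p - snd p)\<^sup>2)) \<partial>(\<mu> \<Otimes>\<^sub>M \<nu>))"

text \<open>The Frullani integral at X = (x - y)^2 represents -2 \<open>logker\<close> off the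
  diagonal, and Fubini moves the measures inside. Both parts of \<open>log_finite\<close> enter:
  integrability of the kernel, and the null diagonal, where \<open>logker\<close> is 0 by convention
  and the representation fails. The mass term keeps the \<open>u\<close>-integral convergent at 0;
  it cancels in differences of equal mass.\<close>

lemma logI_gauss:
  assumes "finite_measure \<mu>" "finite_measure \<nu>" and [measurable_cong]: "sets \<mu> = sets borel" "sets \<nu> = sets borel"
    and lf: "log_finite \<mu> \<nu>"
  defines "g \<equiv> \<lambda>u. indicator {0<..} u * ((measure \<mu> UNIV * measure \<nu> UNIV * exp (-u) - gaussG \<mu> \<nu> u) / u)"
  shows "integrable lborel g" "logI \<mu> \<nu> = - (1/2) * (\<integral>u. g u \<partial>lborel)"
proof -
  interpret M: finite_measure \<mu> by fact
  interpret N: finite_measure \<nu> by fact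
  interpret MN: pair_sigma_finite \<mu> \<nu> ..
  let ?P = "\<mu> \<Otimes>\<^sub>M \<nu>"
  have finP: "finite_measure ?P"
    using finite_measure_pair_measure[OF assms(2,1)] .
  interpret P: finite_measure ?P by (rule finP)
  interpret PL: pair_sigma_finite ?P lborel ..
  have spP: "space ?P = UNIV" using sets_eq_imp_space_eq[OF assms(3)] sets_eq_imp_space_eq[OF assms(4)]
    by (simp add: space_pair_measure)
  have mP: "measure ?P UNIV = measure \<mu> UNIV * measure \<nu> UNIV"
  proof -
    have "emeasure ?P (UNIV \<times> UNIV) = emeasure \<mu> UNIV * emeasure \<nu> UNIV"
      by (rule N.emeasure_pair_measure_Times) (simp_all add: assms)
    then show ?thesis by (simp add: measure_def enn2real_mult)
  qed
  have int: "integrable ?P logker" and diag: "emeasure ?P {p. fst p = snd p} = 0"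
    using lf by (auto simp: log_finite_def)
  have AE: "AE p in ?P. fst p \<noteq> snd p"
  proof (rule AE_I')
    have "{p \<in> space ?P. fst p = snd p} \<in> sets ?P" by measurable
    then show "{p. fst p = snd p} \<in> null_sets ?P"
      using diag by (auto simp: null_sets_def spP)
  qed auto
  let ?f = "\<lambda>p u. frul u ((fst p - snd p)\<^sup>2)"
  have fi: "integrable (?P \<Otimes>\<^sub>M lborel) (case_prod ?f)"
  proof (rule PL.Fubini_integrable)
    show "(\<lambda>(p,u). ?f p u) \<in> borel_measurable (?P \<Otimes>\<^sub>M lborel)" by measurable
    show "integrable ?P (\<lambda>p. \<integral>u. norm (case_prod ?f (p,u)) \<partial>lborel)"
    proof (rule integrable_cong_AE_imp)
      show "integrable ?P (\<lambda>p. 2 * \<bar>logker p\<bar>)" using int by simp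
      show "AE p in ?P. 2 * \<bar>logker p\<bar> = (\<integral>u. norm (case_prod ?f (p,u)) \<partial>lborel)"
        using AE
      proof eventually_elim
        case (elim p)
        then show ?case using frul_integral(3)[of "(fst p - snd p)\<^sup>2"] logker_eq[of p] by (simp add: abs_mult)
      qed
    qed measurable
    show "AE p in ?P. integrable lborel (\<lambda>u. case_prod ?f (p,u))"
      using AE
    proof eventually_elim
      case (elim p)
      then show ?case using frul_integral(1)[of "(fst p - snd p)\<^sup>2"] by simp
    qed
  qed
  have inner: "(\<integral>p. ?f p u \<partial>?P) = g u" for u
  proof -
    have i2: "integrable ?P (\<lambda>p. exp (-(u * (fst p - snd p)\<^sup>2)))" if "u > 0"
    proof (rule P.integrable_const_bound[where B=1])
      show "AE x in ?P. norm (exp (- (u * (fst x - snd x)\<^sup>2))) \<le> 1"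
        using that by (auto intro!: AE_I2)
    qed measurable
    have i1: "integrable ?P (\<lambda>p. exp (- u))" by simp
    have "(\<integral>p. exp (-u) - exp (-(u * (fst p - snd p)\<^sup>2)) \<partial>?P) = measure \<mu> UNIV * measure \<nu> UNIV * exp (-u) - gaussG \<mu> \<nu> u" if "u > 0"
      unfolding gaussG_def
      by (subst Bochner_Integration.integral_diff[OF i1 i2[OF that]]) (simp add: spP mP)
    then show ?thesis
      by (cases "u > 0") (simp_all add: frul_def g_def)
  qed
  show "integrable lborel g" using PL.integrable_snd[OF fi] by (simp add: inner)
  have "(\<integral>u. g u \<partial>lborel) = (\<integral>u. (\<integral>p. ?f p u \<partial>?P) \<partial>lborel)" by (simp add: inner)
  also have "\<dots> = (\<integral>p. (\<integral>u. ?f p u \<partial>lborel) \<partial>?P)" by (rule PL.Fubini_integral[OF fi])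
  also have "\<dots> = (\<integral>p. - 2 * logker p \<partial>?P)"
  proof (rule integral_cong_AE)
    show "AE p in ?P. (\<integral>u. ?f p u \<partial>lborel) = - 2 * logker p"
      using AE
    proof eventually_elim
      case (elim p)
      then show ?case using frul_integral(2)[of "(fst p - snd p)\<^sup>2"] logker_eq[of p] by simp
    qed
  qed measurable
  finally show "logI \<mu> \<nu> = - (1/2) * (\<integral>u. g u \<partial>lborel)" by (simp add: logI_def)
qed

definition gphi :: "real measure \<Rightarrow> real \<Rightarrow> real \<Rightarrow> real" where
  "gphi \<mu> u z = (\<integral>x. exp (-(2 * u * (x - z)\<^sup>2)) \<partial>\<mu>)"

text \<open>Rests on (x-y)^2 + 4(z - (x+y)/2)^2 = 2(x-z)^2 + 2(y-z)^2. Multiplying by a probability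
  density in an auxiliary variable \<open>z\<close> separates \<open>x\<close> from
  \<open>y\<close>.\<close>

lemma gaussian_product:
  fixes u x y z :: real
  assumes "u > 0"
  shows "exp (-(u * (x - y)\<^sup>2)) * normal_density ((x + y)/2) (1 / sqrt (8*u)) z
      = sqrt (4*u/pi) * (exp (-(2*u*(x-z)\<^sup>2)) * exp (-(2*u*(y-z)\<^sup>2)))"
proof -
  have 1: "1 / sqrt (2 * pi * (1 / sqrt (8*u))\<^sup>2) = sqrt (4*u/pi)"
    using assms by (simp add: power_divide real_sqrt_divide real_sqrt_mult field_simps)
  have 2: "(z - (x+y)/2)\<^sup>2 / (2 * (1 / sqrt (8*u))\<^sup>2) = 4 * u * (z - (x+y)/2)\<^sup>2"
    using assms by (simp add: power_divide field_simps)
  have 3: "u * (x - y)\<^sup>2 + 4 * u * (z - (x+y)/2)\<^sup>2 = 2*u*(x-z)\<^sup>2 + 2*u*(y-z)\<^sup>2"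
    by (simp add: power2_eq_square field_simps)
  have "exp (-(u * (x - y)\<^sup>2)) * normal_density ((x + y)/2) (1 / sqrt (8*u)) z
      = sqrt (4*u/pi) * (exp (-(u * (x - y)\<^sup>2)) * exp (-(4 * u * (z - (x+y)/2)\<^sup>2)))"
    unfolding normal_density_def 1 by (simp add: 2 minus_divide_left[symmetric])
  also have "exp (-(u * (x - y)\<^sup>2)) * exp (-(4 * u * (z - (x+y)/2)\<^sup>2)) = exp (-(2*u*(x-z)\<^sup>2)) * exp (-(2*u*(y-z)\<^sup>2))"
    unfolding exp_add[symmetric] using 3 by simp
  finally show ?thesis .
qed

text \<open>The inserted normal density integrates to 1 in \<open>z\<close>, and after Fubini the
  Gaussian energy is an L2 inner product of the smoothed measures \<open>gphi\<close>. This is the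
  source of positivity.\<close>

lemma gaussG_factor:
  assumes "finite_measure \<mu>" "finite_measure \<nu>" and [measurable_cong]: "sets \<mu> = sets borel" "sets \<nu> = sets borel"
    and u: "u > 0"
  shows "integrable lborel (\<lambda>z. gphi \<mu> u z * gphi \<nu> u z)"
    "gaussG \<mu> \<nu> u = sqrt (4*u/pi) * (\<integral>z. gphi \<mu> u z * gphi \<nu> u z \<partial>lborel)"
proof -
  interpret M: finite_measure \<mu> by fact
  interpret N: finite_measure \<nu> by fact
  interpret MN: pair_sigma_finite \<mu> \<nu> ..
  let ?P = "\<mu> \<Otimes>\<^sub>M \<nu>"
  interpret P: finite_measure ?P using finite_measure_pair_measure[OF assms(2,1)] .
  interpret PL: pair_sigma_finite ?P lborel ..
  let ?f = "\<lambda>p z. exp (-(u * (fst p - snd p)\<^sup>2)) * normal_density ((fst p + snd p)/2) (1 / sqrt (8*u)) z"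
  have s: "1 / sqrt (8*u) > 0" using u by simp
  have [measurable]: "case_prod ?f \<in> borel_measurable (?P \<Otimes>\<^sub>M lborel)"
    unfolding normal_density_def by measurable
  have nd: "(\<integral>z. normal_density m (1 / sqrt (8*u)) z \<partial>lborel) = 1" "integrable lborel (normal_density m (1 / sqrt (8*u)))" for m
    using integral_normal_density[OF s] integrable_normal_density[OF s] by auto
  have i: "integrable ?P (\<lambda>p. exp (-(u * (fst p - snd p)\<^sup>2)))"
    by (rule P.integrable_const_bound[where B=1]) (use u in \<open>auto intro!: AE_I2\<close>)
  have fi: "integrable (?P \<Otimes>\<^sub>M lborel) (case_prod ?f)"
    by (rule PL.Fubini_integrable) (use i nd in \<open>auto intro!: AE_I2 simp: abs_mult\<close>)
  have inner: "(\<integral>p. ?f p z \<partial>?P) = sqrt (4*u/pi) * (gphi \<mu> u z * gphi \<nu> u z)" for z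
  proof -
    have b1: "integrable \<mu> (\<lambda>x. exp (-(2*u*(x-z)\<^sup>2)))"
      by (rule M.integrable_const_bound[where B=1]) (use u in \<open>auto intro!: AE_I2\<close>)
    have b2: "integrable \<nu> (\<lambda>x. exp (-(2*u*(x-z)\<^sup>2)))"
      by (rule N.integrable_const_bound[where B=1]) (use u in \<open>auto intro!: AE_I2\<close>)
    have e1: "exp (-(2*u*(x-z)\<^sup>2)) \<le> 1" for x :: real using u by simp
    have b3: "integrable ?P (\<lambda>p. exp (-(2*u*(fst p-z)\<^sup>2)) * exp (-(2*u*(snd p-z)\<^sup>2)))"
      by (rule P.integrable_const_bound[where B=1]) (auto intro!: AE_I2 mult_le_one e1)
    have "(\<integral>p. ?f p z \<partial>?P) = sqrt (4*u/pi) * (\<integral>p. exp (-(2*u*(fst p-z)\<^sup>2)) * exp (-(2*u*(snd p-z)\<^sup>2)) \<partial>?P)"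
      by (simp add: gaussian_product[OF u])
    also have "(\<integral>p. exp (-(2*u*(fst p-z)\<^sup>2)) * exp (-(2*u*(snd p-z)\<^sup>2)) \<partial>?P)
        = (\<integral>x. (\<integral>y. exp (-(2*u*(x-z)\<^sup>2)) * exp (-(2*u*(y-z)\<^sup>2)) \<partial>\<nu>) \<partial>\<mu>)"
      by (subst MN.integral_fst'[OF b3, symmetric]) simp
    also have "\<dots> = gphi \<mu> u z * gphi \<nu> u z" by (simp add: gphi_def)
    finally show ?thesis .
  qed
  have "integrable lborel (\<lambda>z. sqrt (4*u/pi) * (gphi \<mu> u z * gphi \<nu> u z))"
    using PL.integrable_snd[OF fi] by (simp add: inner)
  then show "integrable lborel (\<lambda>z. gphi \<mu> u z * gphi \<nu> u z)"
    using u by simp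
  have "gaussG \<mu> \<nu> u = (\<integral>p. (\<integral>z. ?f p z \<partial>lborel) \<partial>?P)"
    unfolding gaussG_def by (simp add: nd)
  also have "\<dots> = (\<integral>z. (\<integral>p. ?f p z \<partial>?P) \<partial>lborel)" by (rule PL.Fubini_integral[OF fi, symmetric])
  also have "\<dots> = sqrt (4*u/pi) * (\<integral>z. gphi \<mu> u z * gphi \<nu> u z \<partial>lborel)" by (simp add: inner)
  finally show "gaussG \<mu> \<nu> u = sqrt (4*u/pi) * (\<integral>z. gphi \<mu> u z * gphi \<nu> u z \<partial>lborel)" .
qed

section \<open>Injectivity of Gaussian smoothing\<close>

lemma gaussian_fourier_nonzero:
  fixes u t :: real
  assumes u: "u > 0"
  shows "(\<integral>w. iexp (t * w) * complex_of_real (exp (-(2*u*w\<^sup>2))) \<partial>lborel) \<noteq> 0"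
proof -
  \<comment> \<open>Scaling with \<open>2 * u * c^2 = 1/2\<close>: the Gaussian becomes a multiple
    of the standard normal density, whose characteristic function has no zeros.\<close>
  define c where "c = 1 / (2 * sqrt u)"
  have c: "c > 0" "2 * u * c\<^sup>2 = 1/2" using u by (auto simp: c_def power_divide power_mult_distrib)
  have "(\<integral>w. iexp (t * w) * complex_of_real (exp (-(2*u*w\<^sup>2))) \<partial>lborel)
     = \<bar>c\<bar> *\<^sub>R (\<integral>x. iexp (t * (0 + c * x)) * complex_of_real (exp (-(2*u*(0 + c * x)\<^sup>2))) \<partial>lborel)"
    by (rule lborel_integral_real_affine) (use c in auto)
  also have "(\<lambda>x. iexp (t * (0 + c * x)) * complex_of_real (exp (-(2*u*(0 + c * x)\<^sup>2))))
      = (\<lambda>x. complex_of_real (sqrt (2*pi)) * (std_normal_density x *\<^sub>R iexp ((t * c) * x)))"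
  proof
    fix x :: real
    have 1: "2*u*(0 + c * x)\<^sup>2 = x\<^sup>2 / 2"
    proof -
      have "2*u*(0 + c * x)\<^sup>2 = (2 * u * c\<^sup>2) * x\<^sup>2" by (simp add: power_mult_distrib)
      then show ?thesis by (simp only: c(2))
    qed
    have "exp (- (x\<^sup>2 / 2)) = sqrt (2*pi) * std_normal_density x" by (simp add: std_normal_density_def)
    then have 2: "complex_of_real (exp (-(2*u*(0 + c * x)\<^sup>2))) = complex_of_real (sqrt (2*pi)) * complex_of_real (std_normal_density x)"
      unfolding 1 by (simp only: of_real_mult)
    have 3: "t * (0 + c * x) = (t * c) * x" by simp
    show "iexp (t * (0 + c * x)) * complex_of_real (exp (-(2*u*(0 + c * x)\<^sup>2)))
      = complex_of_real (sqrt (2*pi)) * (std_normal_density x *\<^sub>R iexp ((t * c) * x))"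
      unfolding 2 3 scaleR_conv_of_real by (simp only: mult_ac)
  qed
  also have "(\<integral>x. complex_of_real (sqrt (2*pi)) * (std_normal_density x *\<^sub>R iexp ((t * c) * x)) \<partial>lborel)
     = complex_of_real (sqrt (2*pi)) * (\<integral>x. std_normal_density x *\<^sub>R iexp ((t * c) * x) \<partial>lborel)"
    by (rule integral_mult_right_zero)
  also have "(\<integral>x. std_normal_density x *\<^sub>R iexp ((t * c) * x) \<partial>lborel) = char std_normal_distribution (t * c)"
    unfolding char_def by (subst integral_density) auto
  finally show ?thesis using c(1) by (simp add: char_std_normal_distribution)
qed

text \<open>Convolution theorem: \<open>gphi \<mu> u\<close> is \<mu> convolved with a Gaussian, and
  the translation z = x + w separates the two exponentials.\<close>

lemma gphi_fourier:
  assumes "finite_measure \<mu>" and [measurable_cong]: "sets \<mu> = sets borel" and u: "u > 0"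
  shows "(\<integral>z. iexp (t * z) * complex_of_real (gphi \<mu> u z) \<partial>lborel)
     = (\<integral>x. iexp (t * x) \<partial>\<mu>) * (\<integral>w. iexp (t * w) * complex_of_real (exp (-(2*u*w\<^sup>2))) \<partial>lborel)"
proof -
  interpret M: finite_measure \<mu> by fact
  interpret MLb: pair_sigma_finite \<mu> lborel ..
  let ?f = "\<lambda>x z. iexp (t * z) * complex_of_real (exp (-(2*u*(x-z)\<^sup>2)))"
  have s: "1 / (2 * sqrt u) > 0" using u by simp
  have e: "exp (-(2*u*(x-z)\<^sup>2)) = sqrt (pi/(2*u)) * normal_density x (1 / (2 * sqrt u)) z" for x z
  proof -
    have 1: "1 / sqrt (2 * pi * (1 / (2 * sqrt u))\<^sup>2) = sqrt (2*u/pi)"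
      using u by (simp add: power_divide power_mult_distrib real_sqrt_divide real_sqrt_mult field_simps)
    have 2: "(z - x)\<^sup>2 / (2 * (1 / (2 * sqrt u))\<^sup>2) = 2 * u * (x - z)\<^sup>2"
      using u by (simp add: power_divide power_mult_distrib field_simps power2_commute)
    have 3: "sqrt (pi/(2*u)) * sqrt (2*u/pi) = 1" using u by (simp add: real_sqrt_mult[symmetric])
    show ?thesis unfolding normal_density_def 1 using 2 3 by (simp add: minus_divide_left[symmetric] mult.assoc[symmetric])
  qed
  have ei: "integrable lborel (\<lambda>z. exp (-(2*u*(x-z)\<^sup>2)))" "(\<integral>z. exp (-(2*u*(x-z)\<^sup>2)) \<partial>lborel) = sqrt (pi/(2*u))" for x
    using integral_normal_density[OF s] integrable_normal_density[OF s] by (simp_all add: e)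
  have fi: "integrable (\<mu> \<Otimes>\<^sub>M lborel) (case_prod ?f)"
  proof (rule MLb.Fubini_integrable)
    show "integrable \<mu> (\<lambda>x. \<integral>z. norm (case_prod ?f (x,z)) \<partial>lborel)"
      by (simp add: norm_mult ei)
    show "AE x in \<mu>. integrable lborel (\<lambda>z. case_prod ?f (x,z))"
    proof (rule AE_I2)
      fix x
      show "integrable lborel (\<lambda>z. case_prod ?f (x,z))"
        by (rule Bochner_Integration.integrable_bound[OF ei(1)[of x]]) (auto simp: norm_mult)
    qed
  qed measurable
  have "(\<integral>z. iexp (t * z) * complex_of_real (gphi \<mu> u z) \<partial>lborel) = (\<integral>z. (\<integral>x. ?f x z \<partial>\<mu>) \<partial>lborel)"
    by (simp add: gphi_def)
  also have "\<dots> = (\<integral>x. (\<integral>z. ?f x z \<partial>lborel) \<partial>\<mu>)" by (rule MLb.Fubini_integral[OF fi])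
  also have "(\<lambda>x. \<integral>z. ?f x z \<partial>lborel) = (\<lambda>x. iexp (t * x) * (\<integral>w. iexp (t * w) * complex_of_real (exp (-(2*u*w\<^sup>2))) \<partial>lborel))"
  proof
    fix x
    have "(\<integral>z. ?f x z \<partial>lborel) = \<bar>1\<bar> *\<^sub>R (\<integral>w. ?f x (x + 1 * w) \<partial>lborel)"
      by (rule lborel_integral_real_affine) simp
    also have "(\<lambda>w. ?f x (x + 1 * w)) = (\<lambda>w. iexp (t * x) * (iexp (t * w) * complex_of_real (exp (-(2*u*w\<^sup>2)))))"
      by (auto simp: exp_add[symmetric] algebra_simps)
    finally show "(\<integral>z. ?f x z \<partial>lborel) = iexp (t * x) * (\<integral>w. iexp (t * w) * complex_of_real (exp (-(2*u*w\<^sup>2))) \<partial>lborel)"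
      by simp
  qed
  finally show ?thesis by simp
qed

text \<open>A single \<open>u\<close> suffices, because the Fourier transform of the Gaussian can be
  divided out. \<open>Levy_uniqueness\<close> is about probability measures, hence the rescaling by
  the common mass and the separate case of mass 0.\<close>

lemma measure_eq_gphi:
  assumes fin: "finite_measure \<mu>" "finite_measure \<nu>" and sets: "sets \<mu> = sets borel" "sets \<nu> = sets borel"
    and mass: "measure \<mu> UNIV = measure \<nu> UNIV" and u: "u > 0"
    and eq: "AE z in lborel. gphi \<mu> u z = gphi \<nu> u z"
  shows "\<mu> = \<nu>"
proof -
  interpret M: finite_measure \<mu> by fact
  interpret N: finite_measure \<nu> by fact
  note [measurable_cong] = sets
  have sp: "space \<mu> = UNIV" "space \<nu> = UNIV" using sets[THEN sets_eq_imp_space_eq] by auto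
  define m where "m = measure \<mu> UNIV"
  have em: "emeasure \<mu> UNIV = ennreal m" "emeasure \<nu> UNIV = ennreal m"
    using mass by (simp_all add: m_def M.emeasure_eq_measure N.emeasure_eq_measure)
  have ch: "(\<integral>x. iexp (t * x) \<partial>\<mu>) = (\<integral>x. iexp (t * x) \<partial>\<nu>)" for t
  proof -
    have [measurable]: "gphi \<mu> u \<in> borel_measurable borel" "gphi \<nu> u \<in> borel_measurable borel"
      unfolding gphi_def[abs_def] by measurable
    have "(\<integral>z. iexp (t * z) * complex_of_real (gphi \<mu> u z) \<partial>lborel) = (\<integral>z. iexp (t * z) * complex_of_real (gphi \<nu> u z) \<partial>lborel)"
      by (rule integral_cong_AE) (use eq in auto)
    then show ?thesis
      unfolding gphi_fourier[OF fin(1) sets(1) u] gphi_fourier[OF fin(2) sets(2) u]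
      using gaussian_fourier_nonzero[OF u, of t] by simp
  qed
  show ?thesis
  proof (cases "m = 0")
    case True
    have "emeasure \<mu> A = 0 \<and> emeasure \<nu> A = 0" for A
      using em True emeasure_space[of \<mu> A] emeasure_space[of \<nu> A] by (simp add: sp)
    then show ?thesis using sets by (intro measure_eqI) auto
  next
    case False
    then have m: "m > 0" by (simp add: m_def zero_less_measure_iff)
    have D: "real_distribution (density M (\<lambda>_. ennreal (1/m)))" if "sets M = sets borel" "emeasure M UNIV = ennreal m" for M :: "real measure"
    proof -
      have "space M = UNIV" using that sets_eq_imp_space_eq by force
      moreover have "emeasure (density M (\<lambda>_. ennreal (1/m))) UNIV = ennreal (1/m) * ennreal m"
        using that by (subst emeasure_density_const) auto
      ultimately show ?thesis
        using that m by (intro real_distribution.intro prob_spaceI real_distribution_axioms.intro)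
         (auto simp: ennreal_mult[symmetric])
    qed
    have C: "char (density M (\<lambda>_. ennreal (1/m))) = (\<lambda>t. (1/m) *\<^sub>R (\<integral>x. iexp (t * x) \<partial>M))"
      if "sets M = sets borel" for M :: "real measure"
    proof
      fix t :: real
      note [measurable_cong] = that
      show "char (density M (\<lambda>_. ennreal (1/m))) t = (1/m) *\<^sub>R (\<integral>x. iexp (t * x) \<partial>M)"
        unfolding char_def using m by (subst integral_density) auto
    qed
    have E: "density \<mu> (\<lambda>_. ennreal (1/m)) = density \<nu> (\<lambda>_. ennreal (1/m))"
      by (rule Levy_uniqueness) (use D[OF sets(1) em(1)] D[OF sets(2) em(2)] C[OF sets(1)] C[OF sets(2)] ch in auto)
    show ?thesis
    proof (rule measure_eqI)
      show "sets \<mu> = sets \<nu>" using sets by simp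
      fix A assume A: "A \<in> sets \<mu>"
      have "ennreal (1/m) * emeasure \<mu> A = ennreal (1/m) * emeasure \<nu> A"
        using arg_cong[OF E, of "\<lambda>M. emeasure M A"] A sets by (simp add: emeasure_density_const)
      then show "emeasure \<mu> A = emeasure \<nu> A"
        using m by (simp add: ennreal_mult_cancel_left)
    qed
  qed
qed

text \<open>The interaction matrix, with 1 on the diagonal and -1/2 between neighbours, is positive
  definite. Equal masses remove the \<open>exp (-u)\<close> terms, and for every \<open>u\<close>
  what remains is, up to a positive factor and sign, the integral of this matrix form evaluated at
  the smoothed differences.\<close>

theorem energy_form_posdef:
  fixes \<mu>1 \<mu>2 \<mu>3 \<nu>1 \<nu>2 \<nu>3 :: "real measure"
  assumes fin: "finite_measure \<mu>1" "finite_measure \<mu>2" "finite_measure \<mu>3" "finite_measure \<nu>1" "finite_measure \<nu>2" "finite_measure \<nu>3"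
    and sets: "sets \<mu>1 = sets borel" "sets \<mu>2 = sets borel" "sets \<mu>3 = sets borel" "sets \<nu>1 = sets borel" "sets \<nu>2 = sets borel" "sets \<nu>3 = sets borel"
    and mass: "measure \<nu>1 UNIV = measure \<mu>1 UNIV" "measure \<nu>2 UNIV = measure \<mu>2 UNIV" "measure \<nu>3 UNIV = measure \<mu>3 UNIV"
    and lf: "log_finite \<nu>1 \<nu>1" "log_finite \<nu>1 \<mu>1" "log_finite \<mu>1 \<mu>1"
      "log_finite \<nu>2 \<nu>2" "log_finite \<nu>2 \<mu>2" "log_finite \<mu>2 \<mu>2"
      "log_finite \<nu>3 \<nu>3" "log_finite \<nu>3 \<mu>3" "log_finite \<mu>3 \<mu>3"
      "log_finite \<nu>1 \<nu>2" "log_finite \<nu>1 \<mu>2" "log_finite \<mu>1 \<nu>2" "log_finite \<mu>1 \<mu>2"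
      "log_finite \<nu>2 \<nu>3" "log_finite \<nu>2 \<mu>3" "log_finite \<mu>2 \<nu>3" "log_finite \<mu>2 \<mu>3"
  defines "Q \<equiv> (logI \<nu>1 \<nu>1 - 2 * logI \<nu>1 \<mu>1 + logI \<mu>1 \<mu>1) + (logI \<nu>2 \<nu>2 - 2 * logI \<nu>2 \<mu>2 + logI \<mu>2 \<mu>2)
     + (logI \<nu>3 \<nu>3 - 2 * logI \<nu>3 \<mu>3 + logI \<mu>3 \<mu>3)
     - (logI \<nu>1 \<nu>2 - logI \<nu>1 \<mu>2 - logI \<mu>1 \<nu>2 + logI \<mu>1 \<mu>2)
     - (logI \<nu>2 \<nu>3 - logI \<nu>2 \<mu>3 - logI \<mu>2 \<nu>3 + logI \<mu>2 \<mu>3)"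
  shows "Q \<ge> 0" "Q = 0 \<Longrightarrow> \<nu>1 = \<mu>1 \<and> \<nu>2 = \<mu>2 \<and> \<nu>3 = \<mu>3"
proof -
  define g where "g = (\<lambda>\<mu> \<nu> u. indicator {0<..} u * ((measure \<mu> UNIV * measure \<nu> UNIV * exp (-u) - gaussG \<mu> \<nu> u) / u))"
  \<comment> \<open>The quadratic form of the differences \<nu>i - \<mu>i, expanded for an arbitrary
    pairing \<open>h\<close>. One formula thus serves \<open>logI\<close>, the integrand
    \<open>g\<close>, \<open>gaussG\<close> and the products of \<open>gphi\<close>, and signed
    measures are avoided.\<close>
  define F where "F = (\<lambda>h::real measure \<Rightarrow> real measure \<Rightarrow> real. (h \<nu>1 \<nu>1 - 2 * h \<nu>1 \<mu>1 + h \<mu>1 \<mu>1) + (h \<nu>2 \<nu>2 - 2 * h \<nu>2 \<mu>2 + h \<mu>2 \<mu>2)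
     + (h \<nu>3 \<nu>3 - 2 * h \<nu>3 \<mu>3 + h \<mu>3 \<mu>3)
     - (h \<nu>1 \<nu>2 - h \<nu>1 \<mu>2 - h \<mu>1 \<nu>2 + h \<mu>1 \<mu>2)
     - (h \<nu>2 \<nu>3 - h \<nu>2 \<mu>3 - h \<mu>2 \<nu>3 + h \<mu>2 \<mu>3))"
  have gi: "log_finite \<mu> \<nu> \<Longrightarrow> finite_measure \<mu> \<Longrightarrow> finite_measure \<nu> \<Longrightarrow> sets \<mu> = sets borel \<Longrightarrow> sets \<nu> = sets borel
     \<Longrightarrow> integrable lborel (g \<mu> \<nu>) \<and> logI \<mu> \<nu> = - (1/2) * (\<integral>u. g \<mu> \<nu> u \<partial>lborel)" for \<mu> \<nu>
    using logI_gauss[of \<mu> \<nu>] unfolding g_def by blast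
  note G = lf[THEN gi]
  have int: "integrable lborel (\<lambda>u. F (\<lambda>\<mu> \<nu>. g \<mu> \<nu> u))"
    unfolding F_def by (intro Bochner_Integration.integrable_add Bochner_Integration.integrable_diff integrable_mult_right)
      (use G fin sets in auto)
  have FQ: "Q = F logI" by (simp add: Q_def F_def)
  have Qeq: "Q = - (1/2) * (\<integral>u. F (\<lambda>\<mu> \<nu>. g \<mu> \<nu> u) \<partial>lborel)"
    unfolding FQ F_def using G fin sets
    by (simp add: Bochner_Integration.integral_add Bochner_Integration.integral_diff) (simp add: field_simps)
  define d where "d = (\<lambda>\<mu> \<nu> u z. gphi \<nu> u z - gphi \<mu> u z)"
  define S where "S = (\<lambda>u z. (d \<mu>1 \<nu>1 u z)\<^sup>2 + (d \<mu>2 \<nu>2 u z)\<^sup>2 + (d \<mu>3 \<nu>3 u z)\<^sup>2 - d \<mu>1 \<nu>1 u z * d \<mu>2 \<nu>2 u z - d \<mu>2 \<nu>2 u z * d \<mu>3 \<nu>3 u z)"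
  \<comment> \<open>Completed squares that control each of the three components, so that they give
    the equality case as well as the sign.\<close>
  have S_sq: "S u z = (d \<mu>1 \<nu>1 u z - d \<mu>2 \<nu>2 u z / 2)\<^sup>2 + (d \<mu>3 \<nu>3 u z - d \<mu>2 \<nu>2 u z / 2)\<^sup>2 + (d \<mu>2 \<nu>2 u z)\<^sup>2 / 2" for u z
    by (simp add: S_def power2_eq_square field_simps)
  have S_nn: "S u z \<ge> 0" for u z unfolding S_sq by simp
  have GS: "integrable lborel (S u) \<and> F (\<lambda>\<mu> \<nu>. g \<mu> \<nu> u) = - (sqrt (4*u/pi) / u) * (\<integral>z. S u z \<partial>lborel)" if u: "u > 0" for u
  proof -
    note H = gaussG_factor[OF _ _ _ _ u]
    have SF: "S u = (\<lambda>z. F (\<lambda>\<mu> \<nu>. gphi \<mu> u z * gphi \<nu> u z))"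
      by (rule ext) (simp add: S_def d_def F_def power2_eq_square algebra_simps)
    have i: "integrable lborel (S u)"
      unfolding SF F_def
      by (intro Bochner_Integration.integrable_add Bochner_Integration.integrable_diff integrable_mult_right H(1))
        (use fin sets in auto)
    have "(\<integral>z. S u z \<partial>lborel) = F (\<lambda>\<mu> \<nu>. \<integral>z. gphi \<mu> u z * gphi \<nu> u z \<partial>lborel)"
      unfolding SF F_def using fin sets H(1)
      by (simp add: Bochner_Integration.integral_add Bochner_Integration.integral_diff)
    also have "sqrt (4*u/pi) * \<dots> = F (\<lambda>\<mu> \<nu>. gaussG \<mu> \<nu> u)"
      unfolding F_def using fin sets by (simp add: H(2) algebra_simps)
    finally have 1: "sqrt (4*u/pi) * (\<integral>z. S u z \<partial>lborel) = F (\<lambda>\<mu> \<nu>. gaussG \<mu> \<nu> u)" .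
    have "F (\<lambda>\<mu> \<nu>. g \<mu> \<nu> u) = F (\<lambda>\<mu> \<nu>. (measure \<mu> UNIV * measure \<nu> UNIV * exp (-u)) / u - gaussG \<mu> \<nu> u / u)"
      using u by (simp add: g_def diff_divide_distrib)
    \<comment> \<open>The products of total masses form the same quadratic form evaluated at the
      differences of the masses, which are 0.\<close>
    also have "\<dots> = - F (\<lambda>\<mu> \<nu>. gaussG \<mu> \<nu> u) / u"
      unfolding F_def mass by (simp add: algebra_simps add_divide_distrib diff_divide_distrib)
    finally show ?thesis using i 1 by simp
  qed
  have neg: "F (\<lambda>\<mu> \<nu>. g \<mu> \<nu> u) \<le> 0" for u
  proof (cases "u > 0")
    case True
    have "(\<integral>z. S u z \<partial>lborel) \<ge> 0" by (rule Bochner_Integration.integral_nonneg) (rule S_nn)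
    then show ?thesis using GS[OF True] True by simp
  qed (simp add: g_def F_def)
  have Q2: "Q = (1/2) * (\<integral>u. - F (\<lambda>\<mu> \<nu>. g \<mu> \<nu> u) \<partial>lborel)" using Qeq by simp
  show "Q \<ge> 0" unfolding Q2 using neg by (intro mult_nonneg_nonneg Bochner_Integration.integral_nonneg) auto
  assume "Q = 0"
  then have "(\<integral>u. - F (\<lambda>\<mu> \<nu>. g \<mu> \<nu> u) \<partial>lborel) = 0" using Q2 by simp
  then have AE0: "AE u in lborel. - F (\<lambda>\<mu> \<nu>. g \<mu> \<nu> u) = 0"
    by (subst (asm) integral_nonneg_eq_0_iff_AE) (use int neg in auto)
  \<comment> \<open>The form vanishes for almost every \<open>u\<close>; one positive
    \<open>u\<close> is enough by injectivity of the smoothing.\<close>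
  have "\<exists>u>0. F (\<lambda>\<mu> \<nu>. g \<mu> \<nu> u) = 0"
  proof (rule ccontr)
    assume no: "\<not> (\<exists>u>0. F (\<lambda>\<mu> \<nu>. g \<mu> \<nu> u) = 0)"
    have "AE u in lborel. u \<notin> {0<..<(1::real)}" using AE0
    proof eventually_elim
      case (elim u)
      then show ?case using no by auto
    qed
    then have "emeasure lborel {0<..<(1::real)} = 0" 
      by (subst (asm) AE_iff_measurable[OF _ refl]) (auto simp: greaterThanLessThan_def greaterThan_def lessThan_def Int_def)
    then show False by simp
  qed
  then obtain u where u: "u > 0" "F (\<lambda>\<mu> \<nu>. g \<mu> \<nu> u) = 0" by blast
  then have "(\<integral>z. S u z \<partial>lborel) = 0" using GS[OF u(1)] by simp
  then have "AE z in lborel. S u z = 0"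
    by (subst (asm) integral_nonneg_eq_0_iff_AE) (use GS[OF u(1)] S_nn in auto)
  then have "AE z in lborel. d \<mu>1 \<nu>1 u z = 0 \<and> d \<mu>2 \<nu>2 u z = 0 \<and> d \<mu>3 \<nu>3 u z = 0"
  proof eventually_elim
    case (elim z)
    have "(d \<mu>1 \<nu>1 u z - d \<mu>2 \<nu>2 u z / 2)\<^sup>2 \<ge> 0" "(d \<mu>3 \<nu>3 u z - d \<mu>2 \<nu>2 u z / 2)\<^sup>2 \<ge> 0" "(d \<mu>2 \<nu>2 u z)\<^sup>2 \<ge> 0"
      by simp_all
    then have "(d \<mu>2 \<nu>2 u z)\<^sup>2 = 0" using elim unfolding S_sq by linarith
    then have d2: "d \<mu>2 \<nu>2 u z = 0" by simp
    have "(d \<mu>1 \<nu>1 u z)\<^sup>2 + (d \<mu>3 \<nu>3 u z)\<^sup>2 = 0" using elim unfolding S_sq d2 by simp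
    then show ?case using d2 by (simp add: sum_power2_eq_zero_iff)
  qed
  then have "AE z in lborel. gphi \<nu>1 u z = gphi \<mu>1 u z" "AE z in lborel. gphi \<nu>2 u z = gphi \<mu>2 u z" "AE z in lborel. gphi \<nu>3 u z = gphi \<mu>3 u z"
    by (auto simp: d_def)
  then show "\<nu>1 = \<mu>1 \<and> \<nu>2 = \<mu>2 \<and> \<nu>3 = \<mu>3"
    using measure_eq_gphi[OF _ _ _ _ _ u(1)] fin sets mass by blast
qed

section \<open>Weighted integrals against the logarithm\<close>

lemma integrable_lborel_of_nonneg_integrable_on:
  fixes f :: "real \<Rightarrow> real"
  assumes "f integrable_on S" "\<And>x. x \<in> S \<Longrightarrow> f x \<ge> 0" "S \<in> sets borel" "f \<in> borel_measurable borel"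
  shows "integrable lborel (\<lambda>x. indicator S x * f x)"
proof -
  have "f absolutely_integrable_on S"
    by (rule nonnegative_absolutely_integrable_1) (use assms in auto)
  then have "integrable lebesgue (\<lambda>x. indicator S x * f x)"
    by (simp add: set_integrable_def)
  then show ?thesis
    by (subst (asm) integrable_completion) (use assms in auto)
qed

definition pow0 :: "real \<Rightarrow> real \<Rightarrow> real" where
  "pow0 p x = indicator {-1..1} x * \<bar>x\<bar> powr p"

definition pow1 :: "real \<Rightarrow> real \<Rightarrow> real" where
  "pow1 p x = indicator {x. \<bar>x\<bar> \<ge> 1} x * \<bar>x\<bar> powr p"

lemma pow_measurable [measurable]: "pow0 p \<in> borel_measurable borel" "pow1 p \<in> borel_measurable borel"
proof -
  have [measurable]: "{x::real. \<bar>x\<bar> \<ge> 1} \<in> sets borel" by measurable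
  show "pow0 p \<in> borel_measurable borel" "pow1 p \<in> borel_measurable borel"
    unfolding pow0_def[abs_def] pow1_def[abs_def] by measurable
qed

lemma pow_nonneg [simp]: "pow0 p x \<ge> 0" "pow1 p x \<ge> 0" by (auto simp: pow0_def pow1_def)

lemma integrable_even_of_half:
  fixes f :: "real \<Rightarrow> real"
  assumes "integrable lborel (\<lambda>x. indicator {0..} x * f x)" "\<And>x. f (-x) = f x" "f 0 = 0"
  shows "integrable lborel f"
proof -
  have "integrable lborel (\<lambda>x. indicator {0..} (0 + (-1) * x) * f (0 + (-1) * x))"
    using lborel_integrable_real_affine[OF assms(1), of "-1" 0] by simp
  then have "integrable lborel (\<lambda>x. indicator {0..} x * f x + indicator {0..} (0 + (-1) * x) * f (0 + (-1) * x))"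
    using assms(1) by simp
  also have "(\<lambda>x. indicator {0..} x * f x + indicator {0..} (0 + (-1) * x) * f (0 + (-1) * x)) = f"
    using assms(2,3) by (auto simp: indicator_def fun_eq_iff)
  finally show ?thesis .
qed

lemma pow0_integrable: "p > -1 \<Longrightarrow> integrable lborel (pow0 p)"
proof (rule integrable_even_of_half)
  assume p: "p > -1"
  have "integrable lborel (\<lambda>x. indicator {0..1} x * (x powr p))"
    by (rule integrable_lborel_of_nonneg_integrable_on) (use integrable_on_powr_from_0[OF p, of 1] in auto)
  also have "(\<lambda>x. indicator {0..1} x * (x powr p)) = (\<lambda>x. indicator {0..} x * pow0 p x)"
    by (auto simp: pow0_def indicator_def)
  finally show "integrable lborel (\<lambda>x. indicator {0..} x * pow0 p x)" .
qed (auto simp: pow0_def indicator_def)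

lemma pow1_integrable: "p < -1 \<Longrightarrow> integrable lborel (pow1 p)"
proof (rule integrable_even_of_half)
  assume p: "p < -1"
  have "(\<lambda>x. x powr p) integrable_on {1..}"
    using has_integral_powr_to_inf[OF p, of 1] by auto
  then have "integrable lborel (\<lambda>x::real. indicator {1..} x * (x powr p))"
    by (rule integrable_lborel_of_nonneg_integrable_on) auto
  also have "(\<lambda>x::real. indicator {1..} x * (x powr p)) = (\<lambda>x. indicator {0..} x * pow1 p x)"
    by (auto simp: pow1_def indicator_def fun_eq_iff)
  finally show "integrable lborel (\<lambda>x. indicator {0..} x * pow1 p x)" .
qed (auto simp: pow1_def indicator_def)

text \<open>Common majorant of the densities: of order |x|^(-1/2) at 0, like the constraint
  measures, and |x|^(-3/2) at infinity, so that \<open>ln (1 + |x|)\<close> is integrable against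
  it.\<close>

definition wt :: "real \<Rightarrow> real" where "wt x = \<bar>x\<bar> powr (-1/2) / (1 + \<bar>x\<bar>)"

lemma wt_measurable [measurable]: "wt \<in> borel_measurable borel"
  unfolding wt_def[abs_def] by measurable

lemma wt_eq: "wt x = 1 / (sqrt \<bar>x\<bar> * (1 + \<bar>x\<bar>))"
proof -
  have "\<bar>x\<bar> powr (-1/2) = inverse (sqrt \<bar>x\<bar>)"
    using powr_minus[of "\<bar>x\<bar>" "1/2"] powr_half_sqrt[of "\<bar>x\<bar>"] by simp
  then show ?thesis by (simp add: wt_def inverse_eq_divide)
qed

lemma wt_nonneg [simp]: "wt x \<ge> 0" by (simp add: wt_def)

lemma wt_le: "wt x \<le> pow0 (-1/2) x + pow1 (-3/2) x"
proof (cases "\<bar>x\<bar> \<le> 1")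
  case True
  then have "wt x \<le> \<bar>x\<bar> powr (-1/2) / 1" unfolding wt_def by (intro divide_left_mono) auto
  also have "\<dots> \<le> pow0 (-1/2) x + pow1 (-3/2) x" using True by (auto simp: pow0_def indicator_def)
  finally show ?thesis .
next
  case False
  then have "wt x \<le> \<bar>x\<bar> powr (-1/2) / \<bar>x\<bar>" unfolding wt_def by (intro divide_left_mono) auto
  also have "\<dots> = \<bar>x\<bar> powr (-1/2) / \<bar>x\<bar> powr 1" using False by simp
  also have "\<dots> = \<bar>x\<bar> powr (-3/2)" unfolding powr_diff[symmetric] by simp
  also have "\<dots> \<le> pow0 (-1/2) x + pow1 (-3/2) x" using False by (auto simp: pow1_def indicator_def)
  finally show ?thesis .
qed

lemma wt_integrable: "integrable lborel wt"
proof (rule Bochner_Integration.integrable_bound)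
  show "integrable lborel (\<lambda>x. pow0 (-1/2) x + pow1 (-3/2) x)"
    using pow0_integrable[of "-1/2"] pow1_integrable[of "-3/2"] by simp
  show "AE x in lborel. norm (wt x) \<le> norm (pow0 (-1/2) x + pow1 (-3/2) x)"
  proof (rule AE_I2)
    fix x :: real
    show "norm (wt x) \<le> norm (pow0 (-1/2) x + pow1 (-3/2) x)" using wt_le[of x] by simp
  qed
qed measurable

text \<open>With w = v^(1/4) one has 1 + v \<le> (1 + w)^4. The exponent 1/4 is small enough that
  -1/2 - 1/4 stays above -1 and -3/2 + 1/4 stays below -1.\<close>

lemma ln_one_plus_le: 
  fixes v :: real
  assumes "v \<ge> 0" shows "ln (1 + v) \<le> 4 * v powr (1/4)"
proof (cases "v = 0")
  case False
  then have v: "v > 0" using assms by simp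
  define w where "w = v powr (1/4)"
  have w: "w > 0" "w ^ 4 = v" using v by (auto simp: w_def powr_power)
  have "1 + v \<le> (1 + w) ^ 4" using w(1) unfolding w(2)[symmetric]
    by (simp add: power4_eq_xxxx algebra_simps)
  then have "ln (1 + v) \<le> ln ((1 + w) ^ 4)" by (rule ln_mono) (use v in auto)
  also have "\<dots> = 4 * ln (1 + w)" using w by (simp add: ln_realpow)
  also have "\<dots> \<le> 4 * w" using ln_add_one_self_le_self[of w] w by simp
  finally show ?thesis by (simp add: w_def)
qed simp

lemma wt_ln_integrable: "integrable lborel (\<lambda>y. ln (1 + \<bar>y\<bar>) * wt y)"
proof (rule Bochner_Integration.integrable_bound)
  show "integrable lborel (\<lambda>x. 4 * (pow0 (-1/4) x + pow1 (-5/4) x))"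
    using pow0_integrable[of "-1/4"] pow1_integrable[of "-5/4"] by simp
  have "ln (1 + \<bar>y\<bar>) * wt y \<le> 4 * (pow0 (-1/4) y + pow1 (-5/4) y)" for y
  proof -
    have "ln (1 + \<bar>y\<bar>) * wt y \<le> (4 * \<bar>y\<bar> powr (1/4)) * (pow0 (-1/2) y + pow1 (-3/2) y)"
      by (intro mult_mono ln_one_plus_le wt_le) auto
    also have "\<dots> = 4 * (pow0 (-1/4) y + pow1 (-5/4) y)"
      by (simp add: pow0_def pow1_def algebra_simps powr_add[symmetric])
    finally show ?thesis .
  qed
  then show "AE y in lborel. norm (ln (1 + \<bar>y\<bar>) * wt y) \<le> norm (4 * (pow0 (-1/4) y + pow1 (-5/4) y))"
    by (intro AE_I2) (simp add: abs_of_nonneg)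
qed measurable

lemma abs_ln_le: "\<bar>ln u\<bar> \<le> ln (1 + u) + ln (1 + 1/u)" if "u \<ge> 0" for u :: real
proof (cases "u = 0")
  case False
  then have u: "u > 0" using that by simp
  have 1: "ln u \<le> ln (1 + u)" by (rule ln_mono) (use u in auto)
  have 2: "ln (1/u) \<le> ln (1 + 1/u)" by (rule ln_mono) (use u in \<open>auto simp: field_simps\<close>)
  have 3: "ln (1 + u) \<ge> 0" "ln (1 + 1/u) \<ge> 0" "ln (1/u) = - ln u" using u by (auto simp: ln_div)
  show ?thesis using 1 2 3 by linarith
qed simp

lemma ln_one_plus_triangle: "ln (1 + \<bar>x - y\<bar>) \<le> ln (1 + \<bar>x\<bar>) + ln (1 + \<bar>y::real\<bar>)"
proof -
  have "1 + \<bar>x - y\<bar> \<le> (1 + \<bar>x\<bar>) * (1 + \<bar>y\<bar>)"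
  proof -
    have "(1 + \<bar>x\<bar>) * (1 + \<bar>y\<bar>) = 1 + \<bar>x\<bar> + \<bar>y\<bar> + \<bar>x\<bar> * \<bar>y\<bar>" by (simp add: algebra_simps)
    moreover have "0 \<le> \<bar>x\<bar> * \<bar>y\<bar>" by simp
    ultimately show ?thesis using abs_triangle_ineq4[of x y] by linarith
  qed
  then have "ln (1 + \<bar>x - y\<bar>) \<le> ln ((1 + \<bar>x\<bar>) * (1 + \<bar>y\<bar>))" by (intro ln_mono) auto
  moreover have "1 + \<bar>x\<bar> \<noteq> 0" "1 + \<bar>y\<bar> \<noteq> 0" by linarith+
  ultimately show ?thesis by (simp add: ln_mult)
qed

text \<open>Near the diagonal the left side is at most 4 |x-y|^(-1/4) |y|^(-1/2), hence at most 4
  times the power -3/4 of the smaller of |x-y| and |y|. The integral of this in \<open>y\<close> is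
  bounded uniformly in \<open>x\<close>. On the diagonal the left side is 0 because 1/0 = 0.\<close>

lemma singular_bound:
  "ln (1 + 1/\<bar>x - y\<bar>) * wt y \<le> ln 2 * wt y + 4 * pow0 (-3/4) (x - y) + 4 * pow0 (-3/4) y"
proof -
  consider "x = y" | "\<bar>x - y\<bar> \<ge> 1" | "0 < \<bar>x - y\<bar>" "\<bar>x - y\<bar> < 1" by linarith
  then show ?thesis
  proof cases
    case 2
    then have "1 + 1/\<bar>x - y\<bar> \<le> 2" by (simp add: field_simps)
    moreover have "0 < 1 + 1/\<bar>x - y\<bar>" by (intro add_pos_nonneg) auto
    ultimately have "ln (1 + 1/\<bar>x - y\<bar>) * wt y \<le> ln 2 * wt y"
      by (intro mult_right_mono ln_mono) auto
    then show ?thesis using pow_nonneg(1)[of "-3/4" "x-y"] pow_nonneg(1)[of "-3/4" y] by linarith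
  next
    case 3
    define s where "s = \<bar>x - y\<bar>"
    have s: "0 < s" "s < 1" using 3 by (auto simp: s_def)
    have "ln (1 + 1/s) \<le> 4 * (1/s) powr (1/4)" using s by (intro ln_one_plus_le) auto
    also have "(1/s) powr (1/4) = s powr (-1/4)" using s by (simp add: powr_minus_divide powr_divide)
    finally have 1: "ln (1 + 1/s) \<le> 4 * s powr (-1/4)" .
    have w: "wt y \<le> \<bar>y\<bar> powr (-1/2)" unfolding wt_def by (auto simp: divide_le_eq mult_le_cancel_left1)
    have "s powr (-1/4) * \<bar>y\<bar> powr (-1/2) \<le> pow0 (-3/4) (x - y) + pow0 (-3/4) y"
    proof (cases "s \<le> \<bar>y\<bar>")
      case True
      have "\<bar>y\<bar> powr (-1/2) \<le> s powr (-1/2)" using True s by (intro powr_mono2') auto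
      then have "s powr (-1/4) * \<bar>y\<bar> powr (-1/2) \<le> s powr (-1/4) * s powr (-1/2)" by (intro mult_left_mono) auto
      also have "\<dots> = s powr (-3/4)" by (simp add: powr_add[symmetric])
      also have "\<dots> = pow0 (-3/4) (x - y)" using s by (auto simp: pow0_def s_def indicator_def)
      finally show ?thesis using pow_nonneg(1)[of "-3/4" y] by linarith
    next
      case False
      show ?thesis
      proof (cases "y = 0")
        case False
        then have "s powr (-1/4) \<le> \<bar>y\<bar> powr (-1/4)" using \<open>\<not> s \<le> \<bar>y\<bar>\<close> by (intro powr_mono2') auto
        then have "s powr (-1/4) * \<bar>y\<bar> powr (-1/2) \<le> \<bar>y\<bar> powr (-1/4) * \<bar>y\<bar> powr (-1/2)" by (intro mult_right_mono) auto
        also have "\<dots> = \<bar>y\<bar> powr (-3/4)" by (simp add: powr_add[symmetric])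
        also have "\<dots> = pow0 (-3/4) y" using s \<open>\<not> s \<le> \<bar>y\<bar>\<close> by (auto simp: pow0_def indicator_def)
        finally show ?thesis using pow_nonneg(1)[of "-3/4" "x - y"] by linarith
      qed auto
    qed
    moreover have "ln (1 + 1/s) * wt y \<le> (4 * s powr (-1/4)) * \<bar>y\<bar> powr (-1/2)"
      by (intro mult_mono 1 w) auto
    moreover have "ln 2 * wt y \<ge> 0" by simp
    ultimately show ?thesis unfolding s_def by linarith
  qed (simp add: add_nonneg_nonneg)
qed

text \<open>The potential grows at most logarithmically, so a density below a multiple of
  \<open>wt\<close> has finite mutual energy with every finite measure that integrates
  \<open>ln (1 + |x|)\<close>.\<close>

lemma log_potential_bound:
  "\<exists>K\<ge>0. \<forall>x. integrable lborel (\<lambda>y. \<bar>ln \<bar>x - y\<bar>\<bar> * wt y) \<and> (\<integral>y. \<bar>ln \<bar>x - y\<bar>\<bar> * wt y \<partial>lborel) \<le> K * (1 + ln (1 + \<bar>x\<bar>))"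
proof -
  define A where "A = (\<integral>y. wt y \<partial>lborel)"
  define B where "B = (\<integral>y. ln (1 + \<bar>y\<bar>) * wt y \<partial>lborel)"
  define P where "P = (\<integral>y. pow0 (-3/4) y \<partial>lborel)"
  have nn: "A \<ge> 0" "B \<ge> 0" "P \<ge> 0" unfolding A_def B_def P_def by (auto intro!: Bochner_Integration.integral_nonneg)
  have pi0: "integrable lborel (pow0 (-3/4))" by (rule pow0_integrable) simp
  have "integrable lborel (\<lambda>y. \<bar>ln \<bar>x - y\<bar>\<bar> * wt y) \<and> (\<integral>y. \<bar>ln \<bar>x - y\<bar>\<bar> * wt y \<partial>lborel) \<le> (A + B + A + 8 * P) * (1 + ln (1 + \<bar>x\<bar>))" for x
  proof -
    let ?b = "\<lambda>y. ln (1 + \<bar>x\<bar>) * wt y + ln (1 + \<bar>y\<bar>) * wt y + (ln 2 * wt y + 4 * pow0 (-3/4) (x + (-1) * y) + 4 * pow0 (-3/4) y)"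
    have pi1: "integrable lborel (\<lambda>y. pow0 (-3/4) (x + (-1) * y))"
      by (rule lborel_integrable_real_affine[OF pi0]) simp
    have pv1: "(\<integral>y. pow0 (-3/4) (x + (-1) * y) \<partial>lborel) = P"
      using lborel_integral_real_affine[of "-1" "pow0 (-3/4)" x] by (simp add: P_def)
    have bi: "integrable lborel ?b" using wt_integrable wt_ln_integrable pi0 pi1 by simp
    have bv: "(\<integral>y. ?b y \<partial>lborel) = ln (1 + \<bar>x\<bar>) * A + B + (ln 2 * A + 4 * P + 4 * P)"
      using wt_integrable wt_ln_integrable pi0 pi1 pv1 by (simp add: A_def B_def P_def)
    have le: "\<bar>ln \<bar>x - y\<bar>\<bar> * wt y \<le> ?b y" for y
    proof -
      have "\<bar>ln \<bar>x - y\<bar>\<bar> * wt y \<le> (ln (1 + \<bar>x - y\<bar>) + ln (1 + 1/\<bar>x - y\<bar>)) * wt y"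
        by (intro mult_right_mono abs_ln_le) auto
      also have "\<dots> \<le> (ln (1 + \<bar>x\<bar>) + ln (1 + \<bar>y\<bar>)) * wt y + ln (1 + 1/\<bar>x - y\<bar>) * wt y"
        unfolding distrib_right by (intro add_mono order_refl) (simp add: distrib_right[symmetric] mult_right_mono ln_one_plus_triangle)
      also have "\<dots> \<le> ?b y" using singular_bound[of x y] by (simp add: distrib_right)
      finally show ?thesis .
    qed
    have i: "integrable lborel (\<lambda>y. \<bar>ln \<bar>x - y\<bar>\<bar> * wt y)"
    proof (rule Bochner_Integration.integrable_bound[OF bi])
      show "AE y in lborel. norm (\<bar>ln \<bar>x - y\<bar>\<bar> * wt y) \<le> norm (?b y)"
      proof (rule AE_I2)
        fix y
        have "norm (\<bar>ln \<bar>x - y\<bar>\<bar> * wt y) = \<bar>ln \<bar>x - y\<bar>\<bar> * wt y" by (simp add: abs_mult)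
        also have "\<dots> \<le> ?b y" by (rule le)
        also have "\<dots> \<le> norm (?b y)" by simp
        finally show "norm (\<bar>ln \<bar>x - y\<bar>\<bar> * wt y) \<le> norm (?b y)" .
      qed
    qed measurable
    have "(\<integral>y. \<bar>ln \<bar>x - y\<bar>\<bar> * wt y \<partial>lborel) \<le> (\<integral>y. ?b y \<partial>lborel)"
      by (rule integral_mono[OF i bi]) (rule le)
    also have "\<dots> \<le> (A + B + A + 8 * P) * (1 + ln (1 + \<bar>x\<bar>))"
    proof -
      have l: "ln (1 + \<bar>x\<bar>) \<ge> 0" by simp
      have "ln 2 * A \<le> A" using nn ln2_le_25_over_36 by (intro mult_left_le_one_le) auto
      then have "(\<integral>y. ?b y \<partial>lborel) \<le> ln (1 + \<bar>x\<bar>) * A + (A + B + 8 * P)" unfolding bv by simp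
      moreover have "0 \<le> ln (1 + \<bar>x\<bar>) * (B + A + 8 * P)" using nn l by simp
      moreover have "(A + B + A + 8 * P) * (1 + ln (1 + \<bar>x\<bar>)) = ln (1 + \<bar>x\<bar>) * A + ln (1 + \<bar>x\<bar>) * (B + A + 8 * P) + (A + B + A + 8 * P)"
        by (simp add: algebra_simps)
      ultimately show ?thesis using nn(1) by linarith
    qed
    finally show ?thesis using i by simp
  qed
  then show ?thesis using nn by (intro exI[of _ "A + B + A + 8 * P"]) auto
qed

section \<open>Reconstruction of a holomorphic function on the half plane from its boundary values\<close>

lemma resolvent_bound:
  fixes z :: complex
  assumes "Im z \<noteq> 0"
  shows "1 / cmod (of_real x - z) \<le> (1 + (1 + cmod z) / \<bar>Im z\<bar>) / (1 + \<bar>x\<bar>)"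
proof -
  have d: "\<bar>Im z\<bar> \<le> cmod (of_real x - z)" using abs_Im_le_cmod[of "of_real x - z"] by simp
  have pos: "0 < \<bar>Im z\<bar>" using assms by simp
  have "\<bar>x\<bar> \<le> cmod (of_real x - z) + cmod z" using norm_triangle_sub[of "of_real x" z] by simp
  then have "1 + \<bar>x\<bar> \<le> cmod (of_real x - z) + (1 + cmod z)" by simp
  also have "1 + cmod z = ((1 + cmod z) / \<bar>Im z\<bar>) * \<bar>Im z\<bar>" using pos by simp
  also have "\<dots> \<le> ((1 + cmod z) / \<bar>Im z\<bar>) * cmod (of_real x - z)" by (rule mult_left_mono[OF d]) auto
  finally have "1 + \<bar>x\<bar> \<le> (1 + (1 + cmod z) / \<bar>Im z\<bar>) * cmod (of_real x - z)" by (simp add: algebra_simps)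
  moreover have "cmod (of_real x - z) > 0" using d pos by linarith
  ultimately show ?thesis by (simp add: field_simps)
qed

text \<open>The three sides off the real axis have total length 4R and \<open>k\<close> is at most
  C/R^(3/2) on them, so they contribute O(1/sqrt R). Continuity is assumed only on the axis and far
  out, because \<open>k\<close> may have a pole inside the rectangle.\<close>

lemma rectpath_real_line_integral:
  fixes k :: "complex \<Rightarrow> complex"
  assumes cont: "continuous_on {w. Im w \<ge> 0 \<and> (Im w = 0 \<or> cmod w \<ge> Rz)} k"
    and bnd: "\<And>w. Im w \<ge> 0 \<Longrightarrow> cmod w \<ge> Rz \<Longrightarrow> cmod (k w) \<le> C / (cmod w * sqrt (cmod w))"
    and Rz: "Rz > 0"
    and I: "\<And>R. R \<ge> Rz \<Longrightarrow> contour_integral (rectpath (of_real (-R)) (Complex R R)) k = I"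
    and int: "integrable lborel (\<lambda>x. k (of_real x))"
  shows "(\<integral>x. k (of_real x) \<partial>lborel) = I"
proof -
  have C: "C \<ge> 0" 
  proof -
    have "0 \<le> C / (cmod (of_real Rz) * sqrt (cmod (of_real Rz)))"
      using bnd[of "of_real Rz"] Rz by (intro order_trans[OF norm_ge_zero bnd]) auto
    then have "0 \<le> C / (Rz * sqrt Rz)" using Rz by simp
    moreover have "Rz * sqrt Rz > 0" using Rz by simp
    ultimately show ?thesis by (meson divide_neg_pos not_less)
  qed
  have key: "norm (I - (\<integral>x. indicator {-R..R} x *\<^sub>R k (of_real x) \<partial>lborel)) \<le> 4 * C / sqrt R" if R: "R \<ge> Rz" for R
  proof -
    have Rp: "R > 0" using R Rz by simp
    let ?l1 = "linepath (of_real (-R)) (of_real R)" and ?l2 = "linepath (of_real R) (Complex R R)"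
      and ?l3 = "linepath (Complex R R) (Complex (-R) R)" and ?l4 = "linepath (Complex (-R) R) (of_real (-R))"
    have eqs: "Complex R 0 = of_real R" "Complex (-R) 0 = of_real (-R)" by (auto simp: complex_eq_iff)
    have rp: "rectpath (of_real (-R)) (Complex R R) = ?l1 +++ ?l2 +++ ?l3 +++ ?l4"
      unfolding rectpath_def Let_def using eqs by simp
    have cn: "closed_segment p q \<subseteq> {w. Im w \<ge> 0}" if "Im p \<ge> 0" "Im q \<ge> 0" for p q
      by (rule closed_segment_subset) (use that convex_halfspace_Im_ge[of 0] in auto)
    have cn2: "closed_segment p q \<subseteq> {w. Im w \<le> 0}" if "Im p \<le> 0" "Im q \<le> 0" for p q
      by (rule closed_segment_subset) (use that convex_halfspace_Im_le[of 0] in auto)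
    have f2: "cmod w \<ge> R" if "w \<in> closed_segment (of_real R) (Complex R R)" for w
    proof -
      have "w \<in> {w. Re w \<ge> R}" using that closed_segment_subset[of "of_real R" "{w. Re w \<ge> R}" "Complex R R"] convex_halfspace_Re_ge[of R] by auto
      then show ?thesis using complex_Re_le_cmod[of w] by simp
    qed
    have f3: "cmod w \<ge> R" if "w \<in> closed_segment (Complex R R) (Complex (-R) R)" for w
    proof -
      have "w \<in> {w. Im w \<ge> R}" using that closed_segment_subset[of "Complex R R" "{w. Im w \<ge> R}" "Complex (-R) R"] convex_halfspace_Im_ge[of R] by auto
      then show ?thesis using abs_Im_le_cmod[of w] by simp
    qed
    have f4: "cmod w \<ge> R" if "w \<in> closed_segment (Complex (-R) R) (of_real (-R))" for w
    proof -
      have "w \<in> {w. Re w \<le> -R}" using that closed_segment_subset[of "Complex (-R) R" "{w. Re w \<le> -R}" "of_real (-R)"] convex_halfspace_Re_le[of "-R"] by auto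
      then show ?thesis using abs_Re_le_cmod[of w] by simp
    qed
    have ci: "k contour_integrable_on linepath p q" if "Im p \<ge> 0" "Im q \<ge> 0" "\<And>w. w \<in> closed_segment p q \<Longrightarrow> cmod w \<ge> R" for p q
      by (rule contour_integrable_continuous_linepath, rule continuous_on_subset[OF cont])
        (use cn[OF that(1,2)] that(3) R in force)
    have ci1: "k contour_integrable_on ?l1"
      by (rule contour_integrable_continuous_linepath, rule continuous_on_subset[OF cont])
        (use cn[of "of_real (-R)" "of_real R"] cn2[of "of_real (-R)" "of_real R"] in force)
    have ci2: "k contour_integrable_on ?l2" by (rule ci) (use f2 Rp in auto)
    have ci3: "k contour_integrable_on ?l3" by (rule ci) (use f3 Rp in auto)
    have ci4: "k contour_integrable_on ?l4" by (rule ci) (use f4 Rp in auto)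
    have sum: "contour_integral (rectpath (of_real (-R)) (Complex R R)) k
       = contour_integral ?l1 k + (contour_integral ?l2 k + (contour_integral ?l3 k + contour_integral ?l4 k))"
      unfolding rp using ci1 ci2 ci3 ci4 by simp
    have B: "cmod (contour_integral (linepath p q) k) \<le> C / (R * sqrt R) * cmod (q - p)"
      if pq: "Im p \<ge> 0" "Im q \<ge> 0" and far: "\<And>w. w \<in> closed_segment p q \<Longrightarrow> cmod w \<ge> R" for p q
    proof (rule contour_integral_bound_linepath)
      show "k contour_integrable_on linepath p q" using ci pq far by blast
      show "0 \<le> C / (R * sqrt R)" using C Rp by simp
      fix w assume w: "w \<in> closed_segment p q"
      then have "cmod w \<ge> R" "Im w \<ge> 0" using far cn[OF pq] by auto
      then have "cmod (k w) \<le> C / (cmod w * sqrt (cmod w))" using bnd R by auto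
      also have "\<dots> \<le> C / (R * sqrt R)"
        using \<open>cmod w \<ge> R\<close> Rp C by (intro divide_left_mono mult_mono mult_pos_pos) auto
      finally show "cmod (k w) \<le> C / (R * sqrt R)" .
    qed
    have n2: "cmod (Complex R R - of_real R) = R" "cmod (Complex (-R) R - Complex R R) = 2 * R" "cmod (of_real (-R) - Complex (-R) R) = R"
      using Rp by (simp_all add: complex_eq_iff cmod_def real_sqrt_mult)
    have b2: "cmod (contour_integral ?l2 k) \<le> C / (R * sqrt R) * R" using B[of "of_real R" "Complex R R"] f2 Rp n2 by auto
    have b3: "cmod (contour_integral ?l3 k) \<le> C / (R * sqrt R) * (2 * R)" using B[of "Complex R R" "Complex (-R) R"] f3 Rp n2 by auto
    have b4: "cmod (contour_integral ?l4 k) \<le> C / (R * sqrt R) * R" using B[of "Complex (-R) R" "of_real (-R)"] f4 Rp n2 by auto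
    have "contour_integral ?l1 k = integral {-R..R} (\<lambda>x. k (of_real x))"
      using contour_integral_linepath_Reals_eq[of "of_real (-R)" "of_real R" k] Rp by simp
    also have "\<dots> = (\<integral>x. indicator {-R..R} x *\<^sub>R k (of_real x) \<partial>lborel)"
    proof -
      have "set_integrable lborel {-R..R} (\<lambda>x. k (of_real x))"
        unfolding set_integrable_def by (rule integrable_mult_indicator) (use int in auto)
      from set_borel_integral_eq_integral(2)[OF this] show ?thesis
        by (simp add: set_lebesgue_integral_def)
    qed
    finally have l1: "contour_integral ?l1 k = (\<integral>x. indicator {-R..R} x *\<^sub>R k (of_real x) \<partial>lborel)" .
    have "I - (\<integral>x. indicator {-R..R} x *\<^sub>R k (of_real x) \<partial>lborel) = contour_integral ?l2 k + (contour_integral ?l3 k + contour_integral ?l4 k)"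
    proof -
      have e: "\<And>X Y Z :: complex. X = Y + Z \<Longrightarrow> X - Y = Z" by simp
      show ?thesis by (rule e) (use sum I[OF R] l1 in argo)
    qed
    also have "cmod \<dots> \<le> C / (R * sqrt R) * R + (C / (R * sqrt R) * (2 * R) + C / (R * sqrt R) * R)"
      by (intro order_trans[OF norm_triangle_ineq] add_mono b2 b3 b4)
    also have "\<dots> = 4 * C / sqrt R" using Rp by (simp add: field_simps)
    finally show ?thesis .
  qed
  have lim1: "(\<lambda>n. \<integral>x. indicator {-real n..real n} x *\<^sub>R k (of_real x) \<partial>lborel) \<longlonglongrightarrow> (\<integral>x. k (of_real x) \<partial>lborel)"
  proof (rule integral_dominated_convergence[where w="\<lambda>x. norm (k (of_real x))"])
    show "AE x in lborel. (\<lambda>n. indicator {-real n..real n} x *\<^sub>R k (of_real x)) \<longlonglongrightarrow> k (of_real x)"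
    proof (rule AE_I2)
      fix x :: real
      have "\<forall>\<^sub>F n in sequentially. real n \<ge> \<bar>x\<bar>" by real_asymp
      then have "\<forall>\<^sub>F n in sequentially. k (of_real x) = indicator {-real n..real n} x *\<^sub>R k (of_real x)"
        by eventually_elim (auto simp: indicator_def)
      then show "(\<lambda>n. indicator {-real n..real n} x *\<^sub>R k (of_real x)) \<longlonglongrightarrow> k (of_real x)"
        by (rule Lim_transform_eventually[OF tendsto_const])
    qed
  qed (use int in \<open>auto simp: indicator_def intro!: borel_measurable_integrable integrable_mult_indicator\<close>)
  have lim2: "(\<lambda>n. \<integral>x. indicator {-real n..real n} x *\<^sub>R k (of_real x) \<partial>lborel) \<longlonglongrightarrow> I"
  proof -
    have ev: "\<forall>\<^sub>F n in sequentially. norm (I - (\<integral>x. indicator {-real n..real n} x *\<^sub>R k (of_real x) \<partial>lborel)) \<le> 4 * C * (1 / sqrt (real n))"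
    proof -
      have "\<forall>\<^sub>F n in sequentially. real n \<ge> Rz"
        using filterlim_real_sequentially by (simp add: filterlim_at_top)
      then show ?thesis
      proof eventually_elim
        case (elim n)
        then show ?case using key[of "real n"] by simp
      qed
    qed
    have "(\<lambda>n. 1 / sqrt (real n)) \<longlonglongrightarrow> 0" by real_asymp
    then have "(\<lambda>n. 4 * C * (1 / sqrt (real n))) \<longlonglongrightarrow> 4 * C * 0" by (intro tendsto_intros)
    then have "(\<lambda>n. I - (\<integral>x. indicator {-real n..real n} x *\<^sub>R k (of_real x) \<partial>lborel)) \<longlonglongrightarrow> 0"
      by (intro Lim_null_comparison[OF ev]) simp
    then have "(\<lambda>n. I - (I - (\<integral>x. indicator {-real n..real n} x *\<^sub>R k (of_real x) \<partial>lborel))) \<longlonglongrightarrow> I - 0"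
      by (intro tendsto_intros)
    then show ?thesis by simp
  qed
  show ?thesis by (rule LIMSEQ_unique[OF lim1 lim2])
qed

text \<open>Cauchy's formula at \<open>z\<close> yields 2 pi i F(z), Cauchy's theorem at the
  conjugate point yields 0; subtracting the conjugate of the second from the first leaves only the
  imaginary part under the integral. This is done on the line raised by \<open>e\<close>, where F is
  holomorphic. The bound C/sqrt|z| serves twice: it gives the Cauchy integrand the decay |w|^(-3/2),
  and it gives a majorant \<open>wt\<close>, uniform in \<open>e\<close>, for the passage to the
  boundary.\<close>

theorem half_plane_reconstruction:
  fixes F :: "complex \<Rightarrow> complex" and b :: "real \<Rightarrow> real"
  assumes holo: "F holomorphic_on {z. Im z > 0}"
    and bnd: "\<And>z. Im z > 0 \<Longrightarrow> cmod (F z) \<le> C / sqrt (cmod z)"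
    and b[measurable]: "b \<in> borel_measurable borel"
    and lim: "AE x in lborel. (\<lambda>n. Im (F (Complex x (1 / real (Suc n))))) \<longlonglongrightarrow> b x"
    and z: "Im z > 0"
  shows "integrable lborel (\<lambda>x. of_real (b x) / (of_real x - z))"
    "F z = of_real (1/pi) * (\<integral>x. of_real (b x) / (of_real x - z) \<partial>lborel)"
proof -
  have C: "C \<ge> 0" using bnd[of \<i>] order_trans[OF norm_ge_zero bnd[of \<i>]] by simp
  define G where "G = (\<lambda>e w. F (w + \<i> * of_real e))"
  have Gholo: "G e holomorphic_on {w. Im w > -e}" for e
  proof -
    have "(F \<circ> (\<lambda>w. w + \<i> * of_real e)) holomorphic_on {w. Im w > -e}"
      by (rule holomorphic_on_compose_gen[OF _ holo]) (auto intro!: holomorphic_intros)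
    then show ?thesis by (simp add: G_def o_def)
  qed
  have shift: "cmod w \<le> cmod (w + \<i> * of_real e)" if "e > 0" "Im w \<ge> 0" for w e
    unfolding cmod_def using that by (intro real_sqrt_le_mono) (auto intro!: power_mono)
  have Gb: "cmod (G e w) \<le> C / sqrt (cmod w)" if "e > 0" "Im w \<ge> 0" "w \<noteq> 0" for w e
  proof -
    have "cmod (G e w) \<le> C / sqrt (cmod (w + \<i> * of_real e))" unfolding G_def by (rule bnd) (use that in auto)
    also have "\<dots> \<le> C / sqrt (cmod w)"
      using shift[OF that(1,2)] that C by (intro divide_left_mono real_sqrt_le_mono mult_pos_pos) (auto intro: less_le_trans)
    finally show ?thesis .
  qed
  have kb: "cmod (G e (of_real x) / (of_real x - \<zeta>)) \<le> C * (1 + (1 + cmod \<zeta>) / \<bar>Im \<zeta>\<bar>) * wt x"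
    if "e > 0" "Im \<zeta> \<noteq> 0" "x \<noteq> 0" for e \<zeta> x
  proof -
    have "cmod (G e (of_real x) / (of_real x - \<zeta>)) = cmod (G e (of_real x)) * (1 / cmod (of_real x - \<zeta>))"
      by (simp add: norm_divide)
    also have "\<dots> \<le> (C / sqrt \<bar>x\<bar>) * ((1 + (1 + cmod \<zeta>) / \<bar>Im \<zeta>\<bar>) / (1 + \<bar>x\<bar>))"
      by (rule mult_mono) (use Gb[of e "of_real x"] that resolvent_bound[OF that(2)] C in auto)
    also have "\<dots> = C * (1 + (1 + cmod \<zeta>) / \<bar>Im \<zeta>\<bar>) * wt x"
      by (simp add: wt_eq)
    finally show ?thesis .
  qed
  have AE0: "AE x in lborel. x \<noteq> (0::real)" by (rule AE_lborel_singleton)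
  have meas: "(\<lambda>x. G e (of_real x)) \<in> borel_measurable borel" if "e > 0" for e
    by (rule borel_measurable_continuous_onI, rule continuous_on_compose2[OF holomorphic_on_imp_continuous_on[OF Gholo[of e]]])
       (use that in \<open>auto intro!: continuous_intros\<close>)
  have kint: "integrable lborel (\<lambda>x. G e (of_real x) / (of_real x - \<zeta>))" if e: "e > 0" "Im \<zeta> \<noteq> 0" for e \<zeta>
  proof (rule Bochner_Integration.integrable_bound)
    show "integrable lborel (\<lambda>x. C * (1 + (1 + cmod \<zeta>) / \<bar>Im \<zeta>\<bar>) * wt x)" using wt_integrable by simp
    show "AE x in lborel. cmod (G e (of_real x) / (of_real x - \<zeta>)) \<le> norm (C * (1 + (1 + cmod \<zeta>) / \<bar>Im \<zeta>\<bar>) * wt x)"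
      using AE0
    proof eventually_elim
      case (elim x)
      then show ?case using kb[OF that, of x] by (metis abs_ge_self order_trans real_norm_def)
    qed
    show "(\<lambda>x. G e (of_real x) / (of_real x - \<zeta>)) \<in> borel_measurable lborel"
      using meas[OF e(1)] by measurable
  qed
  \<comment> \<open>Beyond the radius 2|\<zeta>| + 1 the distance to \<zeta> is at least |w|/2; the
    same radius keeps a pole in the upper half plane inside the rectangle.\<close>
  have kfar: "cmod (G e w / (w - \<zeta>)) \<le> 2 * C / (cmod w * sqrt (cmod w))"
    if "e > 0" "Im w \<ge> 0" "cmod w \<ge> 2 * cmod \<zeta> + 1" for e w \<zeta>
  proof -
    have w0: "w \<noteq> 0" using that(3) by (metis norm_zero add_nonneg_pos norm_ge_zero not_less zero_less_one mult_nonneg_nonneg zero_le_numeral)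
    have "cmod w / 2 \<le> cmod (w - \<zeta>)" using norm_triangle_ineq2[of w \<zeta>] that(3) by simp
    then have "1 / cmod (w - \<zeta>) \<le> 1 / (cmod w / 2)" using w0 by (intro divide_left_mono mult_pos_pos) (auto intro: less_le_trans)
    then have "cmod (G e w) * (1 / cmod (w - \<zeta>)) \<le> (C / sqrt (cmod w)) * (1 / (cmod w / 2))"
      using Gb[OF that(1,2) w0] C by (intro mult_mono) auto
    then show ?thesis by (simp add: norm_divide mult_ac)
  qed
  have rect: "valid_path (rectpath (of_real (-R)) (Complex R R))"
     "path_image (rectpath (of_real (-R)) (Complex R R)) = cbox (of_real (-R)) (Complex R R) - box (of_real (-R)) (Complex R R)" if "R > 0" for R
    using that by (auto intro!: path_image_rectpath_cbox_minus_box)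
  have opn: "open {w. Im w > d}" "convex {w. Im w > d}" for d
    using open_halfspace_Im_gt[of d] convex_halfspace_Im_gt[of d] by auto
  have up: "(\<integral>x. G e (of_real x) / (of_real x - \<zeta>) \<partial>lborel) = 2 * of_real pi * \<i> * G e \<zeta>" if e: "e > 0" and \<zeta>: "Im \<zeta> > 0" for e \<zeta>
  proof (rule rectpath_real_line_integral[where Rz="2 * cmod \<zeta> + 1" and C="2 * C" and k="\<lambda>w. G e w / (w - \<zeta>)"])
    show "continuous_on {w. Im w \<ge> 0 \<and> (Im w = 0 \<or> 2 * cmod \<zeta> + 1 \<le> cmod w)} (\<lambda>w. G e w / (w - \<zeta>))"
    proof (rule continuous_on_divide)
      show "continuous_on {w. Im w \<ge> 0 \<and> (Im w = 0 \<or> 2 * cmod \<zeta> + 1 \<le> cmod w)} (G e)"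
        by (rule continuous_on_subset[OF holomorphic_on_imp_continuous_on[OF Gholo[of e]]]) (use e in auto)
      have "2 * cmod \<zeta> + 1 \<le> cmod \<zeta> \<Longrightarrow> False" using norm_ge_zero[of \<zeta>] by linarith
      then show "\<forall>w\<in>{w. Im w \<ge> 0 \<and> (Im w = 0 \<or> 2 * cmod \<zeta> + 1 \<le> cmod w)}. w - \<zeta> \<noteq> 0"
        using \<zeta> by auto
    qed (intro continuous_intros)
    show "0 < 2 * cmod \<zeta> + 1" by (simp add: add_nonneg_pos)
    show "integrable lborel (\<lambda>x. G e (of_real x) / (of_real x - \<zeta>))" using kint[OF e] \<zeta> by simp
    show "cmod (G e w / (w - \<zeta>)) \<le> 2 * C / (cmod w * sqrt (cmod w))"
      if "Im w \<ge> 0" "2 * cmod \<zeta> + 1 \<le> cmod w" for w by (rule kfar[OF e that])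
    fix R assume R: "2 * cmod \<zeta> + 1 \<le> R"
    have R1: "R > cmod \<zeta>" "R > 0" using R norm_ge_zero[of \<zeta>] by linarith+
    have zb: "\<zeta> \<in> box (of_real (-R)) (Complex R R)"
      using abs_Re_le_cmod[of \<zeta>] abs_Im_le_cmod[of \<zeta>] R1 \<zeta> by (auto simp: in_box_complex_iff)
    have "((\<lambda>w. G e w / (w - \<zeta>)) has_contour_integral (2 * pi * \<i> * winding_number (rectpath (of_real (-R)) (Complex R R)) \<zeta> * G e \<zeta>)) (rectpath (of_real (-R)) (Complex R R))"
    proof (rule Cauchy_integral_formula_convex_simple[OF opn(2)[of "-e"] Gholo[of e]])
      show "\<zeta> \<in> interior {w. Im w > -e}" using opn(1)[of "-e"] e \<zeta> by (simp add: interior_open)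
      have "w \<in> {w. Im w > -e} - {\<zeta>}" if "w \<in> cbox (of_real (-R)) (Complex R R) - box (of_real (-R)) (Complex R R)" for w
      proof -
        have "Im w \<ge> 0" using that by (simp add: in_cbox_complex_iff)
        then show ?thesis using that zb e by auto
      qed
      then show "path_image (rectpath (of_real (-R)) (Complex R R)) \<subseteq> {w. Im w > -e} - {\<zeta>}"
        unfolding rect(2)[OF R1(2)] by blast
    qed (use rect(1)[OF R1(2)] in auto)
    then show "contour_integral (rectpath (of_real (-R)) (Complex R R)) (\<lambda>w. G e w / (w - \<zeta>)) = 2 * of_real pi * \<i> * G e \<zeta>"
      using winding_number_rectpath[OF zb] by (simp add: contour_integral_unique)
  qed
  have down: "(\<integral>x. G e (of_real x) / (of_real x - \<zeta>) \<partial>lborel) = 0" if e: "e > 0" and \<zeta>: "Im \<zeta> < 0" for e \<zeta>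
  proof (rule rectpath_real_line_integral[where Rz="2 * cmod \<zeta> + 1" and C="2 * C" and k="\<lambda>w. G e w / (w - \<zeta>)"])
    show "continuous_on {w. Im w \<ge> 0 \<and> (Im w = 0 \<or> 2 * cmod \<zeta> + 1 \<le> cmod w)} (\<lambda>w. G e w / (w - \<zeta>))"
    proof (rule continuous_on_divide)
      show "continuous_on {w. Im w \<ge> 0 \<and> (Im w = 0 \<or> 2 * cmod \<zeta> + 1 \<le> cmod w)} (G e)"
        by (rule continuous_on_subset[OF holomorphic_on_imp_continuous_on[OF Gholo[of e]]]) (use e in auto)
    qed (use \<zeta> in \<open>auto intro!: continuous_intros\<close>)
    show "0 < 2 * cmod \<zeta> + 1" by (simp add: add_nonneg_pos)
    show "integrable lborel (\<lambda>x. G e (of_real x) / (of_real x - \<zeta>))" using kint[OF e] \<zeta> by simp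
    show "cmod (G e w / (w - \<zeta>)) \<le> 2 * C / (cmod w * sqrt (cmod w))"
      if "Im w \<ge> 0" "2 * cmod \<zeta> + 1 \<le> cmod w" for w by (rule kfar[OF e that])
    fix R assume R: "2 * cmod \<zeta> + 1 \<le> R"
    have R1: "R > 0" using R norm_ge_zero[of \<zeta>] by linarith
    have "((\<lambda>w. G e w / (w - \<zeta>)) has_contour_integral 0) (rectpath (of_real (-R)) (Complex R R))"
    proof (rule Cauchy_theorem_convex_simple[OF _ opn(2)[of "- min e (- Im \<zeta>)"]])
      show "(\<lambda>w. G e w / (w - \<zeta>)) holomorphic_on {w. Im w > - min e (- Im \<zeta>)}"
        using Gholo[of e] by (intro holomorphic_intros holomorphic_on_subset[OF Gholo[of e]]) auto
      show "path_image (rectpath (of_real (-R)) (Complex R R)) \<subseteq> {w. Im w > - min e (- Im \<zeta>)}"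
        unfolding rect(2)[OF R1]
      proof
        fix w assume "w \<in> cbox (of_real (-R)) (Complex R R) - box (of_real (-R)) (Complex R R)"
        then have "Im w \<ge> 0" by (simp add: in_cbox_complex_iff)
        then show "w \<in> {w. Im w > - min e (- Im \<zeta>)}" using e \<zeta> by auto
      qed
    qed (use rect(1)[OF R1] in auto)
    then show "contour_integral (rectpath (of_real (-R)) (Complex R R)) (\<lambda>w. G e w / (w - \<zeta>)) = 0"
      by (simp add: contour_integral_unique)
  qed
  have rep: "G e z = of_real (1/pi) * (\<integral>x. of_real (Im (G e (of_real x))) / (of_real x - z) \<partial>lborel)" if e: "e > 0" for e
  proof -
    have zc: "Im (cnj z) < 0" "Im (cnj z) \<noteq> 0" "Im z \<noteq> 0" using z by auto
    have "(\<integral>x. cnj (G e (of_real x) / (of_real x - cnj z)) \<partial>lborel) = cnj (\<integral>x. G e (of_real x) / (of_real x - cnj z) \<partial>lborel)"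
      by (rule Bochner_Integration.integral_cnj)
    then have 0: "(\<integral>x. cnj (G e (of_real x)) / (of_real x - z) \<partial>lborel) = 0"
      using down[OF e zc(1)] by simp
    have i2: "integrable lborel (\<lambda>x. cnj (G e (of_real x)) / (of_real x - z))"
      using integrable_cnj[OF kint[OF e zc(2)]] by simp
    have "(\<lambda>x. of_real (Im (G e (of_real x))) / (of_real x - z))
        = (\<lambda>x. (1/(2*\<i>)) * (G e (of_real x) / (of_real x - z) - cnj (G e (of_real x)) / (of_real x - z)))"
    proof
      fix x
      have "G e (of_real x) - cnj (G e (of_real x)) = 2 * \<i> * of_real (Im (G e (of_real x)))"
        by (simp add: complex_eq_iff)
      then have "(1/(2*\<i>)) * ((G e (of_real x) - cnj (G e (of_real x))) / (of_real x - z)) = of_real (Im (G e (of_real x))) / (of_real x - z)"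
        by simp
      then show "of_real (Im (G e (of_real x))) / (of_real x - z) = (1/(2*\<i>)) * (G e (of_real x) / (of_real x - z) - cnj (G e (of_real x)) / (of_real x - z))"
        by (simp only: diff_divide_distrib)
    qed
    then have "(\<integral>x. of_real (Im (G e (of_real x))) / (of_real x - z) \<partial>lborel)
      = (1/(2*\<i>)) * ((\<integral>x. G e (of_real x) / (of_real x - z) \<partial>lborel) - (\<integral>x. cnj (G e (of_real x)) / (of_real x - z) \<partial>lborel))"
      by (simp only: integral_mult_right_zero Bochner_Integration.integral_diff[OF kint[OF e zc(3)] i2])
    also have "\<dots> = of_real pi * G e z"
    proof -
      have "(1/(2*\<i>)) * (2 * P * \<i> * X - 0) = P * X" for P X :: complex by (simp add: complex_eq_iff)
      then show ?thesis unfolding 0 up[OF e z] .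
    qed
    finally show ?thesis by simp
  qed
  \<comment> \<open>The heights along which \<open>lim\<close> supplies the boundary values.\<close>
  define \<epsilon> where "\<epsilon> = (\<lambda>n. 1 / real (Suc n))"
  have \<epsilon>: "\<epsilon> n > 0" for n by (simp add: \<epsilon>_def)
  have dom: "AE x in lborel. norm (complex_of_real (Im (G (\<epsilon> n) (of_real x))) / (of_real x - z)) \<le> C * (1 + (1 + cmod z) / \<bar>Im z\<bar>) * wt x" for n
    using AE0
  proof eventually_elim
    case (elim x)
    have "norm (complex_of_real (Im (G (\<epsilon> n) (of_real x))) / (of_real x - z)) \<le> cmod (G (\<epsilon> n) (of_real x) / (of_real x - z))"
      by (simp add: norm_divide divide_right_mono abs_Im_le_cmod)
    also have "\<dots> \<le> C * (1 + (1 + cmod z) / \<bar>Im z\<bar>) * wt x"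
      using kb[OF \<epsilon>, of z x n] elim z by simp
    finally show ?case .
  qed
  have lim': "AE x in lborel. (\<lambda>n. complex_of_real (Im (G (\<epsilon> n) (of_real x))) / (of_real x - z)) \<longlonglongrightarrow> of_real (b x) / (of_real x - z)"
    using lim
  proof eventually_elim
    case (elim x)
    have "of_real x + \<i> * of_real (\<epsilon> n) = Complex x (1 / real (Suc n))" for n by (simp add: \<epsilon>_def complex_eq_iff)
    then have "(\<lambda>n. Im (G (\<epsilon> n) (of_real x))) \<longlonglongrightarrow> b x" using elim by (simp add: G_def)
    moreover have "of_real x - z \<noteq> 0" using z by auto
    ultimately show ?case by (intro tendsto_intros)
  qed
  have wi: "integrable lborel (\<lambda>x. C * (1 + (1 + cmod z) / \<bar>Im z\<bar>) * wt x)" using wt_integrable by simp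
  have m1: "(\<lambda>x. complex_of_real (b x) / (of_real x - z)) \<in> borel_measurable lborel" by measurable
  have m2: "(\<lambda>x. complex_of_real (Im (G (\<epsilon> n) (of_real x))) / (of_real x - z)) \<in> borel_measurable lborel" for n
    using meas[OF \<epsilon>[of n]] by measurable
  show "integrable lborel (\<lambda>x. of_real (b x) / (of_real x - z))"
    by (rule integrable_dominated_convergence[OF m1 m2 wi lim' dom])
  have "(\<lambda>n. \<integral>x. complex_of_real (Im (G (\<epsilon> n) (of_real x))) / (of_real x - z) \<partial>lborel) \<longlonglongrightarrow> (\<integral>x. of_real (b x) / (of_real x - z) \<partial>lborel)"
    by (rule integral_dominated_convergence[OF m1 m2 wi lim' dom])
  then have "(\<lambda>n. of_real (1/pi) * (\<integral>x. complex_of_real (Im (G (\<epsilon> n) (of_real x))) / (of_real x - z) \<partial>lborel)) \<longlonglongrightarrow> of_real (1/pi) * (\<integral>x. of_real (b x) / (of_real x - z) \<partial>lborel)"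
    by (intro tendsto_intros)
  then have L: "(\<lambda>n. G (\<epsilon> n) z) \<longlonglongrightarrow> of_real (1/pi) * (\<integral>x. of_real (b x) / (of_real x - z) \<partial>lborel)"
    using rep[OF \<epsilon>] by simp
  have "(\<lambda>n. z + \<i> * of_real (\<epsilon> n)) \<longlonglongrightarrow> z + \<i> * of_real 0"
    unfolding \<epsilon>_def by (intro tendsto_intros LIMSEQ_Suc[OF lim_1_over_n])
  moreover have "isCont F z"
    using holomorphic_on_imp_continuous_on[OF holo] opn(1)[of 0] z by (simp add: continuous_on_eq_continuous_at)
  ultimately have "(\<lambda>n. G (\<epsilon> n) z) \<longlonglongrightarrow> F z"
    unfolding G_def using isCont_tendsto_compose by fastforce
  then show "F z = of_real (1/pi) * (\<integral>x. of_real (b x) / (of_real x - z) \<partial>lborel)"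
    by (rule LIMSEQ_unique[OF _ L])
qed


section \<open>Logarithmic potentials of measures with a density\<close>

lemma ln_cmod_integrable:
  fixes h :: "real \<Rightarrow> real"
  assumes [measurable]: "h \<in> borel_measurable borel" and h: "\<And>y. 0 \<le> h y" "\<And>y. h y \<le> K * wt y" and z: "Im z > 0"
  shows "integrable lborel (\<lambda>y. ln (cmod (z - of_real y)) * h y)"
proof (rule Bochner_Integration.integrable_bound)
  let ?c = "ln (1 + cmod z) + ln (1 + 1 / Im z)"
  show "integrable lborel (\<lambda>y. K * (?c * wt y + ln (1 + \<bar>y\<bar>) * wt y))"
    using wt_integrable wt_ln_integrable by simp
  show "AE y in lborel. norm (ln (cmod (z - of_real y)) * h y) \<le> norm (K * (?c * wt y + ln (1 + \<bar>y\<bar>) * wt y))"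
  proof (rule AE_I2)
    fix y :: real
    have low: "Im z \<le> cmod (z - of_real y)" using abs_Im_le_cmod[of "z - of_real y"] z by simp
    have tri: "cmod (z - of_real y) \<le> cmod z + \<bar>y\<bar>" using norm_triangle_ineq4[of z "of_real y"] by simp
    have "1 + cmod (z - of_real y) \<le> (1 + cmod z) * (1 + \<bar>y\<bar>)"
    proof -
      have "(1 + cmod z) * (1 + \<bar>y\<bar>) = 1 + cmod z + \<bar>y\<bar> + cmod z * \<bar>y\<bar>" by (simp add: algebra_simps)
      moreover have "0 \<le> cmod z * \<bar>y\<bar>" by simp
      ultimately show ?thesis using tri by linarith
    qed
    then have "ln (1 + cmod (z - of_real y)) \<le> ln ((1 + cmod z) * (1 + \<bar>y\<bar>))"
      by (rule ln_mono) (simp add: add_pos_nonneg)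
    also have "\<dots> = ln (1 + cmod z) + ln (1 + \<bar>y\<bar>)"
    proof -
      have "1 + cmod z \<noteq> 0" "1 + \<bar>y\<bar> \<noteq> 0" using norm_ge_zero[of z] by linarith+
      then show ?thesis by (simp add: ln_mult)
    qed
    finally have 1: "ln (1 + cmod (z - of_real y)) \<le> ln (1 + cmod z) + ln (1 + \<bar>y\<bar>)" .
    have cp: "cmod (z - of_real y) > 0" using low z by linarith
    have "1 / cmod (z - of_real y) \<le> 1 / Im z" by (rule divide_left_mono) (use low z cp in simp_all)
    then have 2: "ln (1 + 1 / cmod (z - of_real y)) \<le> ln (1 + 1 / Im z)"
      by (intro ln_mono) (auto intro: add_pos_nonneg)
    have a: "\<bar>ln (cmod (z - of_real y))\<bar> \<le> ?c + ln (1 + \<bar>y\<bar>)"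
      using abs_ln_le[of "cmod (z - of_real y)"] 1 2 by simp
    have "norm (ln (cmod (z - of_real y)) * h y) = \<bar>ln (cmod (z - of_real y))\<bar> * h y" using h(1)[of y] by (simp add: abs_mult)
    also have "\<dots> \<le> (?c + ln (1 + \<bar>y\<bar>)) * (K * wt y)"
      by (rule mult_mono) (use a h[of y] in auto)
    also have "\<dots> = K * (?c * wt y + ln (1 + \<bar>y\<bar>) * wt y)" by (simp add: algebra_simps)
    also have "\<dots> \<le> norm \<dots>" by simp
    finally show "norm (ln (cmod (z - of_real y)) * h y) \<le> norm (K * (?c * wt y + ln (1 + \<bar>y\<bar>) * wt y))" .
  qed
qed measurable

text \<open>The logarithmic potential is the real part of a primitive of the Stieltjes transform. A
  second-order estimate differentiates under the integral; the difference with
  \<open>Re (\<Phi> z)\<close> then has zero derivative on a convex set.\<close>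

lemma log_potential_half_plane:
  fixes h :: "real \<Rightarrow> real"
  assumes [measurable]: "h \<in> borel_measurable borel" and h: "\<And>y. 0 \<le> h y" "\<And>y. h y \<le> K * wt y"
    and \<Phi>: "\<And>z. Im z > 0 \<Longrightarrow> (\<Phi> has_field_derivative (\<integral>y. of_real (h y) / (z - of_real y) \<partial>lborel)) (at z)"
  shows "\<exists>c. \<forall>z. Im z > 0 \<longrightarrow> (\<integral>y. ln (cmod (z - of_real y)) * h y \<partial>lborel) = Re (\<Phi> z) + c"
proof -
  define L where "L = (\<lambda>z. \<integral>y. ln (cmod (z - of_real y)) * h y \<partial>lborel)"
  define F where "F = (\<lambda>z::complex. \<integral>y. of_real (h y) / (z - of_real y) \<partial>lborel)"
  have hi: "integrable lborel h"
  proof (rule Bochner_Integration.integrable_bound)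
    show "integrable lborel (\<lambda>y. K * wt y)" using wt_integrable by simp
    show "AE y in lborel. norm (h y) \<le> norm (K * wt y)"
    proof (rule AE_I2)
      fix y :: real
      show "norm (h y) \<le> norm (K * wt y)" using h[of y] unfolding real_norm_def by linarith
    qed
  qed measurable
  have D: "(L has_derivative (\<lambda>d. Re (F z * d))) (at z)" if z: "Im z > 0" for z
  proof (rule has_derivativeI_sandwich[where e="Im z / 2" and H="\<lambda>w. 2 / (Im z)\<^sup>2 * (\<integral>y. h y \<partial>lborel) * norm (w - z)"])
    show "Im z / 2 > 0" using z by simp
    show "bounded_linear (\<lambda>d. Re (F z * d))"
      using bounded_linear_compose[OF bounded_linear_Re bounded_linear_mult_right] .
    have "((\<lambda>w. 2 / (Im z)\<^sup>2 * (\<integral>y. h y \<partial>lborel) * norm (w - z)) \<longlongrightarrow> 2 / (Im z)\<^sup>2 * (\<integral>y. h y \<partial>lborel) * norm (z - z)) (at z)"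
      by (intro tendsto_intros)
    then show "((\<lambda>w. 2 / (Im z)\<^sup>2 * (\<integral>y. h y \<partial>lborel) * norm (w - z)) \<longlongrightarrow> 0) (at z within UNIV)" by simp
    fix w assume w: "w \<noteq> z" "dist w z < Im z / 2"
    have Imw: "Im w > 0" using w(2) abs_Im_le_cmod[of "w - z"] z by (auto simp: dist_norm)
    note iz = ln_cmod_integrable[OF assms(1) h z] and iw = ln_cmod_integrable[OF assms(1) h Imw]
    have iF: "complex_integrable lborel (\<lambda>y. of_real (h y) / (z - of_real y))"
    proof (rule Bochner_Integration.integrable_bound)
      show "integrable lborel (\<lambda>y. h y / Im z)" using hi by simp
      show "AE y in lborel. cmod (of_real (h y) / (z - of_real y)) \<le> norm (h y / Im z)"
      proof (rule AE_I2)
        fix y :: real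
        have "Im z \<le> cmod (z - of_real y)" using abs_Im_le_cmod[of "z - of_real y"] z by simp
        moreover from this z have "cmod (z - of_real y) > 0" by linarith
        ultimately have "h y / cmod (z - of_real y) \<le> h y / Im z"
          using z h(1)[of y] by (intro divide_left_mono) simp_all
        then show "cmod (of_real (h y) / (z - of_real y)) \<le> norm (h y / Im z)"
          using z h(1)[of y] by (simp add: norm_divide)
      qed
    qed measurable
    have kb: "\<bar>ln (cmod (w - of_real y)) * h y - ln (cmod (z - of_real y)) * h y - Re (of_real (h y) / (z - of_real y) * (w - z))\<bar>
        \<le> 2 / (Im z)\<^sup>2 * (norm (w - z))\<^sup>2 * h y" for y
    proof -
      \<comment> \<open>\<open>w - y = (z - y) * (1 + u)\<close>, and the radius
        \<open>Im z / 2\<close> gives |u| \<le> 1/2. The increment of the logarithm is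
        \<open>Re (Ln (1 + u))\<close>, which differs from \<open>Re u\<close> by at most
        2|u|^2.\<close>
      define u where "u = (w - z) / (z - of_real y)"
      have low: "Im z \<le> cmod (z - of_real y)" using abs_Im_le_cmod[of "z - of_real y"] z by simp
      have nz: "z - of_real y \<noteq> 0" using low z by auto
      have "cmod u \<le> cmod (w - z) / Im z" unfolding u_def norm_divide
        by (rule divide_left_mono) (use low z nz in simp_all)
      moreover have "cmod (w - z) / Im z \<le> 1/2" using w(2) z by (simp add: dist_norm field_simps)
      ultimately have u: "cmod u \<le> cmod (w - z) / Im z" "cmod u \<le> 1/2" by - (assumption, linarith)
      have u1: "1 + u \<noteq> 0"
      proof
        assume "1 + u = 0"
        then have "u = -1" by (simp add: add_eq_0_iff)
        then show False using u(2) by simp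
      qed
      have "w - of_real y = (z - of_real y) * (1 + u)" using nz by (simp add: u_def field_simps)
      then have "ln (cmod (w - of_real y)) = ln (cmod (z - of_real y)) + ln (cmod (1 + u))"
        using nz u1 by (simp add: norm_mult ln_mult)
      then have "ln (cmod (w - of_real y)) - ln (cmod (z - of_real y)) - Re u = Re (Ln (1 + u) - u)"
        using u1 by simp
      also have "\<bar>\<dots>\<bar> \<le> cmod (Ln (1 + u) - u)" by (rule abs_Re_le_cmod)
      also have "\<dots> \<le> (cmod u)\<^sup>2 / (1 - cmod u)" using Ln_approx_linear[of u] u by simp
      also have "\<dots> \<le> (cmod u)\<^sup>2 / (1/2)" by (rule divide_left_mono) (use u in auto)
      also have "\<dots> \<le> 2 * (cmod (w - z) / Im z)\<^sup>2" using u power_mono[OF u(1), of 2] by simp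
      also have "\<dots> = 2 / (Im z)\<^sup>2 * (norm (w - z))\<^sup>2" by (simp add: power_divide)
      finally have fin: "\<bar>ln (cmod (w - of_real y)) - ln (cmod (z - of_real y)) - Re u\<bar> * h y \<le> 2 / (Im z)\<^sup>2 * (norm (w - z))\<^sup>2 * h y"
        by (rule mult_right_mono) (rule h)
      have re: "Re (of_real (h y) / (z - of_real y) * (w - z)) = h y * Re u"
      proof -
        have "of_real (h y) / (z - of_real y) * (w - z) = of_real (h y) * u" by (simp add: u_def)
        then show ?thesis by simp
      qed
      have "\<bar>(ln (cmod (w - of_real y)) - ln (cmod (z - of_real y)) - Re u) * h y\<bar> \<le> 2 / (Im z)\<^sup>2 * (norm (w - z))\<^sup>2 * h y"
        using fin h(1)[of y] by (simp only: abs_mult abs_of_nonneg)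
      moreover have "(ln (cmod (w - of_real y)) - ln (cmod (z - of_real y)) - Re u) * h y
        = ln (cmod (w - of_real y)) * h y - ln (cmod (z - of_real y)) * h y - Re (of_real (h y) / (z - of_real y) * (w - z))"
        unfolding re by (simp add: algebra_simps)
      ultimately show ?thesis by (simp only:)
    qed
    have iF2: "complex_integrable lborel (\<lambda>y. of_real (h y) / (z - of_real y) * (w - z))"
      by (rule integrable_mult_left) (rule iF)
    have iR: "integrable lborel (\<lambda>y. Re (of_real (h y) / (z - of_real y) * (w - z)))"
      by (rule integrable_Re[OF iF2])
    have FR: "Re (F z * (w - z)) = (\<integral>y. Re (of_real (h y) / (z - of_real y) * (w - z)) \<partial>lborel)"
      unfolding F_def integral_Re[OF iF2] by (simp only: integral_mult_left_zero)
    have "L w - L z - Re (F z * (w - z)) = (\<integral>y. ln (cmod (w - of_real y)) * h y - ln (cmod (z - of_real y)) * h y - Re (of_real (h y) / (z - of_real y) * (w - z)) \<partial>lborel)"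
      unfolding L_def FR using iz iw iR by (simp add: Bochner_Integration.integral_diff)
    also have "norm \<dots> \<le> (\<integral>y. 2 / (Im z)\<^sup>2 * (norm (w - z))\<^sup>2 * h y \<partial>lborel)"
    proof (rule order_trans[OF integral_norm_bound], rule integral_mono)
      show "integrable lborel (\<lambda>y. norm (ln (cmod (w - of_real y)) * h y - ln (cmod (z - of_real y)) * h y - Re (of_real (h y) / (z - of_real y) * (w - z))))"
        by (intro integrable_norm Bochner_Integration.integrable_diff iz iw iR)
      show "integrable lborel (\<lambda>y. 2 / (Im z)\<^sup>2 * (norm (w - z))\<^sup>2 * h y)" using hi by (intro integrable_mult_right) auto
    qed (use kb in simp)
    also have "\<dots> = 2 / (Im z)\<^sup>2 * (norm (w - z))\<^sup>2 * (\<integral>y. h y \<partial>lborel)" by simp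
    finally have "norm (L w - L z - Re (F z * (w - z))) \<le> (2 / (Im z)\<^sup>2 * (\<integral>y. h y \<partial>lborel) * norm (w - z)) * norm (w - z)"
      by (simp add: power2_eq_square algebra_simps)
    then show "norm (L w - L z - Re (F z * (w - z))) / norm (w - z) \<le> 2 / (Im z)\<^sup>2 * (\<integral>y. h y \<partial>lborel) * norm (w - z)"
      using w(1) by (simp add: pos_divide_le_eq)
  qed
  have "\<exists>c. \<forall>z\<in>{z. Im z > 0}. L z - Re (\<Phi> z) = c"
  proof (rule has_derivative_zero_constant)
    show "convex {z. Im z > 0}" by (rule convex_halfspace_Im_gt)
    fix z assume z: "z \<in> {z. Im z > 0}"
    have "(\<Phi> has_derivative (\<lambda>d. F z * d)) (at z)"
      using \<Phi>[of z] z by (simp add: F_def has_field_derivative_def)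
    then have "((\<lambda>z. Re (\<Phi> z)) has_derivative (\<lambda>d. Re (F z * d))) (at z)"
      by (rule bounded_linear.has_derivative[OF bounded_linear_Re])
    then have "((\<lambda>z. L z - Re (\<Phi> z)) has_derivative (\<lambda>d. Re (F z * d) - Re (F z * d))) (at z)"
      using D[of z] z by (intro has_derivative_diff) auto
    then show "((\<lambda>z. L z - Re (\<Phi> z)) has_derivative (\<lambda>h. 0)) (at z within {z. Im z > 0})"
      by (simp add: has_derivative_at_withinI)
  qed
  then obtain c where "\<forall>z\<in>{z. Im z > 0}. L z - Re (\<Phi> z) = c" ..
  then show ?thesis by (intro exI[of _ c]) (auto simp: L_def algebra_simps)
qed

text \<open>At height at most 1 above \<open>x\<close> the modulus lies between |x-y| and 1 + |x-y|,
  so its logarithm is dominated by functions that \<open>wt\<close> integrates.\<close>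

lemma log_potential_boundary:
  fixes h :: "real \<Rightarrow> real"
  assumes [measurable]: "h \<in> borel_measurable borel" and h: "\<And>y. 0 \<le> h y" "\<And>y. h y \<le> K * wt y"
  shows "(\<lambda>n. \<integral>y. ln (cmod (Complex x (1 / real (Suc n)) - of_real y)) * h y \<partial>lborel) \<longlonglongrightarrow> (\<integral>y. ln \<bar>x - y\<bar> * h y \<partial>lborel)"
proof (rule integral_dominated_convergence)
  obtain K' where K': "integrable lborel (\<lambda>y. \<bar>ln \<bar>x - y\<bar>\<bar> * wt y)" using log_potential_bound by blast
  show "integrable lborel (\<lambda>y. K * (\<bar>ln \<bar>x - y\<bar>\<bar> * wt y + ln (1 + \<bar>x\<bar>) * wt y + ln (1 + \<bar>y\<bar>) * wt y))"
    using K' wt_integrable wt_ln_integrable by simp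
  have ne: "AE y in lborel. y \<noteq> x" by (rule AE_lborel_singleton)
  show "AE y in lborel. (\<lambda>n. ln (cmod (Complex x (1 / real (Suc n)) - of_real y)) * h y) \<longlonglongrightarrow> ln \<bar>x - y\<bar> * h y"
    using ne
  proof eventually_elim
    case (elim y)
    have "(\<lambda>n. Complex x (1 / real (Suc n))) \<longlonglongrightarrow> Complex x 0"
      by (rule tendsto_Complex[OF tendsto_const LIMSEQ_Suc[OF lim_1_over_n]])
    then have "(\<lambda>n. cmod (Complex x (1 / real (Suc n)) - of_real y)) \<longlonglongrightarrow> cmod (Complex x 0 - of_real y)"
      by (rule tendsto_norm[OF tendsto_diff[OF _ tendsto_const]])
    moreover have "cmod (Complex x 0 - of_real y) = \<bar>x - y\<bar>" by (simp add: cmod_def)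
    ultimately show ?case using elim by (auto intro!: tendsto_intros)
  qed
  fix n
  show "AE y in lborel. norm (ln (cmod (Complex x (1 / real (Suc n)) - of_real y)) * h y)
      \<le> K * (\<bar>ln \<bar>x - y\<bar>\<bar> * wt y + ln (1 + \<bar>x\<bar>) * wt y + ln (1 + \<bar>y\<bar>) * wt y)"
    using ne
  proof eventually_elim
    case (elim y)
    let ?m = "cmod (Complex x (1 / real (Suc n)) - of_real y)"
    have e: "Complex x (1 / real (Suc n)) - of_real y = of_real (x - y) + of_real (1 / real (Suc n)) * \<i>"
      by (simp add: complex_eq_iff)
    have "?m \<le> cmod (of_real (x - y)) + cmod (of_real (1 / real (Suc n)) * \<i>)"
      unfolding e by (rule norm_triangle_ineq)
    also have "cmod (of_real (x - y)) = \<bar>x - y\<bar>" by (rule norm_of_real)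
    also have "cmod (of_real (1 / real (Suc n)) * \<i>) = 1 / real (Suc n)" by (simp add: norm_mult norm_divide del: of_nat_Suc)
    also have "\<bar>x - y\<bar> + 1 / real (Suc n) \<le> \<bar>x - y\<bar> + 1" by simp
    finally have up: "?m \<le> 1 + \<bar>x - y\<bar>" by simp
    have lo: "\<bar>x - y\<bar> \<le> ?m" using abs_Re_le_cmod[of "Complex x (1 / real (Suc n)) - of_real y"] by simp
    have p: "\<bar>x - y\<bar> > 0" using elim by simp
    have lm: "ln \<bar>x - y\<bar> \<le> ln ?m" "ln ?m \<le> ln (1 + \<bar>x - y\<bar>)"
      using lo up p by (auto intro!: ln_mono)
    have a: "\<bar>ln ?m\<bar> \<le> \<bar>ln \<bar>x - y\<bar>\<bar> + ln (1 + \<bar>x\<bar>) + ln (1 + \<bar>y\<bar>)"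
    proof -
      have "0 \<le> ln (1 + \<bar>x\<bar>)" "0 \<le> ln (1 + \<bar>y\<bar>)" by simp_all
      then show ?thesis using lm ln_one_plus_triangle[of x y] by linarith
    qed
    have "norm (ln ?m * h y) = \<bar>ln ?m\<bar> * h y" using h(1)[of y] by (simp add: abs_mult)
    also have "\<dots> \<le> (\<bar>ln \<bar>x - y\<bar>\<bar> + ln (1 + \<bar>x\<bar>) + ln (1 + \<bar>y\<bar>)) * (K * wt y)"
      by (rule mult_mono) (use a h[of y] in auto)
    also have "\<dots> = K * (\<bar>ln \<bar>x - y\<bar>\<bar> * wt y + ln (1 + \<bar>x\<bar>) * wt y + ln (1 + \<bar>y\<bar>) * wt y)" by (simp add: algebra_simps)
    finally show ?case .
  qed
qed measurable

text \<open>Any primitive of the Stieltjes transform with known boundary limits gives the potential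
  on the line up to a constant; such constants end up in the multipliers of the Euler--Lagrange
  conditions.\<close>

lemma log_potential_line:
  fixes h :: "real \<Rightarrow> real"
  assumes "h \<in> borel_measurable borel" "\<And>y. 0 \<le> h y" "\<And>y. h y \<le> K * wt y"
    and "\<And>z. Im z > 0 \<Longrightarrow> (\<Phi> has_field_derivative (\<integral>y. of_real (h y) / (z - of_real y) \<partial>lborel)) (at z)"
    and lim: "\<And>x. (\<lambda>n. Re (\<Phi> (Complex x (1 / real (Suc n))))) \<longlonglongrightarrow> \<phi> x"
  shows "\<exists>c. \<forall>x. (\<integral>y. ln \<bar>x - y\<bar> * h y \<partial>lborel) = \<phi> x + c"
proof -
  obtain c where c: "\<And>z. Im z > 0 \<Longrightarrow> (\<integral>y. ln (cmod (z - of_real y)) * h y \<partial>lborel) = Re (\<Phi> z) + c"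
    using log_potential_half_plane[OF assms(1-4)] by blast
  have "(\<integral>y. ln \<bar>x - y\<bar> * h y \<partial>lborel) = \<phi> x + c" for x
  proof (rule LIMSEQ_unique[OF log_potential_boundary[OF assms(1-3)]])
    have "(\<lambda>n. Re (\<Phi> (Complex x (1 / real (Suc n)))) + c) \<longlonglongrightarrow> \<phi> x + c"
      by (intro tendsto_intros lim)
    then show "(\<lambda>n. \<integral>y. ln (cmod (Complex x (1 / real (Suc n)) - of_real y)) * h y \<partial>lborel) \<longlonglongrightarrow> \<phi> x + c"
      using c by simp
  qed
  then show ?thesis by blast
qed

section \<open>Masses, finiteness of energies and logarithmic moments\<close>

lemma stieltjes_mass:
  fixes h :: "real \<Rightarrow> real"
  assumes hi: "integrable lborel h"
    and lim: "(\<lambda>n. \<i> * of_nat (Suc n) * (\<integral>y. of_real (h y) / (\<i> * of_nat (Suc n) - of_real y) \<partial>lborel)) \<longlonglongrightarrow> of_real m"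
  shows "(\<integral>y. h y \<partial>lborel) = m"
proof -
  have [measurable]: "h \<in> borel_measurable borel" using hi by auto
  \<comment> \<open>Along the imaginary axis z/(z - y) tends to 1 with modulus at most 1, so |h|
    dominates.\<close>
  have "(\<lambda>n. \<integral>y. \<i> * of_nat (Suc n) * (of_real (h y) / (\<i> * of_nat (Suc n) - of_real y)) \<partial>lborel) \<longlonglongrightarrow> (\<integral>y. complex_of_real (h y) \<partial>lborel)"
  proof (rule integral_dominated_convergence[where w="\<lambda>y. norm (h y)"])
    show "integrable lborel (\<lambda>y. norm (h y))" using hi by simp
    show "AE y in lborel. (\<lambda>n. \<i> * of_nat (Suc n) * (of_real (h y) / (\<i> * of_nat (Suc n) - of_real y))) \<longlonglongrightarrow> complex_of_real (h y)"
    proof (rule AE_I2)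
      fix y :: real
      have "(\<lambda>n. of_real (h y) / (1 - of_real y / \<i> * of_real (1 / real (Suc n)))) \<longlonglongrightarrow> complex_of_real (h y) / (1 - of_real y / \<i> * of_real 0)"
        by (intro tendsto_intros LIMSEQ_Suc[OF lim_1_over_n]) auto
      moreover have "of_real (h y) / (1 - of_real y / \<i> * of_real (1 / real (Suc n))) = \<i> * of_nat (Suc n) * (of_real (h y) / (\<i> * of_nat (Suc n) - of_real y))" for n
      proof -
        have e: "1 - Y / \<i> * (1 / N) = (\<i> * N - Y) / (\<i> * N)" if "N \<noteq> 0" for N Y :: complex
          using that by (simp add: field_simps)
        have "(1 - of_real y / \<i> * of_real (1 / real (Suc n))) = (\<i> * of_nat (Suc n) - of_real y) / (\<i> * of_nat (Suc n))"
          using e[of "of_nat (Suc n)" "of_real y"] by (simp del: of_nat_Suc)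
        then show ?thesis by simp
      qed
      ultimately show "(\<lambda>n. \<i> * of_nat (Suc n) * (of_real (h y) / (\<i> * of_nat (Suc n) - of_real y))) \<longlonglongrightarrow> complex_of_real (h y)"
        by simp
    qed
    fix n
    show "AE y in lborel. norm (\<i> * of_nat (Suc n) * (of_real (h y) / (\<i> * of_nat (Suc n) - complex_of_real y))) \<le> norm (h y)"
    proof (rule AE_I2)
      fix y :: real
      have "real (Suc n) \<le> cmod (\<i> * of_nat (Suc n) - complex_of_real y)"
        using abs_Im_le_cmod[of "\<i> * of_nat (Suc n) - complex_of_real y"] by simp
      then show "norm (\<i> * of_nat (Suc n) * (of_real (h y) / (\<i> * of_nat (Suc n) - complex_of_real y))) \<le> norm (h y)"
        by (simp add: norm_mult norm_divide divide_le_eq mult.commute mult_left_mono del: of_nat_Suc)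
    qed
  qed measurable
  then have "(\<integral>y. complex_of_real (h y) \<partial>lborel) = of_real m"
    unfolding integral_mult_right_zero by (rule LIMSEQ_unique[OF _ lim])
  then show ?thesis by simp
qed

lemma finite_measure_density_wt:
  fixes h :: "real \<Rightarrow> real"
  assumes [measurable]: "h \<in> borel_measurable borel" and h: "\<And>y. 0 \<le> h y" "\<And>y. h y \<le> K * wt y"
  shows "integrable lborel h" "finite_measure (density lborel (\<lambda>y. ennreal (h y)))"
    "emeasure (density lborel (\<lambda>y. ennreal (h y))) UNIV = ennreal (\<integral>y. h y \<partial>lborel)"
proof -
  show i: "integrable lborel h"
  proof (rule Bochner_Integration.integrable_bound)
    show "integrable lborel (\<lambda>y. K * wt y)" using wt_integrable by simp
    show "AE y in lborel. norm (h y) \<le> norm (K * wt y)"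
    proof (rule AE_I2)
      fix y :: real
      show "norm (h y) \<le> norm (K * wt y)" using h[of y] unfolding real_norm_def by linarith
    qed
  qed measurable
  show e: "emeasure (density lborel (\<lambda>y. ennreal (h y))) UNIV = ennreal (\<integral>y. h y \<partial>lborel)"
    using nn_integral_eq_integral[OF i] h(1) by (simp add: emeasure_density)
  show "finite_measure (density lborel (\<lambda>y. ennreal (h y)))"
    by (rule finite_measureI) (use e in simp)
qed

text \<open>Integrates the logarithmic growth bound against \<nu>. The diagonal is null because
  \<mu> has no atoms. Both orders of the pair are recorded, since \<open>log_finite\<close> and
  \<open>logI\<close> refer to an ordered product measure.\<close>

lemma log_finite_density:
  fixes h :: "real \<Rightarrow> real"
  assumes hm[measurable]: "h \<in> borel_measurable borel" and h: "\<And>y. 0 \<le> h y" "\<And>y. h y \<le> K * wt y"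
    and fin: "finite_measure \<nu>" and sb[measurable_cong]: "sets \<nu> = sets borel" and ln: "integrable \<nu> (\<lambda>x. ln (1 + \<bar>x\<bar>))"
  defines "\<mu> \<equiv> density lborel (\<lambda>y. ennreal (h y))"
  defines "L \<equiv> \<lambda>x. \<integral>y. ln \<bar>x - y\<bar> * h y \<partial>lborel"
  shows "log_finite \<nu> \<mu>" "log_finite \<mu> \<nu>" "integrable \<nu> L" "logI \<nu> \<mu> = - (\<integral>x. L x \<partial>\<nu>)" "logI \<mu> \<nu> = - (\<integral>x. L x \<partial>\<nu>)"
proof -
  interpret N: finite_measure \<nu> by fact
  interpret M: finite_measure \<mu> unfolding \<mu>_def by (rule finite_measure_density_wt[OF hm h])
  interpret NM: pair_sigma_finite \<nu> \<mu> ..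
  interpret MN: pair_sigma_finite \<mu> \<nu> ..
  have sm[measurable_cong]: "sets \<mu> = sets borel" by (simp add: \<mu>_def)
  have spN: "space \<nu> = UNIV" "space \<mu> = UNIV" using sb[THEN sets_eq_imp_space_eq] sm[THEN sets_eq_imp_space_eq] by auto
  obtain K' where K': "K' \<ge> 0" "\<And>x. integrable lborel (\<lambda>y. \<bar>ln \<bar>x - y\<bar>\<bar> * wt y)"
    "\<And>x. (\<integral>y. \<bar>ln \<bar>x - y\<bar>\<bar> * wt y \<partial>lborel) \<le> K' * (1 + ln (1 + \<bar>x\<bar>))" using log_potential_bound by blast
  have K: "K \<ge> 0"
  proof -
    have "0 \<le> K * wt 1" using h[of 1] by linarith
    then show ?thesis by (simp add: wt_eq)
  qed
  have hb: "\<bar>ln \<bar>x - y\<bar>\<bar> * h y \<le> K * (\<bar>ln \<bar>x - y\<bar>\<bar> * wt y)" for x y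
    using mult_left_mono[OF h(2)[of y], of "\<bar>ln \<bar>x - y\<bar>\<bar>"] by (simp add: mult_ac)
  have ia: "integrable lborel (\<lambda>y. \<bar>ln \<bar>x - y\<bar>\<bar> * h y)" for x
  proof (rule Bochner_Integration.integrable_bound)
    show "integrable lborel (\<lambda>y. K * (\<bar>ln \<bar>x - y\<bar>\<bar> * wt y))" using K'(2) by simp
    show "AE y in lborel. norm (\<bar>ln \<bar>x - y\<bar>\<bar> * h y) \<le> norm (K * (\<bar>ln \<bar>x - y\<bar>\<bar> * wt y))"
    proof (rule AE_I2)
      fix y
      show "norm (\<bar>ln \<bar>x - y\<bar>\<bar> * h y) \<le> norm (K * (\<bar>ln \<bar>x - y\<bar>\<bar> * wt y))"
        using hb[of x y] h(1)[of y] by (simp add: abs_mult K)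
    qed
  qed measurable
  have lk: "logker (x, y) = - ln \<bar>x - y\<bar>" for x y by (cases "x = y") (simp_all add: logker_def ln_div)
  have in_int: "integrable \<mu> (\<lambda>y. logker (x, y))" for x
    unfolding \<mu>_def
  proof (subst integrable_density)
    show "integrable lborel (\<lambda>y. h y *\<^sub>R logker (x, y))"
      by (rule Bochner_Integration.integrable_bound[OF ia[of x]]) (auto simp: lk abs_mult mult.commute)
  qed (use h in auto)
  have in_val: "(\<integral>y. logker (x, y) \<partial>\<mu>) = - L x" for x
    unfolding \<mu>_def L_def by (subst integral_density) (use h in \<open>auto simp: lk mult.commute\<close>)
  have in_abs: "(\<integral>y. norm (logker (x, y)) \<partial>\<mu>) = (\<integral>y. \<bar>ln \<bar>x - y\<bar>\<bar> * h y \<partial>lborel)" for x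
    unfolding \<mu>_def by (subst integral_density) (use h in \<open>auto simp: lk mult.commute\<close>)
  have fi: "integrable (\<nu> \<Otimes>\<^sub>M \<mu>) logker"
  proof (rule NM.Fubini_integrable)
    show "integrable \<nu> (\<lambda>x. \<integral>y. norm (logker (x, y)) \<partial>\<mu>)"
    proof (rule Bochner_Integration.integrable_bound)
      show "integrable \<nu> (\<lambda>x. K * (K' * (1 + ln (1 + \<bar>x\<bar>))))" using ln by simp
      show "AE x in \<nu>. norm (\<integral>y. norm (logker (x, y)) \<partial>\<mu>) \<le> norm (K * (K' * (1 + ln (1 + \<bar>x\<bar>))))"
      proof (rule AE_I2)
        fix x
        have "(\<integral>y. \<bar>ln \<bar>x - y\<bar>\<bar> * h y \<partial>lborel) \<le> (\<integral>y. K * (\<bar>ln \<bar>x - y\<bar>\<bar> * wt y) \<partial>lborel)"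
          by (rule integral_mono[OF ia]) (use K'(2) hb in auto)
        also have "\<dots> \<le> K * (K' * (1 + ln (1 + \<bar>x\<bar>)))" using K'(3)[of x] K by (simp add: mult_left_mono)
        finally have "(\<integral>y. \<bar>ln \<bar>x - y\<bar>\<bar> * h y \<partial>lborel) \<le> K * (K' * (1 + ln (1 + \<bar>x\<bar>)))" .
        moreover have "0 \<le> (\<integral>y. \<bar>ln \<bar>x - y\<bar>\<bar> * h y \<partial>lborel)" using h by (intro Bochner_Integration.integral_nonneg) auto
        ultimately show "norm (\<integral>y. norm (logker (x, y)) \<partial>\<mu>) \<le> norm (K * (K' * (1 + ln (1 + \<bar>x\<bar>))))"
          unfolding in_abs unfolding real_norm_def by linarith
      qed
    qed measurable
  qed (use in_int in auto)
  have sing: "emeasure \<mu> {x} = 0" for x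
  proof -
    have "AE y in lborel. y \<notin> {x}" using AE_lborel_singleton[of x] by simp
    then have "(\<integral>\<^sup>+y. ennreal (h y) * indicator {x} y \<partial>lborel) = 0"
      by (subst nn_integral_0_iff_AE) (auto elim: eventually_mono)
    then show ?thesis unfolding \<mu>_def by (simp add: emeasure_density)
  qed
  have dm: "{p. fst p = snd p} \<in> sets (\<nu> \<Otimes>\<^sub>M \<mu>)" "{p. fst p = snd p} \<in> sets (\<mu> \<Otimes>\<^sub>M \<nu>)"
  proof -
    have "{p \<in> space (\<nu> \<Otimes>\<^sub>M \<mu>). fst p = snd p} \<in> sets (\<nu> \<Otimes>\<^sub>M \<mu>)" by measurable
    then show "{p. fst p = snd p} \<in> sets (\<nu> \<Otimes>\<^sub>M \<mu>)" by (simp add: space_pair_measure spN)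
    have "{p \<in> space (\<mu> \<Otimes>\<^sub>M \<nu>). fst p = snd p} \<in> sets (\<mu> \<Otimes>\<^sub>M \<nu>)" by measurable
    then show "{p. fst p = snd p} \<in> sets (\<mu> \<Otimes>\<^sub>M \<nu>)" by (simp add: space_pair_measure spN)
  qed
  have "Pair x -` {p::real\<times>real. fst p = snd p} = {x}" "(\<lambda>x. (x, y)) -` {p::real\<times>real. fst p = snd p} = {y}" for x y by auto
  then have diag: "emeasure (\<nu> \<Otimes>\<^sub>M \<mu>) {p. fst p = snd p} = 0" "emeasure (\<mu> \<Otimes>\<^sub>M \<nu>) {p. fst p = snd p} = 0"
    using M.emeasure_pair_measure_alt[OF dm(1)] MN.emeasure_pair_measure_alt2[OF dm(2)] sing by simp_all
  show lf: "log_finite \<nu> \<mu>" using fi diag by (simp add: log_finite_def)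
  have sym: "(\<lambda>(x, y). logker (y, x)) = logker" by (auto simp: logker_def abs_minus_commute)
  show "log_finite \<mu> \<nu>" using NM.integrable_product_swap[OF fi] diag sym by (simp add: log_finite_def)
  show "integrable \<nu> L" using NM.integrable_fst'[OF fi] by (simp add: in_val)
  show I: "logI \<nu> \<mu> = - (\<integral>x. L x \<partial>\<nu>)" unfolding logI_def NM.integral_fst'[OF fi, symmetric] by (simp add: in_val)
  have "logI \<mu> \<nu> = logI \<nu> \<mu>" unfolding logI_def
    using NM.integral_product_swap[of logker] sym by simp
  then show "logI \<mu> \<nu> = - (\<integral>x. L x \<partial>\<nu>)" using I by simp
qed

text \<open>A competitor is only known to have finite energy. By Fubini some section of the kernel
  at a point \<open>x\<close> is integrable, positive mass ensuring that such an \<open>x\<close>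
  exists, and this section controls \<open>ln (1 + |y|)\<close> up to a constant depending on
  \<open>x\<close>.\<close>

lemma log_integrable_of_log_finite:
  assumes "finite_measure \<nu>" and sb[measurable_cong]: "sets \<nu> = sets borel" and "emeasure \<nu> UNIV \<noteq> 0" and lf: "log_finite \<nu> \<nu>"
  shows "integrable \<nu> (\<lambda>x. ln (1 + \<bar>x\<bar>))"
proof -
  interpret N: finite_measure \<nu> by fact
  interpret NN: pair_sigma_finite \<nu> \<nu> ..
  have sp: "space \<nu> = UNIV" using sb[THEN sets_eq_imp_space_eq] by simp
  have "AE x in \<nu>. integrable \<nu> (\<lambda>y. logker (x, y))"
    using NN.AE_integrable_fst' lf by (auto simp: log_finite_def)
  moreover have "\<not> (AE x in \<nu>. False)"
    using assms(3) by (simp add: AE_iff_measurable[OF _ refl] sp)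
  ultimately obtain x where x: "integrable \<nu> (\<lambda>y. logker (x, y))"
    by (metis (mono_tags, lifting) eventually_mono)
  show ?thesis
  proof (rule Bochner_Integration.integrable_bound)
    show "integrable \<nu> (\<lambda>y. ln (2 + \<bar>x\<bar>) + \<bar>logker (x, y)\<bar>)" using x by simp
    have "ln (1 + \<bar>y\<bar>) \<le> ln (2 + \<bar>x\<bar>) + \<bar>logker (x, y)\<bar>" for y
    proof (cases "\<bar>x - y\<bar> \<ge> 1")
      case True
      have "1 + \<bar>y\<bar> \<le> 1 + \<bar>x\<bar> + \<bar>x - y\<bar>" by linarith
      also have "\<dots> \<le> (2 + \<bar>x\<bar>) * \<bar>x - y\<bar>"
        using True mult_right_mono[of 1 "\<bar>x - y\<bar>" "1 + \<bar>x\<bar>"] by (simp add: algebra_simps)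
      finally have "ln (1 + \<bar>y\<bar>) \<le> ln ((2 + \<bar>x\<bar>) * \<bar>x - y\<bar>)" by (intro ln_mono) auto
      also have "\<dots> = ln (2 + \<bar>x\<bar>) + ln \<bar>x - y\<bar>"
      proof -
        have "2 + \<bar>x\<bar> \<noteq> 0" "\<bar>x - y\<bar> \<noteq> 0" using True by linarith+
        then show ?thesis by (simp add: ln_mult)
      qed
      also have "ln \<bar>x - y\<bar> \<le> \<bar>logker (x, y)\<bar>" using True by (simp add: logker_def ln_div)
      finally show ?thesis by simp
    next
      case False
      have "ln (1 + \<bar>y\<bar>) \<le> ln (2 + \<bar>x\<bar>)" by (rule ln_mono) (use False in linarith)+
      then show ?thesis using abs_ge_zero[of "logker (x, y)"] by linarith
    qed
    then show "AE y in \<nu>. norm (ln (1 + \<bar>y\<bar>)) \<le> norm (ln (2 + \<bar>x\<bar>) + \<bar>logker (x, y)\<bar>)"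
      by (intro AE_I2) (simp add: order_trans)
  qed measurable
qed

section \<open>Inverse branches of a holomorphic function over the half plane\<close>

text \<open>Connectedness argument: the part of \<open>W\<close> covered by \<open>f\<close> on D
  \<inter> N is open by the open mapping theorem. It is relatively closed because by
  \<open>proper\<close> preimages of a convergent sequence accumulate at a nonzero point, and the
  frontier conditions keep that point in D \<inter> N. With N the whole plane this gives global
  surjectivity, with N a small ball the local version.\<close>

lemma half_plane_in_image:
  fixes f :: "complex \<Rightarrow> complex"
  assumes holo: "f holomorphic_on (-{0})"
    and nc: "\<And>X. open X \<Longrightarrow> X \<subseteq> -{0} \<Longrightarrow> X \<noteq> {} \<Longrightarrow> \<not> f constant_on X"
    and proper: "\<And>R. \<exists>e>0. \<exists>M. \<forall>\<tau>. \<tau> \<noteq> 0 \<longrightarrow> cmod (f \<tau>) \<le> R \<longrightarrow> e \<le> cmod \<tau> \<and> cmod \<tau> \<le> M"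
    and D: "open D" "0 \<notin> D"
    and fr: "\<And>\<tau>. \<tau> \<in> closure D \<Longrightarrow> \<tau> \<notin> D \<Longrightarrow> \<tau> \<noteq> 0 \<Longrightarrow> Im (f \<tau>) \<le> 0"
    and W: "connected W" "\<And>z. z \<in> W \<Longrightarrow> Im z > 0"
    and N: "open N" "\<And>\<tau>. \<tau> \<in> closure N \<Longrightarrow> \<tau> \<notin> N \<Longrightarrow> \<tau> \<noteq> 0 \<Longrightarrow> f \<tau> \<notin> W"
    and ne: "p \<in> D \<inter> N" "f p \<in> W"
    and z: "z \<in> W"
  shows "\<exists>\<tau>\<in>D \<inter> N. f \<tau> = z"
proof -
  let ?U = "D \<inter> N"
  define S where "S = W \<inter> f ` ?U"
  have oU: "open ?U" "?U \<subseteq> -{0}" using D N by auto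
  have "open (f ` ?U)"
    by (rule open_mapping_thm2[OF holo _ oU(1) oU(2) nc]) auto
  then have 1: "openin (top_of_set W) S" unfolding S_def by (rule openin_open_Int)
  have 2: "closedin (top_of_set W) S"
  proof -
    have "S = W \<inter> closure S"
    proof
      show "S \<subseteq> W \<inter> closure S" unfolding S_def using closure_subset by fastforce
      show "W \<inter> closure S \<subseteq> S"
      proof
        fix y assume y: "y \<in> W \<inter> closure S"
        then obtain x where x: "\<And>n. x n \<in> S" "x \<longlonglongrightarrow> y" by (auto simp: closure_sequential)
        have "\<forall>n. \<exists>\<tau>. \<tau> \<in> ?U \<and> f \<tau> = x n" using x(1) unfolding S_def by (metis IntE imageE)
        from choice[OF this] obtain \<tau> where \<tau>: "\<And>n. \<tau> n \<in> ?U" "\<And>n. f (\<tau> n) = x n" by blast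
        have "Bseq x" using x(2) by (intro convergent_imp_Bseq) (auto simp: convergent_def)
        then obtain R where R: "\<And>n. cmod (x n) \<le> R" by (auto simp: Bseq_def)
        obtain e M where e: "e > 0" "\<And>\<tau>. \<tau> \<noteq> 0 \<Longrightarrow> cmod (f \<tau>) \<le> R \<Longrightarrow> e \<le> cmod \<tau> \<and> cmod \<tau> \<le> M" using proper[of R] by blast
        have bd: "e \<le> cmod (\<tau> n) \<and> cmod (\<tau> n) \<le> M" for n
        proof (rule e(2))
          show "\<tau> n \<noteq> 0" using \<tau>(1)[of n] D(2) by auto
        qed (use \<tau>(2) R in auto)
        then have "\<And>n. \<tau> n \<in> cball 0 M" by auto
        then obtain t r where t: "strict_mono (r::nat\<Rightarrow>nat)" "(\<tau> \<circ> r) \<longlonglongrightarrow> t"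
          using compact_cball[of 0 M] unfolding compact_def by blast
        have "e \<le> cmod t"
          using tendsto_norm[OF t(2)] by (rule tendsto_lowerbound) (use bd in auto)
        then have t0: "t \<noteq> 0" using e(1) by auto
        then have "isCont f t"
          using holomorphic_on_imp_continuous_on[OF holo] by (simp add: continuous_on_eq_continuous_at open_Compl)
        then have "(\<lambda>n. f ((\<tau> \<circ> r) n)) \<longlonglongrightarrow> f t" using t(2) isCont_tendsto_compose by blast
        moreover have "(\<lambda>n. f ((\<tau> \<circ> r) n)) = x \<circ> r" using \<tau>(2) by auto
        moreover have "(x \<circ> r) \<longlonglongrightarrow> y" using x(2) t(1) by (rule LIMSEQ_subseq_LIMSEQ)
        ultimately have ft: "f t = y" using LIMSEQ_unique by metis
        have tc: "t \<in> closure D" "t \<in> closure N"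
          using t(2) \<tau>(1) unfolding closure_sequential by (auto intro!: exI[of _ "\<tau> \<circ> r"])
        have "Im (f t) > 0" using W(2)[of y] y ft by auto
        then have "t \<in> D" using fr[OF tc(1) _ t0] by force
        moreover have "t \<in> N" using N(2)[OF tc(2) _ t0] ft y by auto
        ultimately show "y \<in> S" using ft y unfolding S_def by auto
      qed
    qed
    then show ?thesis by (metis closed_closure closedin_closed_Int)
  qed
  have "f p \<in> S" using ne unfolding S_def by auto
  then have "S = W" using W(1) 1 2 unfolding connected_clopen by blast
  then show ?thesis using z unfolding S_def by (metis Int_iff imageE)
qed

section \<open>The spectral curve\<close>

text \<open>Polymorphic, so that the complex map \<open>f\<close> and its restriction
  \<open>fr\<close> to the real axis are instances of one formula.\<close>

definition laurent :: "real \<Rightarrow> real \<Rightarrow> real \<Rightarrow> real \<Rightarrow> real \<Rightarrow> 'a::real_field \<Rightarrow> 'a" where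
  "laurent u B C D v \<tau> = of_real (u\<^sup>2) * \<tau>\<^sup>2 + of_real B * \<tau> + of_real C + of_real D / \<tau> + of_real (v\<^sup>2) / \<tau>\<^sup>2"

lemma laurent_of_real: "laurent u B C D v (of_real t :: 'a::real_field) = of_real (laurent u B C D v t)"
  by (simp add: laurent_def)

definition resid :: "real \<Rightarrow> real \<Rightarrow> real \<Rightarrow> real \<Rightarrow> real \<Rightarrow> real \<Rightarrow> 'a::real_field \<Rightarrow> 'a" where
  "resid a1 a2 a3 c1 c2 c3 \<tau> = of_real a1 / (of_real c1 - \<tau>) + of_real a2 / (of_real c2 - \<tau>) + of_real a3 / (of_real c3 - \<tau>)"

lemma resid_of_real: "resid a1 a2 a3 c1 c2 c3 (of_real t :: 'a::real_field) = of_real (resid a1 a2 a3 c1 c2 c3 t)"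
  by (simp add: resid_def)

text \<open>Here \<open>z = f \<tau>\<close> is a degree 4 map from the sphere, with double poles at \<open>\<infinity>\<close> and \<open>0\<close> and critical
  points \<open>c1, c2, c3, -c0\<close>; the branches of \<open>s\<close> are built from the Stieltjes transforms of the measures. The hypotheses
  \<open>sq\<close> and \<open>sq'\<close> say that \<open>s\<close> is \<open>\<minusplus> \<alpha> / sqrt z\<close> on the two sheets near \<open>\<tau> = \<infinity>\<close> and
  \<open>\<gamma> \<minusplus> \<beta> / sqrt z\<close> on the two sheets near \<open>\<tau> = 0\<close>, up to lower order.\<close>

locale spectral_curve =
  fixes \<alpha> \<beta> \<gamma> u v B C D c0 c1 c2 c3 a1 a2 a3 k l :: real
  fixes f s :: "complex \<Rightarrow> complex" and fr :: "real \<Rightarrow> real"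
  defines "f \<equiv> laurent u B C D v" and "fr \<equiv> laurent u B C D v" and "s \<equiv> resid a1 a2 a3 c1 c2 c3"
  assumes pos: "\<alpha> > 0" "\<beta> > 0" "\<gamma> > 0" "u > 0" "v > 0" "c0 > 0" "c3 > 0"
    and ord: "c3 \<le> c2" "c2 \<le> c1"
    and a_nonneg: "a1 \<ge> 0" "a2 \<ge> 0" "a3 \<ge> 0"
    and cB: "B = 2 * u\<^sup>2 * (c0 - c1 - c2 - c3)"
    and e2: "c1*c2 + c1*c3 + c2*c3 = c0 * (c1 + c2 + c3)"
    and cD: "D = 2 * u\<^sup>2 * (c1*c2*c3 - c0 * (c1*c2 + c1*c3 + c2*c3))"
    and cv: "v\<^sup>2 = u\<^sup>2 * c0 * c1 * c2 * c3"
    and circ: "u * c3\<^sup>2 \<le> v" "v \<le> u * c1\<^sup>2"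
    and vals: "fr c1 \<le> 0" "fr c3 \<le> 0" "fr c2 \<ge> 0"
    and neg: "\<And>t. t < 0 \<Longrightarrow> fr t > 0"
    and degen: "\<And>\<tau>. c3 = c1 \<Longrightarrow> cmod \<tau> = c1 \<Longrightarrow> Re (f \<tau>) \<ge> 0"
    and a_sum: "a1 + a2 + a3 = \<alpha> / u" "a1/c1 + a2/c2 + a3/c3 = \<gamma>" "a1/c1\<^sup>2 + a2/c2\<^sup>2 + a3/c3\<^sup>2 = \<beta> / v"
    and sq: "\<And>\<tau>. \<tau> \<noteq> 0 \<Longrightarrow> \<tau> \<noteq> of_real c1 \<Longrightarrow> \<tau> \<noteq> of_real c2 \<Longrightarrow> \<tau> \<noteq> of_real c3 \<Longrightarrow>
       (s \<tau>)\<^sup>2 * f \<tau> = of_real (\<alpha>\<^sup>2) - of_real (\<alpha> / u) / \<tau> + of_real k / \<tau>\<^sup>2"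
    and sq': "\<And>\<tau>. \<tau> \<noteq> 0 \<Longrightarrow> \<tau> \<noteq> of_real c1 \<Longrightarrow> \<tau> \<noteq> of_real c2 \<Longrightarrow> \<tau> \<noteq> of_real c3 \<Longrightarrow>
       (of_real \<gamma> - s \<tau>)\<^sup>2 * f \<tau> = of_real (\<beta>\<^sup>2) - of_real (\<beta> / v) * \<tau> + of_real l * \<tau>\<^sup>2"
    and pole: "a1 > 0 \<Longrightarrow> fr c1 = 0" "a2 > 0 \<Longrightarrow> fr c2 = 0" "a3 > 0 \<Longrightarrow> fr c3 = 0"
begin

lemma cpos: "c1 > 0" "c2 > 0" using pos ord by auto

lemma f_def': "f \<tau> = of_real (u\<^sup>2) * \<tau>\<^sup>2 + of_real B * \<tau> + of_real C + of_real D / \<tau> + of_real (v\<^sup>2) / \<tau>\<^sup>2"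
  by (simp add: f_def laurent_def)

lemma fr_def': "fr t = u\<^sup>2 * t\<^sup>2 + B * t + C + D / t + v\<^sup>2 / t\<^sup>2"
  by (simp add: fr_def laurent_def)

lemma f_real: "f (of_real t) = of_real (fr t)"
  by (simp add: f_def fr_def laurent_of_real)

lemma f_cnj: "f (cnj \<tau>) = cnj (f \<tau>)" by (simp add: f_def')

section \<open>Critical points, fibres and properness of the covering map\<close>

definition f' :: "complex \<Rightarrow> complex" where
  "f' \<tau> = 2 * of_real (u\<^sup>2) * \<tau> + of_real B - of_real D / \<tau>\<^sup>2 - 2 * of_real (v\<^sup>2) / \<tau>^3"

definition fr' :: "real \<Rightarrow> real" where
  "fr' t = 2 * u\<^sup>2 * t + B - D / t\<^sup>2 - 2 * v\<^sup>2 / t^3"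

lemma f_deriv: "\<tau> \<noteq> 0 \<Longrightarrow> (f has_field_derivative f' \<tau>) (at \<tau>)"
  unfolding f_def'[abs_def] f'_def
  by (auto intro!: derivative_eq_intros simp: power2_eq_square power3_eq_cube field_simps)

lemma fr_deriv: "t \<noteq> 0 \<Longrightarrow> (fr has_field_derivative fr' t) (at t)"
  unfolding fr_def'[abs_def] fr'_def
  by (auto intro!: derivative_eq_intros simp: power2_eq_square power3_eq_cube field_simps)

text \<open>\<open>t^3 * fr' t\<close> is a quartic without a \<open>t^2\<close> term. The
  hypotheses \<open>cB\<close>, \<open>e2\<close>, \<open>cD\<close> and \<open>cv\<close> are the
  four coefficient identities saying that its roots are \<open>c1\<close>, \<open>c2\<close>,
  \<open>c3\<close> and \<open>-c0\<close>; \<open>e2\<close> is the one for the missing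
  term.\<close>

lemma fr'_prod: "t \<noteq> 0 \<Longrightarrow> fr' t = 2 * u\<^sup>2 * ((t - c1) * (t - c2) * (t - c3) * (t + c0)) / t^3"
proof -
  assume t: "t \<noteq> 0"
  have "fr' t * t^3 = 2*u\<^sup>2*t^4 + B*t^3 - D*t - 2* v\<^sup>2"
    using t by (simp add: fr'_def field_simps power2_eq_square power3_eq_cube power4_eq_xxxx)
  also have "\<dots> = 2 * u\<^sup>2 * (t^4 + (c0 - c1 - c2 - c3) * t^3 + (c1*c2 + c1*c3 + c2*c3 - c0*(c1+c2+c3)) * t^2 - (c1*c2*c3 - c0 * (c1*c2 + c1*c3 + c2*c3)) * t - c0*c1*c2*c3)"
    unfolding cB cD cv using e2 by (simp add: algebra_simps)
  also have "\<dots> = 2 * u\<^sup>2 * ((t - c1) * (t - c2) * (t - c3) * (t + c0))"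
    by (simp add: algebra_simps power2_eq_square power3_eq_cube power4_eq_xxxx)
  finally show ?thesis using t by (simp add: field_simps)
qed

lemma f'_prod: "\<tau> \<noteq> 0 \<Longrightarrow> f' \<tau> = 2 * of_real (u\<^sup>2) * ((\<tau> - of_real c1) * (\<tau> - of_real c2) * (\<tau> - of_real c3) * (\<tau> + of_real c0)) / \<tau>^3"
proof -
  assume t: "\<tau> \<noteq> 0"
  have B: "of_real B = 2 * of_real (u\<^sup>2) * (of_real c0 - of_real c1 - of_real c2 - of_real c3 :: complex)" by (simp add: cB)
  have D: "of_real D = 2 * of_real (u\<^sup>2) * (of_real c1 * of_real c2 * of_real c3 - of_real c0 * (of_real c1 * of_real c2 + of_real c1 * of_real c3 + of_real c2 * of_real c3) :: complex)" by (simp add: cD)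
  have V: "of_real (v\<^sup>2) = of_real (u\<^sup>2) * of_real c0 * of_real c1 * of_real c2 * (of_real c3 :: complex)" unfolding cv by simp
  have E: "of_real c1 * of_real c2 + of_real c1 * of_real c3 + of_real c2 * of_real c3 = of_real c0 * (of_real c1 + of_real c2 + of_real c3 :: complex)"
    using arg_cong[OF e2, of complex_of_real] by simp
  have "f' \<tau> * \<tau>^3 = 2 * of_real (u\<^sup>2)*\<tau>^4 + of_real B*\<tau>^3 - of_real D*\<tau> - 2 * of_real (v\<^sup>2)"
    using t by (simp add: f'_def field_simps power2_eq_square power3_eq_cube power4_eq_xxxx)
  also have "\<dots> = 2 * of_real (u\<^sup>2) * (\<tau>^4 + (of_real c0 - of_real c1 - of_real c2 - of_real c3) * \<tau>^3 + (of_real c1 * of_real c2 + of_real c1 * of_real c3 + of_real c2 * of_real c3 - of_real c0*(of_real c1+ of_real c2+ of_real c3)) * \<tau>^2 - (of_real c1 * of_real c2 * of_real c3 - of_real c0 * (of_real c1 * of_real c2 + of_real c1 * of_real c3 + of_real c2 * of_real c3)) * \<tau> - of_real c0 * of_real c1 * of_real c2 * of_real c3)"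
    unfolding B D V using E by (simp add: algebra_simps)
  also have "\<dots> = 2 * of_real (u\<^sup>2) * ((\<tau> - of_real c1) * (\<tau> - of_real c2) * (\<tau> - of_real c3) * (\<tau> + of_real c0))"
    by (simp add: algebra_simps power2_eq_square power3_eq_cube power4_eq_xxxx)
  finally show ?thesis using t by (simp add: field_simps)
qed

lemma f'_nonzero: "Im \<tau> \<noteq> 0 \<Longrightarrow> f' \<tau> \<noteq> 0"
proof -
  assume im: "Im \<tau> \<noteq> 0"
  then have "\<tau> \<noteq> 0" "\<tau> - of_real c1 \<noteq> 0" "\<tau> - of_real c2 \<noteq> 0" "\<tau> - of_real c3 \<noteq> 0" "\<tau> + of_real c0 \<noteq> 0"
    by (auto simp: complex_eq_iff)
  then show ?thesis using pos by (simp add: f'_prod)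
qed

lemma f_holo: "f holomorphic_on (-{0})"
  using f_deriv by (auto simp: holomorphic_on_def field_differentiable_def intro: has_field_derivative_at_within)

lemma f_isCont: "\<tau> \<noteq> 0 \<Longrightarrow> isCont f \<tau>"
  using f_deriv DERIV_isCont by blast

lemma fr_isCont: "t \<noteq> 0 \<Longrightarrow> isCont fr t"
  using fr_deriv DERIV_isCont by blast

definition fpoly :: "complex \<Rightarrow> complex poly" where
  "fpoly z = [: of_real (v\<^sup>2), of_real D, of_real C - z, of_real B, of_real (u\<^sup>2) :]"

lemma fpoly_root: "\<tau> \<noteq> 0 \<Longrightarrow> f \<tau> = z \<Longrightarrow> poly (fpoly z) \<tau> = 0"
  by (auto simp: f_def' fpoly_def field_simps power2_eq_square)

text \<open>Clearing denominators in f \<tau> = z leaves a quartic. The count 4 is what later makes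
  four disjoint surjective sheets injective.\<close>

lemma f_fibre: "finite {\<tau>. \<tau> \<noteq> 0 \<and> f \<tau> = z}" "card {\<tau>. \<tau> \<noteq> 0 \<and> f \<tau> = z} \<le> 4"
proof -
  have nz: "fpoly z \<noteq> 0" and deg: "degree (fpoly z) = 4" using pos by (simp_all add: fpoly_def)
  have sub: "{\<tau>. \<tau> \<noteq> 0 \<and> f \<tau> = z} \<subseteq> {\<tau>. poly (fpoly z) \<tau> = 0}" using fpoly_root by auto
  show "finite {\<tau>. \<tau> \<noteq> 0 \<and> f \<tau> = z}" using sub poly_roots_finite[OF nz] finite_subset by blast
  have "card {\<tau>. \<tau> \<noteq> 0 \<and> f \<tau> = z} \<le> card {\<tau>. poly (fpoly z) \<tau> = 0}"
    by (rule card_mono[OF poly_roots_finite[OF nz] sub])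
  also have "\<dots> \<le> 4" using card_poly_roots_bound[OF nz] deg by simp
  finally show "card {\<tau>. \<tau> \<noteq> 0 \<and> f \<tau> = z} \<le> 4" .
qed

lemma f_nonconst: "open X \<Longrightarrow> X \<subseteq> -{0} \<Longrightarrow> X \<noteq> {} \<Longrightarrow> \<not> f constant_on X"
proof
  assume X: "open X" "X \<subseteq> -{0}" "X \<noteq> {}" and "f constant_on X"
  then obtain z where "\<And>\<tau>. \<tau> \<in> X \<Longrightarrow> f \<tau> = z" by (auto simp: constant_on_def)
  then have "X \<subseteq> {\<tau>. \<tau> \<noteq> 0 \<and> f \<tau> = z}" using X(2) by auto
  then have "finite X" using f_fibre(1) finite_subset by blast
  then show False using X finite_imp_not_open by blast
qed

text \<open>The only poles of \<open>f\<close> are 0 and infinity. In f(\<tau>) \<tau>^2 the term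
  u^2 \<tau>^4 can be bounded by the others when |\<tau>| > 1, and the term v^2 when |\<tau>| \<le>
  1; \<open>K\<close> simply adds up all coefficients.\<close>

lemma f_proper: "\<exists>e>0. \<exists>M. \<forall>\<tau>. \<tau> \<noteq> 0 \<longrightarrow> cmod (f \<tau>) \<le> R \<longrightarrow> e \<le> cmod \<tau> \<and> cmod \<tau> \<le> M"
proof -
  define K where "K = \<bar>R\<bar> + \<bar>B\<bar> + \<bar>C\<bar> + \<bar>D\<bar> + v\<^sup>2 + u\<^sup>2 + 1"
  have K: "K > 0" unfolding K_def by (intro add_nonneg_pos) auto
  have up: "cmod \<tau> \<le> K / u\<^sup>2 + 1" and lo: "min 1 (v\<^sup>2 / K) \<le> cmod \<tau>" if t: "\<tau> \<noteq> 0" "cmod (f \<tau>) \<le> R" for \<tau>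
  proof -
    have R: "cmod (f \<tau>) \<le> \<bar>R\<bar>" using t(2) by simp
    have b1: "cmod (f \<tau> * \<tau>^2 - of_real B * \<tau>^3 - of_real C * \<tau>^2 - of_real D * \<tau> - of_real (v\<^sup>2)) \<le> \<bar>R\<bar> * cmod \<tau>^2 + \<bar>B\<bar> * cmod \<tau>^3 + \<bar>C\<bar> * cmod \<tau>^2 + \<bar>D\<bar> * cmod \<tau> + v\<^sup>2"
      by (intro order_trans[OF norm_triangle_ineq4] add_mono) (use R in \<open>auto simp: norm_mult norm_power intro!: mult_right_mono\<close>)
    have eq1: "f \<tau> * \<tau>^2 - of_real B * \<tau>^3 - of_real C * \<tau>^2 - of_real D * \<tau> - of_real (v\<^sup>2) = of_real (u\<^sup>2) * \<tau>^4"
      using t(1) by (simp add: f_def' field_simps power2_eq_square power3_eq_cube power4_eq_xxxx)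
    have b2: "cmod (f \<tau> * \<tau>^2 - of_real B * \<tau>^3 - of_real C * \<tau>^2 - of_real D * \<tau> - of_real (u\<^sup>2) * \<tau>^4) \<le> \<bar>R\<bar> * cmod \<tau>^2 + \<bar>B\<bar> * cmod \<tau>^3 + \<bar>C\<bar> * cmod \<tau>^2 + \<bar>D\<bar> * cmod \<tau> + u\<^sup>2 * cmod \<tau>^4"
      by (intro order_trans[OF norm_triangle_ineq4] add_mono) (use R in \<open>auto simp: norm_mult norm_power intro!: mult_right_mono\<close>)
    have eq2: "f \<tau> * \<tau>^2 - of_real B * \<tau>^3 - of_real C * \<tau>^2 - of_real D * \<tau> - of_real (u\<^sup>2) * \<tau>^4 = of_real (v\<^sup>2)"
      using t(1) by (simp add: f_def' field_simps power2_eq_square power3_eq_cube power4_eq_xxxx)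
    define r where "r = cmod \<tau>"
    have r: "r > 0" using t(1) by (simp add: r_def)
    have B1: "u\<^sup>2 * r^4 \<le> \<bar>R\<bar> * r^2 + \<bar>B\<bar> * r^3 + \<bar>C\<bar> * r^2 + \<bar>D\<bar> * r + v\<^sup>2"
      using b1 unfolding eq1 by (simp add: norm_mult norm_power r_def)
    have B2: "v\<^sup>2 \<le> \<bar>R\<bar> * r^2 + \<bar>B\<bar> * r^3 + \<bar>C\<bar> * r^2 + \<bar>D\<bar> * r + u\<^sup>2 * r^4"
      using b2 unfolding eq2 by (simp add: norm_mult norm_power r_def)
    show "cmod \<tau> \<le> K / u\<^sup>2 + 1"
    proof (cases "r \<le> 1")
      case False
      then have p: "r^2 \<le> r^3" "r \<le> r^3" "1 \<le> r^3" using power_increasing[of 2 3 r] power_increasing[of 1 3 r] by auto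
      have "u\<^sup>2 * r^4 \<le> \<bar>R\<bar> * r^3 + \<bar>B\<bar> * r^3 + \<bar>C\<bar> * r^3 + \<bar>D\<bar> * r^3 + v\<^sup>2 * r^3"
        using B1 mult_left_mono[OF p(1), of "\<bar>R\<bar>"] mult_left_mono[OF p(1), of "\<bar>C\<bar>"] mult_left_mono[OF p(2), of "\<bar>D\<bar>"] mult_left_mono[OF p(3), of "v\<^sup>2"] by simp
      also have "\<dots> = (K - u\<^sup>2 - 1) * r^3" by (simp add: K_def algebra_simps)
      also have "\<dots> \<le> K * r^3"
      proof (rule mult_right_mono)
        show "K - u\<^sup>2 - 1 \<le> K" using zero_le_power2[of u] by linarith
      qed (use r in simp)
      finally have "(u\<^sup>2 * r) * r^3 \<le> K * r^3" by (simp add: power3_eq_cube power4_eq_xxxx mult_ac)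
      then have "u\<^sup>2 * r \<le> K" using r by simp
      then have "r \<le> K / u\<^sup>2" using pos by (simp add: pos_le_divide_eq mult.commute)
      then show ?thesis by (simp add: r_def)
    next
      case True
      have "0 \<le> K / u\<^sup>2" using K by simp
      then show ?thesis using True unfolding r_def by linarith
    qed
    show "min 1 (v\<^sup>2 / K) \<le> cmod \<tau>"
    proof (cases "r \<le> 1")
      case True
      have p: "r^2 \<le> r" "r^3 \<le> r" "r^4 \<le> r" using True r power_decreasing[of 1 2 r] power_decreasing[of 1 3 r] power_decreasing[of 1 4 r] by auto
      have "v\<^sup>2 \<le> \<bar>R\<bar> * r + \<bar>B\<bar> * r + \<bar>C\<bar> * r + \<bar>D\<bar> * r + u\<^sup>2 * r"
        using B2 mult_left_mono[OF p(1), of "\<bar>R\<bar>"] mult_left_mono[OF p(1), of "\<bar>C\<bar>"] mult_left_mono[OF p(2), of "\<bar>B\<bar>"] mult_left_mono[OF p(3), of "u\<^sup>2"] by simp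
      also have "\<dots> = (K - v\<^sup>2 - 1) * r" by (simp add: K_def algebra_simps)
      also have "\<dots> \<le> K * r"
      proof (rule mult_right_mono)
        show "K - v\<^sup>2 - 1 \<le> K" using zero_le_power2[of v] by linarith
      qed (use r in simp)
      finally have "v\<^sup>2 / K \<le> r" using K by (simp add: pos_divide_le_eq mult.commute)
      then show ?thesis by (simp add: r_def min_le_iff_disj)
    qed (simp add: r_def)
  qed
  have "min 1 (v\<^sup>2 / K) > 0" using K pos by simp
  then show ?thesis using up lo by blast
qed

text \<open>\<open>Im (f \<tau>) = Im \<tau> * Wf \<tau>\<close>, so the sign of \<open>Wf\<close> decides which half plane \<open>f\<close> maps to.\<close>

definition Wf :: "complex \<Rightarrow> real" where
  "Wf \<tau> = 2 * u\<^sup>2 * Re \<tau> + B - D / (cmod \<tau>)\<^sup>2 - 2 * v\<^sup>2 * Re \<tau> / (cmod \<tau>)^4"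

lemma Im_f: "\<tau> \<noteq> 0 \<Longrightarrow> Im (f \<tau>) = Im \<tau> * Wf \<tau>"
proof -
  assume t: "\<tau> \<noteq> 0"
  then have n: "(cmod \<tau>)\<^sup>2 \<noteq> 0" by simp
  have i: "1 / \<tau> = cnj \<tau> / of_real ((cmod \<tau>)\<^sup>2)"
    using t complex_norm_square[of \<tau>] by (simp add: field_simps)
  have i2: "1 / \<tau>\<^sup>2 = (cnj \<tau>)\<^sup>2 / of_real ((cmod \<tau>)^4)"
  proof -
    have "1 / \<tau>\<^sup>2 = (1 / \<tau>)\<^sup>2" by (simp add: power_divide)
    also have "\<dots> = (cnj \<tau>)\<^sup>2 / of_real ((cmod \<tau>)^4)" unfolding i by (simp add: power_divide flip: of_real_power)
    finally show ?thesis .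
  qed
  have "f \<tau> = of_real (u\<^sup>2) * \<tau>\<^sup>2 + of_real B * \<tau> + of_real C + of_real D * (1 / \<tau>) + of_real (v\<^sup>2) * (1 / \<tau>\<^sup>2)"
    by (simp add: f_def')
  then have "Im (f \<tau>) = u\<^sup>2 * (2 * Re \<tau> * Im \<tau>) + B * Im \<tau> - D * (Im \<tau> / (cmod \<tau>)\<^sup>2) - v\<^sup>2 * (2 * Re \<tau> * Im \<tau> / (cmod \<tau>)^4)"
    unfolding i i2 by (simp add: Im_power2 Im_divide_of_real flip: of_real_power)
  then show ?thesis by (simp add: Wf_def algebra_simps)
qed

lemma Wf_real: "Wf (of_real t) = fr' t"
proof -
  have "2 * v\<^sup>2 * t / \<bar>t\<bar>^4 = 2 * v\<^sup>2 / t^3"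
    by (cases "t = 0") (simp_all add: power_even_abs power3_eq_cube power4_eq_xxxx)
  then show ?thesis by (simp add: Wf_def fr'_def)
qed

lemma Wf_isCont: "\<tau> \<noteq> 0 \<Longrightarrow> isCont Wf \<tau>"
  unfolding Wf_def[abs_def] by (intro continuous_intros) auto

text \<open>On a circle about 0, \<open>Wf\<close> is affine in \<open>Re \<tau>\<close> and takes
  the value \<open>fr'\<close> at the positive real point. On a circle through a critical point its
  sign is therefore decided by u^2 - v^2/|\<tau>|^4 alone, which \<open>circ\<close>
  controls.\<close>

lemma Wf_circle: "\<tau> \<noteq> 0 \<Longrightarrow> Wf \<tau> - fr' (cmod \<tau>) = 2 * (u\<^sup>2 - v\<^sup>2 / (cmod \<tau>)^4) * (Re \<tau> - cmod \<tau>)"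
  by (simp add: Wf_def fr'_def field_simps power2_eq_square power3_eq_cube power4_eq_xxxx)

lemma fr'_crit: "fr' c1 = 0" "fr' c2 = 0" "fr' c3 = 0" "fr' (-c0) = 0"
  using pos cpos by (simp_all add: fr'_prod)

lemma Wf_outer_circle: "cmod \<tau> = c1 \<Longrightarrow> Wf \<tau> \<le> 0"
proof -
  assume t: "cmod \<tau> = c1"
  have t0: "\<tau> \<noteq> 0" using t cpos by auto
  have "v\<^sup>2 \<le> (u * c1\<^sup>2)\<^sup>2" using circ pos by (intro power_mono) auto
  then have "v\<^sup>2 / c1^4 \<le> u\<^sup>2" using cpos by (simp add: divide_le_eq power_mult_distrib)
  moreover have "Re \<tau> \<le> c1" using t complex_Re_le_cmod[of \<tau>] by simp
  ultimately have "2 * (u\<^sup>2 - v\<^sup>2 / c1^4) * (Re \<tau> - c1) \<le> 0" by (intro mult_nonneg_nonpos) auto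
  then show ?thesis using Wf_circle[OF t0] fr'_crit(1) unfolding t by simp
qed

lemma Wf_inner_circle: "cmod \<tau> = c3 \<Longrightarrow> Wf \<tau> \<ge> 0"
proof -
  assume t: "cmod \<tau> = c3"
  have t0: "\<tau> \<noteq> 0" using t pos by auto
  have "(u * c3\<^sup>2)\<^sup>2 \<le> v\<^sup>2" using circ pos by (intro power_mono) auto
  then have "u\<^sup>2 \<le> v\<^sup>2 / c3^4" using pos by (simp add: le_divide_eq power_mult_distrib)
  moreover have "Re \<tau> \<le> c3" using t complex_Re_le_cmod[of \<tau>] by simp
  ultimately have "2 * (u\<^sup>2 - v\<^sup>2 / c3^4) * (Re \<tau> - c3) \<ge> 0" by (intro mult_nonpos_nonpos) auto
  then show ?thesis using Wf_circle[OF t0] fr'_crit(3) unfolding t by simp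
qed

text \<open>Reads the circle estimates at the real points -c3 and -c1, where the product formula
  leaves only the sign of c0 - c3 or c0 - c1. Thus \<open>-c0\<close> lies between the two circles,
  and the real axis on its two sides borders sheets 2 and 3.\<close>

lemma c0_between: "c3 \<le> c0" "c0 \<le> c1"
proof -
  have "fr' (-c3) \<ge> 0" using Wf_inner_circle[of "of_real (-c3)"] pos Wf_real[of "-c3"] by simp
  moreover have "fr' (-c3) = 4 * u\<^sup>2 * ((c3 + c1) * (c3 + c2)) * (c0 - c3) / c3^2"
    using pos by (simp add: fr'_prod field_simps power2_eq_square power3_eq_cube)
  moreover have "4 * u\<^sup>2 * ((c3 + c1) * (c3 + c2)) > 0" using pos cpos by simp
  ultimately show "c3 \<le> c0" using pos by (smt (verit) divide_neg_pos mult_pos_neg zero_less_power)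
  have "fr' (-c1) \<le> 0" using Wf_outer_circle[of "of_real (-c1)"] cpos Wf_real[of "-c1"] by simp
  moreover have "fr' (-c1) = 4 * u\<^sup>2 * ((c1 + c2) * (c1 + c3)) * (c0 - c1) / c1^2"
    using cpos by (simp add: fr'_prod field_simps power2_eq_square power3_eq_cube)
  moreover have "4 * u\<^sup>2 * ((c1 + c2) * (c1 + c3)) > 0" using pos cpos by simp
  ultimately show "c0 \<le> c1" using cpos by (smt (verit) divide_pos_pos mult_pos_pos zero_less_power)
qed

lemma fr'_pos_outer: "t > c1 \<Longrightarrow> fr' t > 0" and fr'_neg_inner: "0 < t \<Longrightarrow> t < c3 \<Longrightarrow> fr' t < 0"
  and fr'_neg_mid: "c2 < t \<Longrightarrow> t < c1 \<Longrightarrow> fr' t < 0" and fr'_pos_mid: "c3 < t \<Longrightarrow> t < c2 \<Longrightarrow> fr' t > 0"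
  and fr'_neg_far: "t < -c0 \<Longrightarrow> fr' t < 0" and fr'_pos_near: "-c0 < t \<Longrightarrow> t < 0 \<Longrightarrow> fr' t > 0"
proof -
  define X where "X = ((t - c1) * (t - c2) * (t - c3) * (t + c0)) / t"
  have P: "t \<noteq> 0 \<Longrightarrow> fr' t = (2 * u\<^sup>2 / t^2) * X"
    unfolding X_def by (simp add: fr'_prod power2_eq_square power3_eq_cube)
  have q: "t \<noteq> 0 \<Longrightarrow> 2 * u\<^sup>2 / t^2 > 0" using pos by simp
  have up: "t \<noteq> 0 \<Longrightarrow> X > 0 \<Longrightarrow> fr' t > 0" using P q mult_pos_pos by metis
  have dn: "t \<noteq> 0 \<Longrightarrow> X < 0 \<Longrightarrow> fr' t < 0" using P q mult_pos_neg by metis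
  note o = ord cpos pos(6,7)
  show "fr' t > 0" if "t > c1"
    by (rule up) (use that o in \<open>simp_all add: X_def\<close>)
  show "fr' t < 0" if "0 < t" "t < c3"
    by (rule dn) (use that o in \<open>simp_all add: X_def mult_less_0_iff divide_less_0_iff zero_less_mult_iff\<close>)
  show "fr' t < 0" if "c2 < t" "t < c1"
    by (rule dn) (use that o in \<open>simp_all add: X_def mult_less_0_iff divide_less_0_iff zero_less_mult_iff\<close>)
  show "fr' t > 0" if "c3 < t" "t < c2"
    by (rule up) (use that o in \<open>simp_all add: X_def mult_less_0_iff zero_less_divide_iff zero_less_mult_iff\<close>)
  show "fr' t < 0" if "t < -c0"
    by (rule dn) (use that o in \<open>simp_all add: X_def mult_less_0_iff divide_less_0_iff zero_less_mult_iff\<close>)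
  show "fr' t > 0" if "-c0 < t" "t < 0"
    by (rule up) (use that o in \<open>simp_all add: X_def mult_less_0_iff zero_less_divide_iff zero_less_mult_iff\<close>)
qed

section \<open>The four sheets over the closed upper half plane\<close>

text \<open>The half circles |\<tau>| = c1 above and |\<tau>| = c3 below the real axis separate the
  sheets: Im f \<le> 0 on them, so no component of the set Im f > 0 crosses. Sheet 4 is the default
  of the case distinction.\<close>

definition reg :: "nat \<Rightarrow> complex set" where
  "reg j = (if j = 1 then {\<tau>. Im \<tau> > 0 \<and> cmod \<tau> > c1} else if j = 3 then {\<tau>. Im \<tau> > 0 \<and> cmod \<tau> < c1}
    else if j = 2 then {\<tau>. Im \<tau> < 0 \<and> cmod \<tau> > c3} else {\<tau>. Im \<tau> < 0 \<and> cmod \<tau> < c3})"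

definition Om :: "nat \<Rightarrow> complex set" where
  "Om j = reg j \<inter> {\<tau>. Im (f \<tau>) > 0}"

lemma reg_open: "open (reg j)" "0 \<notin> reg j"
  by (auto simp: reg_def intro!: open_Collect_conj open_Collect_less continuous_intros)

lemma reg_closure:
  "\<tau> \<in> closure (reg 1) \<Longrightarrow> Im \<tau> \<ge> 0 \<and> cmod \<tau> \<ge> c1"
  "\<tau> \<in> closure (reg 3) \<Longrightarrow> Im \<tau> \<ge> 0 \<and> cmod \<tau> \<le> c1"
  "\<tau> \<in> closure (reg 2) \<Longrightarrow> Im \<tau> \<le> 0 \<and> cmod \<tau> \<ge> c3"
  "j \<notin> {1,2,3} \<Longrightarrow> \<tau> \<in> closure (reg j) \<Longrightarrow> Im \<tau> \<le> 0 \<and> cmod \<tau> \<le> c3"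
proof -
  have c: "closed {\<tau>. Im \<tau> \<ge> 0 \<and> cmod \<tau> \<ge> c1}" "closed {\<tau>. Im \<tau> \<ge> 0 \<and> cmod \<tau> \<le> c1}"
    "closed {\<tau>. Im \<tau> \<le> 0 \<and> cmod \<tau> \<ge> c3}" "closed {\<tau>. Im \<tau> \<le> 0 \<and> cmod \<tau> \<le> c3}"
    by (auto intro!: closed_Collect_conj closed_Collect_le continuous_intros)
  have "reg 1 \<subseteq> {\<tau>. Im \<tau> \<ge> 0 \<and> cmod \<tau> \<ge> c1}" by (auto simp: reg_def)
  from closure_minimal[OF this c(1)] show "\<tau> \<in> closure (reg 1) \<Longrightarrow> Im \<tau> \<ge> 0 \<and> cmod \<tau> \<ge> c1" by auto
  have "reg 3 \<subseteq> {\<tau>. Im \<tau> \<ge> 0 \<and> cmod \<tau> \<le> c1}" by (auto simp: reg_def)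
  from closure_minimal[OF this c(2)] show "\<tau> \<in> closure (reg 3) \<Longrightarrow> Im \<tau> \<ge> 0 \<and> cmod \<tau> \<le> c1" by auto
  have "reg 2 \<subseteq> {\<tau>. Im \<tau> \<le> 0 \<and> cmod \<tau> \<ge> c3}" by (auto simp: reg_def)
  from closure_minimal[OF this c(3)] show "\<tau> \<in> closure (reg 2) \<Longrightarrow> Im \<tau> \<le> 0 \<and> cmod \<tau> \<ge> c3" by auto
  assume "j \<notin> {1,2,3}"
  then have "reg j \<subseteq> {\<tau>. Im \<tau> \<le> 0 \<and> cmod \<tau> \<le> c3}" by (auto simp: reg_def)
  from closure_minimal[OF this c(4)] show "\<tau> \<in> closure (reg j) \<Longrightarrow> Im \<tau> \<le> 0 \<and> cmod \<tau> \<le> c3" by auto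
qed

text \<open>The frontier consists of real points, where \<open>f\<close> is real, and of points on
  the half circles, where \<open>Wf\<close> has the unfavourable sign. This is the frontier
  condition for \<open>half_plane_in_image\<close>.\<close>

lemma reg_frontier:
  assumes "\<tau> \<in> closure (reg j)" "\<tau> \<notin> reg j" "\<tau> \<noteq> 0"
  shows "Im (f \<tau>) \<le> 0"
proof -
  consider "j = 1" | "j = 2" | "j = 3" | "j \<notin> {1,2,3}" by auto
  then have "Im \<tau> = 0 \<or> (Im \<tau> \<ge> 0 \<and> cmod \<tau> = c1) \<or> (Im \<tau> \<le> 0 \<and> cmod \<tau> = c3)"
  proof cases
    case 1 then show ?thesis using assms reg_closure(1)[of \<tau>] by (auto simp: reg_def)
  next
    case 2 then show ?thesis using assms reg_closure(3)[of \<tau>] by (auto simp: reg_def)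
  next
    case 3 then show ?thesis using assms reg_closure(2)[of \<tau>] by (auto simp: reg_def)
  next
    case 4 then show ?thesis using assms reg_closure(4)[of j \<tau>] by (auto simp: reg_def)
  qed
  then show ?thesis
    using Im_f[OF assms(3)] Wf_outer_circle[of \<tau>] Wf_inner_circle[of \<tau>]
    by (auto simp: mult_nonneg_nonpos mult_nonpos_nonneg)
qed

lemma reg_disjoint:
  assumes "i \<in> {1,2,3,4}" "j \<in> {1,2,3,4}" "\<tau> \<in> reg i" "\<tau> \<in> reg j" shows "i = j"
  using assms by (auto simp: reg_def split: if_splits)

text \<open>\<open>Im (f \<tau>) = Im \<tau> * Wf \<tau>\<close>, and \<open>Wf\<close> is
  continuous with value \<open>fr' r\<close> at r. The sign of \<open>fr'\<close> thus decides from
  which side of the axis r is approached by points with Im f > 0.\<close>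

lemma near_real:
  assumes r: "r \<noteq> 0" and U: "open U" "of_real r \<in> U"
  shows "fr' r > 0 \<Longrightarrow> \<exists>\<tau>\<in>U. Im \<tau> > 0 \<and> Im (f \<tau>) > 0"
    "fr' r < 0 \<Longrightarrow> \<exists>\<tau>\<in>U. Im \<tau> < 0 \<and> Im (f \<tau>) > 0"
proof -
  obtain e where e: "e > 0" "ball (of_real r) e \<subseteq> U" using U open_contains_ball by blast
  have cont: "isCont Wf (of_real r)" using r Wf_isCont by simp
  have pt: "of_real r + of_real t * \<i> \<in> U" "of_real r + of_real t * \<i> \<noteq> (0::complex)" "dist (of_real r + of_real t * \<i>) (complex_of_real r) < d"
    if "\<bar>t\<bar> < e" "\<bar>t\<bar> < d" for t d
    using that r e(2) by (auto simp: dist_norm norm_mult complex_eq_iff subset_iff norm_minus_commute)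
  show "\<exists>\<tau>\<in>U. Im \<tau> > 0 \<and> Im (f \<tau>) > 0" if "fr' r > 0"
  proof -
    have "\<forall>\<^sub>F \<tau> in at (of_real r). Wf \<tau> > 0"
      using cont that order_tendstoD(1)[of Wf "Wf (of_real r)" "at (of_real r)" 0] by (simp add: isCont_def Wf_real)
    then obtain d where d: "d > 0" "\<And>\<tau>. \<tau> \<noteq> of_real r \<Longrightarrow> dist \<tau> (of_real r) < d \<Longrightarrow> Wf \<tau> > 0"
      unfolding eventually_at by auto
    define t where "t = min d e / 2"
    have t: "t > 0" "\<bar>t\<bar> < e" "\<bar>t\<bar> < d" using d(1) e(1) by (auto simp: t_def)
    let ?p = "of_real r + of_real t * \<i> :: complex"
    have "?p \<noteq> of_real r" using t by simp
    then have "Wf ?p > 0" using d(2) pt(3)[OF t(2,3)] by auto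
    then have "Im ?p > 0 \<and> Im (f ?p) > 0" using t(1) Im_f[OF pt(2)[OF t(2,3)]] by simp
    then show ?thesis using pt(1)[OF t(2,3)] by blast
  qed
  show "\<exists>\<tau>\<in>U. Im \<tau> < 0 \<and> Im (f \<tau>) > 0" if "fr' r < 0"
  proof -
    have "\<forall>\<^sub>F \<tau> in at (of_real r). Wf \<tau> < 0"
      using cont that order_tendstoD(2)[of Wf "Wf (of_real r)" "at (of_real r)" 0] by (simp add: isCont_def Wf_real)
    then obtain d where d: "d > 0" "\<And>\<tau>. \<tau> \<noteq> of_real r \<Longrightarrow> dist \<tau> (of_real r) < d \<Longrightarrow> Wf \<tau> < 0"
      unfolding eventually_at by auto
    define t where "t = - (min d e / 2)"
    have t: "t < 0" "\<bar>t\<bar> < e" "\<bar>t\<bar> < d" using d(1) e(1) by (auto simp: t_def)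
    let ?p = "of_real r + of_real t * \<i> :: complex"
    have "?p \<noteq> of_real r" using t by simp
    then have "Wf ?p < 0" using d(2) pt(3)[OF t(2,3)] by auto
    then have "Im ?p < 0 \<and> Im (f ?p) > 0" using t(1) Im_f[OF pt(2)[OF t(2,3)]] by (simp add: mult_neg_neg)
    then show ?thesis using pt(1)[OF t(2,3)] by blast
  qed
qed

lemma real_in_closure_up:
  assumes "r \<noteq> 0" "fr' r > 0" "open V" "of_real r \<in> V" "\<And>\<tau>. \<tau> \<in> V \<Longrightarrow> Im \<tau> > 0 \<Longrightarrow> \<tau> \<in> reg j"
  shows "of_real r \<in> closure (Om j)"
  unfolding closure_approachable
proof (intro allI impI)
  fix e :: real assume e: "e > 0"
  have "\<exists>\<tau>\<in>V \<inter> ball (of_real r) e. Im \<tau> > 0 \<and> Im (f \<tau>) > 0"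
    by (rule near_real(1)) (use assms e in auto)
  then obtain \<tau> where "\<tau> \<in> V" "dist \<tau> (of_real r) < e" "Im \<tau> > 0" "Im (f \<tau>) > 0" by (auto simp: dist_commute)
  then show "\<exists>y\<in>Om j. dist y (of_real r) < e" using assms(5) by (intro bexI[of _ \<tau>]) (auto simp: Om_def)
qed

lemma real_in_closure_lo:
  assumes "r \<noteq> 0" "fr' r < 0" "open V" "of_real r \<in> V" "\<And>\<tau>. \<tau> \<in> V \<Longrightarrow> Im \<tau> < 0 \<Longrightarrow> \<tau> \<in> reg j"
  shows "of_real r \<in> closure (Om j)"
  unfolding closure_approachable
proof (intro allI impI)
  fix e :: real assume e: "e > 0"
  have "\<exists>\<tau>\<in>V \<inter> ball (of_real r) e. Im \<tau> < 0 \<and> Im (f \<tau>) > 0"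
    by (rule near_real(2)) (use assms e in auto)
  then obtain \<tau> where "\<tau> \<in> V" "dist \<tau> (of_real r) < e" "Im \<tau> < 0" "Im (f \<tau>) > 0" by (auto simp: dist_commute)
  then show "\<exists>y\<in>Om j. dist y (of_real r) < e" using assms(5) by (intro bexI[of _ \<tau>]) (auto simp: Om_def)
qed

lemma interval_closure:
  assumes "a < b" "\<And>t. a < t \<Longrightarrow> t < b \<Longrightarrow> of_real t \<in> closure X" "a \<le> t" "t \<le> b"
  shows "(of_real t :: complex) \<in> closure X"
proof -
  have "of_real ` closure {a<..<b} \<subseteq> closure X"
    by (rule image_closure_subset) (use assms in \<open>auto intro!: continuous_intros\<close>)
  then show ?thesis using assms by auto
qed

lemma opens: "open {\<tau>::complex. cmod \<tau> > c}" "open {\<tau>::complex. cmod \<tau> < c}"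
  by (auto intro!: open_Collect_less continuous_intros)

text \<open>This and the next lemmas distribute the punctured real axis over the closures of the
  sheets: an interval where \<open>fr'\<close> is positive belongs to the sheet above it, one where
  it is negative to the sheet below. Critical points are reached by closure.\<close>

lemma cl1: "t \<ge> c1 \<Longrightarrow> of_real t \<in> closure (Om 1)"
proof (rule interval_closure[of c1 "t + 1"])
  fix r assume r: "c1 < r"
  show "of_real r \<in> closure (Om 1)"
    by (rule real_in_closure_up[OF _ fr'_pos_outer opens(1)[of c1]]) (use r cpos in \<open>auto simp: reg_def\<close>)
qed auto

lemma cl4: "0 < t \<Longrightarrow> t \<le> c3 \<Longrightarrow> of_real t \<in> closure (Om 4)"
proof (rule interval_closure[of "t/2" c3])
  fix r assume "0 < t" and r: "t/2 < r" "r < c3"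
  show "of_real r \<in> closure (Om 4)"
    by (rule real_in_closure_lo[OF _ fr'_neg_inner opens(2)[of c3]]) (use r \<open>0 < t\<close> in \<open>auto simp: reg_def\<close>)
qed auto

lemma cl2a: "c2 < c1 \<Longrightarrow> c2 \<le> t \<Longrightarrow> t \<le> c1 \<Longrightarrow> of_real t \<in> closure (Om 2)"
proof (rule interval_closure[of c2 c1])
  fix r assume r: "c2 < r" "r < c1"
  show "of_real r \<in> closure (Om 2)"
    by (rule real_in_closure_lo[OF _ fr'_neg_mid opens(1)[of c3]]) (use r cpos ord in \<open>auto simp: reg_def\<close>)
qed auto

lemma cl3a: "c3 < c2 \<Longrightarrow> c3 \<le> t \<Longrightarrow> t \<le> c2 \<Longrightarrow> of_real t \<in> closure (Om 3)"
proof (rule interval_closure[of c3 c2])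
  fix r assume r: "c3 < r" "r < c2"
  show "of_real r \<in> closure (Om 3)"
    by (rule real_in_closure_up[OF _ fr'_pos_mid opens(2)[of c1]]) (use r pos ord in \<open>auto simp: reg_def\<close>)
qed auto

lemma cl2b: "t \<le> -c0 \<Longrightarrow> of_real t \<in> closure (Om 2)"
proof (rule interval_closure[of "t - 1" "-c0"])
  fix r assume r: "r < -c0"
  show "of_real r \<in> closure (Om 2)"
    by (rule real_in_closure_lo[OF _ fr'_neg_far opens(1)[of c3]]) (use r pos c0_between in \<open>auto simp: reg_def\<close>)
qed auto

lemma cl3b: "-c0 \<le> t \<Longrightarrow> t < 0 \<Longrightarrow> of_real t \<in> closure (Om 3)"
proof (rule interval_closure[of "-c0" "t/2"])
  fix r assume "t < 0" and r: "-c0 < r" "r < t/2"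
  show "of_real r \<in> closure (Om 3)"
    by (rule real_in_closure_up[OF _ fr'_pos_near opens(2)[of c1]]) (use r \<open>t < 0\<close> pos c0_between in \<open>auto simp: reg_def\<close>)
qed (use pos in auto)

lemma Om_nonempty: "Om j \<noteq> {}"
proof -
  consider "j = 1" | "j = 2" | "j = 3" | "j \<notin> {1,2,3}" by auto
  then have "closure (Om j) \<noteq> {}"
  proof cases
    case 1 then show ?thesis using cl1[of c1] by auto
  next
    case 2 then show ?thesis using cl2b[of "-c0"] by auto
  next
    case 3 then show ?thesis using cl3b[of "-c0"] pos by auto
  next
    case 4
    then have "Om j = Om 4" by (simp add: Om_def reg_def)
    then show ?thesis using cl4[of c3] pos by auto
  qed
  then show ?thesis by auto
qed

lemma Om_surj: "Im z > 0 \<Longrightarrow> \<exists>\<tau>\<in>Om j. f \<tau> = z"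
proof -
  assume z: "Im z > 0"
  obtain \<tau>0 where t0: "\<tau>0 \<in> Om j" using Om_nonempty by blast
  have "\<exists>\<tau>\<in>reg j \<inter> UNIV. f \<tau> = z"
  proof (rule half_plane_in_image[where W="{z. Im z > 0}" and p=\<tau>0])
    show "f holomorphic_on - {0}" by (rule f_holo)
    show "connected {z. 0 < Im z}" by (rule convex_connected[OF convex_halfspace_Im_gt])
  qed (use f_nonconst f_proper reg_open reg_frontier t0 z in \<open>auto simp: Om_def\<close>)
  then show ?thesis using z by (auto simp: Om_def)
qed

lemma closure_Om_nonneg: "\<tau> \<in> closure (Om j) \<Longrightarrow> \<tau> \<noteq> 0 \<Longrightarrow> Im (f \<tau>) \<ge> 0"
proof -
  assume t: "\<tau> \<in> closure (Om j)" "\<tau> \<noteq> 0"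
  then obtain x where x: "\<And>n. x n \<in> Om j" "x \<longlonglongrightarrow> \<tau>" by (auto simp: closure_sequential)
  have "(\<lambda>n. f (x n)) \<longlonglongrightarrow> f \<tau>" using isCont_tendsto_compose[OF f_isCont[OF t(2)] x(2)] .
  then have "(\<lambda>n. Im (f (x n))) \<longlonglongrightarrow> Im (f \<tau>)" by (rule tendsto_Im)
  then show ?thesis by (rule tendsto_lowerbound) (use x(1) in \<open>auto simp: Om_def intro!: always_eventually less_imp_le\<close>)
qed

lemma closure_Om_Wf: "\<tau> \<in> closure (Om j) \<Longrightarrow> \<tau> \<noteq> 0 \<Longrightarrow> (if j \<in> {1,3} then Im \<tau> \<ge> 0 \<and> Wf \<tau> \<ge> 0 else Im \<tau> \<le> 0 \<and> Wf \<tau> \<le> 0)"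
proof -
  assume t: "\<tau> \<in> closure (Om j)" "\<tau> \<noteq> 0"
  then obtain x where x: "\<And>n. x n \<in> Om j" "x \<longlonglongrightarrow> \<tau>" by (auto simp: closure_sequential)
  have L: "(\<lambda>n. Wf (x n)) \<longlonglongrightarrow> Wf \<tau>" "(\<lambda>n. Im (x n)) \<longlonglongrightarrow> Im \<tau>"
    using isCont_tendsto_compose[OF Wf_isCont[OF t(2)] x(2)] tendsto_Im[OF x(2)] by auto
  have W: "Im (x n) * Wf (x n) > 0" for n
  proof -
    have "x n \<noteq> 0" using x(1)[of n] reg_open(2)[of j] by (auto simp: Om_def)
    then show ?thesis using x(1)[of n] Im_f by (simp add: Om_def)
  qed
  show ?thesis
  proof (cases "j \<in> {1,3}")
    case True
    have i: "Im (x n) > 0" for n using x(1)[of n] True by (auto simp: Om_def reg_def)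
    then have w: "Wf (x n) > 0" for n using W[of n] by (simp add: zero_less_mult_iff) (metis i not_less_iff_gr_or_eq)
    have "Im \<tau> \<ge> 0" by (rule tendsto_lowerbound[OF L(2)]) (use i in \<open>auto intro!: always_eventually less_imp_le\<close>)
    moreover have "Wf \<tau> \<ge> 0" by (rule tendsto_lowerbound[OF L(1)]) (use w in \<open>auto intro!: always_eventually less_imp_le\<close>)
    ultimately show ?thesis using True by simp
  next
    case False
    have i: "Im (x n) < 0" for n using x(1)[of n] False by (auto simp: Om_def reg_def split: if_splits)
    then have w: "Wf (x n) < 0" for n using W[of n] by (simp add: zero_less_mult_iff) (metis i not_less_iff_gr_or_eq)
    have "Im \<tau> \<le> 0" by (rule tendsto_upperbound[OF L(2)]) (use i in \<open>auto intro!: always_eventually less_imp_le\<close>)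
    moreover have "Wf \<tau> \<le> 0" by (rule tendsto_upperbound[OF L(1)]) (use w in \<open>auto intro!: always_eventually less_imp_le\<close>)
    ultimately show ?thesis using False by auto
  qed
qed

text \<open>Surjectivity near a boundary point, with control of the preimage. A small sphere about
  \<open>\<tau>0\<close> contains no other preimage of \<open>f \<tau>0\<close>, so on it
  \<open>f\<close> stays at distance at least \<delta> from that value; the half disc of radius
  \<delta> is convex, and the ball plays the role of \<open>N\<close>.\<close>

lemma closure_Om_local:
  assumes t: "\<tau>0 \<in> closure (Om j)" "\<tau>0 \<noteq> 0" and e: "e > 0"
  shows "\<exists>\<delta>>0. \<forall>z. Im z > 0 \<longrightarrow> cmod (z - f \<tau>0) < \<delta> \<longrightarrow> (\<exists>\<tau>\<in>Om j. dist \<tau> \<tau>0 < e \<and> f \<tau> = z)"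
proof -
  obtain d where d: "d > 0" "\<And>\<tau>. \<tau> \<in> {\<tau>. \<tau> \<noteq> 0 \<and> f \<tau> = f \<tau>0} \<Longrightarrow> \<tau> \<noteq> \<tau>0 \<Longrightarrow> d \<le> dist \<tau>0 \<tau>"
    using finite_set_avoid[OF f_fibre(1), of "f \<tau>0" \<tau>0] by blast
  define r where "r = min (min d e) (cmod \<tau>0) / 2"
  have r: "r > 0" "r < d" "r < e" "r < cmod \<tau>0" using d(1) e t(2) zero_less_norm_iff[of \<tau>0] by (auto simp: r_def min_less_iff_disj)
  have nz: "\<tau> \<noteq> 0" if "dist \<tau>0 \<tau> \<le> r" for \<tau> using that r(4) by auto
  have sph: "f \<tau> \<noteq> f \<tau>0" if "\<tau> \<in> sphere \<tau>0 r" for \<tau>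
    using d(2)[of \<tau>] that nz[of \<tau>] r by auto
  have "\<exists>y\<in>sphere \<tau>0 r. \<forall>x\<in>sphere \<tau>0 r. cmod (f y - f \<tau>0) \<le> cmod (f x - f \<tau>0)"
  proof (rule continuous_attains_inf)
    show "sphere \<tau>0 r \<noteq> {}" using r(1) by simp
    have "continuous_on (sphere \<tau>0 r) f"
      by (rule continuous_on_subset[OF holomorphic_on_imp_continuous_on[OF f_holo]]) (use r(4) in auto)
    then show "continuous_on (sphere \<tau>0 r) (\<lambda>x. cmod (f x - f \<tau>0))" by (intro continuous_intros)
  qed simp
  then obtain y where y: "y \<in> sphere \<tau>0 r" "\<And>x. x \<in> sphere \<tau>0 r \<Longrightarrow> cmod (f y - f \<tau>0) \<le> cmod (f x - f \<tau>0)" by blast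
  define \<delta> where "\<delta> = cmod (f y - f \<tau>0)"
  have \<delta>: "\<delta> > 0" using sph[OF y(1)] by (simp add: \<delta>_def)
  obtain \<eta> where \<eta>: "\<eta> > 0" "\<And>\<tau>. dist \<tau> \<tau>0 < \<eta> \<Longrightarrow> dist (f \<tau>) (f \<tau>0) < \<delta>"
    using f_isCont[OF t(2)] \<delta> unfolding continuous_at_eps_delta by blast
  obtain \<tau>1 where \<tau>1: "\<tau>1 \<in> Om j" "dist \<tau>1 \<tau>0 < min \<eta> r"
    using t(1) \<eta>(1) r(1) unfolding closure_approachable by (metis min_less_iff_conj)
  let ?W = "ball (f \<tau>0) \<delta> \<inter> {z. Im z > 0}"
  have "\<exists>\<tau>\<in>reg j \<inter> ball \<tau>0 r. f \<tau> = z" if z: "Im z > 0" "cmod (z - f \<tau>0) < \<delta>" for z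
  proof (rule half_plane_in_image[where W="?W" and p=\<tau>1])
    show "f holomorphic_on - {0}" by (rule f_holo)
    show "connected ?W" by (intro convex_connected convex_Int convex_ball convex_halfspace_Im_gt)
    show "f \<tau> \<notin> ?W" if "\<tau> \<in> closure (ball \<tau>0 r)" "\<tau> \<notin> ball \<tau>0 r" for \<tau>
    proof -
      have "\<tau> \<in> sphere \<tau>0 r" using that r(1) by auto
      then show ?thesis using y(2)[of \<tau>] by (auto simp: \<delta>_def dist_norm norm_minus_commute)
    qed
    show "f \<tau>1 \<in> ?W" using \<tau>1 \<eta>(2)[of \<tau>1] by (auto simp: Om_def dist_commute)
    show "\<tau>1 \<in> reg j \<inter> ball \<tau>0 r" using \<tau>1 by (auto simp: Om_def dist_commute)
    show "z \<in> ?W" using z by (auto simp: dist_norm norm_minus_commute)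
  qed (use f_nonconst f_proper reg_open reg_frontier in auto)
  note ex = this
  have "\<exists>\<tau>\<in>Om j. dist \<tau> \<tau>0 < e \<and> f \<tau> = z" if z: "Im z > 0" "cmod (z - f \<tau>0) < \<delta>" for z
  proof -
    obtain \<tau> where "\<tau> \<in> reg j" "dist \<tau>0 \<tau> < r" "f \<tau> = z" using ex[OF z] by auto
    then show ?thesis using r(3) z(1) by (intro bexI[of _ \<tau>]) (auto simp: Om_def dist_commute)
  qed
  then show ?thesis using \<delta> by blast
qed

text \<open>Counting: each of the other three disjoint sheets contributes a preimage of
  \<open>z\<close>, so two of them in sheet \<open>j\<close> would make five in a fibre of at most
  four.\<close>

lemma Om_inj:
  assumes j: "j \<in> {1,2,3,4}" and t: "\<tau> \<in> Om j" "\<tau>' \<in> Om j" "f \<tau> = f \<tau>'"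
  shows "\<tau> = \<tau>'"
proof (rule ccontr)
  assume ne: "\<tau> \<noteq> \<tau>'"
  define z where "z = f \<tau>"
  have z: "Im z > 0" using t(1) by (simp add: z_def Om_def)
  have "\<forall>i. \<exists>\<sigma>. \<sigma> \<in> Om i \<and> f \<sigma> = z" using Om_surj[OF z] by blast
  from choice[OF this] obtain \<sigma> where \<sigma>: "\<And>i. \<sigma> i \<in> Om i" "\<And>i. f (\<sigma> i) = z" by blast
  define S where "S = insert \<tau> (insert \<tau>' (\<sigma> ` ({1,2,3,4} - {j})))"
  have nm: "\<sigma> i \<notin> reg j" if "i \<in> {1,2,3,4} - {j}" for i
    using reg_disjoint[of i j "\<sigma> i"] \<sigma>(1)[of i] that j by (auto simp: Om_def)
  have inj: "inj_on \<sigma> ({1,2,3,4} - {j})"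
  proof (rule inj_onI)
    fix i i' assume a: "i \<in> {1,2,3,4} - {j}" "i' \<in> {1,2,3,4} - {j}" "\<sigma> i = \<sigma> i'"
    have "\<sigma> i \<in> reg i" "\<sigma> i \<in> reg i'" using \<sigma>(1)[of i] \<sigma>(1)[of i'] a(3) by (auto simp: Om_def)
    then show "i = i'" using reg_disjoint[of i i' "\<sigma> i"] a(1,2) by blast
  qed
  have c3: "card (\<sigma> ` ({1,2,3,4} - {j})) = 3" unfolding card_image[OF inj] using j by auto
  have n1: "\<tau>' \<notin> \<sigma> ` ({1,2,3,4} - {j})" "\<tau> \<notin> \<sigma> ` ({1,2,3,4} - {j})" using nm t by (auto simp: Om_def)
  have "card S = 5" unfolding S_def using c3 n1 ne by (simp add: card_insert_if)
  moreover have "S \<subseteq> {\<tau>. \<tau> \<noteq> 0 \<and> f \<tau> = z}"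
    using t \<sigma> reg_open(2) unfolding S_def z_def by (auto simp: Om_def) (metis)+
  ultimately have "5 \<le> card {\<tau>. \<tau> \<noteq> 0 \<and> f \<tau> = z}" using card_mono[OF f_fibre(1)] by metis
  then show False using f_fibre(2)[of z] by linarith
qed

text \<open>Two distinct boundary points over one value would, after lifting the value slightly into
  the upper half plane, both have preimages of the lifted value nearby in \<open>Om j\<close>. The
  radius is half their distance, so these preimages differ, contradicting
  \<open>Om_inj\<close>.\<close>

lemma closure_Om_inj:
  assumes j: "j \<in> {1,2,3,4}" and t: "\<tau> \<in> closure (Om j)" "\<tau>' \<in> closure (Om j)" "\<tau> \<noteq> 0" "\<tau>' \<noteq> 0" "f \<tau> = f \<tau>'"
  shows "\<tau> = \<tau>'"
proof (rule ccontr)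
  assume ne: "\<tau> \<noteq> \<tau>'"
  define e where "e = dist \<tau> \<tau>' / 2"
  have e: "e > 0" using ne by (simp add: e_def)
  obtain \<delta>1 where d1: "\<delta>1 > 0" "\<And>z. Im z > 0 \<Longrightarrow> cmod (z - f \<tau>) < \<delta>1 \<Longrightarrow> \<exists>\<sigma>\<in>Om j. dist \<sigma> \<tau> < e \<and> f \<sigma> = z"
    using closure_Om_local[OF t(1,3) e] by blast
  obtain \<delta>2 where d2: "\<delta>2 > 0" "\<And>z. Im z > 0 \<Longrightarrow> cmod (z - f \<tau>') < \<delta>2 \<Longrightarrow> \<exists>\<sigma>\<in>Om j. dist \<sigma> \<tau>' < e \<and> f \<sigma> = z"
    using closure_Om_local[OF t(2,4) e] by blast
  define z where "z = f \<tau> + of_real (min \<delta>1 \<delta>2 / 2) * \<i>"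
  have z: "Im z > 0" using closure_Om_nonneg[OF t(1,3)] d1(1) d2(1) by (simp add: z_def add_nonneg_pos)
  have zd: "cmod (z - f \<tau>) < \<delta>1" "cmod (z - f \<tau>') < \<delta>2" using d1(1) d2(1) t(5)[symmetric] by (simp_all add: z_def norm_mult)
  obtain \<sigma>1 where s1: "\<sigma>1 \<in> Om j" "dist \<sigma>1 \<tau> < e" "f \<sigma>1 = z" using d1(2)[OF z zd(1)] by blast
  obtain \<sigma>2 where s2: "\<sigma>2 \<in> Om j" "dist \<sigma>2 \<tau>' < e" "f \<sigma>2 = z" using d2(2)[OF z zd(2)] by blast
  have "\<sigma>1 = \<sigma>2" using Om_inj[OF j s1(1) s2(1)] s1(3) s2(3) by simp
  then have "dist \<tau> \<tau>' < 2 * e" using s1(2) s2(2) dist_triangle2[of \<tau> \<tau>' \<sigma>1] by (simp add: dist_commute)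
  then show False by (simp add: e_def)
qed

section \<open>Inverse branches on the closed upper half plane\<close>

definition br :: "nat \<Rightarrow> complex \<Rightarrow> complex" where
  "br j z = (SOME \<tau>. \<tau> \<in> closure (Om j) \<and> \<tau> \<noteq> 0 \<and> f \<tau> = z)"

text \<open>A limit of preimages of z + i/(n+1), with compactness from \<open>f_proper\<close>. For
  the four actual sheets \<open>closure_Om_inj\<close> makes the choice in \<open>br\<close>
  unique.\<close>

lemma br_exists:
  assumes "Im z \<ge> 0"
  shows "\<exists>\<tau>. \<tau> \<in> closure (Om j) \<and> \<tau> \<noteq> 0 \<and> f \<tau> = z"
proof -
  have "\<forall>n. \<exists>\<tau>. \<tau> \<in> Om j \<and> f \<tau> = z + \<i> * of_real (1 / real (Suc n))"
    using Om_surj assms by (metis (no_types, lifting) Im_complex_of_real Re_complex_of_real add_nonneg_pos divide_pos_pos imaginary_unit.simps(1) imaginary_unit.simps(2) mult_cancel_right1 mult_zero_left of_nat_0_less_iff plus_complex.sel(2) times_complex.sel(2) zero_less_Suc zero_less_one add.left_neutral)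
  from choice[OF this] obtain \<sigma> where \<sigma>: "\<And>n. \<sigma> n \<in> Om j" "\<And>n. f (\<sigma> n) = z + \<i> * of_real (1 / real (Suc n))" by blast
  have bd: "cmod (f (\<sigma> n)) \<le> cmod z + 1" for n
    unfolding \<sigma>(2) by (rule order_trans[OF norm_triangle_ineq]) (simp add: norm_mult norm_divide del: of_nat_Suc)
  obtain e M where e: "e > 0" "\<And>\<tau>. \<tau> \<noteq> 0 \<Longrightarrow> cmod (f \<tau>) \<le> cmod z + 1 \<Longrightarrow> e \<le> cmod \<tau> \<and> cmod \<tau> \<le> M" using f_proper[of "cmod z + 1"] by blast
  have s0: "\<sigma> n \<noteq> 0" for n using \<sigma>(1)[of n] reg_open(2)[of j] by (auto simp: Om_def)
  have sb: "e \<le> cmod (\<sigma> n) \<and> cmod (\<sigma> n) \<le> M" for n using e(2)[OF s0 bd] .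
  then have "\<And>n. \<sigma> n \<in> cball 0 M" by auto
  then obtain t r where t: "strict_mono (r::nat\<Rightarrow>nat)" "(\<sigma> \<circ> r) \<longlonglongrightarrow> t"
    using compact_cball[of 0 M] unfolding compact_def by blast
  have "e \<le> cmod t" using tendsto_norm[OF t(2)] by (rule tendsto_lowerbound) (use sb in auto)
  then have t0: "t \<noteq> 0" using e(1) by auto
  have tc: "t \<in> closure (Om j)"
    unfolding closure_sequential using t(2) \<sigma>(1) by (auto intro!: exI[of _ "\<sigma> \<circ> r"])
  have "(\<lambda>n. f ((\<sigma> \<circ> r) n)) \<longlonglongrightarrow> f t" using isCont_tendsto_compose[OF f_isCont[OF t0] t(2)] .
  moreover have "(\<lambda>n. z + \<i> * of_real (1 / real (Suc n))) \<longlonglongrightarrow> z + \<i> * of_real 0"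
    by (intro tendsto_intros LIMSEQ_Suc[OF lim_1_over_n])
  then have "((\<lambda>n. z + \<i> * of_real (1 / real (Suc n))) \<circ> r) \<longlonglongrightarrow> z + \<i> * of_real 0"
    by (rule LIMSEQ_subseq_LIMSEQ[OF _ t(1)])
  then have "(\<lambda>n. f ((\<sigma> \<circ> r) n)) \<longlonglongrightarrow> z" by (simp add: \<sigma>(2) o_def)
  ultimately have "f t = z" by (rule LIMSEQ_unique)
  then show ?thesis using tc t0 by blast
qed

lemma br: "Im z \<ge> 0 \<Longrightarrow> br j z \<in> closure (Om j)" "Im z \<ge> 0 \<Longrightarrow> br j z \<noteq> 0" "Im z \<ge> 0 \<Longrightarrow> f (br j z) = z"
  using someI_ex[OF br_exists[of z j]] unfolding br_def by blast+

lemma br_eq: "j \<in> {1,2,3,4} \<Longrightarrow> \<tau> \<in> closure (Om j) \<Longrightarrow> \<tau> \<noteq> 0 \<Longrightarrow> f \<tau> = z \<Longrightarrow> br j z = \<tau>"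
  using closure_Om_inj[of j "br j z" \<tau>] br[of z j] closure_Om_nonneg[of \<tau> j] by auto

lemma br_Om: "j \<in> {1,2,3,4} \<Longrightarrow> Im z > 0 \<Longrightarrow> br j z \<in> Om j"
proof -
  assume j: "j \<in> {1,2,3,4}" and z: "Im z > 0"
  obtain \<tau> where t: "\<tau> \<in> Om j" "f \<tau> = z" using Om_surj[OF z] by blast
  then have "br j z = \<tau>" using br_eq[OF j, of \<tau> z] closure_subset[of "Om j"] reg_open(2)[of j] by (auto simp: Om_def)
  then show ?thesis using t by simp
qed

text \<open>Over each disc \<open>br j\<close> inverts a continuous injection of a compact set and
  is therefore continuous; continuity is a local matter, so the discs exhaust the half
  plane.\<close>

lemma br_continuous: "j \<in> {1,2,3,4} \<Longrightarrow> continuous_on {z. Im z \<ge> 0} (br j)"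
proof -
  assume j: "j \<in> {1,2,3,4}"
  have c: "continuous_on ({z. Im z \<ge> 0} \<inter> cball 0 R) (br j)" for R
  proof -
    obtain e M where e: "e > 0" "\<And>\<tau>. \<tau> \<noteq> 0 \<Longrightarrow> cmod (f \<tau>) \<le> R \<Longrightarrow> e \<le> cmod \<tau> \<and> cmod \<tau> \<le> M" using f_proper[of R] by blast
    let ?A = "cball (0::complex) M \<inter> (- ball 0 e)"
    have cA: "compact ?A" by (rule compact_Int_closed) auto
    have contA: "continuous_on ?A f"
      by (rule continuous_on_subset[OF holomorphic_on_imp_continuous_on[OF f_holo]]) (use e(1) in auto)
    let ?K = "closure (Om j) \<inter> (?A \<inter> f -` cball 0 R)"
    have cK: "compact ?K"
    proof -
      have "closedin (top_of_set ?A) (?A \<inter> f -` cball 0 R)"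
        by (rule continuous_closedin_preimage[OF contA closed_cball])
      then have "compact (?A \<inter> f -` cball 0 R)" using closedin_compact[OF cA] by blast
      then show ?thesis by (rule closed_Int_compact[OF closed_closure])
    qed
    have "continuous_on (f ` ?K) (br j)"
    proof (rule continuous_on_inv[OF continuous_on_subset[OF contA] cK])
      show "\<forall>x\<in>?K. br j (f x) = x"
      proof
        fix x assume x: "x \<in> ?K"
        then have "x \<noteq> 0" using e(1) by auto
        then show "br j (f x) = x" using br_eq[OF j _ _ refl, of x] x by simp
      qed
    qed auto
    moreover have "{z. Im z \<ge> 0} \<inter> cball 0 R \<subseteq> f ` ?K"
    proof
      fix z assume z: "z \<in> {z. Im z \<ge> 0} \<inter> cball 0 R"
      then have "br j z \<in> ?K" using br[of z j] e(2)[of "br j z"] by auto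
      moreover have "f (br j z) = z" using br z by auto
      ultimately show "z \<in> f ` ?K" by (metis imageI)
    qed
    ultimately show ?thesis using continuous_on_subset by blast
  qed
  show ?thesis
    unfolding continuous_on_eq_continuous_within
  proof
    fix z :: complex assume z: "z \<in> {z. Im z \<ge> 0}"
    have "continuous (at z within ({z. Im z \<ge> 0} \<inter> cball 0 (cmod z + 1))) (br j)"
      using c[of "cmod z + 1"] z by (simp add: continuous_on_eq_continuous_within)
    moreover have "at z within ({z. Im z \<ge> 0} \<inter> cball 0 (cmod z + 1)) = at z within {z. Im z \<ge> 0}"
    proof (rule at_within_nhd[of z "ball z 1"])
      have "w \<in> cball 0 (cmod z + 1)" if "w \<in> ball z 1" for w
        using that norm_triangle_ineq2[of w z] by (simp add: dist_norm norm_minus_commute)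
      then show "({z. Im z \<ge> 0} \<inter> cball 0 (cmod z + 1)) \<inter> ball z 1 - {z} = {z. Im z \<ge> 0} \<inter> ball z 1 - {z}" by auto
    qed auto
    ultimately show "continuous (at z within {z. Im z \<ge> 0}) (br j)" by simp
  qed
qed

lemma br_tendsto: "j \<in> {1,2,3,4} \<Longrightarrow> Im z \<ge> 0 \<Longrightarrow> (\<And>n. Im (x n) \<ge> 0) \<Longrightarrow> x \<longlonglongrightarrow> z \<Longrightarrow> (\<lambda>n. br j (x n)) \<longlonglongrightarrow> br j z"
  using br_continuous[of j] unfolding continuous_on_sequentially by (auto simp: o_def)

lemma br_deriv: "j \<in> {1,2,3,4} \<Longrightarrow> Im z > 0 \<Longrightarrow> (br j has_field_derivative 1 / f' (br j z)) (at z)"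
proof -
  assume j: "j \<in> {1,2,3,4}" and z: "Im z > 0"
  have H: "open {z::complex. Im z > 0}" by (rule open_halfspace_Im_gt)
  have im: "Im (br j z) \<noteq> 0" using br_Om[OF j z] by (auto simp: Om_def reg_def split: if_splits)
  show ?thesis
  proof (rule has_field_derivative_inverse_basic[where f=f and t="{z. Im z > 0}", THEN DERIV_cong])
    show "(f has_field_derivative f' (br j z)) (at (br j z))" using f_deriv br(2)[of z j] z by simp
    show "f' (br j z) \<noteq> 0" by (rule f'_nonzero[OF im])
    have "continuous_on {z. Im z > 0} (br j)" by (rule continuous_on_subset[OF br_continuous[OF j]]) auto
    then show "continuous (at z) (br j)" using H z by (simp add: continuous_on_eq_continuous_at)
    show "\<And>w. w \<in> {z. 0 < Im z} \<Longrightarrow> f (br j w) = w" using br(3) by auto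
  qed (use H z in \<open>auto simp: divide_inverse\<close>)
qed

section \<open>The sheets over the real line\<close>

lemma fr_incr: "a < b \<Longrightarrow> 0 < a \<or> b < 0 \<Longrightarrow> (\<And>t. a < t \<Longrightarrow> t < b \<Longrightarrow> fr' t > 0) \<Longrightarrow> fr a < fr b"
proof -
  assume ab: "a < b" "0 < a \<or> b < 0" and p: "\<And>t. a < t \<Longrightarrow> t < b \<Longrightarrow> fr' t > 0"
  have nz: "t \<noteq> 0" if "a \<le> t" "t \<le> b" for t using ab that by auto
  show ?thesis
  proof (rule DERIV_pos_imp_increasing_open[OF ab(1)])
    show "continuous_on {a..b} fr"
      by (rule continuous_at_imp_continuous_on) (use fr_isCont nz in auto)
    fix t assume "a < t" "t < b"
    then show "\<exists>y. (fr has_real_derivative y) (at t) \<and> y > 0" using fr_deriv[of t] p nz[of t] by auto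
  qed
qed

lemma fr_decr: "a < b \<Longrightarrow> 0 < a \<or> b < 0 \<Longrightarrow> (\<And>t. a < t \<Longrightarrow> t < b \<Longrightarrow> fr' t < 0) \<Longrightarrow> fr b < fr a"
proof -
  assume ab: "a < b" "0 < a \<or> b < 0" and p: "\<And>t. a < t \<Longrightarrow> t < b \<Longrightarrow> fr' t < 0"
  have nz: "t \<noteq> 0" if "a \<le> t" "t \<le> b" for t using ab that by auto
  show ?thesis
  proof (rule DERIV_neg_imp_decreasing_open[OF ab(1)])
    show "continuous_on {a..b} fr"
      by (rule continuous_at_imp_continuous_on) (use fr_isCont nz in auto)
    fix t assume "a < t" "t < b"
    then show "\<exists>y. (fr has_real_derivative y) (at t) \<and> y < 0" using fr_deriv[of t] p nz[of t] by auto
  qed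
qed

lemma fr_mono:
  "c1 \<le> r \<Longrightarrow> r < t \<Longrightarrow> fr r < fr t"
  "0 < r \<Longrightarrow> r < t \<Longrightarrow> t \<le> c3 \<Longrightarrow> fr t < fr r"
  "c2 \<le> r \<Longrightarrow> r < t \<Longrightarrow> t \<le> c1 \<Longrightarrow> fr t < fr r"
  "c3 \<le> r \<Longrightarrow> r < t \<Longrightarrow> t \<le> c2 \<Longrightarrow> fr r < fr t"
  "r < t \<Longrightarrow> t \<le> -c0 \<Longrightarrow> fr t < fr r"
  "-c0 \<le> r \<Longrightarrow> r < t \<Longrightarrow> t < 0 \<Longrightarrow> fr r < fr t"
  subgoal by (rule fr_incr) (use pos cpos ord in \<open>auto intro: fr'_pos_outer\<close>)
  subgoal by (rule fr_decr) (use pos cpos ord in \<open>auto intro: fr'_neg_inner\<close>)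
  subgoal by (rule fr_decr) (use pos cpos ord in \<open>auto intro: fr'_neg_mid\<close>)
  subgoal by (rule fr_incr) (use pos cpos ord in \<open>auto intro: fr'_pos_mid\<close>)
  subgoal by (rule fr_decr) (use pos cpos ord in \<open>auto intro: fr'_neg_far\<close>)
  subgoal by (rule fr_incr) (use pos cpos ord in \<open>auto intro: fr'_pos_near\<close>)
  done

lemma fr_large: "\<exists>T>0. \<forall>t. \<bar>t\<bar> \<ge> T \<longrightarrow> \<bar>fr t\<bar> > R" "\<exists>e>0. \<forall>t. t \<noteq> 0 \<longrightarrow> \<bar>t\<bar> < e \<longrightarrow> \<bar>fr t\<bar> > R"
proof -
  obtain e M where e: "e > 0" "\<And>\<tau>. \<tau> \<noteq> 0 \<Longrightarrow> cmod (f \<tau>) \<le> R \<Longrightarrow> e \<le> cmod \<tau> \<and> cmod \<tau> \<le> M" using f_proper[of R] by blast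
  have A: "e \<le> \<bar>t\<bar> \<and> \<bar>t\<bar> \<le> M" if "t \<noteq> 0" "\<bar>fr t\<bar> \<le> R" for t
    using e(2)[of "of_real t"] that by (simp add: f_real)
  show "\<exists>T>0. \<forall>t. \<bar>t\<bar> \<ge> T \<longrightarrow> \<bar>fr t\<bar> > R"
  proof (intro exI[of _ "\<bar>M\<bar> + 1"] conjI allI impI)
    fix t assume "\<bar>M\<bar> + 1 \<le> \<bar>t\<bar>"
    then show "\<bar>fr t\<bar> > R" using A[of t] by force
  qed simp
  show "\<exists>e>0. \<forall>t. t \<noteq> 0 \<longrightarrow> \<bar>t\<bar> < e \<longrightarrow> \<bar>fr t\<bar> > R"
    using A e(1) by (intro exI[of _ e]) force
qed

lemma fr_IVT: "a \<le> b \<Longrightarrow> 0 < a \<or> b < 0 \<Longrightarrow> (fr a \<le> x \<and> x \<le> fr b) \<or> (fr b \<le> x \<and> x \<le> fr a) \<Longrightarrow> \<exists>t\<ge>a. t \<le> b \<and> fr t = x"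
proof -
  assume ab: "a \<le> b" "0 < a \<or> b < 0" and x: "(fr a \<le> x \<and> x \<le> fr b) \<or> (fr b \<le> x \<and> x \<le> fr a)"
  have c: "continuous_on {a..b} fr"
    by (rule continuous_at_imp_continuous_on) (use fr_isCont ab in auto)
  from x show ?thesis
  proof
    assume "fr a \<le> x \<and> x \<le> fr b" then show ?thesis using IVT'[of fr a x b] ab c by auto
  next
    assume "fr b \<le> x \<and> x \<le> fr a" then show ?thesis using IVT2'[of fr b x a] ab c by auto
  qed
qed

lemma root_outer: "fr c1 \<le> x \<Longrightarrow> \<exists>t\<ge>c1. fr t = x"
proof -
  assume x: "fr c1 \<le> x"
  obtain T where T: "T > 0" "\<And>t. \<bar>t\<bar> \<ge> T \<Longrightarrow> \<bar>fr t\<bar> > \<bar>x\<bar> + \<bar>fr c1\<bar>" using fr_large(1)[of "\<bar>x\<bar> + \<bar>fr c1\<bar>"] by blast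
  define t where "t = max T c1 + 1"
  have "fr c1 < fr t" by (rule fr_mono(1)) (auto simp: t_def)
  moreover have "\<bar>fr t\<bar> > \<bar>x\<bar> + \<bar>fr c1\<bar>" by (rule T(2)) (use T(1) in \<open>auto simp: t_def\<close>)
  ultimately have "x \<le> fr t" by linarith
  moreover have "c1 \<le> t" by (simp add: t_def)
  ultimately show ?thesis using fr_IVT[of c1 t x] x cpos by blast
qed

lemma root_far: "fr (-c0) \<le> x \<Longrightarrow> \<exists>t\<le>-c0. fr t = x"
proof -
  assume x: "fr (-c0) \<le> x"
  obtain T where T: "T > 0" "\<And>t. \<bar>t\<bar> \<ge> T \<Longrightarrow> \<bar>fr t\<bar> > \<bar>x\<bar> + \<bar>fr (-c0)\<bar>" using fr_large(1)[of "\<bar>x\<bar> + \<bar>fr (-c0)\<bar>"] by blast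
  define t where "t = - (max T c0 + 1)"
  have t: "t < -c0" "t < 0" using T(1) by (auto simp: t_def)
  have "fr (-c0) < fr t" by (rule fr_mono(5)) (use t in auto)
  moreover have "\<bar>fr t\<bar> > \<bar>x\<bar> + \<bar>fr (-c0)\<bar>" by (rule T(2)) (use T(1) in \<open>auto simp: t_def\<close>)
  ultimately have "x \<le> fr t" by linarith
  then obtain t' where "t' \<ge> t" "t' \<le> -c0" "fr t' = x" using fr_IVT[of t "-c0" x] x t pos by auto
  then show ?thesis by auto
qed

lemma root_near: "fr (-c0) \<le> x \<Longrightarrow> \<exists>t\<ge>-c0. t < 0 \<and> fr t = x"
proof -
  assume x: "fr (-c0) \<le> x"
  obtain e where e: "e > 0" "\<And>t. t \<noteq> 0 \<Longrightarrow> \<bar>t\<bar> < e \<Longrightarrow> \<bar>fr t\<bar> > \<bar>x\<bar> + \<bar>fr (-c0)\<bar>" using fr_large(2)[of "\<bar>x\<bar> + \<bar>fr (-c0)\<bar>"] by blast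
  define t where "t = - (min e c0 / 2)"
  have t: "t < 0" "-c0 < t" "\<bar>t\<bar> < e" using e(1) pos by (auto simp: t_def min_def)
  have "fr (-c0) < fr t" by (rule fr_mono(6)) (use t in auto)
  moreover have "\<bar>fr t\<bar> > \<bar>x\<bar> + \<bar>fr (-c0)\<bar>" by (rule e(2)) (use t in auto)
  ultimately have "x \<le> fr t" by linarith
  then obtain t' where "t' \<ge> -c0" "t' \<le> t" "fr t' = x" using fr_IVT[of "-c0" t x] x t by auto
  then show ?thesis using t(1) by (intro exI[of _ t']) auto
qed

lemma br1_real: "fr c1 \<le> x \<Longrightarrow> \<exists>t\<ge>c1. br 1 (of_real x) = of_real t \<and> fr t = x"
proof -
  assume "fr c1 \<le> x"
  then obtain t where t: "t \<ge> c1" "fr t = x" using root_outer by blast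
  then have "br 1 (of_real x) = of_real t" using cpos by (intro br_eq cl1) (auto simp: f_real)
  then show ?thesis using t by blast
qed

lemma br2_real_mid: "c2 < c1 \<Longrightarrow> fr c1 \<le> x \<Longrightarrow> x \<le> fr c2 \<Longrightarrow> \<exists>t\<ge>c2. t \<le> c1 \<and> br 2 (of_real x) = of_real t \<and> fr t = x"
proof -
  assume a: "c2 < c1" "fr c1 \<le> x" "x \<le> fr c2"
  then obtain t where t: "t \<ge> c2" "t \<le> c1" "fr t = x" using fr_IVT[of c2 c1 x] cpos by auto
  then have "br 2 (of_real x) = of_real t" using a cpos by (intro br_eq cl2a) (auto simp: f_real)
  then show ?thesis using t by blast
qed

lemma br3_real_mid: "c3 < c2 \<Longrightarrow> fr c3 \<le> x \<Longrightarrow> x \<le> fr c2 \<Longrightarrow> \<exists>t\<ge>c3. t \<le> c2 \<and> br 3 (of_real x) = of_real t \<and> fr t = x"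
proof -
  assume a: "c3 < c2" "fr c3 \<le> x" "x \<le> fr c2"
  then obtain t where t: "t \<ge> c3" "t \<le> c2" "fr t = x" using fr_IVT[of c3 c2 x] pos by auto
  then have "br 3 (of_real x) = of_real t" using a pos by (intro br_eq cl3a) (auto simp: f_real)
  then show ?thesis using t by blast
qed

lemma br2_real_far: "fr (-c0) \<le> x \<Longrightarrow> \<exists>t\<le>-c0. br 2 (of_real x) = of_real t \<and> fr t = x"
proof -
  assume "fr (-c0) \<le> x"
  then obtain t where t: "t \<le> -c0" "fr t = x" using root_far by blast
  then have "br 2 (of_real x) = of_real t" using pos by (intro br_eq cl2b) (auto simp: f_real)
  then show ?thesis using t by blast
qed

lemma br3_real_near: "fr (-c0) \<le> x \<Longrightarrow> \<exists>t\<ge>-c0. t < 0 \<and> br 3 (of_real x) = of_real t \<and> fr t = x"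
proof -
  assume "fr (-c0) \<le> x"
  then obtain t where t: "t \<ge> -c0" "t < 0" "fr t = x" using root_near by blast
  then have "br 3 (of_real x) = of_real t" using pos by (intro br_eq cl3b) (auto simp: f_real)
  then show ?thesis using t by blast
qed

lemma closure_Om_reg: "\<tau> \<in> closure (Om j) \<Longrightarrow> \<tau> \<in> closure (reg j)"
  using closure_mono[of "Om j" "reg j"] by (auto simp: Om_def)

lemma br_range:
  assumes "Im z \<ge> 0"
  shows "Im (br 1 z) \<ge> 0" "cmod (br 1 z) \<ge> c1" "Wf (br 1 z) \<ge> 0"
    "Im (br 2 z) \<le> 0" "cmod (br 2 z) \<ge> c3" "Wf (br 2 z) \<le> 0"
    "Im (br 3 z) \<ge> 0" "cmod (br 3 z) \<le> c1" "Wf (br 3 z) \<ge> 0"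
    "Im (br 4 z) \<le> 0" "cmod (br 4 z) \<le> c3" "Wf (br 4 z) \<le> 0"
  using reg_closure(1)[OF closure_Om_reg[OF br(1)[OF assms, of 1]]] reg_closure(3)[OF closure_Om_reg[OF br(1)[OF assms, of 2]]]
    reg_closure(2)[OF closure_Om_reg[OF br(1)[OF assms, of 3]]] reg_closure(4)[OF _ closure_Om_reg[OF br(1)[OF assms, of 4]]]
    closure_Om_Wf[OF br(1)[OF assms, of 1] br(2)[OF assms, of 1]] closure_Om_Wf[OF br(1)[OF assms, of 2] br(2)[OF assms, of 2]]
    closure_Om_Wf[OF br(1)[OF assms, of 3] br(2)[OF assms, of 3]] closure_Om_Wf[OF br(1)[OF assms, of 4] br(2)[OF assms, of 4]]
  by auto

text \<open>A real preimage on sheet 1 has |t| \<ge> c1. To the right of \<open>c1\<close> the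
  function \<open>fr\<close> is at least \<open>fr c1\<close>, and on the negative axis it is
  positive by \<open>neg\<close>.\<close>

lemma br1_nonreal: "x < fr c1 \<Longrightarrow> Im (br 1 (of_real x)) > 0"
proof (rule ccontr)
  assume x: "x < fr c1" and "\<not> Im (br 1 (of_real x)) > 0"
  then have "Im (br 1 (of_real x)) = 0" using br_range(1)[of "of_real x"] by simp
  then obtain t where t: "br 1 (of_real x) = of_real t" by (metis complex_is_Real_iff Reals_cases)
  have ft: "fr t = x" using br(3)[of "of_real x" 1] t by (simp add: f_real)
  have "\<bar>t\<bar> \<ge> c1" using br_range(2)[of "of_real x"] t by simp
  then consider "t \<ge> c1" | "t < 0" using cpos by linarith
  then show False
  proof cases
    case 1 then show False using fr_mono(1)[of c1 t] ft x by (cases "t = c1") auto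
  next
    case 2 then show False using neg[of t] ft x vals by simp
  qed
qed

text \<open>The critical values at \<open>c2\<close> and \<open>-c0\<close> will be the endpoints of
  the support of \<open>\<mu>2\<close>, while \<open>fr c1\<close> will be -r1.\<close>

definition p where "p = fr c2"
definition q where "q = fr (-c0)"

lemma p_nonneg: "p \<ge> 0" using vals by (simp add: p_def)
lemma q_pos: "q > 0" using neg pos by (simp add: q_def)

lemma p_pos_strict: "p > 0 \<Longrightarrow> c3 < c2 \<and> c2 < c1"
  using vals ord unfolding p_def by (metis less_le_not_le nless_le)

text \<open>Otherwise \<open>br 2\<close> would be real at \<open>p\<close> in two ways: negative,
  on the branch left of \<open>-c0\<close>, and positive, on the branch between \<open>c2\<close>
  and \<open>c1\<close>.\<close>

lemma p_less_q: "p < q"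
proof (rule ccontr)
  assume "\<not> p < q"
  then have pq: "q \<le> p" and p0: "p > 0" using q_pos by auto
  then have c: "c3 < c2" "c2 < c1" using p_pos_strict by auto
  obtain t where t: "t \<le> -c0" "br 2 (of_real p) = of_real t" using br2_real_far[of p] pq by (auto simp: q_def)
  obtain t' where t': "t' \<ge> c2" "br 2 (of_real p) = of_real t'" using br2_real_mid[of p] c vals fr_mono(3)[of c2 c1] by (auto simp: p_def)
  show False using t t' cpos pos by auto
qed

text \<open>A real point of sheet 2 satisfies |t| \<ge> c3 and \<open>fr' t \<le> 0\<close>. The
  second condition excludes t > c1, and on the remaining pieces \<open>fr\<close> is at most
  \<open>p\<close> or at least \<open>q\<close>.\<close>

lemma br2_nonreal: "p < x \<Longrightarrow> x < q \<Longrightarrow> Im (br 2 (of_real x)) < 0"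
proof (rule ccontr)
  assume x: "p < x" "x < q" and "\<not> Im (br 2 (of_real x)) < 0"
  then have "Im (br 2 (of_real x)) = 0" using br_range(4)[of "of_real x"] by simp
  then obtain t where t: "br 2 (of_real x) = of_real t" by (metis complex_is_Real_iff Reals_cases)
  have ft: "fr t = x" using br(3)[of "of_real x" 2] t by (simp add: f_real)
  have t3: "\<bar>t\<bar> \<ge> c3" using br_range(5)[of "of_real x"] t by simp
  have dt: "fr' t \<le> 0" using br_range(6)[of "of_real x"] t by (simp add: Wf_real)
  have t0: "t \<noteq> 0" using t3 pos by auto
  consider "t < 0" | "c3 \<le> t" "t \<le> c2" | "c2 \<le> t" "t \<le> c1" | "t > c1" using t3 by linarith
  then show False
  proof cases
    case 1
    have "q \<le> fr t" using fr_mono(5)[of t "-c0"] fr_mono(6)[of "-c0" t] 1 by (cases "t < -c0"; cases "t = -c0") (auto simp: q_def)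
    then show False using ft x by simp
  next
    case 2
    then have "fr t \<le> p" using fr_mono(4)[of t c2] by (cases "t = c2") (auto simp: p_def)
    then show False using ft x by simp
  next
    case 3
    then have "fr t \<le> p" using fr_mono(3)[of c2 t] by (cases "t = c2") (auto simp: p_def)
    then show False using ft x by simp
  next
    case 4 then show False using fr'_pos_outer[of t] dt by simp
  qed
qed

text \<open>By the open mapping theorem a nonreal root is a limit of points with Im f > 0 in the
  same half plane. Such points do not lie on the separating circle, so they belong to one of the two
  sheets of that half plane.\<close>

lemma nonreal_root_closure:
  assumes t: "Im \<tau> \<noteq> 0" "f \<tau> = of_real x"
  shows "Im \<tau> > 0 \<Longrightarrow> \<tau> = br 1 (of_real x) \<or> \<tau> = br 3 (of_real x)"
    "Im \<tau> < 0 \<Longrightarrow> \<tau> = br 2 (of_real x) \<or> \<tau> = br 4 (of_real x)"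
proof -
  have t0: "\<tau> \<noteq> 0" using t(1) by auto
  have ex: "\<exists>\<sigma>\<in>U. dist \<sigma> \<tau> < e \<and> Im (f \<sigma>) > 0" if e: "e > 0" and U: "open U" "\<tau> \<in> U" "0 \<notin> U" for e U
  proof -
    have o: "open (f ` (ball \<tau> e \<inter> U))"
      by (rule open_mapping_thm2[OF f_holo _ _ _ f_nonconst]) (use U in auto)
    have "f \<tau> \<in> f ` (ball \<tau> e \<inter> U)" using e U by auto
    then obtain d where d: "d > 0" "ball (f \<tau>) d \<subseteq> f ` (ball \<tau> e \<inter> U)" using o open_contains_ball by blast
    have "f \<tau> + of_real (d/2) * \<i> \<in> ball (f \<tau>) d" using d(1) by (simp add: dist_norm norm_mult)
    then obtain \<sigma> where "\<sigma> \<in> ball \<tau> e \<inter> U" "f \<sigma> = f \<tau> + of_real (d/2) * \<i>" using d(2) by (metis imageE subsetD)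
    then show ?thesis using d(1) t(2) by (intro bexI[of _ \<sigma>]) (auto simp: dist_commute)
  qed
  have cl: "\<tau> \<in> closure A \<union> closure A'" if "open U" "\<tau> \<in> U" "0 \<notin> U" "\<And>\<sigma>. \<sigma> \<in> U \<Longrightarrow> Im (f \<sigma>) > 0 \<Longrightarrow> \<sigma> \<in> A \<union> A'" for U A A'
    unfolding closure_Un[symmetric] closure_approachable
    using ex[OF _ that(1-3)] that(4) by blast
  show "\<tau> = br 1 (of_real x) \<or> \<tau> = br 3 (of_real x)" if i: "Im \<tau> > 0"
  proof -
    have "\<tau> \<in> closure (Om 1) \<union> closure (Om 3)"
    proof (rule cl[of "{\<tau>. Im \<tau> > 0}"])
      fix \<sigma> assume s: "\<sigma> \<in> {\<tau>. Im \<tau> > 0}" "Im (f \<sigma>) > 0"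
      have "cmod \<sigma> \<noteq> c1"
      proof
        assume "cmod \<sigma> = c1"
        moreover have "\<sigma> \<noteq> 0" using s(1) by auto
        ultimately have "Im (f \<sigma>) \<le> 0" using Wf_outer_circle[of \<sigma>] Im_f[of \<sigma>] s(1) by (auto simp: mult_nonneg_nonpos)
        then show False using s(2) by simp
      qed
      then show "\<sigma> \<in> Om 1 \<union> Om 3" using s by (auto simp: Om_def reg_def)
    qed (use i in \<open>auto simp: open_halfspace_Im_gt\<close>)
    then show ?thesis using br_eq[of 1 \<tau>] br_eq[of 3 \<tau>] t t0 by auto
  qed
  show "\<tau> = br 2 (of_real x) \<or> \<tau> = br 4 (of_real x)" if i: "Im \<tau> < 0"
  proof -
    have "\<tau> \<in> closure (Om 2) \<union> closure (Om 4)"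
    proof (rule cl[of "{\<tau>. Im \<tau> < 0}"])
      fix \<sigma> assume s: "\<sigma> \<in> {\<tau>. Im \<tau> < 0}" "Im (f \<sigma>) > 0"
      have "cmod \<sigma> \<noteq> c3"
      proof
        assume "cmod \<sigma> = c3"
        moreover have "\<sigma> \<noteq> 0" using s(1) by auto
        ultimately have "Im (f \<sigma>) \<le> 0" using Wf_inner_circle[of \<sigma>] Im_f[of \<sigma>] s(1) by (auto simp: mult_nonpos_nonneg)
        then show False using s(2) by simp
      qed
      then show "\<sigma> \<in> Om 2 \<union> Om 4" using s by (auto simp: Om_def reg_def)
    qed (use i in \<open>auto simp: open_halfspace_Im_lt\<close>)
    then show ?thesis using br_eq[of 2 \<tau>] br_eq[of 4 \<tau>] t t0 by auto
  qed
qed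

text \<open>Conjugation permutes the roots over a real point, so the conjugate of the root on sheet
  1 lies on sheet 2 or 4. Sheet 4 would force c1 = c3 and modulus c1, where \<open>degen\<close>
  gives Re f \<ge> 0, although the value is x < 0.\<close>

lemma br12_conj: "x < fr c1 \<Longrightarrow> br 2 (of_real x) = cnj (br 1 (of_real x))"
proof -
  assume x: "x < fr c1"
  let ?t = "cnj (br 1 (of_real x))"
  have i: "Im ?t < 0" using br1_nonreal[OF x] by simp
  have ft: "f ?t = of_real x" using br(3)[of "of_real x" 1] by (simp add: f_cnj)
  have "?t = br 2 (of_real x) \<or> ?t = br 4 (of_real x)" using nonreal_root_closure(2)[of ?t x] i ft by auto
  moreover have "?t \<noteq> br 4 (of_real x)"
  proof
    assume "?t = br 4 (of_real x)"
    then have "cmod (br 4 (of_real x)) = cmod (br 1 (of_real x))" by (metis complex_mod_cnj)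
    then have "c1 \<le> c3" "cmod (br 1 (of_real x)) \<le> c3" using br_range(2,11)[of "of_real x"] by auto
    then have "c3 = c1" "cmod (br 1 (of_real x)) = c1" using ord br_range(2)[of "of_real x"] by auto
    then have "Re (f (br 1 (of_real x))) \<ge> 0" using degen by blast
    then show False using br(3)[of "of_real x" 1] x vals by simp
  qed
  ultimately show ?thesis by simp
qed

text \<open>The competing candidate, the root on sheet 1, is real here because x > p \<ge> 0 \<ge>
  \<open>fr c1\<close>.\<close>

lemma br23_conj: "p < x \<Longrightarrow> x < q \<Longrightarrow> br 3 (of_real x) = cnj (br 2 (of_real x))"
proof -
  assume x: "p < x" "x < q"
  let ?t = "cnj (br 2 (of_real x))"
  have i: "Im ?t > 0" using br2_nonreal[OF x] by simp
  have ft: "f ?t = of_real x" using br(3)[of "of_real x" 2] by (simp add: f_cnj)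
  have "?t = br 1 (of_real x) \<or> ?t = br 3 (of_real x)" using nonreal_root_closure(1)[of ?t x] i ft by auto
  moreover have "?t \<noteq> br 1 (of_real x)"
  proof
    assume "?t = br 1 (of_real x)"
    moreover have "Im (br 1 (of_real x)) = 0" using br1_real[of x] x p_nonneg vals by auto
    ultimately show False using i by simp
  qed
  ultimately show ?thesis by simp
qed

lemma br2_real:
  assumes "fr c1 \<le> x" "x \<le> p \<or> q \<le> x" "x \<noteq> 0"
  shows "Im (br 2 (of_real x)) = 0"
proof (cases "q \<le> x")
  case True then show ?thesis using br2_real_far[of x] by (auto simp: q_def)
next
  case False
  then have xp: "x \<le> p" using assms by auto
  have "c2 < c1"
  proof (rule ccontr)
    assume "\<not> c2 < c1"
    then have "c2 = c1" using ord by simp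
    then have "fr c2 = fr c1" by simp
    then have "p = fr c1" unfolding p_def .
    then have "x = 0" using assms(1) xp vals(1) p_nonneg by linarith
    then show False using assms by simp
  qed
  then show ?thesis using br2_real_mid[of x] assms(1) xp by (auto simp: p_def)
qed

end

section \<open>Boundary values of the principal square root\<close>

lemma csqrt_upper: "Im z \<ge> 0 \<Longrightarrow> csqrt z = Complex (sqrt ((cmod z + Re z) / 2)) (sqrt ((cmod z - Re z) / 2))"
  by (auto simp: complex_eq_iff sgn_if)

lemma csqrt_tendsto_real:
  "(\<lambda>n. csqrt (Complex x (1 / real (Suc n)))) \<longlonglongrightarrow> (if x \<ge> 0 then of_real (sqrt x) else \<i> * of_real (sqrt \<bar>x\<bar>))"
proof -
  have "(\<lambda>n. Complex x (1 / real (Suc n))) \<longlonglongrightarrow> Complex x 0"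
    by (rule tendsto_Complex[OF tendsto_const LIMSEQ_Suc[OF lim_1_over_n]])
  then have n: "(\<lambda>n. cmod (Complex x (1 / real (Suc n)))) \<longlonglongrightarrow> \<bar>x\<bar>"
    using tendsto_norm by (fastforce simp: cmod_def)
  have "(\<lambda>n. Complex (sqrt ((cmod (Complex x (1 / real (Suc n))) + x) / 2)) (sqrt ((cmod (Complex x (1 / real (Suc n))) - x) / 2)))
     \<longlonglongrightarrow> Complex (sqrt ((\<bar>x\<bar> + x) / 2)) (sqrt ((\<bar>x\<bar> - x) / 2))"
    by (rule tendsto_Complex; rule tendsto_real_sqrt; rule tendsto_divide; (rule tendsto_add[OF n tendsto_const] tendsto_diff[OF n tendsto_const] tendsto_const)?) auto
  moreover have "csqrt (Complex x (1 / real (Suc n))) = Complex (sqrt ((cmod (Complex x (1 / real (Suc n))) + x) / 2)) (sqrt ((cmod (Complex x (1 / real (Suc n))) - x) / 2))" for n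
    by (subst csqrt_upper) auto
  moreover have "Complex (sqrt ((\<bar>x\<bar> + x) / 2)) (sqrt ((\<bar>x\<bar> - x) / 2)) = (if x \<ge> 0 then of_real (sqrt x) else \<i> * of_real (sqrt \<bar>x\<bar>))"
    by (auto simp: complex_eq_iff)
  ultimately show ?thesis by simp
qed

lemma csqrt_first_quadrant: "Im z > 0 \<Longrightarrow> Re (csqrt z) \<ge> 0 \<and> Im (csqrt z) \<ge> 0"
  using Re_csqrt[of z] complex_Re_le_cmod[of z] by (simp add: csqrt_upper)

lemma csqrt_deriv: "Im z > 0 \<Longrightarrow> (csqrt has_field_derivative 1 / (2 * csqrt z)) (at z)"
  using has_field_derivative_csqrt[of z] by (auto simp: complex_nonpos_Reals_iff inverse_eq_divide)

context spectral_curve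
begin

section \<open>Stieltjes transforms and densities\<close>

definition sr :: "real \<Rightarrow> real" where "sr = resid a1 a2 a3 c1 c2 c3"

lemma s_real: "s (of_real t) = of_real (sr t)" by (simp add: s_def sr_def resid_of_real)

lemma s_def': "s \<tau> = of_real a1 / (of_real c1 - \<tau>) + of_real a2 / (of_real c2 - \<tau>) + of_real a3 / (of_real c3 - \<tau>)"
  by (simp add: s_def resid_def)

lemma s_cnj: "s (cnj \<tau>) = cnj (s \<tau>)" by (simp add: s_def')

text \<open>The weights are nonnegative and, by \<open>a_sum\<close>, not all 0. Positivity of the
  slack density \<open>d1\<close> and of the band density \<open>h2\<close> rests on this.\<close>

lemma s_pick: "Im \<tau> > 0 \<Longrightarrow> Im (s \<tau>) > 0"
proof -
  assume i: "Im \<tau> > 0"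
  have T: "Im (of_real a / (of_real c - \<tau>)) = a * (Im \<tau> / (cmod (of_real c - \<tau>))\<^sup>2)" for a c
    by (simp add: Im_divide cmod_power2)
  have P: "Im \<tau> / (cmod (of_real c - \<tau>))\<^sup>2 > 0" for c
  proof -
    have "of_real c - \<tau> \<noteq> 0" using i by (auto simp: complex_eq_iff)
    then show ?thesis using i by simp
  qed
  have "a1 > 0 \<or> a2 > 0 \<or> a3 > 0" using a_sum(1) pos a_nonneg divide_pos_pos[of \<alpha> u] by linarith
  moreover have "a1 * (Im \<tau> / (cmod (of_real c1 - \<tau>))\<^sup>2) \<ge> 0" "a2 * (Im \<tau> / (cmod (of_real c2 - \<tau>))\<^sup>2) \<ge> 0"
    "a3 * (Im \<tau> / (cmod (of_real c3 - \<tau>))\<^sup>2) \<ge> 0"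
    using a_nonneg P[of c1] P[of c2] P[of c3] by (metis less_imp_le mult_nonneg_nonneg)+
  moreover have "a > 0 \<Longrightarrow> a * (Im \<tau> / (cmod (of_real c - \<tau>))\<^sup>2) > 0" for a c
    by (rule mult_pos_pos[OF _ P])
  ultimately show ?thesis unfolding s_def' plus_complex.sel T
    by (metis add_nonneg_pos add_pos_nonneg add_nonneg_nonneg)
qed

text \<open>A point \<open>c1\<close>, \<open>c2\<close> or \<open>c3\<close> is a pole of
  \<open>s\<close> only if its weight is positive; with weight 0 the summand is identically 0, also
  under division by 0.\<close>

definition reglr :: "complex \<Rightarrow> bool" where
  "reglr \<tau> \<longleftrightarrow> (a1 > 0 \<longrightarrow> \<tau> \<noteq> of_real c1) \<and> (a2 > 0 \<longrightarrow> \<tau> \<noteq> of_real c2) \<and> (a3 > 0 \<longrightarrow> \<tau> \<noteq> of_real c3)"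

lemma s_isCont: "reglr \<tau> \<Longrightarrow> isCont s \<tau>"
proof -
  assume r: "reglr \<tau>"
  have T: "isCont (\<lambda>\<tau>. of_real a / (of_real c - \<tau>) :: complex) \<tau>" if "a \<ge> 0" "a > 0 \<longrightarrow> \<tau> \<noteq> of_real c" for a c
  proof (cases "a = 0")
    case False
    then show ?thesis using that by (intro continuous_intros) auto
  qed simp
  show ?thesis unfolding s_def'[abs_def] using r a_nonneg by (intro continuous_add T) (auto simp: reglr_def)
qed

lemma s_holo: "s holomorphic_on {\<tau>. Im \<tau> \<noteq> 0}"
  unfolding s_def'[abs_def] by (intro holomorphic_intros) (auto simp: complex_eq_iff)

lemma reglr_br: "x \<noteq> 0 \<Longrightarrow> reglr (br j (of_real x))"
  using br(3)[of "of_real x" j] pole by (auto simp: reglr_def f_real)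

lemma nonreal_ne: "Im \<tau> \<noteq> 0 \<Longrightarrow> \<tau> \<noteq> 0 \<and> \<tau> \<noteq> of_real c1 \<and> \<tau> \<noteq> of_real c2 \<and> \<tau> \<noteq> of_real c3"
  by auto

lemma br_nonreal: "j \<in> {1,2,3,4} \<Longrightarrow> Im z > 0 \<Longrightarrow> Im (br j z) \<noteq> 0"
  using br_Om[of j z] by (auto simp: Om_def reg_def split: if_splits)

lemma sr_mono:
  assumes "t' \<le> t" "a1 = 0 \<or> (c1 - t) * (c1 - t') > 0" "a2 = 0 \<or> (c2 - t) * (c2 - t') > 0" "a3 = 0 \<or> (c3 - t) * (c3 - t') > 0"
  shows "sr t' \<le> sr t"
proof -
  have T: "a / (c - t') \<le> a / (c - t)" if "a \<ge> 0" "a = 0 \<or> (c - t) * (c - t') > 0" for a c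
  proof (cases "a = 0")
    case False
    then have p: "(c - t) * (c - t') > 0" using that by simp
    then have nz: "c - t \<noteq> 0" "c - t' \<noteq> 0" by auto
    have "a / (c - t) - a / (c - t') = a * (t - t') / ((c - t) * (c - t'))"
      using nz by (simp add: diff_frac_eq algebra_simps)
    also have "\<dots> \<ge> 0" using p that assms(1) by (intro divide_nonneg_pos mult_nonneg_nonneg) auto
    finally show ?thesis by simp
  qed simp
  show ?thesis unfolding sr_def resid_def using T a_nonneg assms by (auto intro!: add_mono)
qed

text \<open>The branches of \<open>s\<close> over the z-plane. \<open>xi 1\<close> will be the
  Stieltjes transform of the first measure minus \<alpha>/sqrt z, and \<open>xi 1 + xi 2\<close>
  that of the second measure.\<close>

definition xi :: "nat \<Rightarrow> complex \<Rightarrow> complex" where "xi j z = s (br j z)"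

lemma half_open: "open {z::complex. Im z > 0}" by (rule open_halfspace_Im_gt)

lemma br_holo: "j \<in> {1,2,3,4} \<Longrightarrow> br j holomorphic_on {z. Im z > 0}"
  using br_deriv[of j] half_open by (auto simp: holomorphic_on_open)

lemma xi_holo: "j \<in> {1,2,3,4} \<Longrightarrow> xi j holomorphic_on {z. Im z > 0}"
proof -
  assume j: "j \<in> {1,2,3,4}"
  have "(s \<circ> br j) holomorphic_on {z. Im z > 0}"
    by (rule holomorphic_on_compose_gen[OF br_holo[OF j] s_holo]) (use br_nonreal[OF j] in auto)
  then show ?thesis by (simp add: xi_def[abs_def] o_def)
qed

lemma approach_real: "(\<lambda>n. Complex x (1 / real (Suc n))) \<longlonglongrightarrow> of_real x"
  using tendsto_Complex[OF tendsto_const LIMSEQ_Suc[OF lim_1_over_n], of x] by (simp add: complex_of_real_def)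

lemma br_lim: "j \<in> {1,2,3,4} \<Longrightarrow> (\<lambda>n. br j (Complex x (1 / real (Suc n)))) \<longlonglongrightarrow> br j (of_real x)"
  by (rule br_tendsto[OF _ _ _ approach_real]) auto

lemma xi_lim: "j \<in> {1,2,3,4} \<Longrightarrow> x \<noteq> 0 \<Longrightarrow> (\<lambda>n. xi j (Complex x (1 / real (Suc n)))) \<longlonglongrightarrow> xi j (of_real x)"
  unfolding xi_def by (rule isCont_tendsto_compose[OF s_isCont[OF reglr_br] br_lim])

lemma xi_cont: "j \<in> {1,2,3,4} \<Longrightarrow> continuous_on (-{0}) (\<lambda>x::real. xi j (of_real x))"
proof -
  assume j: "j \<in> {1,2,3,4}"
  have b: "continuous_on (-{0}) (\<lambda>x::real. br j (of_real x))"
    by (rule continuous_on_compose2[OF br_continuous[OF j]]) (auto intro!: continuous_intros)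
  show ?thesis unfolding xi_def
  proof (rule continuous_on_compose2[OF _ b])
    show "continuous_on ((\<lambda>x::real. br j (of_real x)) ` (-{0})) s"
      by (rule continuous_at_imp_continuous_on) (use s_isCont reglr_br in auto)
  qed auto
qed

lemma xi_meas [measurable]: "j \<in> {1,2,3,4} \<Longrightarrow> (\<lambda>x::real. xi j (of_real x)) \<in> borel_measurable borel"
  using borel_measurable_continuous_countable_exceptions[of "{0}", OF _ xi_cont] by simp

lemma xi_real:
  assumes "br j (of_real x) = of_real t" shows "xi j (of_real x) = of_real (sr t)"
  using assms by (simp add: xi_def s_real)

section \<open>Growth of the branches\<close>

definition C0 where "C0 = sqrt (\<alpha>\<^sup>2 + (\<alpha> / u) / c3 + \<bar>k\<bar> / c3\<^sup>2)"

lemma C0_nonneg: "C0 \<ge> 0" unfolding C0_def using pos by (intro real_sqrt_ge_zero add_nonneg_nonneg) auto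

text \<open>Absolute values in \<open>sq\<close>. Sheets 1 and 2 satisfy |\<tau>| \<ge> c3, so there
  \<open>xi\<close> is O(1/sqrt|z|) both at infinity and at z = 0, the point over which the poles of
  \<open>s\<close> lie.\<close>

lemma sq_bound:
  assumes "Im \<tau> \<noteq> 0" "cmod \<tau> \<ge> c3"
  shows "cmod (s \<tau>) * sqrt (cmod (f \<tau>)) \<le> C0"
proof -
  have ne: "\<tau> \<noteq> 0 \<and> \<tau> \<noteq> of_real c1 \<and> \<tau> \<noteq> of_real c2 \<and> \<tau> \<noteq> of_real c3" using nonreal_ne assms(1) by blast
  have tp: "cmod \<tau> > 0" using ne by simp
  have "cmod (s \<tau>)^2 * cmod (f \<tau>) = cmod (of_real (\<alpha>\<^sup>2) - of_real (\<alpha> / u) / \<tau> + of_real k / \<tau>\<^sup>2)"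
    using sq[of \<tau>] ne by (metis norm_mult norm_power)
  also have "\<dots> \<le> cmod (of_real (\<alpha>\<^sup>2)) + cmod (of_real (\<alpha> / u) / \<tau>) + cmod (of_real k / \<tau>\<^sup>2)"
    by (intro order_trans[OF norm_triangle_ineq] add_mono norm_triangle_ineq4 order_refl)
  also have "cmod (of_real (\<alpha>\<^sup>2)) = \<alpha>\<^sup>2" by (simp add: norm_power)
  also have "cmod (of_real (\<alpha> / u) / \<tau>) = (\<alpha> / u) / cmod \<tau>" using pos by (simp add: norm_divide norm_mult)
  also have "cmod (of_real k / \<tau>\<^sup>2) = \<bar>k\<bar> / (cmod \<tau>)\<^sup>2" by (simp add: norm_divide norm_power)
  also have "\<alpha>\<^sup>2 + (\<alpha> / u) / cmod \<tau> + \<bar>k\<bar> / (cmod \<tau>)\<^sup>2 \<le> \<alpha>\<^sup>2 + (\<alpha> / u) / c3 + \<bar>k\<bar> / c3\<^sup>2"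
    using assms(2) pos tp by (intro add_mono divide_left_mono order_refl power_mono mult_pos_pos) auto
  finally have "cmod (s \<tau>)^2 * cmod (f \<tau>) \<le> \<alpha>\<^sup>2 + (\<alpha> / u) / c3 + \<bar>k\<bar> / c3\<^sup>2" .
  then have "sqrt (cmod (s \<tau>)^2 * cmod (f \<tau>)) \<le> C0" unfolding C0_def by (rule real_sqrt_le_mono)
  then show ?thesis by (simp add: real_sqrt_mult)
qed

lemma xi_bound:
  assumes "j \<in> {1,2}" "Im z > 0"
  shows "cmod (xi j z) \<le> C0 / sqrt (cmod z)" "cmod (csqrt z * xi j z) \<le> C0"
proof -
  have z: "z \<noteq> 0" using assms by auto
  have b: "cmod (br j z) \<ge> c3" using br_range(2,5)[of z] assms ord by auto
  have "cmod (xi j z) * sqrt (cmod z) \<le> C0"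
    using sq_bound[OF br_nonreal b] assms br(3)[of z j] by (auto simp: xi_def)
  then show "cmod (xi j z) \<le> C0 / sqrt (cmod z)" "cmod (csqrt z * xi j z) \<le> C0"
    using z by (simp_all add: pos_le_divide_eq norm_mult mult.commute)
qed

text \<open>On the sheets 1 and 2 the square root of \<open>f \<tau> = u\<^sup>2 \<tau>\<^sup>2 + B \<tau> + \<dots>\<close> is \<open>\<plusminus> (u \<tau> + B / (2 u))\<close> up to
  \<open>O(1 / \<tau>)\<close>; the sign is read off from the quadrants in which both numbers lie.\<close>

lemma sheet_asymptotics:
  "\<exists>R K. R > 0 \<and> K \<ge> 0 \<and> (\<forall>\<tau> y \<sigma>. cmod \<tau> \<ge> R \<longrightarrow> y\<^sup>2 = f \<tau> \<longrightarrow> Re y \<ge> 0 \<longrightarrow> Im y \<ge> 0 \<longrightarrow>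
     (\<sigma> = 1 \<and> Im \<tau> \<ge> 0 \<and> Wf \<tau> \<ge> 0 \<or> \<sigma> = -1 \<and> Im \<tau> \<le> 0 \<and> Wf \<tau> \<le> 0) \<longrightarrow>
     cmod (y * s \<tau> + of_real (\<sigma> * \<alpha>)) \<le> K / cmod \<tau> \<and> cmod (y - of_real (\<sigma> * u) * \<tau>) \<le> K)"
proof -
  define b where "b = B / (2 * u)"
  define K1 where "K1 = \<bar>C - b\<^sup>2\<bar> + \<bar>D\<bar> + v\<^sup>2"
  define K2 where "K2 = (\<bar>D\<bar> + 2 * v\<^sup>2) / (2 * u)"
  define K3 where "K3 = 2 * (a1 * c1 + a2 * c2 + a3 * c3)"
  define K4 where "K4 = 2 * (a1 + a2 + a3)"
  define R where "R = 1 + 2 * c1 + 2 * (\<bar>b\<bar> + 2 * K2) / u + 1"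
  define K where "K = (2 * K1 / u) * K4 + \<bar>b\<bar> * K4 + u * K3 + (2 * K1 / u + \<bar>b\<bar>)"
  have nn: "K1 \<ge> 0" "K2 \<ge> 0" "K3 \<ge> 0" "K4 \<ge> 0"
    using pos cpos a_nonneg by (auto simp: K1_def K2_def K3_def K4_def)
  have R: "R \<ge> 1" "R \<ge> 2 * c1" "R > 2 * (\<bar>b\<bar> + 2 * K2) / u" "R > 0"
  proof -
    have "0 \<le> 2 * (\<bar>b\<bar> + 2 * K2) / u" using nn pos by (intro divide_nonneg_pos) auto
    then show "R \<ge> 1" "R \<ge> 2 * c1" "R > 2 * (\<bar>b\<bar> + 2 * K2) / u" "R > 0"
      using cpos unfolding R_def by linarith+
  qed
  have Kn: "K \<ge> 0" unfolding K_def using nn pos by (intro add_nonneg_nonneg mult_nonneg_nonneg) auto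
  have main: "cmod (y * s \<tau> + of_real (\<sigma> * \<alpha>)) \<le> K / cmod \<tau> \<and> cmod (y - of_real (\<sigma> * u) * \<tau>) \<le> K"
    if t: "cmod \<tau> \<ge> R" and y: "y\<^sup>2 = f \<tau>" "Re y \<ge> 0" "Im y \<ge> 0"
      and sg: "\<sigma> = 1 \<and> Im \<tau> \<ge> 0 \<and> Wf \<tau> \<ge> 0 \<or> \<sigma> = -1 \<and> Im \<tau> \<le> 0 \<and> Wf \<tau> \<le> 0" for \<tau> y \<sigma>
  proof -
    define r where "r = cmod \<tau>"
    have r: "r \<ge> 1" "r \<ge> 2 * c1" "u * r \<ge> 2 * (\<bar>b\<bar> + 2 * K2)" "r > 0"
    proof -
      show "r \<ge> 1" "r \<ge> 2 * c1" "r > 0" using t R unfolding r_def by auto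
      have "2 * (\<bar>b\<bar> + 2 * K2) / u \<le> r" using t R unfolding r_def by linarith
      then show "u * r \<ge> 2 * (\<bar>b\<bar> + 2 * K2)" using pos by (simp add: pos_divide_le_eq mult.commute)
    qed
    have t0: "\<tau> \<noteq> 0" using r(4) by (auto simp: r_def)
    \<comment> \<open>The polynomial part of the square root of \<open>f\<close> at infinity;
      \<sigma> is the sign that goes with the sheet.\<close>
    define \<omega> where "\<omega> = of_real u * \<tau> + of_real b"
    have s2: "\<sigma> * \<sigma> = 1" "\<bar>\<sigma>\<bar> = 1" using sg by auto
    have w2: "(of_real \<sigma> * \<omega>)\<^sup>2 = of_real (u\<^sup>2) * \<tau>\<^sup>2 + of_real B * \<tau> + of_real (b\<^sup>2)"
    proof -
      have "(of_real \<sigma> * \<omega>)\<^sup>2 = of_real (\<sigma> * \<sigma>) * \<omega>\<^sup>2" by (simp add: power2_eq_square mult_ac)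
      also have "\<dots> = of_real (u\<^sup>2) * \<tau>\<^sup>2 + of_real (2 * u * b) * \<tau> + of_real (b\<^sup>2)"
        unfolding s2 \<omega>_def by (simp add: power2_eq_square algebra_simps)
      also have "2 * u * b = B" using pos by (simp add: b_def)
      finally show ?thesis .
    qed
    have d: "(y - of_real \<sigma> * \<omega>) * (y + of_real \<sigma> * \<omega>) = of_real (C - b\<^sup>2) + of_real D / \<tau> + of_real (v\<^sup>2) / \<tau>\<^sup>2"
    proof -
      have "(y - of_real \<sigma> * \<omega>) * (y + of_real \<sigma> * \<omega>) = y\<^sup>2 - (of_real \<sigma> * \<omega>)\<^sup>2" by (simp add: power2_eq_square algebra_simps)
      then show ?thesis unfolding y w2 f_def' by simp
    qed
    have d1: "cmod (y - of_real \<sigma> * \<omega>) * cmod (y + of_real \<sigma> * \<omega>) \<le> K1"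
    proof -
      have "cmod (of_real (C - b\<^sup>2) + of_real D / \<tau> + of_real (v\<^sup>2) / \<tau>\<^sup>2) \<le> \<bar>C - b\<^sup>2\<bar> + \<bar>D\<bar> / r + v\<^sup>2 / r\<^sup>2"
        by (intro order_trans[OF norm_triangle_ineq] add_mono) (auto simp: norm_divide norm_power r_def simp flip: of_real_diff of_real_power)
      also have "\<dots> \<le> \<bar>C - b\<^sup>2\<bar> + \<bar>D\<bar> / 1 + v\<^sup>2 / 1"
        using r by (intro add_mono divide_left_mono order_refl) auto
      finally show ?thesis unfolding norm_mult[symmetric] d K1_def by simp
    qed
    \<comment> \<open>The sign of \<open>Wf\<close> bounds the real part of \<sigma>\<omega> from
      below. As \<open>y\<close> lies in the closed first quadrant and \<sigma>\<omega> nearly does,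
      their sum has modulus of order r; the product of sum and difference is bounded, so the
      difference is O(1/r).\<close>
    have rw: "Re (of_real \<sigma> * \<omega>) \<ge> - K2" "Im (of_real \<sigma> * \<omega>) \<ge> 0"
    proof -
      have e: "Re \<omega> = (2 * u\<^sup>2 * Re \<tau> + B) / (2 * u)" using pos by (simp add: \<omega>_def b_def field_simps power2_eq_square)
      have W: "2 * u\<^sup>2 * Re \<tau> + B = Wf \<tau> + (D / r\<^sup>2 + 2 * v\<^sup>2 * Re \<tau> / r^4)" by (simp add: Wf_def r_def)
      have "\<bar>D / r\<^sup>2 + 2 * v\<^sup>2 * Re \<tau> / r^4\<bar> \<le> \<bar>D\<bar> / r\<^sup>2 + 2 * v\<^sup>2 * (\<bar>Re \<tau>\<bar> / r^4)"
        by (rule order_trans[OF abs_triangle_ineq]) (simp add: abs_mult)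
      also have "\<dots> \<le> \<bar>D\<bar> / 1 + 2 * v\<^sup>2 * 1"
      proof (intro add_mono mult_left_mono divide_left_mono)
        have "\<bar>Re \<tau>\<bar> \<le> r" using abs_Re_le_cmod[of \<tau>] by (simp add: r_def)
        also have "r \<le> r^4" using r(1) power_increasing[of 1 4 r] by simp
        finally show "\<bar>Re \<tau>\<bar> / r^4 \<le> 1" using r by simp
      qed (use r in auto)
      finally have E: "\<bar>D / r\<^sup>2 + 2 * v\<^sup>2 * Re \<tau> / r^4\<bar> \<le> \<bar>D\<bar> + 2 * v\<^sup>2" by simp
      have "\<sigma> * (2 * u\<^sup>2 * Re \<tau> + B) \<ge> - (\<bar>D\<bar> + 2 * v\<^sup>2)"
        unfolding W using sg E by auto
      then have "\<sigma> * (2 * u\<^sup>2 * Re \<tau> + B) / (2 * u) \<ge> - (\<bar>D\<bar> + 2 * v\<^sup>2) / (2 * u)"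
        using pos by (intro divide_right_mono) auto
      then have "- K2 \<le> \<sigma> * ((2 * u\<^sup>2 * Re \<tau> + B) / (2 * u))" unfolding K2_def by (simp add: minus_divide_left)
      then show "Re (of_real \<sigma> * \<omega>) \<ge> - K2" by (simp add: e)
      show "Im (of_real \<sigma> * \<omega>) \<ge> 0" using sg pos by (auto simp: \<omega>_def mult_nonneg_nonpos)
    qed
    have wr: "cmod \<omega> \<ge> u * r - \<bar>b\<bar>"
      using norm_triangle_ineq2[of "of_real u * \<tau>" "- of_real b"] pos by (simp add: \<omega>_def norm_mult r_def)
    have m1: "cmod (of_real \<sigma> * \<omega> + of_real K2) \<le> cmod (y + (of_real \<sigma> * \<omega> + of_real K2))"
      unfolding cmod_def by (intro real_sqrt_le_mono add_mono power_mono) (use y rw in auto)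
    have "cmod (of_real \<sigma> * \<omega>) = cmod \<omega>" using s2 by (simp add: norm_mult)
    then have m2: "cmod \<omega> - K2 \<le> cmod (of_real \<sigma> * \<omega> + of_real K2)"
      using norm_triangle_ineq2[of "of_real \<sigma> * \<omega>" "- of_real K2"] nn by simp
    have m3: "cmod (y + (of_real \<sigma> * \<omega> + of_real K2)) \<le> cmod (y + of_real \<sigma> * \<omega>) + K2"
      using norm_triangle_ineq[of "y + of_real \<sigma> * \<omega>" "of_real K2"] nn by (simp add: add.assoc)
    have arith: "x1 \<le> x2 \<Longrightarrow> w - K2 \<le> x1 \<Longrightarrow> x2 \<le> d + K2 \<Longrightarrow> U - b' \<le> w \<Longrightarrow> 2 * (b' + 2 * K2) \<le> U \<Longrightarrow> U / 2 \<le> d"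
      for x1 x2 w d U b' :: real by argo
    have big: "cmod (y + of_real \<sigma> * \<omega>) \<ge> u * r / 2" by (rule arith[OF m1 m2 m3 wr r(3)])
    have yw: "cmod (y - of_real \<sigma> * \<omega>) \<le> (2 * K1 / u) / r"
    proof -
      have "cmod (y - of_real \<sigma> * \<omega>) * (u * r / 2) \<le> cmod (y - of_real \<sigma> * \<omega>) * cmod (y + of_real \<sigma> * \<omega>)"
        by (rule mult_left_mono[OF big]) simp
      also have "\<dots> \<le> K1" by (rule d1)
      finally show ?thesis using pos r(4) by (simp add: field_simps)
    qed
    have T: "cmod (of_real c - \<tau>) \<ge> r / 2" if "0 < c" "c \<le> c1" for c
      using norm_triangle_ineq2[of \<tau> "of_real c"] that r(2) by (simp add: norm_minus_commute r_def)
    have T1: "cmod (of_real a / (of_real c - \<tau>)) \<le> 2 * a / r" if "0 < c" "c \<le> c1" "a \<ge> 0" for a c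
    proof -
      have "cmod (of_real a / (of_real c - \<tau>)) = a / cmod (of_real c - \<tau>)" using that by (simp add: norm_divide)
      also have "\<dots> \<le> a / (r / 2)" using T[OF that(1,2)] that r by (intro divide_left_mono mult_pos_pos) auto
      finally show ?thesis by (simp add: mult.commute)
    qed
    have sb: "cmod (s \<tau>) \<le> K4 / r"
    proof -
      have "cmod (s \<tau>) \<le> 2 * a1 / r + 2 * a2 / r + 2 * a3 / r"
        unfolding s_def' by (intro order_trans[OF norm_triangle_ineq] add_mono T1) (use a_nonneg cpos ord pos in auto)
      then show ?thesis by (simp add: K4_def add_divide_distrib distrib_left)
    qed
    have st: "cmod (s \<tau> * \<tau> + of_real (\<alpha> / u)) \<le> K3 / r"
    proof -
      have e: "of_real a / (of_real c - \<tau>) * \<tau> + of_real a = of_real (a * c) / (of_real c - \<tau>)" if "0 < c" "c \<le> c1" for a c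
      proof -
        have "of_real c - \<tau> \<noteq> 0" using T[OF that] r by auto
        then show ?thesis by (simp add: field_simps)
      qed
      have "s \<tau> * \<tau> + of_real (\<alpha> / u) = (of_real a1 / (of_real c1 - \<tau>) * \<tau> + of_real a1) + (of_real a2 / (of_real c2 - \<tau>) * \<tau> + of_real a2) + (of_real a3 / (of_real c3 - \<tau>) * \<tau> + of_real a3)"
        unfolding a_sum(1)[symmetric] s_def' by (simp add: algebra_simps)
      also have "\<dots> = of_real (a1 * c1) / (of_real c1 - \<tau>) + of_real (a2 * c2) / (of_real c2 - \<tau>) + of_real (a3 * c3) / (of_real c3 - \<tau>)"
        using e[of c1 a1] e[of c2 a2] e[of c3 a3] cpos ord pos by simp
      also have "cmod \<dots> \<le> 2 * (a1 * c1) / r + 2 * (a2 * c2) / r + 2 * (a3 * c3) / r"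
        by (intro order_trans[OF norm_triangle_ineq] add_mono T1) (use a_nonneg cpos ord pos in auto)
      finally show ?thesis by (simp add: K3_def add_divide_distrib distrib_left)
    qed
    have "y * s \<tau> + of_real (\<sigma> * \<alpha>) = (y - of_real \<sigma> * \<omega>) * s \<tau> + (of_real (\<sigma> * b) * s \<tau> + of_real (\<sigma> * u) * (s \<tau> * \<tau> + of_real (\<alpha> / u)))"
      using pos by (simp add: \<omega>_def field_simps)
    also have "cmod \<dots> \<le> cmod ((y - of_real \<sigma> * \<omega>) * s \<tau>) + (cmod (of_real (\<sigma> * b) * s \<tau>) + cmod (of_real (\<sigma> * u) * (s \<tau> * \<tau> + of_real (\<alpha> / u))))"
      by (intro order_trans[OF norm_triangle_ineq] add_mono norm_triangle_ineq order_refl)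
    also have "\<dots> \<le> ((2 * K1 / u) / r) * (K4 / r) + (\<bar>b\<bar> * (K4 / r) + u * (K3 / r))"
      unfolding norm_mult using yw sb st s2 pos nn r by (intro add_mono mult_mono) (auto simp: abs_mult norm_mult)
    also have "\<dots> \<le> ((2 * K1 / u) / 1) * (K4 / r) + (\<bar>b\<bar> * (K4 / r) + u * (K3 / r))"
      using nn pos r by (intro add_mono mult_right_mono divide_left_mono order_refl) auto
    also have "\<dots> \<le> K / r"
      unfolding K_def using nn pos r by (simp add: add_divide_distrib divide_right_mono)
    finally have 1: "cmod (y * s \<tau> + of_real (\<sigma> * \<alpha>)) \<le> K / r" .
    have "y - of_real (\<sigma> * u) * \<tau> = (y - of_real \<sigma> * \<omega>) + of_real (\<sigma> * b)" by (simp add: \<omega>_def algebra_simps)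
    also have "cmod \<dots> \<le> (2 * K1 / u) / r + \<bar>b\<bar>"
      by (rule order_trans[OF norm_triangle_ineq], rule add_mono[OF yw]) (use s2 in \<open>simp add: abs_mult norm_mult\<close>)
    also have "\<dots> \<le> (2 * K1 / u) / 1 + \<bar>b\<bar>" using nn pos r by (intro add_mono divide_left_mono order_refl) auto
    also have "\<dots> \<le> K"
    proof -
      have "0 \<le> (2 * K1 / u) * K4" "0 \<le> \<bar>b\<bar> * K4" "0 \<le> u * K3" using nn pos by auto
      then show ?thesis unfolding K_def by linarith
    qed
    finally show ?thesis using 1 by (simp add: r_def)
  qed
  show ?thesis by (intro exI[of _ R] exI[of _ K]) (use main R(4) Kn in blast)
qed

lemma br_lower: "\<exists>c>0. \<forall>z. \<forall>j\<in>{1,2}. Im z > 0 \<longrightarrow> c * sqrt (cmod z) \<le> cmod (br j z)"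
proof -
  define K where "K = u\<^sup>2 + \<bar>B\<bar> / c3 + \<bar>C\<bar> / c3^2 + \<bar>D\<bar> / c3^3 + v\<^sup>2 / c3^4"
  have K: "K > 0" unfolding K_def using pos by (intro add_pos_nonneg) auto
  have b: "cmod (f \<tau>) \<le> K * (cmod \<tau>)\<^sup>2" if t: "cmod \<tau> \<ge> c3" for \<tau>
  proof -
    define r where "r = cmod \<tau>"
    have r: "r \<ge> c3" "r > 0" using t pos by (auto simp: r_def)
    have "cmod (f \<tau>) \<le> u\<^sup>2 * r\<^sup>2 + \<bar>B\<bar> * r + \<bar>C\<bar> + \<bar>D\<bar> / r + v\<^sup>2 / r\<^sup>2"
      unfolding f_def' by (intro order_trans[OF norm_triangle_ineq] add_mono) (auto simp: norm_mult norm_divide norm_power r_def)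
    also have "\<dots> = (u\<^sup>2 + \<bar>B\<bar> / r + \<bar>C\<bar> / r^2 + \<bar>D\<bar> / r^3 + v\<^sup>2 / r^4) * r\<^sup>2"
      using r(2) by (simp add: field_simps power2_eq_square power3_eq_cube power4_eq_xxxx)
    also have "\<dots> \<le> K * r\<^sup>2"
      unfolding K_def using r pos by (intro mult_right_mono add_mono divide_left_mono power_mono order_refl mult_pos_pos) auto
    finally show ?thesis by (simp add: r_def)
  qed
  have "1 / sqrt K * sqrt (cmod z) \<le> cmod (br j z)" if "j \<in> {1,2}" "Im z > 0" for j z
  proof -
    have "cmod (br j z) \<ge> c3" using br_range(2,5)[of z] that ord by auto
    from b[OF this] have "cmod z \<le> K * (cmod (br j z))\<^sup>2" using br(3)[of z j] that by simp
    then have "sqrt (cmod z) \<le> sqrt (K * (cmod (br j z))\<^sup>2)" by (rule real_sqrt_le_mono)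
    then show ?thesis using K by (simp add: real_sqrt_mult field_simps)
  qed
  then show ?thesis using K by (intro exI[of _ "1 / sqrt K"]) auto
qed

section \<open>Holomorphic functions whose boundary values are the densities\<close>

definition F1 :: "complex \<Rightarrow> complex" where "F1 z = xi 1 z + of_real \<alpha> / csqrt z"
definition F2 :: "complex \<Rightarrow> complex" where "F2 z = xi 1 z + xi 2 z"
text \<open>At infinity \<open>csqrt z * xi 1 z\<close> tends to -\<alpha> and
  \<open>csqrt z * xi 2 z\<close> to \<alpha>, so the added constant makes the function decay. Its
  boundary imaginary part is nonnegative off one point, and left of \<open>fr c1\<close> its
  boundary real part is a positive multiple of \<open>h1\<close>: this is how \<open>h1 > 0\<close>
  is proved.\<close>

definition Mf :: "complex \<Rightarrow> complex" where "Mf z = csqrt z * (xi 1 z - xi 2 z) + 2 * of_real \<alpha>"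

lemma csqrt_nz: "Im z > 0 \<Longrightarrow> csqrt z \<noteq> 0" by auto

lemma csqrt_holo_half: "csqrt holomorphic_on {z. Im z > 0}"
  by (rule holomorphic_on_subset[OF holomorphic_on_csqrt]) (auto simp: complex_nonpos_Reals_iff)

lemma F_holo: "F1 holomorphic_on {z. Im z > 0}" "F2 holomorphic_on {z. Im z > 0}" "Mf holomorphic_on {z. Im z > 0}"
  unfolding F1_def[abs_def] F2_def[abs_def] Mf_def[abs_def]
  using xi_holo[of 1] xi_holo[of 2] csqrt_holo_half by (auto intro!: holomorphic_intros)

lemma F_bound:
  assumes z: "Im z > 0"
  shows "cmod (F1 z) \<le> (C0 + \<alpha>) / sqrt (cmod z)" "cmod (F2 z) \<le> (2 * C0) / sqrt (cmod z)" "cmod (Mf z) \<le> 2 * C0 + 2 * \<alpha>"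
proof -
  note b1 = xi_bound[of 1 z] and b2 = xi_bound[of 2 z]
  have "cmod (F1 z) \<le> cmod (xi 1 z) + cmod (of_real \<alpha> / csqrt z)" unfolding F1_def by (rule norm_triangle_ineq)
  also have "\<dots> \<le> C0 / sqrt (cmod z) + \<alpha> / sqrt (cmod z)" using b1 z pos by (simp add: norm_divide)
  finally show "cmod (F1 z) \<le> (C0 + \<alpha>) / sqrt (cmod z)" by (simp add: add_divide_distrib)
  have "cmod (F2 z) \<le> cmod (xi 1 z) + cmod (xi 2 z)" unfolding F2_def by (rule norm_triangle_ineq)
  also have "\<dots> \<le> C0 / sqrt (cmod z) + C0 / sqrt (cmod z)" using b1 b2 z by (intro add_mono) auto
  finally show "cmod (F2 z) \<le> (2 * C0) / sqrt (cmod z)" by simp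
  have "cmod (Mf z) \<le> cmod (csqrt z * xi 1 z) + cmod (csqrt z * xi 2 z) + cmod (2 * of_real \<alpha> :: complex)"
    unfolding Mf_def right_diff_distrib by (intro order_trans[OF norm_triangle_ineq] add_mono norm_triangle_ineq4 order_refl)
  also have "\<dots> \<le> C0 + C0 + 2 * \<alpha>" using b1 b2 z pos by (intro add_mono) (auto simp: norm_mult)
  finally show "cmod (Mf z) \<le> 2 * C0 + 2 * \<alpha>" by simp
qed

lemma branch_sqrt_asymptotics:
  "\<exists>Z K. Z > 0 \<and> K \<ge> 0 \<and> (\<forall>z. Im z > 0 \<longrightarrow> cmod z \<ge> Z \<longrightarrow>
     cmod (csqrt z * xi 1 z + of_real \<alpha>) \<le> K / sqrt (cmod z) \<and> cmod (csqrt z * xi 2 z - of_real \<alpha>) \<le> K / sqrt (cmod z)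
     \<and> cmod (csqrt z - of_real u * br 1 z) \<le> K \<and> cmod (csqrt z + of_real u * br 2 z) \<le> K)"
proof -
  obtain R K where R: "R > 0" "K \<ge> 0" and RK: "\<And>\<tau> y \<sigma>. cmod \<tau> \<ge> R \<Longrightarrow> y\<^sup>2 = f \<tau> \<Longrightarrow> Re y \<ge> 0 \<Longrightarrow> Im y \<ge> 0 \<Longrightarrow>
     (\<sigma> = 1 \<and> Im \<tau> \<ge> 0 \<and> Wf \<tau> \<ge> 0 \<or> \<sigma> = -1 \<and> Im \<tau> \<le> 0 \<and> Wf \<tau> \<le> 0) \<Longrightarrow>
     cmod (y * s \<tau> + of_real (\<sigma> * \<alpha>)) \<le> K / cmod \<tau> \<and> cmod (y - of_real (\<sigma> * u) * \<tau>) \<le> K"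
    using sheet_asymptotics by metis
  obtain c where c: "c > 0" "\<And>z j. j \<in> {1,2} \<Longrightarrow> Im z > 0 \<Longrightarrow> c * sqrt (cmod z) \<le> cmod (br j z)" using br_lower by blast
  define Z where "Z = (R / c)\<^sup>2"
  have Zp: "Z > 0" using R c by (simp add: Z_def)
  have "cmod (csqrt z * xi 1 z + of_real \<alpha>) \<le> K / c / sqrt (cmod z) \<and> cmod (csqrt z * xi 2 z - of_real \<alpha>) \<le> K / c / sqrt (cmod z)
     \<and> cmod (csqrt z - of_real u * br 1 z) \<le> K \<and> cmod (csqrt z + of_real u * br 2 z) \<le> K" if z: "Im z > 0" "cmod z \<ge> Z" for z
  proof -
    have z0: "cmod z > 0" using z Zp by linarith
    have "sqrt Z \<le> sqrt (cmod z)" using z(2) by (rule real_sqrt_le_mono)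
    then have Rz: "R \<le> c * sqrt (cmod z)" using R c by (simp add: Z_def pos_divide_le_eq mult.commute)
    have big: "cmod (br j z) \<ge> R" if "j \<in> {1,2}" for j using c(2)[OF that z(1)] Rz by linarith
    have le: "K / cmod (br j z) \<le> K / c / sqrt (cmod z)" if "j \<in> {1,2}" for j
    proof -
      have "K / cmod (br j z) \<le> K / (c * sqrt (cmod z))"
        using c(2)[OF that z(1)] big[OF that] R c(1) z0 by (intro divide_left_mono mult_pos_pos) auto
      then show ?thesis by simp
    qed
    have y: "(csqrt z)\<^sup>2 = f (br j z)" for j using br(3)[of z j] z by simp
    note q = csqrt_first_quadrant[OF z(1)]
    have 1: "cmod (csqrt z * s (br 1 z) + of_real (1 * \<alpha>)) \<le> K / cmod (br 1 z) \<and> cmod (csqrt z - of_real (1 * u) * br 1 z) \<le> K"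
      by (rule RK) (use big y q br_range[of z] z in auto)
    have 2: "cmod (csqrt z * s (br 2 z) + of_real (-1 * \<alpha>)) \<le> K / cmod (br 2 z) \<and> cmod (csqrt z - of_real (-1 * u) * br 2 z) \<le> K"
      by (rule RK) (use big y q br_range[of z] z in auto)
    show ?thesis using 1 2 le[of 1] le[of 2] by (auto simp: xi_def)
  qed
  moreover have "cmod X \<le> K \<Longrightarrow> cmod X \<le> K / c + K" for X using R c by (simp add: add_increasing)
  ultimately show ?thesis using Zp R c
    by (intro exI[of _ Z] exI[of _ "K / c + K"]) (auto simp: add_divide_distrib intro!: order_trans[OF _ le_add_same_cancel1[THEN iffD2]] add_increasing2)
qed

lemma Mf_bound: "\<exists>K. \<forall>z. Im z > 0 \<longrightarrow> cmod (Mf z) \<le> K / sqrt (cmod z)"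
proof -
  obtain Z K where Z: "Z > 0" "K \<ge> 0" and ZK: "\<And>z. Im z > 0 \<Longrightarrow> cmod z \<ge> Z \<Longrightarrow>
     cmod (csqrt z * xi 1 z + of_real \<alpha>) \<le> K / sqrt (cmod z) \<and> cmod (csqrt z * xi 2 z - of_real \<alpha>) \<le> K / sqrt (cmod z)"
    using branch_sqrt_asymptotics by metis
  define K' where "K' = 2 * K + (2 * C0 + 2 * \<alpha>) * sqrt Z"
  have "cmod (Mf z) \<le> K' / sqrt (cmod z)" if z: "Im z > 0" for z
  proof (cases "cmod z \<ge> Z")
    case True
    have "Mf z = (csqrt z * xi 1 z + of_real \<alpha>) - (csqrt z * xi 2 z - of_real \<alpha>)" by (simp add: Mf_def algebra_simps)
    then have "cmod (Mf z) \<le> cmod (csqrt z * xi 1 z + of_real \<alpha>) + cmod (csqrt z * xi 2 z - of_real \<alpha>)"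
      by (simp only: norm_triangle_ineq4)
    also have "\<dots> \<le> K / sqrt (cmod z) + K / sqrt (cmod z)" using ZK[OF z True] by (intro add_mono) auto
    also have "\<dots> = (2 * K) / sqrt (cmod z)" by simp
    also have "\<dots> \<le> K' / sqrt (cmod z)" unfolding K'_def using C0_nonneg pos Z by (intro divide_right_mono) auto
    finally show ?thesis .
  next
    case False
    have z0: "sqrt (cmod z) > 0" using z by auto
    have "cmod (Mf z) * sqrt (cmod z) \<le> (2 * C0 + 2 * \<alpha>) * sqrt Z"
      using F_bound(3)[OF z] False C0_nonneg pos by (intro mult_mono) auto
    also have "\<dots> \<le> K'" unfolding K'_def using Z by simp
    finally show ?thesis using z0 by (simp add: pos_le_divide_eq)
  qed
  then show ?thesis by blast
qed

text \<open>Densities read off by Stieltjes inversion: \<open>d1\<close> for the slack of the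
  constraint, \<open>h1\<close> for \<open>\<mu>1\<close>, \<open>h2\<close> for
  \<open>\<mu>2\<close>. The minus sign in \<open>h2\<close> reflects that sheet 2 lies in the lower
  half plane.\<close>

definition d1 :: "real \<Rightarrow> real" where "d1 x = (if x < fr c1 then Im (xi 1 (of_real x)) / pi else 0)"
definition h1 :: "real \<Rightarrow> real" where "h1 x = (if x < 0 then \<alpha> / (pi * sqrt \<bar>x\<bar>) - d1 x else 0)"
definition h2 :: "real \<Rightarrow> real" where "h2 x = (if p < x \<and> x < q then - Im (xi 2 (of_real x)) / pi else 0)"
text \<open>Boundary imaginary part of \<open>Mf\<close>. Right of 0 the branch \<open>xi 1\<close>
  is real; between \<open>fr c1\<close> and 0 both branches are real and the square root is
  imaginary; left of \<open>fr c1\<close> the branches are conjugate, the square root is imaginary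
  and the product is real.\<close>

definition mm :: "real \<Rightarrow> real" where
  "mm x = (if x > 0 then pi * sqrt x * h2 x else if fr c1 \<le> x \<and> x < 0 then sqrt \<bar>x\<bar> * Re (xi 1 (of_real x) - xi 2 (of_real x)) else 0)"

lemma dens_meas [measurable]: "d1 \<in> borel_measurable borel" "h1 \<in> borel_measurable borel" "h2 \<in> borel_measurable borel" "mm \<in> borel_measurable borel"
proof -
  have [measurable]: "(\<lambda>x. Im (xi 1 (of_real x))) \<in> borel_measurable borel" "(\<lambda>x. Im (xi 2 (of_real x))) \<in> borel_measurable borel"
    "(\<lambda>x. Re (xi 1 (of_real x) - xi 2 (of_real x))) \<in> borel_measurable borel"
    using xi_meas[of 1] xi_meas[of 2] by measurable
  show [measurable]: "d1 \<in> borel_measurable borel" unfolding d1_def[abs_def] by measurable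
  show "h1 \<in> borel_measurable borel" unfolding h1_def[abs_def] by measurable
  show [measurable]: "h2 \<in> borel_measurable borel" unfolding h2_def[abs_def] by measurable
  show "mm \<in> borel_measurable borel" unfolding mm_def[abs_def] by measurable
qed

lemma xi_conj: "br i (of_real x) = cnj (br j (of_real x)) \<Longrightarrow> xi i (of_real x) = cnj (xi j (of_real x))"
  by (simp add: xi_def s_cnj)

lemma Im_xi1_zero: "fr c1 \<le> x \<Longrightarrow> Im (xi 1 (of_real x)) = 0"
  using br1_real[of x] xi_real[of 1 x] by force

lemma Im_xi2_zero: "fr c1 \<le> x \<Longrightarrow> x \<le> p \<or> q \<le> x \<Longrightarrow> x \<noteq> 0 \<Longrightarrow> Im (xi 2 (of_real x)) = 0"
proof -
  assume a: "fr c1 \<le> x" "x \<le> p \<or> q \<le> x" "x \<noteq> 0"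
  obtain t where "br 2 (of_real x) = of_real t" using br2_real[OF a] by (metis complex_is_Real_iff Reals_cases)
  then show ?thesis using xi_real[of 2 x t] by simp
qed

lemma d1_pos: "x < fr c1 \<Longrightarrow> d1 x > 0"
  using s_pick[OF br1_nonreal] by (simp add: d1_def xi_def)

lemma d1_nonneg: "d1 x \<ge> 0" using d1_pos[of x] by (cases "x < fr c1") (auto simp: d1_def)

lemma h2_pos: "p < x \<Longrightarrow> x < q \<Longrightarrow> h2 x > 0"
proof -
  assume x: "p < x" "x < q"
  have "Im (s (cnj (br 2 (of_real x)))) > 0" using br2_nonreal[OF x] by (intro s_pick) simp
  then have "Im (xi 2 (of_real x)) < 0" by (simp add: s_cnj xi_def)
  then show ?thesis using x by (simp add: h2_def divide_neg_pos)
qed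

lemma h2_nonneg: "h2 x \<ge> 0" using h2_pos[of x] by (cases "p < x \<and> x < q") (auto simp: h2_def)

text \<open>A nonempty gap means \<open>fr c1 < 0\<close>, hence c2 < c1 and, by
  \<open>pole\<close>, no pole at \<open>c1\<close>. Away from the edge, \<open>s\<close> therefore
  increases from t' \<le> c1 to t \<ge> c1 without meeting a pole.\<close>

lemma xi12_gap: "fr c1 \<le> x \<Longrightarrow> x < 0 \<Longrightarrow>
   \<exists>t t'. c1 \<le> t \<and> c2 \<le> t' \<and> t' \<le> c1 \<and> xi 1 (of_real x) = of_real (sr t) \<and> xi 2 (of_real x) = of_real (sr t')
     \<and> br 1 (of_real x) = of_real t \<and> br 2 (of_real x) = of_real t' \<and> fr t = x \<and> fr t' = x \<and> (fr c1 < x \<longrightarrow> sr t' \<le> sr t)"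
proof -
  assume x: "fr c1 \<le> x" "x < 0"
  have cc: "c2 < c1" using x vals ord by (metis less_le_not_le nless_le order_trans)
  obtain t where t: "c1 \<le> t" "br 1 (of_real x) = of_real t" "fr t = x" using br1_real[OF x(1)] by blast
  obtain t' where t': "c2 \<le> t'" "t' \<le> c1" "br 2 (of_real x) = of_real t'" "fr t' = x" using br2_real_mid[OF cc x(1)] x vals by auto
  have "sr t' \<le> sr t" if "fr c1 < x"
  proof (rule sr_mono)
    have a1: "a1 = 0" using pole(1) a_nonneg(1) x by (metis less_eq_real_def not_less)
    then show "a1 = 0 \<or> (c1 - t) * (c1 - t') > 0" by simp
    have t2: "c2 < t'" if "a2 > 0" using pole(2)[OF that] t' x by (cases "c2 = t'") auto
    have t3: "c3 < t'" if "a3 > 0"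
    proof -
      have "t' \<noteq> c3" using pole(3)[OF that] t'(4) x by auto
      then show ?thesis using t'(1) ord by linarith
    qed
    show "a2 = 0 \<or> (c2 - t) * (c2 - t') > 0" using t2 t t' cc a_nonneg by (cases "a2 = 0") (auto intro!: mult_neg_neg)
    show "a3 = 0 \<or> (c3 - t) * (c3 - t') > 0" using t3 t t' cc ord a_nonneg by (cases "a3 = 0") (auto intro!: mult_neg_neg)
  qed (use t t' in auto)
  then show ?thesis using t t' xi_real[OF t(2)] xi_real[OF t'(3)] by blast
qed

lemma F2_lim: "x \<noteq> 0 \<Longrightarrow> (\<lambda>n. Im (F2 (Complex x (1 / real (Suc n))))) \<longlonglongrightarrow> - pi * h2 x"
proof -
  assume x: "x \<noteq> 0"
  have "(\<lambda>n. Im (F2 (Complex x (1 / real (Suc n))))) \<longlonglongrightarrow> Im (xi 1 (of_real x) + xi 2 (of_real x))"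
    unfolding F2_def using xi_lim[of 1 x] xi_lim[of 2 x] x by (intro tendsto_Im tendsto_add) auto
  moreover have "Im (xi 1 (of_real x) + xi 2 (of_real x)) = - pi * h2 x"
  proof (cases "x < fr c1")
    case True
    have "xi 2 (of_real x) = cnj (xi 1 (of_real x))" by (rule xi_conj[OF br12_conj[OF True]])
    then show ?thesis using True vals p_nonneg by (simp add: h2_def)
  next
    case False
    then have 1: "Im (xi 1 (of_real x)) = 0" using Im_xi1_zero by simp
    show ?thesis
    proof (cases "p < x \<and> x < q")
      case True then show ?thesis using 1 by (simp add: h2_def)
    next
      case False
      then have "Im (xi 2 (of_real x)) = 0" using Im_xi2_zero[of x] \<open>\<not> x < fr c1\<close> x by auto
      then show ?thesis using 1 False by (auto simp: h2_def)
    qed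
  qed
  ultimately show ?thesis by simp
qed

lemma F1_lim: "x \<noteq> 0 \<Longrightarrow> (\<lambda>n. Im (F1 (Complex x (1 / real (Suc n))))) \<longlonglongrightarrow> - pi * h1 x"
proof -
  assume x: "x \<noteq> 0"
  let ?c = "if x \<ge> 0 then of_real (sqrt x) else \<i> * of_real (sqrt \<bar>x\<bar>)"
  have "(\<lambda>n. Im (F1 (Complex x (1 / real (Suc n))))) \<longlonglongrightarrow> Im (xi 1 (of_real x) + of_real \<alpha> / ?c)"
    unfolding F1_def using xi_lim[of 1 x] x csqrt_tendsto_real[of x] by (intro tendsto_Im tendsto_add tendsto_divide tendsto_const) auto
  moreover have "Im (xi 1 (of_real x) + of_real \<alpha> / ?c) = - pi * h1 x"
  proof (cases "x < 0")
    case True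
    have "complex_of_real \<alpha> / (\<i> * of_real (sqrt \<bar>x\<bar>)) = - \<i> * of_real (\<alpha> / sqrt \<bar>x\<bar>)"
      using True by (simp add: field_simps)
    then have "Im (of_real \<alpha> / ?c) = - \<alpha> / sqrt \<bar>x\<bar>" using True by simp
    moreover have "Im (xi 1 (of_real x)) = pi * d1 x" using Im_xi1_zero[of x] by (auto simp: d1_def)
    ultimately show ?thesis using True by (simp add: h1_def algebra_simps)
  next
    case False
    then have "Im (xi 1 (of_real x)) = 0" using Im_xi1_zero[of x] vals by simp
    then show ?thesis using False by (simp add: h1_def Im_divide)
  qed
  ultimately show ?thesis by simp
qed

lemma Mf_lim: "x \<noteq> 0 \<Longrightarrow> (\<lambda>n. Im (Mf (Complex x (1 / real (Suc n))))) \<longlonglongrightarrow> mm x"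
  and Mf_lim_re: "x < fr c1 \<Longrightarrow> (\<lambda>n. Re (Mf (Complex x (1 / real (Suc n))))) \<longlonglongrightarrow> 2 * pi * sqrt \<bar>x\<bar> * h1 x"
proof -
  let ?c = "if x \<ge> 0 then of_real (sqrt x) else \<i> * of_real (sqrt \<bar>x\<bar>)"
  have L: "(\<lambda>n. Mf (Complex x (1 / real (Suc n)))) \<longlonglongrightarrow> ?c * (xi 1 (of_real x) - xi 2 (of_real x)) + 2 * of_real \<alpha>" if "x \<noteq> 0"
    unfolding Mf_def using xi_lim[of 1 x] xi_lim[of 2 x] that csqrt_tendsto_real[of x] by (intro tendsto_add tendsto_mult tendsto_diff tendsto_const) auto
  have conj: "xi 1 (of_real x) - xi 2 (of_real x) = 2 * \<i> * of_real (pi * d1 x)" if "x < fr c1"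
  proof -
    have "xi 2 (of_real x) = cnj (xi 1 (of_real x))" by (rule xi_conj[OF br12_conj[OF that]])
    then show ?thesis using that by (simp add: d1_def complex_eq_iff)
  qed
  show "(\<lambda>n. Im (Mf (Complex x (1 / real (Suc n))))) \<longlonglongrightarrow> mm x" if x: "x \<noteq> 0"
  proof -
    have "Im (?c * (xi 1 (of_real x) - xi 2 (of_real x)) + 2 * of_real \<alpha>) = mm x"
    proof -
      consider "x > 0" | "fr c1 \<le> x" "x < 0" | "x < fr c1" using x by linarith
      then show ?thesis
      proof cases
        case 1
        have i1: "Im (xi 1 (of_real x)) = 0" using Im_xi1_zero[of x] vals 1 by simp
        have i2: "Im (xi 2 (of_real x)) = - pi * h2 x"
        proof (cases "p < x \<and> x < q")
          case False
          then show ?thesis using Im_xi2_zero[of x] vals 1 by (auto simp: h2_def)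
        qed (simp add: h2_def)
        show ?thesis using 1 i1 i2 by (simp add: mm_def)
      next
        case 2 then show ?thesis by (simp add: mm_def)
      next
        case 3
        then have "x < 0" using vals by simp
        then show ?thesis unfolding conj[OF 3] using 3 by (simp add: mm_def)
      qed
    qed
    then show ?thesis using tendsto_Im[OF L[OF x]] by simp
  qed
  show "(\<lambda>n. Re (Mf (Complex x (1 / real (Suc n))))) \<longlonglongrightarrow> 2 * pi * sqrt \<bar>x\<bar> * h1 x" if x: "x < fr c1"
  proof -
    have x0: "x < 0" using x vals by simp
    have "sqrt \<bar>x\<bar> * (\<alpha> / (pi * sqrt \<bar>x\<bar>)) = \<alpha> / pi" using x0 by simp
    then have "2 * pi * sqrt \<bar>x\<bar> * h1 x = 2 * \<alpha> - 2 * pi * sqrt \<bar>x\<bar> * d1 x"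
      using x0 by (simp add: h1_def algebra_simps)
    also have "\<dots> = Re (?c * (xi 1 (of_real x) - xi 2 (of_real x)) + 2 * of_real \<alpha>)"
      unfolding conj[OF x] using x0 by simp
    finally show ?thesis using tendsto_Re[OF L] x0 by simp
  qed
qed

lemma AE_nz: "AE x in lborel. x \<noteq> (0::real)" by (rule AE_lborel_singleton)

lemma F2_repr: "Im z > 0 \<Longrightarrow> F2 z = (\<integral>x. of_real (h2 x) / (z - of_real x) \<partial>lborel)"
  and F1_repr: "Im z > 0 \<Longrightarrow> F1 z = (\<integral>x. of_real (h1 x) / (z - of_real x) \<partial>lborel)"
proof -
  have conv: "of_real (1/pi) * (\<integral>x. of_real (- pi * h x) / (of_real x - z) \<partial>lborel) = (\<integral>x. of_real (h x) / (z - of_real x) \<partial>lborel)" for h :: "real \<Rightarrow> real" and z :: complex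
  proof -
    have "of_real (- pi * h x) / (of_real x - z) = of_real pi * (of_real (h x) / (z - of_real x))" for x
    proof -
      have "of_real (- pi * h x) / (of_real x - z) = (- (of_real pi * of_real (h x))) / (- (z - of_real x))" by simp
      also have "\<dots> = of_real pi * of_real (h x) / (z - of_real x)" by (rule minus_divide_divide)
      finally show ?thesis by simp
    qed
    then have "(\<integral>x. of_real (- pi * h x) / (of_real x - z) \<partial>lborel) = of_real pi * (\<integral>x. of_real (h x) / (z - of_real x) \<partial>lborel)"
      by (simp only: integral_mult_right_zero)
    then show ?thesis by simp
  qed
  show "F2 z = (\<integral>x. of_real (h2 x) / (z - of_real x) \<partial>lborel)" if z: "Im z > 0"
  proof -
    have "AE x in lborel. (\<lambda>n. Im (F2 (Complex x (1 / real (Suc n))))) \<longlonglongrightarrow> - pi * h2 x"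
      using AE_nz by eventually_elim (rule F2_lim)
    from half_plane_reconstruction(2)[OF F_holo(2) F_bound(2) _ this z] show ?thesis unfolding conv by simp
  qed
  show "F1 z = (\<integral>x. of_real (h1 x) / (z - of_real x) \<partial>lborel)" if z: "Im z > 0"
  proof -
    have "AE x in lborel. (\<lambda>n. Im (F1 (Complex x (1 / real (Suc n))))) \<longlonglongrightarrow> - pi * h1 x"
      using AE_nz by eventually_elim (rule F1_lim)
    from half_plane_reconstruction(2)[OF F_holo(1) F_bound(1) _ this z] show ?thesis unfolding conv by simp
  qed
qed

lemma mm_nonneg: "x \<noteq> fr c1 \<Longrightarrow> mm x \<ge> 0" and mm_pos: "p < x \<Longrightarrow> x < q \<Longrightarrow> mm x > 0" and mm_supp: "x < fr c1 \<or> q < x \<Longrightarrow> mm x = 0"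
proof -
  show "mm x \<ge> 0" if "x \<noteq> fr c1"
  proof (cases "fr c1 \<le> x \<and> x < 0")
    case True
    then have "fr c1 < x" using that by simp
    then obtain t t' where "xi 1 (of_real x) = of_real (sr t)" "xi 2 (of_real x) = of_real (sr t')" "sr t' \<le> sr t"
      using xi12_gap[of x] True by blast
    then show ?thesis using True by (simp add: mm_def)
  qed (use h2_nonneg in \<open>auto simp: mm_def\<close>)
  show "mm x > 0" if "p < x" "x < q" using that p_nonneg h2_pos[OF that] by (simp add: mm_def)
  show "mm x = 0" if "x < fr c1 \<or> q < x" using that vals q_pos by (auto simp: mm_def h2_def)
qed

lemma mm_integrable: "integrable lborel mm"
  and Mf_repr: "Im z > 0 \<Longrightarrow> Mf z = of_real (1/pi) * (\<integral>x. of_real (mm x) / (of_real x - z) \<partial>lborel)"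
proof -
  obtain K where K: "\<And>z. Im z > 0 \<Longrightarrow> cmod (Mf z) \<le> K / sqrt (cmod z)" using Mf_bound by blast
  have ae: "AE x in lborel. (\<lambda>n. Im (Mf (Complex x (1 / real (Suc n))))) \<longlonglongrightarrow> mm x"
    using AE_nz by eventually_elim (rule Mf_lim)
  note H = half_plane_reconstruction[OF F_holo(3) K _ ae]
  show "Mf z = of_real (1/pi) * (\<integral>x. of_real (mm x) / (of_real x - z) \<partial>lborel)" if "Im z > 0" by (rule H(2)) (use that in auto)
  have i: "integrable lborel (\<lambda>x. of_real (mm x) / (of_real x - \<i>))" by (rule H(1)) auto
  define Q where "Q = \<bar>fr c1\<bar> + q + 1"
  show "integrable lborel mm"
  proof (rule Bochner_Integration.integrable_bound)
    show "integrable lborel (\<lambda>x. Q * cmod (of_real (mm x) / (of_real x - \<i>)))" using i by (intro integrable_mult_right integrable_norm) auto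
    show "AE x in lborel. norm (mm x) \<le> norm (Q * cmod (of_real (mm x) / (of_real x - \<i>)))"
    proof (rule AE_I2)
      fix x
      show "norm (mm x) \<le> norm (Q * cmod (of_real (mm x) / (of_real x - \<i>)))"
      proof (cases "x < fr c1 \<or> q < x")
        case True then show ?thesis using mm_supp by simp
      next
        case False
        have "cmod (of_real x - \<i>) \<le> \<bar>x\<bar> + 1" using norm_triangle_ineq4[of "of_real x" \<i>] by simp
        also have "\<dots> \<le> Q" using False q_pos unfolding Q_def by auto
        finally have c: "cmod (of_real x - \<i>) \<le> Q" .
        have nz: "of_real x - \<i> \<noteq> 0" by (auto simp: complex_eq_iff)
        have "\<bar>mm x\<bar> = cmod (of_real x - \<i>) * (\<bar>mm x\<bar> / cmod (of_real x - \<i>))" using nz by simp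
        also have "\<dots> \<le> Q * (\<bar>mm x\<bar> / cmod (of_real x - \<i>))" by (rule mult_right_mono[OF c]) auto
        also have "\<dots> \<le> norm (Q * cmod (of_real (mm x) / (of_real x - \<i>)))"
          by (simp only: norm_divide norm_of_real real_norm_def abs_ge_self)
        finally show ?thesis by simp
      qed
    qed
  qed measurable
qed

text \<open>Since \<open>mm\<close> vanishes left of \<open>fr c1\<close>, the kernel is bounded
  near such an \<open>x\<close>. The representation of \<open>Mf\<close> passes to the boundary by
  dominated convergence, where its real part is known from \<open>Mf_lim_re\<close>.\<close>

lemma h1_formula: "x < fr c1 \<Longrightarrow> 2 * pi * sqrt \<bar>x\<bar> * h1 x = (1/pi) * (\<integral>y. mm y / (y - x) \<partial>lborel)"
  and h1_kernel_integrable: "x < fr c1 \<Longrightarrow> integrable lborel (\<lambda>y. mm y / (y - x))"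
proof -
  assume x: "x < fr c1"
  define \<delta> where "\<delta> = fr c1 - x"
  have d: "\<delta> > 0" using x by (simp add: \<delta>_def)
  let ?z = "\<lambda>n. Complex x (1 / real (Suc n))"
  have bd: "norm (complex_of_real (mm y) / (of_real y - w)) \<le> norm (mm y / \<delta>)" if "Re w = x" for y w
  proof (cases "y < fr c1")
    case False
    have "\<delta> \<le> cmod (of_real y - w)" using False that abs_Re_le_cmod[of "of_real y - w"] by (simp add: \<delta>_def)
    then have "\<bar>mm y\<bar> / cmod (of_real y - w) \<le> \<bar>mm y\<bar> / \<delta>" using d by (intro divide_left_mono mult_pos_pos) auto
    then show ?thesis using d by (simp add: norm_divide)
  qed (simp add: mm_supp)
  have wi: "integrable lborel (\<lambda>y. norm (mm y / \<delta>))" using mm_integrable by simp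
  have lim: "(\<lambda>n. complex_of_real (mm y) / (of_real y - ?z n)) \<longlonglongrightarrow> complex_of_real (mm y) / (of_real y - of_real x)" for y
  proof (cases "y = x")
    case True
    then show ?thesis using mm_supp[of y] x by simp
  next
    case False then show ?thesis by (intro tendsto_intros approach_real) auto
  qed
  have L: "(\<lambda>n. \<integral>y. complex_of_real (mm y) / (of_real y - ?z n) \<partial>lborel) \<longlonglongrightarrow> (\<integral>y. complex_of_real (mm y) / (of_real y - of_real x) \<partial>lborel)"
    by (rule integral_dominated_convergence[OF _ _ wi]) (use lim bd in auto)
  have Li: "integrable lborel (\<lambda>y. complex_of_real (mm y) / (of_real y - of_real x))"
  proof (rule Bochner_Integration.integrable_bound[OF wi])
    show "AE y in lborel. norm (complex_of_real (mm y) / (of_real y - of_real x)) \<le> norm (norm (mm y / \<delta>))"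
      using bd[of "of_real x"] by auto
  qed measurable
  have e: "complex_of_real (mm y) / (of_real y - of_real x) = of_real (mm y / (y - x))" for y by simp
  show i: "integrable lborel (\<lambda>y. mm y / (y - x))" using Li unfolding e complex_of_real_integrable_eq .
  have "(\<lambda>n. Mf (?z n)) \<longlonglongrightarrow> of_real (1/pi) * (\<integral>y. complex_of_real (mm y) / (of_real y - of_real x) \<partial>lborel)"
    using tendsto_mult[OF tendsto_const[of "of_real (1/pi)"] L] Mf_repr by simp
  then have "(\<lambda>n. Re (Mf (?z n))) \<longlonglongrightarrow> Re (of_real (1/pi) * (\<integral>y. complex_of_real (mm y) / (of_real y - of_real x) \<partial>lborel))"
    by (rule tendsto_Re)
  also have "Re (of_real (1/pi) * (\<integral>y. complex_of_real (mm y) / (of_real y - of_real x) \<partial>lborel)) = (1/pi) * (\<integral>y. mm y / (y - x) \<partial>lborel)"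
    unfolding e integral_complex_of_real by (simp flip: of_real_mult of_real_divide)
  finally show "2 * pi * sqrt \<bar>x\<bar> * h1 x = (1/pi) * (\<integral>y. mm y / (y - x) \<partial>lborel)"
    using Mf_lim_re[OF x] LIMSEQ_unique by blast
qed

text \<open>Between \<open>fr c1\<close> and 0 the constraint is attained and \<open>h1\<close> is
  the full constraint density. Further left \<open>h1\<close> is a positive multiple of the integral
  of \<open>mm y / (y - x)\<close>, where \<open>mm\<close> is supported to the right of
  \<open>x\<close> and positive on (p, q).\<close>

lemma h1_pos: "x < 0 \<Longrightarrow> h1 x > 0"
proof -
  assume x: "x < 0"
  show ?thesis
  proof (cases "x < fr c1")
    case False
    then show ?thesis using x pos by (simp add: h1_def d1_def)
  next
    case True
    have ne: "AE y in lborel. y \<noteq> fr c1" by (rule AE_lborel_singleton)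
    have nn: "AE y in lborel. 0 \<le> mm y / (y - x)" using ne
    proof eventually_elim
      case (elim y)
      then show ?case using mm_nonneg[of y] mm_supp[of y] True by (cases "y < fr c1") auto
    qed
    have "(\<integral>y. mm y / (y - x) \<partial>lborel) \<noteq> 0"
    proof
      assume "(\<integral>y. mm y / (y - x) \<partial>lborel) = 0"
      then have "AE y in lborel. mm y / (y - x) = 0"
        using integral_nonneg_eq_0_iff_AE[OF h1_kernel_integrable[OF True] nn] by simp
      then have "AE y in lborel. y \<notin> {p<..<q}"
      proof eventually_elim
        case (elim y)
        then show ?case using mm_pos[of y] True vals p_nonneg by auto
      qed
      then have "emeasure lborel {p<..<q} = 0"
        by (subst (asm) AE_iff_measurable[OF _ refl]) (auto simp: greaterThanLessThan_def greaterThan_def lessThan_def Int_def)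
      then show False using p_less_q by simp
    qed
    moreover have "(\<integral>y. mm y / (y - x) \<partial>lborel) \<ge> 0" by (rule integral_nonneg_AE[OF nn])
    ultimately have "(1/pi) * (\<integral>y. mm y / (y - x) \<partial>lborel) > 0" by simp
    then have "2 * pi * sqrt \<bar>x\<bar> * h1 x > 0" using h1_formula[OF True] by simp
    moreover have "2 * pi * sqrt \<bar>x\<bar> > 0" using x by simp
    ultimately show ?thesis using zero_less_mult_pos by blast
  qed
qed

lemma h1_nonneg: "h1 x \<ge> 0" using h1_pos[of x] by (cases "x < 0") (auto simp: h1_def)

text \<open>Decay of order |x|^(-3/2) is invisible in the definition, a difference of terms of order
  |x|^(-1/2); it comes from \<open>h1_formula\<close>, which has an extra factor 1/|x|. On bounded
  sets the constraint density is a sufficient bound.\<close>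

lemma h1_wt: "\<exists>K. \<forall>x. h1 x \<le> K * wt x"
proof -
  define I where "I = (\<integral>y. \<bar>mm y\<bar> \<partial>lborel)"
  \<comment> \<open>Beyond this radius x < \<open>fr c1\<close>, and y - x \<ge> |x|/2 for all y
    \<ge> \<open>fr c1\<close>.\<close>
  define X where "X = max 1 (2 * \<bar>fr c1\<bar>) + 1"
  define K where "K = \<alpha> / pi * (1 + X) + 4 * I"
  have I: "I \<ge> 0" unfolding I_def by (rule Bochner_Integration.integral_nonneg) auto
  have X: "X > 1" "X > 2 * \<bar>fr c1\<bar>" by (auto simp: X_def)
  have Kn: "K \<ge> 0" unfolding K_def using pos I X by (intro add_nonneg_nonneg mult_nonneg_nonneg) auto
  have "h1 x \<le> K * wt x" for x
  proof (cases "x < 0")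
    case False then show ?thesis using Kn by (simp add: h1_def)
  next
    case x: True
    show ?thesis
    proof (cases "\<bar>x\<bar> \<le> X")
      case True
      have "h1 x \<le> \<alpha> / (pi * sqrt \<bar>x\<bar>)" using x d1_nonneg[of x] by (simp add: h1_def)
      also have "\<dots> = (\<alpha> / pi * (1 + \<bar>x\<bar>)) * wt x"
      proof -
        have "1 + \<bar>x\<bar> \<noteq> 0" by linarith
        then show ?thesis by (simp add: wt_eq)
      qed
      also have "\<dots> \<le> K * wt x"
      proof (rule mult_right_mono)
        have "\<alpha> / pi * (1 + \<bar>x\<bar>) \<le> \<alpha> / pi * (1 + X)" using True pos by (intro mult_left_mono) auto
        then show "\<alpha> / pi * (1 + \<bar>x\<bar>) \<le> K" unfolding K_def using I by linarith
      qed auto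
      finally show ?thesis .
    next
      case False
      have xr: "x < fr c1" "\<bar>x\<bar> / 2 \<le> y - x" if "y \<ge> fr c1" for y using False X x that by auto
      have xr1: "x < fr c1" using False X x by auto
      have b: "mm y / (y - x) \<le> (2 / \<bar>x\<bar>) * \<bar>mm y\<bar>" for y
      proof (cases "y < fr c1")
        case False
        have "mm y / (y - x) \<le> \<bar>mm y\<bar> / (y - x)" using xr[of y] False xr1 by (intro divide_right_mono) auto
        also have "\<dots> \<le> \<bar>mm y\<bar> / (\<bar>x\<bar> / 2)" using xr[of y] False x by (intro divide_left_mono mult_pos_pos) auto
        finally show ?thesis by (simp add: mult.commute)
      qed (simp add: mm_supp)
      have "2 * pi * sqrt \<bar>x\<bar> * h1 x \<le> (1/pi) * ((2 / \<bar>x\<bar>) * I)"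
        unfolding h1_formula[OF xr1] I_def integral_mult_right_zero[of lborel "2 / \<bar>x\<bar>", symmetric]
      proof (rule mult_left_mono)
        show "(\<integral>y. mm y / (y - x) \<partial>lborel) \<le> (\<integral>y. (2 / \<bar>x\<bar>) * \<bar>mm y\<bar> \<partial>lborel)"
          by (rule integral_mono[OF h1_kernel_integrable[OF xr1] _ b]) (use mm_integrable in auto)
      qed simp
      also have "\<dots> \<le> 1 * ((2 / \<bar>x\<bar>) * I)" using I pi_gt3 by (intro mult_right_mono) auto
      also have "\<dots> = 2 * I / \<bar>x\<bar>" by simp
      finally have "sqrt \<bar>x\<bar> * h1 x * (2 * pi) \<le> 2 * I / \<bar>x\<bar>" by (simp add: mult_ac)
      moreover have "sqrt \<bar>x\<bar> * h1 x * 1 \<le> sqrt \<bar>x\<bar> * h1 x * (2 * pi)" using h1_nonneg[of x] pi_gt3 by (intro mult_left_mono) auto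
      ultimately have "sqrt \<bar>x\<bar> * h1 x \<le> 2 * I / \<bar>x\<bar>" by linarith
      then have "h1 x \<le> 2 * I / \<bar>x\<bar> / sqrt \<bar>x\<bar>" proof -
        have "sqrt \<bar>x\<bar> > 0" using x by simp
        then show ?thesis using \<open>sqrt \<bar>x\<bar> * h1 x \<le> 2 * I / \<bar>x\<bar>\<close> by (metis pos_le_divide_eq mult.commute)
      qed
      also have "\<dots> = (2 * I) * ((1 + \<bar>x\<bar>) / \<bar>x\<bar>) * wt x"
      proof -
        have "1 + \<bar>x\<bar> \<noteq> 0" by linarith
        then show ?thesis by (simp add: wt_eq)
      qed
      also have "\<dots> \<le> (2 * I) * 2 * wt x"
        using False X I by (intro mult_right_mono mult_left_mono) (auto simp: divide_le_eq)
      also have "\<dots> = 4 * I * wt x" by simp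
      also have "\<dots> \<le> K * wt x" unfolding K_def using pos X I by (intro mult_right_mono) (auto intro!: add_increasing)
      finally show ?thesis .
    qed
  qed
  then show ?thesis by blast
qed

section \<open>Masses, potentials and the Euler--Lagrange conditions\<close>

lemma h2_wt: "\<exists>K. \<forall>x. h2 x \<le> K * wt x"
proof -
  define K where "K = C0 * (1 + q) / pi"
  have K: "K \<ge> 0" using C0_nonneg q_pos by (simp add: K_def)
  have "h2 x \<le> K * wt x" for x
  proof (cases "p < x \<and> x < q")
    case False
    then show ?thesis using K by (auto simp: h2_def wt_eq)
  next
    case True
    have x: "x > 0" "x < q" using True p_nonneg by auto
    let ?t = "br 2 (of_real x)"
    have "cmod (s ?t) * sqrt (cmod (f ?t)) \<le> C0"
      by (rule sq_bound) (use br2_nonreal[of x] True br_range[of "of_real x"] in auto)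
    then have "cmod (s ?t) * sqrt x \<le> C0" using br(3)[of "of_real x" 2] x by simp
    then have c: "cmod (s ?t) \<le> C0 / sqrt x" using x by (simp add: pos_le_divide_eq)
    have "h2 x \<le> cmod (s ?t) / pi"
    proof -
      have "- Im (s ?t) \<le> cmod (s ?t)" using abs_Im_le_cmod[of "s ?t"] by linarith
      then have "- Im (s ?t) / pi \<le> cmod (s ?t) / pi" by (rule divide_right_mono) simp
      then show ?thesis using True by (simp add: h2_def xi_def)
    qed
    also have "\<dots> \<le> C0 / sqrt x / pi" by (rule divide_right_mono[OF c]) simp
    also have "\<dots> = C0 / pi * (1 + x) * wt x"
    proof -
      have "1 + x \<noteq> 0" using x by linarith
      then show ?thesis using x by (simp add: wt_eq)
    qed
    also have "\<dots> \<le> C0 / pi * (1 + q) * wt x"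
      using x C0_nonneg by (intro mult_right_mono mult_left_mono) (auto simp: wt_eq)
    finally show ?thesis by (simp add: K_def)
  qed
  then show ?thesis by blast
qed

text \<open>Difference of squares in \<open>sq\<close>. One factor tends to a nonzero constant at
  infinity, so the limit of the other factor, multiplied by the square root, can be computed where
  the earlier asymptotics only bound it.\<close>

lemma xi_product:
  assumes "Im z > 0" "j \<in> {1,2}" "\<epsilon> = 1 \<or> \<epsilon> = -1"
  shows "(csqrt z * (csqrt z * xi j z + of_real (\<epsilon> * \<alpha>))) * (csqrt z * xi j z - of_real (\<epsilon> * \<alpha>))
    = of_real (- (\<alpha> / u)) * (csqrt z / br j z) + of_real k * ((csqrt z / br j z) / br j z)"
proof -
  let ?t = "br j z"
  have t: "Im ?t \<noteq> 0" using br_nonreal[of j z] assms by auto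
  note ne = nonreal_ne[OF t]
  have "(csqrt z * xi j z + of_real (\<epsilon> * \<alpha>)) * (csqrt z * xi j z - of_real (\<epsilon> * \<alpha>)) = (csqrt z)\<^sup>2 * (s ?t)\<^sup>2 - of_real (\<alpha>\<^sup>2)"
    using assms(3) by (auto simp: xi_def power2_eq_square algebra_simps)
  also have "\<dots> = (s ?t)\<^sup>2 * f ?t - of_real (\<alpha>\<^sup>2)" using br(3)[of z j] assms by simp
  also have "\<dots> = of_real (- (\<alpha> / u)) / ?t + of_real k / ?t\<^sup>2" using sq[of ?t] ne by simp
  finally show ?thesis by (simp only: mult.assoc) (simp add: algebra_simps power2_eq_square)
qed

text \<open>In \<open>xi_product\<close> the ratio \<open>csqrt z / br j z\<close> tends to
  \<epsilon> u, \<open>1 / br j z\<close> to 0 and the second factor to -2\<epsilon>\<alpha>. The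
  coefficient \<alpha>/u in \<open>sq\<close> thus produces
  (-\<alpha>\<epsilon>)/(-2\<epsilon>\<alpha>) = 1/2 on both sheets: mass 1/2 for \<open>h1\<close>
  and 1/2 + 1/2 for \<open>h2\<close>.\<close>

lemma mass_limit:
  assumes j: "j \<in> {1,2}" "\<epsilon> = (if j = 1 then 1 else -1)"
  shows "(\<lambda>n. csqrt (\<i> * of_nat (Suc n)) * (csqrt (\<i> * of_nat (Suc n)) * xi j (\<i> * of_nat (Suc n)) + of_real (\<epsilon> * \<alpha>))) \<longlonglongrightarrow> 1/2"
proof -
  define z where "z n = \<i> * of_nat (Suc n)" for n
  obtain Z K where Z: "Z > 0" "K \<ge> 0" and ZK: "\<And>z. Im z > 0 \<Longrightarrow> cmod z \<ge> Z \<Longrightarrow>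
     cmod (csqrt z * xi 1 z + of_real \<alpha>) \<le> K / sqrt (cmod z) \<and> cmod (csqrt z * xi 2 z - of_real \<alpha>) \<le> K / sqrt (cmod z)
     \<and> cmod (csqrt z - of_real u * br 1 z) \<le> K \<and> cmod (csqrt z + of_real u * br 2 z) \<le> K"
    using branch_sqrt_asymptotics by metis
  obtain c where c: "c > 0" "\<And>z j. j \<in> {1,2} \<Longrightarrow> Im z > 0 \<Longrightarrow> c * sqrt (cmod z) \<le> cmod (br j z)" using br_lower by blast
  have e: "\<epsilon> = 1 \<or> \<epsilon> = -1" using j(2) by auto
  have zn: "Im (z n) > 0" "cmod (z n) = real (Suc n)" for n by (auto simp: z_def norm_mult simp del: of_nat_Suc)
  have big: "eventually (\<lambda>n. cmod (z n) \<ge> Z) sequentially"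
    unfolding zn using filterlim_at_top[THEN iffD1, OF filterlim_compose[OF filterlim_real_sequentially filterlim_Suc]] by blast
  have sq0: "(\<lambda>n. K' / sqrt (cmod (z n))) \<longlonglongrightarrow> 0" for K' :: real
    unfolding zn by real_asymp
  have A: "(\<lambda>n. csqrt (z n) * xi j (z n) + of_real (\<epsilon> * \<alpha>)) \<longlonglongrightarrow> 0"
  proof (rule Lim_null_comparison[OF _ sq0[of K]], use big in eventually_elim)
    case (elim n)
    show ?case using ZK[OF zn(1) elim] j by (auto simp: zn(2) simp del: of_nat_Suc)
  qed
  then have "(\<lambda>n. (csqrt (z n) * xi j (z n) + of_real (\<epsilon> * \<alpha>)) - of_real (2 * \<epsilon> * \<alpha>)) \<longlonglongrightarrow> 0 - of_real (2 * \<epsilon> * \<alpha>)"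
    by (intro tendsto_intros)
  moreover have "(csqrt (z n) * xi j (z n) + of_real (\<epsilon> * \<alpha>)) - of_real (2 * \<epsilon> * \<alpha>) = csqrt (z n) * xi j (z n) - of_real (\<epsilon> * \<alpha>)" for n
    by simp
  ultimately have A2: "(\<lambda>n. csqrt (z n) * xi j (z n) - of_real (\<epsilon> * \<alpha>)) \<longlonglongrightarrow> of_real (- (2 * \<epsilon> * \<alpha>))"
    by (simp only: diff_0 of_real_minus)
  have inv: "(\<lambda>n. 1 / br j (z n)) \<longlonglongrightarrow> 0"
  proof (rule Lim_null_comparison[OF _ sq0[of "1 / c"]], rule always_eventually, rule allI)
    fix n
    have "c * sqrt (cmod (z n)) > 0" using c zn by auto
    then show "norm (1 / br j (z n)) \<le> 1 / c / sqrt (cmod (z n))"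
      using c(2)[OF j(1) zn(1)[of n]] by (auto simp: norm_divide intro!: divide_left_mono mult_pos_pos)
  qed
  have R0: "(\<lambda>n. (csqrt (z n) - of_real (\<epsilon> * u) * br j (z n)) / br j (z n)) \<longlonglongrightarrow> 0"
  proof (rule Lim_null_comparison[OF _ tendsto_mult_right_zero[OF tendsto_norm_zero[OF inv], of K]], use big in eventually_elim)
    case (elim n)
    have "cmod (csqrt (z n) - of_real (\<epsilon> * u) * br j (z n)) \<le> K" using ZK[OF zn(1) elim] j by auto
    then show ?case by (auto simp: norm_divide norm_mult divide_inverse intro!: mult_right_mono)
  qed
  have nz: "br j (z n) \<noteq> 0" for n using br(2)[of "z n" j] zn(1)[of n] by simp
  have "(\<lambda>n. (csqrt (z n) - of_real (\<epsilon> * u) * br j (z n)) / br j (z n) + of_real (\<epsilon> * u)) \<longlonglongrightarrow> 0 + of_real (\<epsilon> * u)"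
    by (intro tendsto_intros R0)
  moreover have "(csqrt (z n) - of_real (\<epsilon> * u) * br j (z n)) / br j (z n) + of_real (\<epsilon> * u) = csqrt (z n) / br j (z n)" for n
    using nz by (simp add: field_simps)
  ultimately have R: "(\<lambda>n. csqrt (z n) / br j (z n)) \<longlonglongrightarrow> of_real (\<epsilon> * u)" by simp
  have "(\<lambda>n. (of_real (- (\<alpha> / u)) * (csqrt (z n) / br j (z n)) + of_real k * ((csqrt (z n) / br j (z n)) * (1 / br j (z n)))) / (csqrt (z n) * xi j (z n) - of_real (\<epsilon> * \<alpha>)))
    \<longlonglongrightarrow> (of_real (- (\<alpha> / u)) * of_real (\<epsilon> * u) + of_real k * (of_real (\<epsilon> * u) * 0)) / of_real (- (2 * \<epsilon> * \<alpha>))"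
    by (intro tendsto_intros R inv A2) (use e pos in auto)
  moreover have "(of_real (- (\<alpha> / u)) * of_real (\<epsilon> * u) + of_real k * (of_real (\<epsilon> * u) * 0)) / of_real (- (2 * \<epsilon> * \<alpha>)) = (1/2 :: complex)"
    using e pos by auto
  moreover have "eventually (\<lambda>n. (of_real (- (\<alpha> / u)) * (csqrt (z n) / br j (z n)) + of_real k * ((csqrt (z n) / br j (z n)) * (1 / br j (z n)))) / (csqrt (z n) * xi j (z n) - of_real (\<epsilon> * \<alpha>))
     = csqrt (z n) * (csqrt (z n) * xi j (z n) + of_real (\<epsilon> * \<alpha>))) sequentially"
  proof -
    have "of_real (- (2 * \<epsilon> * \<alpha>)) \<noteq> (0::complex)" using e pos by auto
    from tendsto_imp_eventually_ne[OF A2 this] show ?thesis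
    proof eventually_elim
      case (elim n)
      then show ?case using xi_product[OF zn(1)[of n] j(1) e] by (simp add: divide_eq_eq)
    qed
  qed
  ultimately have "(\<lambda>n. csqrt (z n) * (csqrt (z n) * xi j (z n) + of_real (\<epsilon> * \<alpha>))) \<longlonglongrightarrow> 1/2"
    using Lim_transform_eventually by fastforce
  then show ?thesis unfolding z_def .
qed

lemma h1_mass: "(\<integral>y. h1 y \<partial>lborel) = 1/2" and h2_mass: "(\<integral>y. h2 y \<partial>lborel) = 1"
proof -
  define z where "z n = \<i> * of_nat (Suc n)" for n
  have zn: "Im (z n) > 0" for n by (auto simp: z_def simp del: of_nat_Suc)
  have s2: "csqrt (z n) * csqrt (z n) = z n" for n by (metis power2_csqrt power2_eq_square)
  have L1: "(\<lambda>n. csqrt (z n) * (csqrt (z n) * xi 1 (z n) + of_real (1 * \<alpha>))) \<longlonglongrightarrow> 1/2"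
    unfolding z_def by (rule mass_limit) auto
  have L2: "(\<lambda>n. csqrt (z n) * (csqrt (z n) * xi 2 (z n) + of_real (-1 * \<alpha>))) \<longlonglongrightarrow> 1/2"
    unfolding z_def by (rule mass_limit) auto
  obtain K1 where K1: "\<And>x. h1 x \<le> K1 * wt x" using h1_wt by blast
  obtain K2 where K2: "\<And>x. h2 x \<le> K2 * wt x" using h2_wt by blast
  have i1: "integrable lborel h1" by (rule finite_measure_density_wt(1)[OF dens_meas(2) h1_nonneg K1])
  have i2: "integrable lborel h2" by (rule finite_measure_density_wt(1)[OF dens_meas(3) h2_nonneg K2])
  have e1: "csqrt (z n) * (csqrt (z n) * xi 1 (z n) + of_real (1 * \<alpha>)) = z n * (\<integral>y. of_real (h1 y) / (z n - of_real y) \<partial>lborel)" for n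
  proof -
    have "csqrt (z n) * (csqrt (z n) * xi 1 (z n) + of_real (1 * \<alpha>)) = z n * F1 (z n)"
      using csqrt_nz[OF zn[of n]] s2[of n] by (simp add: F1_def field_simps flip: mult.assoc)
    then show ?thesis by (simp only: F1_repr[OF zn])
  qed
  have e2: "csqrt (z n) * (csqrt (z n) * xi 1 (z n) + of_real (1 * \<alpha>)) + csqrt (z n) * (csqrt (z n) * xi 2 (z n) + of_real (-1 * \<alpha>))
     = z n * (\<integral>y. of_real (h2 y) / (z n - of_real y) \<partial>lborel)" for n
  proof -
    have "csqrt (z n) * (csqrt (z n) * xi 1 (z n) + of_real (1 * \<alpha>)) + csqrt (z n) * (csqrt (z n) * xi 2 (z n) + of_real (-1 * \<alpha>))
      = (csqrt (z n) * csqrt (z n)) * F2 (z n)" by (simp add: F2_def algebra_simps)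
    then show ?thesis unfolding s2 by (simp only: F2_repr[OF zn])
  qed
  show "(\<integral>y. h1 y \<partial>lborel) = 1/2"
  proof (rule stieltjes_mass[OF i1])
    have "(\<lambda>n. z n * (\<integral>y. of_real (h1 y) / (z n - of_real y) \<partial>lborel)) \<longlonglongrightarrow> 1/2"
      using L1 unfolding e1 .
    then show "(\<lambda>n. \<i> * of_nat (Suc n) * (\<integral>y. of_real (h1 y) / (\<i> * of_nat (Suc n) - of_real y) \<partial>lborel)) \<longlonglongrightarrow> of_real (1/2)"
      unfolding z_def by simp
  qed
  show "(\<integral>y. h2 y \<partial>lborel) = 1"
  proof (rule stieltjes_mass[OF i2])
    have "(\<lambda>n. z n * (\<integral>y. of_real (h2 y) / (z n - of_real y) \<partial>lborel)) \<longlonglongrightarrow> 1/2 + 1/2"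
      using tendsto_add[OF L1 L2] unfolding e2 .
    then show "(\<lambda>n. \<i> * of_nat (Suc n) * (\<integral>y. of_real (h2 y) / (\<i> * of_nat (Suc n) - of_real y) \<partial>lborel)) \<longlonglongrightarrow> of_real 1"
      unfolding z_def by simp
  qed
qed

section \<open>A primitive of \<open>s * f'\<close> and the logarithmic potentials\<close>

definition S0 where "S0 = a1 + a2 + a3"
definition S1 where "S1 = a1 * (c2 + c3) + a2 * (c1 + c3) + a3 * (c1 + c2)"
definition S2 where "S2 = a1 * c2 * c3 + a2 * c1 * c3 + a3 * c1 * c2"

text \<open>A primitive of \<open>s * f'\<close>, whose real part along the sheets gives the logarithmic potentials.\<close>

definition PP :: "complex \<Rightarrow> complex" where
  "PP \<tau> = - 2 * of_real (u\<^sup>2) * (of_real S0 * \<tau> + of_real (S0 * c0 - S1) * Ln \<tau> - of_real (S2 - S1 * c0) / \<tau> - of_real (S2 * c0 / 2) / \<tau>\<^sup>2)"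

text \<open>The coefficient of \<open>Ln\<close> is real, so the real part does not see the branch
  cut: it is continuous on the punctured plane and invariant under conjugation.\<close>

definition PR :: "complex \<Rightarrow> real" where
  "PR \<tau> = - 2 * u\<^sup>2 * (S0 * Re \<tau> + (S0 * c0 - S1) * ln (cmod \<tau>) - (S2 - S1 * c0) * Re (1 / \<tau>) - S2 * c0 / 2 * Re (1 / \<tau>\<^sup>2))"

definition PRr :: "real \<Rightarrow> real" where
  "PRr t = - 2 * u\<^sup>2 * (S0 * t + (S0 * c0 - S1) * ln \<bar>t\<bar> - (S2 - S1 * c0) / t - S2 * c0 / 2 / t\<^sup>2)"

lemma PP_PR: "\<tau> \<noteq> 0 \<Longrightarrow> Re (PP \<tau>) = PR \<tau>"
proof -
  assume t: "\<tau> \<noteq> 0"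
  have e: "PP \<tau> = of_real (- 2 * u\<^sup>2) * (of_real S0 * \<tau> + of_real (S0 * c0 - S1) * Ln \<tau> - of_real (S2 - S1 * c0) * (1 / \<tau>) - of_real (S2 * c0 / 2) * (1 / \<tau>\<^sup>2))"
    by (simp add: PP_def)
  have g: "Re (of_real A * (of_real E * X + of_real F * Y - of_real G * W - of_real H * V)) = A * (E * Re X + F * Re Y - G * Re W - H * Re V)"
    for A E F G H X Y W V by simp
  show ?thesis unfolding e g PR_def Re_Ln[OF t] by simp
qed

lemma PR_real: "PR (of_real t) = PRr t"
proof -
  have "Re (1 / complex_of_real t) = 1 / t" "Re (1 / (complex_of_real t)\<^sup>2) = 1 / t\<^sup>2"
    by (simp_all flip: of_real_power of_real_divide add: Re_divide_of_real)
  then show ?thesis by (simp add: PR_def PRr_def)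
qed

lemma PR_cnj: "PR (cnj \<tau>) = PR \<tau>"
proof -
  have "Re (1 / cnj \<tau>) = Re (1 / \<tau>)" "Re (1 / (cnj \<tau>)\<^sup>2) = Re (1 / \<tau>\<^sup>2)"
    by (metis complex_cnj_divide complex_cnj_one complex_cnj_power cnj.sel(1))+
  then show ?thesis by (simp add: PR_def)
qed

lemma PR_continuous: "\<tau> \<noteq> 0 \<Longrightarrow> isCont PR \<tau>"
  unfolding PR_def[abs_def] by (intro continuous_intros) auto

text \<open>The possible poles of \<open>s\<close> are critical points of \<open>f\<close>, so the
  denominators of \<open>s\<close> cancel against factors of \<open>f'\<close> and the product is a
  Laurent polynomial. S0, S1, S2 are, up to sign, the coefficients of the numerator of
  \<open>s\<close>.\<close>

lemma residue_identity: fixes t :: "'a::{real_field,field}"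
  shows "t \<noteq> 0 \<Longrightarrow> t \<noteq> of_real c1 \<Longrightarrow> t \<noteq> of_real c2 \<Longrightarrow> t \<noteq> of_real c3 \<Longrightarrow>
    - 2 * of_real (u\<^sup>2) * (of_real S0 + of_real (S0 * c0 - S1) / t + of_real (S2 - S1 * c0) / t\<^sup>2 + of_real (S2 * c0) / t^3)
     = resid a1 a2 a3 c1 c2 c3 t * (2 * of_real (u\<^sup>2) * ((t - of_real c1) * (t - of_real c2) * (t - of_real c3) * (t + of_real c0)) / t^3)"
proof -
  assume t: "t \<noteq> 0" "t \<noteq> of_real c1" "t \<noteq> of_real c2" "t \<noteq> of_real c3"
  have gen: "(A + E + G) * (X * Y * Z) = (A * X) * (Y * Z) + (E * Y) * (X * Z) + (G * Z) * (X * Y)" for A E G X Y Z :: 'a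
    by (simp add: algebra_simps)
  have one: "of_real a / (of_real c - t) * (t - of_real c) = - of_real a" if "t \<noteq> of_real c" for a c :: real
    using that by (simp add: field_simps)
  have r: "resid a1 a2 a3 c1 c2 c3 t * ((t - of_real c1) * (t - of_real c2) * (t - of_real c3))
     = - (of_real a1 * (t - of_real c2) * (t - of_real c3) + of_real a2 * (t - of_real c1) * (t - of_real c3) + of_real a3 * (t - of_real c1) * (t - of_real c2))"
  proof -
    have "resid a1 a2 a3 c1 c2 c3 t * ((t - of_real c1) * (t - of_real c2) * (t - of_real c3))
      = (of_real a1 / (of_real c1 - t) * (t - of_real c1)) * ((t - of_real c2) * (t - of_real c3))
       + (of_real a2 / (of_real c2 - t) * (t - of_real c2)) * ((t - of_real c1) * (t - of_real c3))
       + (of_real a3 / (of_real c3 - t) * (t - of_real c3)) * ((t - of_real c1) * (t - of_real c2))"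
      unfolding resid_def by (rule gen)
    then show ?thesis unfolding one[OF t(2)] one[OF t(3)] one[OF t(4)] by (simp add: algebra_simps)
  qed
  have "resid a1 a2 a3 c1 c2 c3 t * (2 * of_real (u\<^sup>2) * ((t - of_real c1) * (t - of_real c2) * (t - of_real c3) * (t + of_real c0)) / t^3)
     = 2 * of_real (u\<^sup>2) * (t + of_real c0) * (resid a1 a2 a3 c1 c2 c3 t * ((t - of_real c1) * (t - of_real c2) * (t - of_real c3))) / t^3"
    by (simp add: mult_ac)
  also have "\<dots> = - 2 * of_real (u\<^sup>2) * (of_real S0 + of_real (S0 * c0 - S1) / t + of_real (S2 - S1 * c0) / t\<^sup>2 + of_real (S2 * c0) / t^3)"
    unfolding r using t(1) by (simp add: S0_def S1_def S2_def divide_simps) (simp add: algebra_simps power2_eq_square power3_eq_cube)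
  finally show ?thesis by simp
qed

lemma DERIV_const_over: "t \<noteq> 0 \<Longrightarrow> ((\<lambda>t. A / t) has_field_derivative - (A / t\<^sup>2)) (at (t::'a::real_normed_field))"
  and DERIV_const_over_sq: "t \<noteq> 0 \<Longrightarrow> ((\<lambda>t. A / t\<^sup>2) has_field_derivative - (2 * A / t^3)) (at (t::'a::real_normed_field))"
  by (auto intro!: derivative_eq_intros simp: power2_eq_square power3_eq_cube mult_ac)

lemma PP_deriv:
  assumes "Im \<tau> \<noteq> 0"
  shows "(PP has_field_derivative s \<tau> * f' \<tau>) (at \<tau>)"
proof -
  note ne = nonreal_ne[OF assms]
  have nn: "\<tau> \<notin> \<real>\<^sub>\<le>\<^sub>0" using assms by (auto simp: complex_nonpos_Reals_iff)
  have "(PP has_field_derivative - 2 * of_real (u\<^sup>2) * (of_real S0 + of_real (S0 * c0 - S1) / \<tau> + of_real (S2 - S1 * c0) / \<tau>\<^sup>2 + of_real (S2 * c0) / \<tau>^3)) (at \<tau>)"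
  proof -
    have d: "((\<lambda>\<tau>. of_real S0 * \<tau> + of_real (S0 * c0 - S1) * Ln \<tau> - of_real (S2 - S1 * c0) / \<tau> - of_real (S2 * c0 / 2) / \<tau>\<^sup>2) has_field_derivative
      of_real S0 * 1 + of_real (S0 * c0 - S1) * inverse \<tau> - (- (of_real (S2 - S1 * c0) / \<tau>\<^sup>2)) - (- (2 * of_real (S2 * c0 / 2) / \<tau>^3))) (at \<tau>)"
      by (intro DERIV_diff DERIV_add DERIV_cmult DERIV_ident has_field_derivative_Ln DERIV_const_over DERIV_const_over_sq) (use ne nn in auto)
    have h: "2 * complex_of_real (S2 * c0 * inverse 2) = of_real (S2 * c0)" by simp
    from DERIV_cmult[OF d, of "- 2 * of_real (u\<^sup>2)"] show ?thesis
      unfolding PP_def[abs_def] by (rule DERIV_cong) (simp only: h minus_minus diff_minus_eq_add divide_inverse mult_1_right)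
  qed
  also have "- 2 * of_real (u\<^sup>2) * (of_real S0 + of_real (S0 * c0 - S1) / \<tau> + of_real (S2 - S1 * c0) / \<tau>\<^sup>2 + of_real (S2 * c0) / \<tau>^3) = s \<tau> * f' \<tau>"
    using residue_identity[of \<tau>] ne by (simp add: s_def f'_prod)
  finally show ?thesis .
qed

lemma PRr_deriv:
  assumes "t \<noteq> 0" "t \<noteq> c1" "t \<noteq> c2" "t \<noteq> c3"
  shows "(PRr has_field_derivative sr t * fr' t) (at t)"
proof -
  have L: "((\<lambda>t. ln \<bar>t\<bar>) has_field_derivative 1 / t) (at t)"
  proof (cases "t > 0")
    case True
    then have "(ln has_field_derivative 1 / t) (at t)" by (auto intro!: derivative_eq_intros)
    then show ?thesis by (rule has_field_derivative_transform_within_open[where S = "{0<..}"]) (use True in auto)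
  next
    case False
    then have "((\<lambda>t. ln (- t)) has_field_derivative 1 / t) (at t)" using assms by (auto intro!: derivative_eq_intros)
    then show ?thesis by (rule has_field_derivative_transform_within_open[where S = "{..<0}"]) (use False assms in auto)
  qed
  have "(PRr has_field_derivative - 2 * u\<^sup>2 * (S0 + (S0 * c0 - S1) / t + (S2 - S1 * c0) / t\<^sup>2 + (S2 * c0) / t^3)) (at t)"
  proof -
    have d: "((\<lambda>t. S0 * t + (S0 * c0 - S1) * ln \<bar>t\<bar> - (S2 - S1 * c0) / t - (S2 * c0 / 2) / t\<^sup>2) has_field_derivative
      S0 * 1 + (S0 * c0 - S1) * (1 / t) - (- ((S2 - S1 * c0) / t\<^sup>2)) - (- (2 * (S2 * c0 / 2) / t^3))) (at t)"
      by (intro DERIV_diff DERIV_add DERIV_cmult DERIV_ident L DERIV_const_over DERIV_const_over_sq) (use assms in auto)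
    have h: "2 * (S2 * c0 * inverse 2) = S2 * c0" by simp
    from DERIV_cmult[OF d, of "- 2 * u\<^sup>2"] show ?thesis
      unfolding PRr_def[abs_def] by (rule DERIV_cong) (simp only: h minus_minus diff_minus_eq_add divide_inverse mult_1_right mult_1_left)
  qed
  also have "- 2 * u\<^sup>2 * (S0 + (S0 * c0 - S1) / t + (S2 - S1 * c0) / t\<^sup>2 + (S2 * c0) / t^3) = sr t * fr' t"
    using residue_identity[of t] assms by (simp add: sr_def fr'_prod)
  finally show ?thesis .
qed

lemma potential_deriv:
  assumes "j \<in> {1,2}" "Im z > 0"
  shows "((\<lambda>z. PP (br j z)) has_field_derivative xi j z) (at z)"
proof -
  have j: "j \<in> {1,2,3,4}" using assms by auto
  have n: "Im (br j z) \<noteq> 0" using br_nonreal[OF j assms(2)] .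
  have "((\<lambda>z. PP (br j z)) has_field_derivative s (br j z) * f' (br j z) * (1 / f' (br j z))) (at z)"
    by (rule DERIV_chain2[OF PP_deriv[OF n] br_deriv[OF j assms(2)]])
  then show ?thesis using f'_nonzero[OF n] by (simp add: xi_def)
qed

lemma PR_br_lim: "j \<in> {1,2,3,4} \<Longrightarrow> (\<lambda>n. Re (PP (br j (Complex x (1 / real (Suc n)))))) \<longlonglongrightarrow> PR (br j (of_real x))"
proof -
  assume j: "j \<in> {1,2,3,4}"
  have "(\<lambda>n. PR (br j (Complex x (1 / real (Suc n))))) \<longlonglongrightarrow> PR (br j (of_real x))"
    by (rule isCont_tendsto_compose[OF PR_continuous br_lim[OF j]]) (use br(2) in simp)
  moreover have "Re (PP (br j (Complex x (1 / real (Suc n))))) = PR (br j (Complex x (1 / real (Suc n))))" for n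
    by (rule PP_PR) (use br(2) in simp)
  ultimately show ?thesis by simp
qed

text \<open>The transform of \<open>h1\<close> is \<open>xi 1 z + \<alpha> / csqrt z\<close>, with
  primitive PP on sheet 1 plus 2\<alpha> sqrt z. The boundary real part of the square root is
  \<open>sqrt (max 0 x)\<close>, so the extra term is absent on the negative axis and yields
  half-power terms of the external field on the positive one.\<close>

lemma h1_potential: "\<exists>c. \<forall>x. (\<integral>y. ln \<bar>x - y\<bar> * h1 y \<partial>lborel) = PR (br 1 (of_real x)) + 2 * \<alpha> * sqrt (max 0 x) + c"
proof -
  obtain K where K: "\<And>x. h1 x \<le> K * wt x" using h1_wt by blast
  show ?thesis
  proof (rule log_potential_line[OF dens_meas(2) h1_nonneg K])
    fix z assume z: "Im z > 0"
    have "((\<lambda>z. PP (br 1 z) + 2 * of_real \<alpha> * csqrt z) has_field_derivative xi 1 z + 2 * of_real \<alpha> * (1 / (2 * csqrt z))) (at z)"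
      by (intro DERIV_add DERIV_cmult potential_deriv csqrt_deriv) (use z in auto)
    moreover have "xi 1 z + 2 * of_real \<alpha> * (1 / (2 * csqrt z)) = (\<integral>y. of_real (h1 y) / (z - of_real y) \<partial>lborel)"
      unfolding F1_repr[OF z, symmetric] by (simp add: F1_def)
    ultimately show "((\<lambda>z. PP (br 1 z) + 2 * of_real \<alpha> * csqrt z) has_field_derivative (\<integral>y. of_real (h1 y) / (z - of_real y) \<partial>lborel)) (at z)" by simp
  next
    fix x
    have "(\<lambda>n. 2 * \<alpha> * Re (csqrt (Complex x (1 / real (Suc n))))) \<longlonglongrightarrow> 2 * \<alpha> * Re (if x \<ge> 0 then of_real (sqrt x) else \<i> * of_real (sqrt \<bar>x\<bar>))"
      by (intro tendsto_intros tendsto_Re csqrt_tendsto_real)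
    moreover have "Re (if x \<ge> 0 then of_real (sqrt x) else \<i> * of_real (sqrt \<bar>x\<bar>)) = sqrt (max 0 x)" by auto
    ultimately have "(\<lambda>n. Re (PP (br 1 (Complex x (1 / real (Suc n))))) + 2 * \<alpha> * Re (csqrt (Complex x (1 / real (Suc n)))))
       \<longlonglongrightarrow> PR (br 1 (of_real x)) + 2 * \<alpha> * sqrt (max 0 x)"
      using PR_br_lim[of 1 x] by (intro tendsto_add) auto
    moreover have "Re (PP (br 1 w) + 2 * of_real \<alpha> * csqrt w) = Re (PP (br 1 w)) + 2 * \<alpha> * Re (csqrt w)" for w
      by (simp del: csqrt.sel)
    ultimately show "(\<lambda>n. Re (PP (br 1 (Complex x (1 / real (Suc n)))) + 2 * of_real \<alpha> * csqrt (Complex x (1 / real (Suc n)))))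
       \<longlonglongrightarrow> PR (br 1 (of_real x)) + 2 * \<alpha> * sqrt (max 0 x)" by presburger
  qed
qed

lemma h2_potential: "\<exists>c. \<forall>x. (\<integral>y. ln \<bar>x - y\<bar> * h2 y \<partial>lborel) = PR (br 1 (of_real x)) + PR (br 2 (of_real x)) + c"
proof -
  obtain K where K: "\<And>x. h2 x \<le> K * wt x" using h2_wt by blast
  show ?thesis
  proof (rule log_potential_line[OF dens_meas(3) h2_nonneg K])
    fix z assume z: "Im z > 0"
    have "((\<lambda>z. PP (br 1 z) + PP (br 2 z)) has_field_derivative xi 1 z + xi 2 z) (at z)"
      by (intro DERIV_add potential_deriv) (use z in auto)
    then show "((\<lambda>z. PP (br 1 z) + PP (br 2 z)) has_field_derivative (\<integral>y. of_real (h2 y) / (z - of_real y) \<partial>lborel)) (at z)"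
      unfolding F2_repr[OF z, symmetric] F2_def .
  next
    fix x
    show "(\<lambda>n. Re (PP (br 1 (Complex x (1 / real (Suc n)))) + PP (br 2 (Complex x (1 / real (Suc n))))))
       \<longlonglongrightarrow> PR (br 1 (of_real x)) + PR (br 2 (of_real x))"
      unfolding plus_complex.sel by (intro tendsto_add PR_br_lim) auto
  qed
qed

lemma br_real_cont: "j \<in> {1,2,3,4} \<Longrightarrow> continuous_on UNIV (\<lambda>x::real. br j (of_real x))"
  by (rule continuous_on_compose2[OF br_continuous]) (auto intro!: continuous_intros)

lemma PR_br_cont: "j \<in> {1,2,3,4} \<Longrightarrow> continuous_on UNIV (\<lambda>x::real. PR (br j (of_real x)))"
proof -
  assume j: "j \<in> {1,2,3,4}"
  have "continuous_on (-{0}) PR" using PR_continuous by (simp add: continuous_on_eq_continuous_at open_Compl)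
  then show ?thesis
    by (rule continuous_on_compose2[OF _ br_real_cont[OF j]]) (use br(2) in auto)
qed

text \<open>Along a real branch the chain rule cancels \<open>fr'\<close> against the derivative of
  the inverse function and leaves the value of \<open>s\<close>.\<close>

lemma PR_branch_deriv:
  assumes j: "j \<in> {1,2,3,4}" and x: "a < x" "x < b"
    and r: "\<And>x. a < x \<Longrightarrow> x < b \<Longrightarrow> Im (br j (of_real x)) = 0 \<and> fr' (Re (br j (of_real x))) \<noteq> 0"
  shows "((\<lambda>x. PR (br j (of_real x))) has_field_derivative sr (Re (br j (of_real x)))) (at x)"
proof -
  let ?g = "\<lambda>x. Re (br j (of_real x))"
  have e: "br j (of_real y) = of_real (?g y)" if "a < y" "y < b" for y using r[OF that] by (simp add: complex_eq_iff)
  have nz: "?g y \<noteq> 0" if "a < y" "y < b" for y using br(2)[of "of_real y" j] e[OF that] by force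
  have fg: "fr (?g y) = y" if "a < y" "y < b" for y
  proof -
    have "of_real (fr (?g y)) = f (br j (of_real y))" using f_real[of "?g y"] e[OF that] by metis
    then show ?thesis using br(3)[of "of_real y" j] by simp
  qed
  have gd: "(?g has_field_derivative inverse (fr' (?g x))) (at x)"
  proof (rule DERIV_inverse_function[where f = fr and a = a and b = b])
    show "(fr has_field_derivative fr' (?g x)) (at (?g x))" by (rule fr_deriv[OF nz[OF x]])
    show "fr' (?g x) \<noteq> 0" using r[OF x] by simp
    show "isCont ?g x" using br_real_cont[OF j] by (simp add: continuous_on_eq_continuous_at)
  qed (use x fg in auto)
  have "?g x \<noteq> c1" "?g x \<noteq> c2" "?g x \<noteq> c3" using r[OF x] fr'_crit by auto
  then have "(PRr has_field_derivative sr (?g x) * fr' (?g x)) (at (?g x))" using PRr_deriv nz[OF x] by blast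
  from DERIV_chain2[OF this gd] have "((\<lambda>x. PRr (?g x)) has_field_derivative sr (?g x)) (at x)" using r[OF x] by (simp add: mult.assoc)
  then show ?thesis
  proof (rule has_field_derivative_transform_within_open[where S = "{a<..<b}"])
    show "PRr (?g y) = PR (br j (of_real y))" if "y \<in> {a<..<b}" for y
      using that e[of y] PR_real[of "?g y"] by auto
  qed (use x in auto)
qed

section \<open>The Euler--Lagrange relations along the real branches\<close>

lemma PR_gap_mono:
  assumes j: "i \<in> {1,2,3,4}" "j \<in> {1,2,3,4}" and ab: "a \<le> b"
    and r: "\<And>x. a < x \<Longrightarrow> x < b \<Longrightarrow> Im (br i (of_real x)) = 0 \<and> fr' (Re (br i (of_real x))) \<noteq> 0"
      "\<And>x. a < x \<Longrightarrow> x < b \<Longrightarrow> Im (br j (of_real x)) = 0 \<and> fr' (Re (br j (of_real x))) \<noteq> 0"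
    and le: "\<And>x. a < x \<Longrightarrow> x < b \<Longrightarrow> sr (Re (br j (of_real x))) \<le> sr (Re (br i (of_real x)))"
  shows "PR (br i (of_real a)) - PR (br j (of_real a)) \<le> PR (br i (of_real b)) - PR (br j (of_real b))"
proof (rule DERIV_nonneg_imp_increasing_open[OF ab])
  fix x assume x: "a < x" "x < b"
  have "((\<lambda>x. PR (br i (of_real x)) - PR (br j (of_real x))) has_field_derivative sr (Re (br i (of_real x))) - sr (Re (br j (of_real x)))) (at x)"
    using PR_branch_deriv[OF j(1) x r(1)] PR_branch_deriv[OF j(2) x r(2)] by (rule DERIV_diff)
  then show "\<exists>y. ((\<lambda>x. PR (br i (of_real x)) - PR (br j (of_real x))) has_field_derivative y) (at x) \<and> 0 \<le> y"
    using le[OF x] by force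
next
  show "continuous_on {a..b} (\<lambda>x. PR (br i (of_real x)) - PR (br j (of_real x)))"
    using PR_br_cont[OF j(1)] PR_br_cont[OF j(2)] by (intro continuous_on_diff) (auto intro: continuous_on_subset)
qed

lemma PR_eq_closure:
  assumes j: "i \<in> {1,2,3,4}" "j \<in> {1,2,3,4}" and S: "\<And>x. x \<in> S \<Longrightarrow> PR (br i (of_real x)) = PR (br j (of_real x))" and x: "x \<in> closure S"
  shows "PR (br i (of_real x)) = PR (br j (of_real x))"
proof -
  have "closed {x. PR (br i (of_real x)) = PR (br j (of_real x))}"
    by (rule closed_Collect_eq[OF PR_br_cont[OF j(1)] PR_br_cont[OF j(2)]])
  then have "closure S \<subseteq> {x. PR (br i (of_real x)) = PR (br j (of_real x))}" using S by (intro closure_minimal) auto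
  then show ?thesis using x by auto
qed

text \<open>Left of \<open>fr c1\<close> the two roots are conjugate and the real parts agree.
  Across the gap the difference starts from 0 and does not decrease, since by
  \<open>xi12_gap\<close> the value of \<open>s\<close> on sheet 1 is at least that on sheet
  2.\<close>

lemma EL1:
  shows "x \<le> fr c1 \<Longrightarrow> PR (br 1 (of_real x)) = PR (br 2 (of_real x))"
    and "x \<le> 0 \<Longrightarrow> PR (br 2 (of_real x)) \<le> PR (br 1 (of_real x))"
proof -
  show eq: "PR (br 1 (of_real x)) = PR (br 2 (of_real x))" if "x \<le> fr c1" for x
  proof (rule PR_eq_closure[where S = "{..<fr c1}"])
    show "PR (br 1 (of_real x)) = PR (br 2 (of_real x))" if "x \<in> {..<fr c1}" for x
      using br12_conj[of x] that PR_cnj by simp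
  qed (use that in auto)
  show "PR (br 2 (of_real x)) \<le> PR (br 1 (of_real x))" if "x \<le> 0"
  proof (cases "x \<le> fr c1")
    case False
    have "PR (br 1 (of_real (fr c1))) - PR (br 2 (of_real (fr c1))) \<le> PR (br 1 (of_real x)) - PR (br 2 (of_real x))"
    proof (rule PR_gap_mono)
      fix y assume y: "fr c1 < y" "y < x"
      have y0: "y < 0" using y that by simp
      obtain t t' where t: "c1 \<le> t" "c2 \<le> t'" "t' \<le> c1" "br 1 (of_real y) = of_real t" "br 2 (of_real y) = of_real t'"
        "fr t = y" "fr t' = y" "sr t' \<le> sr t" using xi12_gap[of y] y y0 by auto
      have "t > c1" "t' < c1" "t' > c2" using t y vals y0 by (auto simp: order_less_le)
      then have f: "fr' t > 0" "fr' t' < 0" using fr'_pos_outer fr'_neg_mid by auto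
      show "Im (br 1 (of_real y)) = 0 \<and> fr' (Re (br 1 (of_real y))) \<noteq> 0" using t f by simp
      show "Im (br 2 (of_real y)) = 0 \<and> fr' (Re (br 2 (of_real y))) \<noteq> 0" using t f by simp
      show "sr (Re (br 2 (of_real y))) \<le> sr (Re (br 1 (of_real y)))" using t by simp
    qed (use False in auto)
    then show ?thesis using eq[of "fr c1"] by simp
  qed (use eq in auto)
qed

text \<open>On [p, q] the roots on sheets 2 and 3 are conjugate. On [0, p) they are real on either
  side of \<open>c2\<close>, where p > 0 rules out a pole. Right of \<open>q\<close> they are
  negative, on either side of \<open>-c0\<close>, where \<open>s\<close> has no poles. In both outer
  regions monotonicity of \<open>s\<close> gives the inequality.\<close>

lemma EL2:
  shows "p \<le> x \<Longrightarrow> x \<le> q \<Longrightarrow> PR (br 3 (of_real x)) = PR (br 2 (of_real x))"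
    and "x \<ge> 0 \<Longrightarrow> PR (br 2 (of_real x)) \<le> PR (br 3 (of_real x))"
proof -
  show eq: "PR (br 3 (of_real x)) = PR (br 2 (of_real x))" if "p \<le> x" "x \<le> q" for x
  proof (rule PR_eq_closure[where S = "{p<..<q}"])
    show "PR (br 3 (of_real x)) = PR (br 2 (of_real x))" if "x \<in> {p<..<q}" for x
      using br23_conj[of x] that PR_cnj by simp
  qed (use that p_less_q in auto)
  show "PR (br 2 (of_real x)) \<le> PR (br 3 (of_real x))" if x0: "x \<ge> 0"
  proof -
    consider "x < p" | "p \<le> x" "x \<le> q" | "q < x" by linarith
    then show ?thesis
    proof cases
      case 1
      then have cc: "c3 < c2" "c2 < c1" using p_pos_strict x0 by auto
      have "PR (br 2 (of_real x)) - PR (br 3 (of_real x)) \<le> PR (br 2 (of_real p)) - PR (br 3 (of_real p))"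
      proof (rule PR_gap_mono)
        fix y assume y: "x < y" "y < p"
        have y0: "y > 0" "y < fr c2" using y x0 by (auto simp: p_def)
        obtain t where t: "c2 \<le> t" "t \<le> c1" "br 2 (of_real y) = of_real t" "fr t = y" using br2_real_mid[OF cc(2), of y] y0 vals by auto
        obtain t' where t': "c3 \<le> t'" "t' \<le> c2" "br 3 (of_real y) = of_real t'" "fr t' = y" using br3_real_mid[OF cc(1), of y] y0 vals by auto
        have tt: "c2 < t" "t < c1" "c3 < t'" "t' < c2" using t t' y0 vals by (auto simp: order_less_le)
        have f: "fr' t < 0" "fr' t' > 0" using tt fr'_neg_mid fr'_pos_mid by auto
        show "Im (br 2 (of_real y)) = 0 \<and> fr' (Re (br 2 (of_real y))) \<noteq> 0" using t f by simp
        show "Im (br 3 (of_real y)) = 0 \<and> fr' (Re (br 3 (of_real y))) \<noteq> 0" using t' f by simp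
        have "a2 = 0" using pole(2) y0 a_nonneg by (metis less_asym order_less_le)
        moreover have "(c3 - t) * (c3 - t') > 0" using tt cc by (intro mult_neg_neg) auto
        moreover have "(c1 - t) * (c1 - t') > 0" using tt cc by (intro mult_pos_pos) auto
        ultimately have "sr t' \<le> sr t" using tt by (intro sr_mono) auto
        then show "sr (Re (br 3 (of_real y))) \<le> sr (Re (br 2 (of_real y)))" using t t' by simp
      qed (use 1 in auto)
      then show ?thesis using eq[of p] p_less_q by simp
    next
      case 3
      have "PR (br 3 (of_real q)) - PR (br 2 (of_real q)) \<le> PR (br 3 (of_real x)) - PR (br 2 (of_real x))"
      proof (rule PR_gap_mono)
        fix y assume y: "q < y" "y < x"
        have y0: "fr (-c0) < y" using y by (simp add: q_def)
        obtain t where t: "t \<le> -c0" "br 2 (of_real y) = of_real t" "fr t = y" using br2_real_far[of y] y0 by auto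
        obtain t' where t': "t' \<ge> -c0" "t' < 0" "br 3 (of_real y) = of_real t'" "fr t' = y" using br3_real_near[of y] y0 by auto
        have tt: "t < -c0" "-c0 < t'" using t t' y0 by (auto simp: order_less_le)
        have f: "fr' t < 0" "fr' t' > 0" using tt t' fr'_neg_far fr'_pos_near by auto
        show "Im (br 2 (of_real y)) = 0 \<and> fr' (Re (br 2 (of_real y))) \<noteq> 0" using t f by simp
        show "Im (br 3 (of_real y)) = 0 \<and> fr' (Re (br 3 (of_real y))) \<noteq> 0" using t' f by simp
        have g: "(c - t') * (c - t) > 0" if "c > 0" for c using that tt t' pos by (intro mult_pos_pos) auto
        have "sr t \<le> sr t'" by (rule sr_mono) (use tt g pos(7) cpos in \<open>simp_all\<close>)
        then show "sr (Re (br 2 (of_real y))) \<le> sr (Re (br 3 (of_real y)))" using t t' by simp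
      qed (use 3 in auto)
      then show ?thesis using eq[of q] p_less_q by simp
    qed (use eq in auto)
  qed
qed

end

section \<open>Square root edges and analyticity\<close>

text \<open>The coefficient of x - t is the one that makes the derivative vanish at t, so a square
  splits off. Naming the inverses turns the claim into polynomial identities modulo x i = 1 and t j
  = 1.\<close>

lemma double_zero:
  fixes x t U V E :: "'a::field"
  assumes "x \<noteq> 0" "t \<noteq> 0"
  shows "U * (x\<^sup>2 - t\<^sup>2) + (- 2 * U * t + E / t\<^sup>2 + 2 * V / t^3) * (x - t) + (E / x - E / t) + (V / x\<^sup>2 - V / t\<^sup>2)
    = (x - t)\<^sup>2 * (U + E / (x * t\<^sup>2) + V * (2 * x + t) / (x\<^sup>2 * t^3))"
proof -
  define i j where "i = inverse x" and "j = inverse t"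
  have ij: "x * i = 1" "t * j = 1" using assms by (simp_all add: i_def j_def)
  have e: "j\<^sup>2 * (x - t) + i - j = (x - t)\<^sup>2 * (i * j\<^sup>2)" using ij by algebra
  have v: "2 * j^3 * (x - t) + i\<^sup>2 - j\<^sup>2 = (x - t)\<^sup>2 * ((2 * x + t) * (i\<^sup>2 * j^3))" using ij by algebra
  have "U * (x\<^sup>2 - t\<^sup>2) + (- 2 * U * t + E / t\<^sup>2 + 2 * V / t^3) * (x - t) + (E / x - E / t) + (V / x\<^sup>2 - V / t\<^sup>2)
    = U * (x\<^sup>2 - t\<^sup>2) + (- 2 * U * t + E * j\<^sup>2 + 2 * V * j^3) * (x - t) + (E * i - E * j) + (V * i\<^sup>2 - V * j\<^sup>2)"
    by (simp add: i_def j_def divide_inverse power_inverse)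
  also have "\<dots> = U * (x - t)\<^sup>2 + E * (j\<^sup>2 * (x - t) + i - j) + V * (2 * j^3 * (x - t) + i\<^sup>2 - j\<^sup>2)"
    by (simp add: algebra_simps power2_eq_square)
  also have "\<dots> = (x - t)\<^sup>2 * (U + E * (i * j\<^sup>2) + V * ((2 * x + t) * (i\<^sup>2 * j^3)))"
    unfolding e v by (simp add: distrib_left mult_ac)
  also have "\<dots> = (x - t)\<^sup>2 * (U + E / (x * t\<^sup>2) + V * (2 * x + t) / (x\<^sup>2 * t^3))"
    by (simp add: i_def j_def divide_inverse power_inverse mult.assoc)
  finally show ?thesis .
qed

context spectral_curve
begin

text \<open>Half the second derivative of \<open>fr\<close>. At a critical point its sign tells on
  which side of the critical value the two merging roots are nonreal.\<close>

definition kap :: "real \<Rightarrow> real" where "kap t = u\<^sup>2 + D / t^3 + 3 * v\<^sup>2 / t^4"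
definition sd :: "real \<Rightarrow> real" where "sd t = a1 / (c1 - t)\<^sup>2 + a2 / (c2 - t)\<^sup>2 + a3 / (c3 - t)\<^sup>2"

lemma kap_critical:
  "kap c1 = u\<^sup>2 * ((c1 - c2) * (c1 - c3) * (c1 + c0)) / c1^3"
  "kap c2 = - u\<^sup>2 * ((c1 - c2) * (c2 - c3) * (c2 + c0)) / c2^3"
  "kap (-c0) = u\<^sup>2 * ((c0 + c1) * (c0 + c2) * (c0 + c3)) / c0^3"
proof -
  have e: "c0 * (c1 + c2 + c3) = c1*c2 + c1*c3 + c2*c3" using e2 by simp
  have K: "kap t * t^4 = u\<^sup>2 * (t^4 + 2 * (c1*c2*c3 - c0 * (c1*c2 + c1*c3 + c2*c3)) * t + 3 * (c0 * c1 * c2 * c3))" if "t \<noteq> 0" for t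
    using that unfolding kap_def unfolding cD cv by (simp add: field_simps power3_eq_cube power4_eq_xxxx)
  have fin: "y = U * X / t^3" if "y * t^4 = U * (t * X)" "t \<noteq> 0" for y U X t :: real
  proof -
    have "(y * t^3) * t = (U * X) * t" using that(1) by (simp add: power3_eq_cube power4_eq_xxxx mult_ac)
    then show ?thesis using that(2) by (simp add: eq_divide_eq)
  qed
  have "kap c1 * c1^4 = u\<^sup>2 * (c1 * ((c1 - c2) * (c1 - c3) * (c1 + c0)))"
    unfolding K[OF cpos(1)[THEN less_imp_neq, symmetric]] using e by (intro arg_cong2[where f = "(*)"] refl) algebra
  then show "kap c1 = u\<^sup>2 * ((c1 - c2) * (c1 - c3) * (c1 + c0)) / c1^3"
    by (rule fin) (use cpos in simp)
  have "kap c2 * c2^4 = u\<^sup>2 * (c2 * (- ((c1 - c2) * (c2 - c3) * (c2 + c0))))"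
    unfolding K[OF cpos(2)[THEN less_imp_neq, symmetric]] using e by (intro arg_cong2[where f = "(*)"] refl) algebra
  then show "kap c2 = - u\<^sup>2 * ((c1 - c2) * (c2 - c3) * (c2 + c0)) / c2^3"
    using fin[of "kap c2" c2 "u\<^sup>2"] cpos by fastforce
  have "-c0 \<noteq> 0" using pos by simp
  from K[OF this] have "kap (-c0) * c0^4 = u\<^sup>2 * (c0 * ((c0 + c1) * (c0 + c2) * (c0 + c3)))"
    using e by simp algebra
  then show "kap (-c0) = u\<^sup>2 * ((c0 + c1) * (c0 + c2) * (c0 + c3)) / c0^3"
    by (rule fin) (use pos in simp)
qed

lemma s_deriv_real:
  assumes "a1 > 0 \<Longrightarrow> c1 \<noteq> t" "a2 > 0 \<Longrightarrow> c2 \<noteq> t" "a3 > 0 \<Longrightarrow> c3 \<noteq> t"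
  shows "(s has_field_derivative of_real (sd t)) (at (of_real t))" "sd t > 0"
proof -
  have one: "((\<lambda>\<tau>. of_real a / (of_real c - \<tau>)) has_field_derivative of_real (a / (c - t)\<^sup>2)) (at (complex_of_real t))"
    if "a \<ge> 0" "a > 0 \<Longrightarrow> c \<noteq> t" for a c
  proof (cases "a = 0")
    case False
    then have "complex_of_real c - of_real t \<noteq> 0" using that by simp
    then show ?thesis by (auto intro!: derivative_eq_intros simp: power2_eq_square)
  qed simp
  show "(s has_field_derivative of_real (sd t)) (at (of_real t))"
    unfolding s_def'[abs_def] sd_def of_real_add by (intro DERIV_add one a_nonneg assms)
  have nn: "a1 / (c1 - t)\<^sup>2 \<ge> 0" "a2 / (c2 - t)\<^sup>2 \<ge> 0" "a3 / (c3 - t)\<^sup>2 \<ge> 0" using a_nonneg by auto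
  have "\<alpha> / u > 0" using pos by simp
  then have "a1 > 0 \<or> a2 > 0 \<or> a3 > 0" using a_sum(1) by linarith
  then have "a1 / (c1 - t)\<^sup>2 > 0 \<or> a2 / (c2 - t)\<^sup>2 > 0 \<or> a3 / (c3 - t)\<^sup>2 > 0" using assms by auto
  then show "sd t > 0" unfolding sd_def using nn by linarith
qed

text \<open>To leading order x - fr t0 = kap(t0) (\<tau> - t0)^2 with a negative quotient, so \<tau>
  - t0 is i sqrt(|x - fr t0| / |kap t0|), the sign being fixed by Im \<tau> > 0. Since s has real
  positive derivative at t0, the normalised imaginary part of s tends to \<open>sd t0\<close> /
  sqrt|kap t0|.\<close>

lemma sqrt_vanishing:
  assumes t0: "t0 \<noteq> 0" "fr' t0 = 0" and k0: "kap t0 \<noteq> 0"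
    and reg: "a1 > 0 \<Longrightarrow> c1 \<noteq> t0" "a2 > 0 \<Longrightarrow> c2 \<noteq> t0" "a3 > 0 \<Longrightarrow> c3 \<noteq> t0"
    and lim: "(\<tau> \<longlongrightarrow> of_real t0) F"
    and ev: "eventually (\<lambda>x. Im (\<tau> x) > 0 \<and> f (\<tau> x) = of_real x \<and> (x - fr t0) / kap t0 < 0) F"
  shows "\<exists>c>0. ((\<lambda>x. Im (s (\<tau> x)) / sqrt \<bar>x - fr t0\<bar>) \<longlongrightarrow> c) F"
proof -
  let ?k = "\<bar>kap t0\<bar>" and ?T = "complex_of_real t0"
  define g where "g \<tau> = of_real (u\<^sup>2) + of_real D / (\<tau> * of_real (t0\<^sup>2)) + of_real (v\<^sup>2) * (2 * \<tau> + ?T) / (\<tau>\<^sup>2 * of_real (t0^3))" for \<tau>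
  have fac: "f \<tau> - of_real (fr t0) = (\<tau> - ?T)\<^sup>2 * g \<tau>" if "\<tau> \<noteq> 0" for \<tau>
  proof -
    have "B = - 2 * u\<^sup>2 * t0 + D / t0\<^sup>2 + 2 * v\<^sup>2 / t0^3" using t0(2) by (simp add: fr'_def)
    then have B: "complex_of_real B = - 2 * of_real (u\<^sup>2) * ?T + of_real D / ?T\<^sup>2 + 2 * of_real (v\<^sup>2) / ?T^3" by simp
    have T: "?T \<noteq> 0" using t0 by simp
    define U V E where "U = complex_of_real (u\<^sup>2)" and "V = complex_of_real (v\<^sup>2)" and "E = complex_of_real D"
    have "f \<tau> - f ?T = U * (\<tau>\<^sup>2 - ?T\<^sup>2) + of_real B * (\<tau> - ?T) + (E / \<tau> - E / ?T) + (V / \<tau>\<^sup>2 - V / ?T\<^sup>2)"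
      unfolding f_def' U_def[symmetric] V_def[symmetric] E_def[symmetric] by (simp add: algebra_simps)
    also have "\<dots> = U * (\<tau>\<^sup>2 - ?T\<^sup>2) + (- 2 * U * ?T + E / ?T\<^sup>2 + 2 * V / ?T^3) * (\<tau> - ?T) + (E / \<tau> - E / ?T) + (V / \<tau>\<^sup>2 - V / ?T\<^sup>2)"
      unfolding B[folded U_def V_def E_def] ..
    also have "\<dots> = (\<tau> - ?T)\<^sup>2 * (U + E / (\<tau> * ?T\<^sup>2) + V * (2 * \<tau> + ?T) / (\<tau>\<^sup>2 * ?T^3))"
      by (rule double_zero[OF that T])
    finally show ?thesis unfolding g_def f_real U_def V_def E_def by simp
  qed
  have "((\<lambda>x. g (\<tau> x)) \<longlongrightarrow> of_real (u\<^sup>2) + of_real D / (?T * of_real (t0\<^sup>2)) + of_real (v\<^sup>2) * (2 * ?T + ?T) / (?T\<^sup>2 * of_real (t0^3))) F"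
    unfolding g_def by (intro tendsto_intros lim) (use t0 in auto)
  also have "of_real (u\<^sup>2) + of_real D / (?T * of_real (t0\<^sup>2)) + of_real (v\<^sup>2) * (2 * ?T + ?T) / (?T\<^sup>2 * of_real (t0^3)) = of_real (kap t0)"
    using t0 by (simp add: kap_def power2_eq_square power3_eq_cube power4_eq_xxxx mult_ac)
  finally have gl: "((\<lambda>x. g (\<tau> x)) \<longlongrightarrow> of_real (kap t0)) F" .
  define W where "W x = (\<tau> x - ?T) / of_real (sqrt \<bar>x - fr t0\<bar>)" for x
  have W2: "eventually (\<lambda>x. of_real (sgn (kap t0)) / g (\<tau> x) = (- \<i> * W x)\<^sup>2 \<and> Re (- \<i> * W x) > 0) F"
    using ev
  proof eventually_elim
    case (elim x)
    define \<sigma> where "\<sigma> = x - fr t0"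
    have neg: "\<sigma> / kap t0 < 0" using elim by (simp add: \<sigma>_def)
    then have s0: "\<sigma> \<noteq> 0" by auto
    have sg: "sgn (kap t0) * \<bar>\<sigma>\<bar> = - \<sigma>" using neg by (cases "kap t0 > 0") (simp_all add: divide_less_0_iff)
    have tn: "\<tau> x \<noteq> 0" using elim by auto
    have "(\<tau> x - ?T)\<^sup>2 * g (\<tau> x) = of_real \<sigma>" using fac[OF tn] elim by (simp add: \<sigma>_def)
    moreover have gn: "g (\<tau> x) \<noteq> 0" using calculation s0 by auto
    ultimately have w: "(\<tau> x - ?T)\<^sup>2 = of_real \<sigma> / g (\<tau> x)" by (simp add: eq_divide_eq)
    have "(W x)\<^sup>2 = (of_real \<sigma> / g (\<tau> x)) / of_real \<bar>\<sigma>\<bar>"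
      unfolding W_def power_divide w \<sigma>_def[symmetric] by (simp flip: of_real_power)
    then have "(- \<i> * W x)\<^sup>2 * (of_real \<bar>\<sigma>\<bar> * g (\<tau> x)) = of_real (- \<sigma>)" using s0 gn by (simp add: power_mult_distrib)
    also have "- \<sigma> = sgn (kap t0) * \<bar>\<sigma>\<bar>" using sg by simp
    finally have "(- \<i> * W x)\<^sup>2 * g (\<tau> x) * of_real \<bar>\<sigma>\<bar> = of_real (sgn (kap t0)) * of_real \<bar>\<sigma>\<bar>" by (simp add: mult_ac)
    then have "(- \<i> * W x)\<^sup>2 * g (\<tau> x) = of_real (sgn (kap t0))" using s0 by (metis abs_eq_0 mult_right_cancel of_real_eq_0_iff)
    moreover have "Re (- \<i> * W x) > 0" using elim s0 by (simp add: W_def Im_divide_of_real \<sigma>_def)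
    ultimately show ?case using gn by (simp add: divide_eq_eq)
  qed
  have "((\<lambda>x. csqrt (of_real (sgn (kap t0)) / g (\<tau> x))) \<longlongrightarrow> csqrt (of_real (sgn (kap t0)) / of_real (kap t0))) F"
  proof (rule isCont_tendsto_compose[OF _ tendsto_divide[OF tendsto_const gl]])
    have "complex_of_real (sgn (kap t0)) / of_real (kap t0) = of_real (1 / ?k)" using k0 by (simp add: sgn_if)
    then show "isCont csqrt (of_real (sgn (kap t0)) / of_real (kap t0))"
      using k0 by (intro continuous_at_csqrt) (auto simp: complex_nonpos_Reals_iff)
  qed (use k0 in auto)
  moreover have "csqrt (of_real (sgn (kap t0)) / of_real (kap t0)) = of_real (1 / sqrt ?k)"
  proof -
    have "complex_of_real (sgn (kap t0)) / of_real (kap t0) = of_real (1 / ?k)" using k0 by (simp add: sgn_if)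
    then show ?thesis by (simp only:) (simp add: of_real_sqrt[symmetric] real_sqrt_divide del: of_real_divide)
  qed
  ultimately have "((\<lambda>x. csqrt (of_real (sgn (kap t0)) / g (\<tau> x))) \<longlongrightarrow> of_real (1 / sqrt ?k)) F" by simp
  moreover have "eventually (\<lambda>x. csqrt (of_real (sgn (kap t0)) / g (\<tau> x)) = - \<i> * W x) F"
    using W2
  proof eventually_elim
    case (elim x)
    then show ?case using csqrt_square[of "- \<i> * W x"] by argo
  qed
  ultimately have "((\<lambda>x. - \<i> * W x) \<longlongrightarrow> of_real (1 / sqrt ?k)) F" by (rule Lim_transform_eventually)
  then have "((\<lambda>x. \<i> * (- \<i> * W x)) \<longlongrightarrow> \<i> * of_real (1 / sqrt ?k)) F" by (intro tendsto_mult tendsto_const)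
  then have Wl: "(W \<longlongrightarrow> \<i> * of_real (1 / sqrt ?k)) F" by simp
  have at: "filterlim \<tau> (at ?T) F"
    unfolding filterlim_at using lim ev by (auto elim!: eventually_mono)
  have "((\<lambda>y. (s y - s ?T) / (y - ?T)) \<longlongrightarrow> of_real (sd t0)) (at ?T)"
    using s_deriv_real(1)[OF reg] by (simp add: has_field_derivative_iff)
  from filterlim_compose[OF this at] have "((\<lambda>x. (s (\<tau> x) - s ?T) / (\<tau> x - ?T) * W x) \<longlongrightarrow> of_real (sd t0) * (\<i> * of_real (1 / sqrt ?k))) F"
    by (intro tendsto_mult Wl)
  then have "((\<lambda>x. Im ((s (\<tau> x) - s ?T) / (\<tau> x - ?T) * W x)) \<longlongrightarrow> Im (of_real (sd t0) * (\<i> * of_real (1 / sqrt ?k)))) F"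
    by (rule tendsto_Im)
  moreover have "Im (of_real (sd t0) * (\<i> * of_real (1 / sqrt ?k))) = sd t0 / sqrt ?k" by (simp add: Im_divide_of_real)
  ultimately have "((\<lambda>x. Im ((s (\<tau> x) - s ?T) / (\<tau> x - ?T) * W x)) \<longlongrightarrow> sd t0 / sqrt ?k) F" by metis
  moreover have "eventually (\<lambda>x. Im ((s (\<tau> x) - s ?T) / (\<tau> x - ?T) * W x) = Im (s (\<tau> x)) / sqrt \<bar>x - fr t0\<bar>) F"
    using ev
  proof eventually_elim
    case (elim x)
    then have "\<tau> x - ?T \<noteq> 0" by (auto simp: complex_eq_iff)
    then have "(s (\<tau> x) - s ?T) / (\<tau> x - ?T) * W x = (s (\<tau> x) - s ?T) / of_real (sqrt \<bar>x - fr t0\<bar>)" by (simp add: W_def)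
    then show ?case by (simp add: s_real Im_divide_of_real)
  qed
  ultimately have "((\<lambda>x. Im (s (\<tau> x)) / sqrt \<bar>x - fr t0\<bar>) \<longlongrightarrow> sd t0 / sqrt ?k) F"
    by (rule Lim_transform_eventually)
  moreover have "sd t0 / sqrt ?k > 0" using s_deriv_real(2)[OF reg] k0 by simp
  ultimately show ?thesis by blast
qed

lemma br_real_tendsto: "j \<in> {1,2,3,4} \<Longrightarrow> ((\<lambda>x. br j (of_real x)) \<longlongrightarrow> br j (of_real y)) (at y within A)"
  using br_real_cont[of j] by (auto simp: continuous_on_eq_continuous_at isCont_def intro: tendsto_within_subset)

lemma h2_eq_br3: "p < x \<Longrightarrow> x < q \<Longrightarrow> h2 x = Im (s (br 3 (of_real x))) / pi"
  by (simp add: h2_def xi_def br23_conj s_cnj)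

lemma br3_nonreal: "p < x \<Longrightarrow> x < q \<Longrightarrow> Im (br 3 (of_real x)) > 0"
  using br2_nonreal[of x] br23_conj[of x] by simp

text \<open>Sheet 3 replaces its conjugate, sheet 2, so that the root has positive imaginary part.
  At \<open>q\<close> it reaches \<open>-c0\<close>, which is a regular point of \<open>s\<close>
  because all poles are positive.\<close>

lemma h2_upper_edge: "\<exists>c>0. ((\<lambda>x. h2 x / sqrt (q - x)) \<longlongrightarrow> c) (at_left q)"
proof -
  have k: "kap (-c0) > 0" unfolding kap_critical using pos cpos by simp
  have b: "br 3 (of_real q) = of_real (-c0)"
  proof -
    obtain t where t: "t \<ge> -c0" "t < 0" "br 3 (of_real q) = of_real t" "fr t = q" using br3_real_near[of q] by (auto simp: q_def)
    have "\<not> -c0 < t"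
    proof
      assume "-c0 < t"
      then have "fr (-c0) < fr t" by (rule fr_mono(6)[OF order_refl _ t(2)])
      then show False using t(4) by (simp add: q_def)
    qed
    then have "t = -c0" using t by simp
    then show ?thesis using t by simp
  qed
  have ev: "eventually (\<lambda>x. p < x \<and> x < q) (at_left q)"
    using eventually_at_left_real[OF p_less_q] by (auto elim: eventually_mono)
  have "\<exists>c>0. ((\<lambda>x. Im (s (br 3 (of_real x))) / sqrt \<bar>x - fr (-c0)\<bar>) \<longlongrightarrow> c) (at_left q)"
  proof (rule sqrt_vanishing)
    show "((\<lambda>x. br 3 (of_real x)) \<longlongrightarrow> of_real (-c0)) (at_left q)" using br_real_tendsto[of 3 q] b by simp
    show "eventually (\<lambda>x. Im (br 3 (of_real x)) > 0 \<and> f (br 3 (of_real x)) = of_real x \<and> (x - fr (-c0)) / kap (-c0) < 0) (at_left q)"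
    proof (rule eventually_mono[OF ev])
      fix x assume "p < x \<and> x < q"
      then show "Im (br 3 (of_real x)) > 0 \<and> f (br 3 (of_real x)) = of_real x \<and> (x - fr (-c0)) / kap (-c0) < 0"
        using br3_nonreal[of x] br(3)[of "of_real x" 3] k by (simp add: q_def[symmetric] divide_neg_pos)
    qed
  qed (use pos(6,7) cpos k fr'_crit(4) in \<open>simp_all\<close>)
  then obtain c where c: "c > 0" "((\<lambda>x. Im (s (br 3 (of_real x))) / sqrt \<bar>x - fr (-c0)\<bar>) \<longlongrightarrow> c) (at_left q)" by blast
  have "((\<lambda>x. h2 x / sqrt (q - x)) \<longlongrightarrow> c / pi) (at_left q)"
  proof (rule Lim_transform_eventually[OF tendsto_divide[OF c(2) tendsto_const[of pi]]])
    show "eventually (\<lambda>x. Im (s (br 3 (of_real x))) / sqrt \<bar>x - fr (-c0)\<bar> / pi = h2 x / sqrt (q - x)) (at_left q)"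
      by (rule eventually_mono[OF ev]) (simp add: h2_eq_br3 q_def[symmetric])
  qed simp
  then show ?thesis using c(1) by (intro exI[of _ "c / pi"]) simp
qed

text \<open>p > 0 excludes a pole at \<open>c2\<close> and separates \<open>c2\<close> from its
  neighbours, so \<open>kap c2\<close> is strictly negative and the roots turn nonreal to the right
  of \<open>p\<close>.\<close>

lemma h2_lower_edge: "p > 0 \<Longrightarrow> \<exists>c>0. ((\<lambda>x. h2 x / sqrt (x - p)) \<longlongrightarrow> c) (at_right p)"
proof -
  assume p0: "p > 0"
  then have cc: "c3 < c2" "c2 < c1" using p_pos_strict by auto
  have "u\<^sup>2 * ((c1 - c2) * (c2 - c3) * (c2 + c0)) / c2^3 > 0" using cc pos cpos by (intro divide_pos_pos mult_pos_pos) auto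
  then have k: "kap c2 < 0" unfolding kap_critical by simp
  have a2: "\<not> a2 > 0" using pole(2) p0 by (auto simp: p_def)
  have b: "br 3 (of_real p) = of_real c2"
  proof -
    obtain t where t: "t \<ge> c3" "t \<le> c2" "br 3 (of_real p) = of_real t" "fr t = p"
      using br3_real_mid[OF cc(1), of p] vals by (auto simp: p_def)
    have "\<not> t < c2"
    proof
      assume "t < c2"
      then have "fr t < fr c2" by (rule fr_mono(4)[OF t(1) _ order_refl])
      then show False using t(4) by (simp add: p_def)
    qed
    then have "t = c2" using t by simp
    then show ?thesis using t by simp
  qed
  have ev: "eventually (\<lambda>x. p < x \<and> x < q) (at_right p)"
    using eventually_at_right_real[OF p_less_q] by (auto elim: eventually_mono)
  have "\<exists>c>0. ((\<lambda>x. Im (s (br 3 (of_real x))) / sqrt \<bar>x - fr c2\<bar>) \<longlongrightarrow> c) (at_right p)"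
  proof (rule sqrt_vanishing)
    show "((\<lambda>x. br 3 (of_real x)) \<longlongrightarrow> of_real c2) (at_right p)" using br_real_tendsto[of 3 p] b by simp
    show "eventually (\<lambda>x. Im (br 3 (of_real x)) > 0 \<and> f (br 3 (of_real x)) = of_real x \<and> (x - fr c2) / kap c2 < 0) (at_right p)"
    proof (rule eventually_mono[OF ev])
      fix x assume "p < x \<and> x < q"
      then show "Im (br 3 (of_real x)) > 0 \<and> f (br 3 (of_real x)) = of_real x \<and> (x - fr c2) / kap c2 < 0"
        using br3_nonreal[of x] br(3)[of "of_real x" 3] k by (simp add: p_def[symmetric] divide_pos_neg)
    qed
  qed (use cpos k fr'_crit(2) a2 cc in \<open>simp_all\<close>)
  then obtain c where c: "c > 0" "((\<lambda>x. Im (s (br 3 (of_real x))) / sqrt \<bar>x - fr c2\<bar>) \<longlongrightarrow> c) (at_right p)" by blast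
  have "((\<lambda>x. h2 x / sqrt (x - p)) \<longlongrightarrow> c / pi) (at_right p)"
  proof (rule Lim_transform_eventually[OF tendsto_divide[OF c(2) tendsto_const[of pi]]])
    show "eventually (\<lambda>x. Im (s (br 3 (of_real x))) / sqrt \<bar>x - fr c2\<bar> / pi = h2 x / sqrt (x - p)) (at_right p)"
      by (rule eventually_mono[OF ev]) (simp add: h2_eq_br3 p_def[symmetric])
  qed simp
  then show ?thesis using c(1) by (intro exI[of _ "c / pi"]) simp
qed

lemma d1_edge: "fr c1 < 0 \<Longrightarrow> \<exists>c>0. ((\<lambda>x. d1 x / sqrt (fr c1 - x)) \<longlongrightarrow> c) (at_left (fr c1))"
proof -
  assume r: "fr c1 < 0"
  have cc: "c2 < c1" using r vals ord by (metis less_le_not_le nless_le order_trans)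
  then have "u\<^sup>2 * ((c1 - c2) * (c1 - c3) * (c1 + c0)) / c1^3 > 0" using ord pos cpos by (intro divide_pos_pos mult_pos_pos) auto
  then have k: "kap c1 > 0" unfolding kap_critical .
  have a1: "\<not> a1 > 0" using pole(1) r by auto
  have b: "br 1 (of_real (fr c1)) = of_real c1"
  proof -
    obtain t where t: "t \<ge> c1" "br 1 (of_real (fr c1)) = of_real t" "fr t = fr c1" using br1_real[of "fr c1"] by auto
    have "\<not> c1 < t"
    proof
      assume "c1 < t"
      then have "fr c1 < fr t" by (rule fr_mono(1)[OF order_refl])
      then show False using t(3) by simp
    qed
    then have "t = c1" using t(1) by linarith
    then show ?thesis using t(2) by (simp only:)
  qed
  have ev: "eventually (\<lambda>x. x < fr c1) (at_left (fr c1))" by (simp add: eventually_at_filter)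
  have "\<exists>c>0. ((\<lambda>x. Im (s (br 1 (of_real x))) / sqrt \<bar>x - fr c1\<bar>) \<longlongrightarrow> c) (at_left (fr c1))"
  proof (rule sqrt_vanishing)
    show "((\<lambda>x. br 1 (of_real x)) \<longlongrightarrow> of_real c1) (at_left (fr c1))" using br_real_tendsto[of 1 "fr c1"] b by simp
    show "eventually (\<lambda>x. Im (br 1 (of_real x)) > 0 \<and> f (br 1 (of_real x)) = of_real x \<and> (x - fr c1) / kap c1 < 0) (at_left (fr c1))"
    proof (rule eventually_mono[OF ev])
      fix x assume "x < fr c1"
      then show "Im (br 1 (of_real x)) > 0 \<and> f (br 1 (of_real x)) = of_real x \<and> (x - fr c1) / kap c1 < 0"
        using br1_nonreal[of x] br(3)[of "of_real x" 1] k by (simp add: divide_neg_pos)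
    qed
  qed (use cpos k fr'_crit(1) a1 cc ord in \<open>simp_all\<close>)
  then obtain c where c: "c > 0" "((\<lambda>x. Im (s (br 1 (of_real x))) / sqrt \<bar>x - fr c1\<bar>) \<longlongrightarrow> c) (at_left (fr c1))" by blast
  have "((\<lambda>x. d1 x / sqrt (fr c1 - x)) \<longlongrightarrow> c / pi) (at_left (fr c1))"
  proof (rule Lim_transform_eventually[OF tendsto_divide[OF c(2) tendsto_const[of pi]]])
    show "eventually (\<lambda>x. Im (s (br 1 (of_real x))) / sqrt \<bar>x - fr c1\<bar> / pi = d1 x / sqrt (fr c1 - x)) (at_left (fr c1))"
      by (rule eventually_mono[OF ev]) (simp add: d1_def xi_def)
  qed simp
  then show ?thesis using c(1) by (intro exI[of _ "c / pi"]) simp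
qed

text \<open>The critical points of \<open>f\<close> are real, so \<open>f\<close> is locally
  invertible at the nonreal root over \<open>x0\<close>. Composing \<open>s\<close> with the local
  inverse gives a holomorphic function near \<open>x0\<close> whose imaginary part on the real line
  is pi times \<open>h2\<close>; its Taylor coefficients supply the real series.\<close>

lemma h2_analytic: "real_analytic_on h2 {p<..<q}"
  unfolding real_analytic_on_def
proof
  fix x0 assume x0: "x0 \<in> {p<..<q}"
  let ?t = "br 3 (of_real x0)" and ?H = "{\<tau>::complex. Im \<tau> > 0}"
  have im: "Im ?t > 0" using br3_nonreal x0 by auto
  have oH: "open ?H" by (rule half_open)
  have fH: "f holomorphic_on ?H" using f_holo by (rule holomorphic_on_subset) auto
  have "deriv f ?t = f' ?t" by (rule DERIV_imp_deriv[OF f_deriv]) (use im in auto)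
  then have d: "deriv f ?t \<noteq> 0" using f'_nonzero[of ?t] im by simp
  obtain r where r: "r > 0" "ball ?t r \<subseteq> ?H" "inj_on f (ball ?t r)"
    using has_complex_derivative_locally_injective[OF fH _ oH d] im by blast
  have fb: "f holomorphic_on ball ?t r" using fH r(2) by (rule holomorphic_on_subset)
  obtain g where g: "g holomorphic_on (f ` ball ?t r)" "\<And>z. z \<in> ball ?t r \<Longrightarrow> g (f z) = z"
    using holomorphic_has_inverse[OF fb open_ball r(3)] by metis
  have oi: "open (f ` ball ?t r)" by (rule open_mapping_thm3[OF fb open_ball r(3)])
  have "of_real x0 \<in> f ` ball ?t r" using br(3)[of "of_real x0" 3] r(1) by (metis Im_complex_of_real centre_in_ball image_eqI order_refl)
  then obtain e where e: "e > 0" "ball (of_real x0) e \<subseteq> f ` ball ?t r" using oi open_contains_ball by metis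
  have "isCont (\<lambda>x::real. br 3 (of_real x)) x0" using br_real_cont[of 3] by (simp add: continuous_on_eq_continuous_at)
  then obtain e' where e': "e' > 0" "\<And>x. dist x x0 < e' \<Longrightarrow> dist (br 3 (of_real x)) ?t < r"
    unfolding continuous_at_eps_delta using r(1) by (metis dist_commute)
  define d where "d = min (min e e') (min (x0 - p) (q - x0))"
  have d0: "d > 0" using e e' x0 by (auto simp: d_def)
  have sg: "(\<lambda>z. s (g z)) holomorphic_on ball (of_real x0) e"
  proof (rule holomorphic_on_compose_gen[unfolded o_def, where g = s and f = g])
    show "g holomorphic_on ball (of_real x0) e" using g(1) e(2) by (rule holomorphic_on_subset)
    show "g ` ball (of_real x0) e \<subseteq> {\<tau>. Im \<tau> \<noteq> 0}"
    proof
      fix w assume "w \<in> g ` ball (of_real x0) e"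
      then obtain z where "z \<in> ball ?t r" "w = g (f z)" using e(2) by auto
      then show "w \<in> {\<tau>. Im \<tau> \<noteq> 0}" using g(2) r(2) by auto
    qed
  qed (rule s_holo)
  define c where "c n = (deriv ^^ n) (\<lambda>z. s (g z)) (of_real x0) / fact n" for n
  show "\<exists>d>0. \<exists>c. \<forall>x. \<bar>x - x0\<bar> < d \<longrightarrow> (\<lambda>n. c n * (x - x0) ^ n) sums h2 x"
  proof (intro exI[of _ d] conjI exI[of _ "\<lambda>n. Im (c n) / pi"] allI impI d0)
    fix x assume x: "\<bar>x - x0\<bar> < d"
    have px: "p < x" "x < q" using x by (auto simp: d_def)
    have "br 3 (of_real x) \<in> ball ?t r" using e'(2)[of x] x by (simp add: d_def dist_real_def dist_commute)
    from g(2)[OF this] have gx: "g (of_real x) = br 3 (of_real x)" using br(3)[of "of_real x" 3] by simp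
    have "(\<lambda>n. c n * (of_real x - of_real x0) ^ n) sums s (g (of_real x))"
      unfolding c_def by (rule holomorphic_power_series[OF sg]) (use x in \<open>simp add: d_def dist_norm abs_minus_commute flip: of_real_diff\<close>)
    then have "(\<lambda>n. Im (c n * (of_real x - of_real x0) ^ n)) sums Im (s (g (of_real x)))" by (rule sums_Im)
    moreover have "Im (c n * (of_real x - of_real x0) ^ n) = Im (c n) * (x - x0) ^ n" for n
      by (simp flip: of_real_diff of_real_power)
    ultimately have "(\<lambda>n. Im (c n) * (x - x0) ^ n) sums Im (s (br 3 (of_real x)))" unfolding gx by simp
    then have "(\<lambda>n. Im (c n) * (x - x0) ^ n / pi) sums (Im (s (br 3 (of_real x))) / pi)" by (rule sums_divide)
    then show "(\<lambda>n. Im (c n) / pi * (x - x0) ^ n) sums h2 x" using h2_eq_br3[OF px] by simp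
  qed
qed

end

section \<open>The symmetry exchanging the two constrained measures\<close>

definition logpot :: "(real \<Rightarrow> real) \<Rightarrow> real \<Rightarrow> real" where
  "logpot h x = (\<integral>y. ln \<bar>x - y\<bar> * h y \<partial>lborel)"

text \<open>What the variational argument needs to know about one constrained measure, detached from
  the curve so that it serves both of them: \<open>h\<close> is its density, \<open>d\<close> the
  density of the slack below the constraint, and \<open>-r\<close> the right end of the
  slack.\<close>

definition constrained_density :: "real \<Rightarrow> (real \<Rightarrow> real) \<Rightarrow> (real \<Rightarrow> real) \<Rightarrow> real \<Rightarrow> bool" where
  "constrained_density c h d r \<longleftrightarrow> h \<in> borel_measurable borel \<and> d \<in> borel_measurable borel \<and> (\<exists>K. \<forall>x. h x \<le> K * wt x)
     \<and> (\<integral>x. h x \<partial>lborel) = 1/2 \<and> r \<ge> 0 \<and> (\<forall>x. h x \<ge> 0 \<and> d x \<ge> 0) \<and> (\<forall>x<0. h x > 0) \<and> (\<forall>x\<ge>0. h x = 0)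
     \<and> (\<forall>x<(-r). d x > 0) \<and> (\<forall>x\<ge>(-r). d x = 0) \<and> (\<forall>x<0. h x + d x = c / (pi * sqrt \<bar>x\<bar>))
     \<and> (r > 0 \<longrightarrow> (\<exists>k>0. ((\<lambda>x. d x / sqrt (- r - x)) \<longlongrightarrow> k) (at_left (- r))))"

definition band_density :: "(real \<Rightarrow> real) \<Rightarrow> real \<Rightarrow> real \<Rightarrow> bool" where
  "band_density h p q \<longleftrightarrow> h \<in> borel_measurable borel \<and> (\<exists>K. \<forall>x. h x \<le> K * wt x) \<and> (\<integral>x. h x \<partial>lborel) = 1 \<and> (\<forall>x. h x \<ge> 0)
     \<and> 0 \<le> p \<and> p < q \<and> (\<forall>x. p < x \<and> x < q \<longrightarrow> h x > 0) \<and> (\<forall>x. x \<le> p \<or> q \<le> x \<longrightarrow> h x = 0) \<and> real_analytic_on h {p<..<q}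
     \<and> (\<exists>c>0. ((\<lambda>x. h x / sqrt (q - x)) \<longlongrightarrow> c) (at_left q))
     \<and> (p > 0 \<longrightarrow> (\<exists>c>0. ((\<lambda>x. h x / sqrt (x - p)) \<longlongrightarrow> c) (at_right p)))"

text \<open>\<open>logpot\<close> is minus the usual potential, so the combination is the gradient
  of the energy with respect to the constrained measure. It is constant where there is slack and may
  be smaller between -r and 0, where no further mass can be placed.\<close>

definition constrained_EL :: "(real \<Rightarrow> real) \<Rightarrow> (real \<Rightarrow> real) \<Rightarrow> real \<Rightarrow> bool" where
  "constrained_EL h h2 r \<longleftrightarrow> (\<exists>l. (\<forall>x\<le>0. logpot h2 x - 2 * logpot h x \<le> l) \<and> (\<forall>x\<le>(-r). logpot h2 x - 2 * logpot h x = l))"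

lemma laurent_swap: "\<tau> \<noteq> 0 \<Longrightarrow> laurent v D C B u (1 / \<tau>) = laurent u B C D v \<tau>"
  by (simp add: laurent_def power_divide)

text \<open>Under inversion a pole \<open>c\<close> of weight \<open>a\<close> becomes a pole 1/c of
  weight a/c^2, up to the constant a/c; these constants add up to \<gamma>.\<close>

lemma resid_swap:
  fixes \<tau> :: complex
  assumes nz: "c1 \<noteq> 0" "c2 \<noteq> 0" "c3 \<noteq> 0" and t: "\<tau> \<noteq> 0" "1 / \<tau> \<noteq> of_real (1/c1)" "1 / \<tau> \<noteq> of_real (1/c2)" "1 / \<tau> \<noteq> of_real (1/c3)"
    and g: "a1 / c1 + a2 / c2 + a3 / c3 = \<gamma>"
  shows "resid (a3/c3\<^sup>2) (a2/c2\<^sup>2) (a1/c1\<^sup>2) (1/c3) (1/c2) (1/c1) (1 / \<tau>) = of_real \<gamma> - resid a1 a2 a3 c1 c2 c3 \<tau>"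
proof -
  have one: "of_real (a / c\<^sup>2) / (of_real (1/c) - 1 / \<tau>) = of_real (a / c) - of_real a / (of_real c - \<tau>)"
    if "c \<noteq> 0" "1 / \<tau> \<noteq> of_real (1/c)" for a c :: real
  proof -
    have n: "\<tau> - of_real c \<noteq> 0" using that(2) by auto
    have 1: "of_real (1/c) - 1 / \<tau> = (\<tau> - of_real c) / (of_real c * \<tau>)" using that(1) t(1) by (simp add: field_simps)
    have 2: "of_real a / (of_real c - \<tau>) = - (of_real a / (\<tau> - of_real c))" by (metis minus_diff_eq minus_divide_right)
    have "of_real (a / c\<^sup>2) / (of_real (1/c) - 1 / \<tau>) = of_real a * \<tau> / (of_real c * (\<tau> - of_real c))"
      unfolding 1 using that(1) t(1) n by (simp add: power2_eq_square)
    also have "\<dots> = of_real a / of_real c + of_real a / (\<tau> - of_real c)"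
      using that(1) n by (simp add: divide_simps) (simp add: algebra_simps)
    finally show ?thesis unfolding 2 by simp
  qed
  have g': "complex_of_real \<gamma> = of_real (a1 / c1) + of_real (a2 / c2) + of_real (a3 / c3)" unfolding g[symmetric] by simp
  show ?thesis unfolding resid_def one[OF nz(3) t(4)] one[OF nz(2) t(3)] one[OF nz(1) t(2)] g' by simp
qed

context spectral_curve
begin

lemma d1_constrained: "constrained_density \<alpha> h1 d1 (- fr c1)"
  unfolding constrained_density_def minus_minus
proof (intro conjI allI impI)
  show "\<And>x. x < fr c1 \<Longrightarrow> 0 < d1 x" "\<And>x. fr c1 \<le> x \<Longrightarrow> d1 x = 0" using d1_pos by (auto simp: d1_def)
  show "0 < - fr c1 \<Longrightarrow> \<exists>k>0. ((\<lambda>x. d1 x / sqrt (fr c1 - x)) \<longlongrightarrow> k) (at_left (fr c1))" using d1_edge by simp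
  show "\<And>x. 0 \<le> x \<Longrightarrow> h1 x = 0" "\<And>x. x < 0 \<Longrightarrow> h1 x + d1 x = \<alpha> / (pi * sqrt \<bar>x\<bar>)" by (simp_all add: h1_def)
qed (use dens_meas h1_wt h1_mass vals(1) h1_nonneg d1_nonneg h1_pos in simp_all)

lemma h2_band: "band_density h2 p q"
  unfolding band_density_def
proof (intro conjI allI impI)
  show "\<And>x. x \<le> p \<or> q \<le> x \<Longrightarrow> h2 x = 0" by (auto simp: h2_def)
qed (use dens_meas(3) h2_wt h2_mass h2_nonneg p_nonneg p_less_q h2_pos h2_analytic h2_upper_edge h2_lower_edge in \<open>simp_all\<close>)

lemma h1_EL: "constrained_EL h1 h2 (- fr c1)"
proof -
  obtain e1 where e1: "\<And>x. logpot h1 x = PR (br 1 (of_real x)) + 2 * \<alpha> * sqrt (max 0 x) + e1"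
    using h1_potential by (auto simp: logpot_def)
  obtain e2 where e2: "\<And>x. logpot h2 x = PR (br 1 (of_real x)) + PR (br 2 (of_real x)) + e2"
    using h2_potential by (auto simp: logpot_def)
  have L: "logpot h2 x - 2 * logpot h1 x = PR (br 2 (of_real x)) - PR (br 1 (of_real x)) + (e2 - 2 * e1)" if "x \<le> 0" for x :: real
    unfolding e1 e2 using that by simp
  show ?thesis unfolding constrained_EL_def minus_minus
  proof (intro exI[of _ "e2 - 2 * e1"] conjI allI impI)
    fix x :: real assume "x \<le> 0" then show "logpot h2 x - 2 * logpot h1 x \<le> e2 - 2 * e1" using L[of x] EL1(2)[of x] by linarith
  next
    fix x :: real assume x: "x \<le> fr c1"
    then have "x \<le> 0" using vals by linarith
    then show "logpot h2 x - 2 * logpot h1 x = e2 - 2 * e1" using L[of x] EL1(1)[OF x] by linarith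
  qed
qed

text \<open>The locale is symmetric under inversion: \<alpha>, u, B, k trade places with \<beta>, v,
  D, l, the points \<open>c1\<close>, \<open>c2\<close>, \<open>c3\<close> are inverted and reversed
  in order, and \<open>sq\<close> is exchanged with \<open>sq'\<close>.\<close>

lemma swap: "spectral_curve \<beta> \<alpha> \<gamma> v u D C B (1/c0) (1/c3) (1/c2) (1/c1) (a3/c3\<^sup>2) (a2/c2\<^sup>2) (a1/c1\<^sup>2) l k"
proof -
  note p = pos cpos
  have nz: "c0 \<noteq> 0" "c1 \<noteq> 0" "c2 \<noteq> 0" "c3 \<noteq> 0" using p by auto
  have fs: "laurent v D C B u (1 / c) = fr c" if "c \<noteq> 0" for c using laurent_swap[OF that] by (simp add: fr_def)
  have cfs: "laurent v D C B u \<tau> = f (1 / \<tau>)" if "\<tau> \<noteq> 0" for \<tau> :: complex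
    using laurent_swap[of "1 / \<tau>" v D C B u] that by (simp add: f_def)
  have ss: "resid (a3/c3\<^sup>2) (a2/c2\<^sup>2) (a1/c1\<^sup>2) (1/c3) (1/c2) (1/c1) \<tau> = of_real \<gamma> - s (1 / \<tau>)"
    if "\<tau> \<noteq> 0" "\<tau> \<noteq> of_real (1/c3)" "\<tau> \<noteq> of_real (1/c2)" "\<tau> \<noteq> of_real (1/c1)" for \<tau> :: complex
    using resid_swap[of c1 c2 c3 "1 / \<tau>" a1 a2 a3 \<gamma>] that nz a_sum(2) by (simp add: s_def)
  define P where "P = c1 * c2 * c3"
  have vv: "v\<^sup>2 = u\<^sup>2 * c0 * P" using cv by (simp add: P_def mult.assoc)
  have inv1: "1/c3 * (1/c2) + 1/c3 * (1/c1) + 1/c2 * (1/c1) = (c1 + c2 + c3) / P" using nz by (simp add: P_def field_simps)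
  have inv2: "1/c3 + 1/c2 + 1/c1 = (c1*c2 + c1*c3 + c2*c3) / P" using nz by (simp add: P_def field_simps)
  have inv3: "1/c3 * (1/c2) * (1/c1) = 1 / P" using nz by (simp add: P_def)
  have Pn: "P \<noteq> 0" using nz by (simp add: P_def)
  show ?thesis
  proof (unfold_locales)
    show "1/c1 \<le> 1/c2" "1/c2 \<le> 1/c3" using ord p by (auto intro!: divide_left_mono mult_pos_pos)
    have "D = 2 * v\<^sup>2 * (1/c0 - (c1*c2 + c1*c3 + c2*c3) / P)"
      unfolding vv cD using Pn nz by (simp add: P_def[symmetric] right_diff_distrib)
    then show "D = 2 * v\<^sup>2 * (1/c0 - 1/c3 - 1/c2 - 1/c1)" unfolding inv2[symmetric] by simp
    show "1/c3 * (1/c2) + 1/c3 * (1/c1) + 1/c2 * (1/c1) = 1/c0 * (1/c3 + 1/c2 + 1/c1)"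
      unfolding inv1 inv2 e2 using nz by simp
    show "B = 2 * v\<^sup>2 * (1/c3 * (1/c2) * (1/c1) - 1/c0 * (1/c3 * (1/c2) + 1/c3 * (1/c1) + 1/c2 * (1/c1)))"
      unfolding inv1 inv3 vv cB using Pn nz by (simp add: right_diff_distrib) (simp add: field_simps)
    have "v\<^sup>2 * (1/c0) * (1/c3) * (1/c2) * (1/c1) = v\<^sup>2 * (1/c0) * (1/c3 * (1/c2) * (1/c1))" by (simp only: mult.assoc)
    also have "\<dots> = u\<^sup>2" unfolding inv3 vv using Pn nz by simp
    finally show "u\<^sup>2 = v\<^sup>2 * (1/c0) * (1/c3) * (1/c2) * (1/c1)" by simp
    show "v * (1/c1)\<^sup>2 \<le> u" "u \<le> v * (1/c3)\<^sup>2" using circ p by (auto simp: power_divide divide_le_eq le_divide_eq)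
    show "laurent v D C B u (1/c3) \<le> 0" "laurent v D C B u (1/c1) \<le> 0" "0 \<le> laurent v D C B u (1/c2)"
      using vals fs nz by simp_all
    show "0 < laurent v D C B u t" if "t < 0" for t :: real using fs[of "1 / t"] neg[of "1/t"] that by simp
    show "0 \<le> Re (laurent v D C B u \<tau>)" if "1/c1 = 1/c3" "cmod \<tau> = 1/c3" for \<tau>
    proof -
      have "\<tau> \<noteq> 0" using that p by auto
      have cc: "c3 = c1" using that(1) nz by simp
      have "cmod (1 / \<tau>) = c1" unfolding norm_divide that(2) using cc by simp
      then show ?thesis unfolding cfs[OF \<open>\<tau> \<noteq> 0\<close>] by (rule degen[OF cc])
    qed
    show "a3/c3\<^sup>2 + a2/c2\<^sup>2 + a1/c1\<^sup>2 = \<beta> / v" using a_sum by simp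
    show "a3/c3\<^sup>2 / (1/c3) + a2/c2\<^sup>2 / (1/c2) + a1/c1\<^sup>2 / (1/c1) = \<gamma>" using a_sum(2) nz by (simp add: power2_eq_square)
    show "a3/c3\<^sup>2 / (1/c3)\<^sup>2 + a2/c2\<^sup>2 / (1/c2)\<^sup>2 + a1/c1\<^sup>2 / (1/c1)\<^sup>2 = \<alpha> / u" using a_sum(1) nz by (simp add: power_divide)
    have ne: "1/\<tau> \<noteq> 0 \<and> 1/\<tau> \<noteq> of_real c1 \<and> 1/\<tau> \<noteq> of_real c2 \<and> 1/\<tau> \<noteq> of_real c3"
      if t: "\<tau> \<noteq> 0" "\<tau> \<noteq> of_real (1/c3)" "\<tau> \<noteq> of_real (1/c2)" "\<tau> \<noteq> of_real (1/c1)" for \<tau> :: complex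
    proof -
      have "1 / \<tau> \<noteq> of_real c" if "\<tau> \<noteq> of_real (1 / c)" for c
      proof
        assume "1 / \<tau> = of_real c"
        then have "\<tau> = 1 / of_real c" using t(1) by (metis div_by_1 divide_divide_eq_right mult_1 nonzero_mult_div_cancel_left)
        then show False using that by simp
      qed
      then show ?thesis using t by simp
    qed
    fix \<tau> :: complex assume t: "\<tau> \<noteq> 0" "\<tau> \<noteq> of_real (1/c3)" "\<tau> \<noteq> of_real (1/c2)" "\<tau> \<noteq> of_real (1/c1)"
    note n = ne[OF t]
    show "(resid (a3/c3\<^sup>2) (a2/c2\<^sup>2) (a1/c1\<^sup>2) (1/c3) (1/c2) (1/c1) \<tau>)\<^sup>2 * laurent v D C B u \<tau> = of_real (\<beta>\<^sup>2) - of_real (\<beta> / v) / \<tau> + of_real l / \<tau>\<^sup>2"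
      unfolding ss[OF t] cfs[OF t(1)] using sq'[of "1 / \<tau>"] n by (simp add: power_divide)
    show "(of_real \<gamma> - resid (a3/c3\<^sup>2) (a2/c2\<^sup>2) (a1/c1\<^sup>2) (1/c3) (1/c2) (1/c1) \<tau>)\<^sup>2 * laurent v D C B u \<tau> = of_real (\<alpha>\<^sup>2) - of_real (\<alpha> / u) * \<tau> + of_real k * \<tau>\<^sup>2"
      unfolding ss[OF t] cfs[OF t(1)] using sq[of "1 / \<tau>"] n by (simp add: power_divide)
  next
    show "0 < a3/c3\<^sup>2 \<Longrightarrow> laurent v D C B u (1/c3) = 0" "0 < a2/c2\<^sup>2 \<Longrightarrow> laurent v D C B u (1/c2) = 0" "0 < a1/c1\<^sup>2 \<Longrightarrow> laurent v D C B u (1/c1) = 0"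
      using pole fs nz by (simp_all add: zero_less_divide_iff)
  qed (use p a_nonneg in simp_all)
qed

text \<open>Coefficient comparison behind the fact that, at 1/\<tau>, the primitive of the swapped
  curve is \<gamma> f minus the primitive of the given one, up to a constant. The last identity
  removes the 1/\<tau>^2 term.\<close>

lemma swap_potential_coefficients:
  defines "T0 \<equiv> a3/c3\<^sup>2 + a2/c2\<^sup>2 + a1/c1\<^sup>2"
    and "T1 \<equiv> a3/c3\<^sup>2 * (1/c2 + 1/c1) + a2/c2\<^sup>2 * (1/c3 + 1/c1) + a1/c1\<^sup>2 * (1/c3 + 1/c2)"
    and "T2 \<equiv> a3/c3\<^sup>2 * (1/c2) * (1/c1) + a2/c2\<^sup>2 * (1/c3) * (1/c1) + a1/c1\<^sup>2 * (1/c3) * (1/c2)"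
  shows "v\<^sup>2 * (T2 * (1/c0)) = \<gamma> * u\<^sup>2"
    "2 * (v\<^sup>2 * (T2 - T1 * (1/c0))) = \<gamma> * B + 2 * u\<^sup>2 * S0"
    "2 * (v\<^sup>2 * (T0 * (1/c0) - T1)) = 2 * u\<^sup>2 * (S0 * c0 - S1)"
    "2 * (v\<^sup>2 * T0) = 2 * u\<^sup>2 * (S2 - S1 * c0) - \<gamma> * D"
    "\<gamma> * v\<^sup>2 = u\<^sup>2 * S2 * c0"
proof -
  \<comment> \<open>The weights of the swapped curve, taken as the basic variables so that the
    denominators disappear.\<close>
  define b1 b2 b3 where "b1 = a1 / c1\<^sup>2" and "b2 = a2 / c2\<^sup>2" and "b3 = a3 / c3\<^sup>2"
  have nz: "c0 \<noteq> 0" "c1 \<noteq> 0" "c2 \<noteq> 0" "c3 \<noteq> 0" using pos cpos by auto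
  have a: "a1 = b1 * c1\<^sup>2" "a2 = b2 * c2\<^sup>2" "a3 = b3 * c3\<^sup>2" using nz by (simp_all add: b1_def b2_def b3_def)
  have g: "\<gamma> = b1 * c1 + b2 * c2 + b3 * c3" using a_sum(2) nz by (simp add: b1_def b2_def b3_def power2_eq_square)
  define P where "P = c1 * c2 * c3"
  have Pn: "P \<noteq> 0" using nz by (simp add: P_def)
  have vv: "v\<^sup>2 = u\<^sup>2 * c0 * P" using cv by (simp add: P_def mult.assoc)
  have T0: "T0 = b1 + b2 + b3" by (simp add: T0_def b1_def b2_def b3_def)
  have T1: "P * T1 = b1 * (c1 * (c2 + c3)) + b2 * (c2 * (c1 + c3)) + b3 * (c3 * (c1 + c2))"
  proof -
    have "P * T1 = b3 * (P * (1/c2 + 1/c1)) + b2 * (P * (1/c3 + 1/c1)) + b1 * (P * (1/c3 + 1/c2))"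
      by (simp add: T1_def b1_def b2_def b3_def algebra_simps)
    also have "P * (1/c2 + 1/c1) = c3 * (c1 + c2)" using nz by (simp add: P_def field_simps)
    also have "P * (1/c3 + 1/c1) = c2 * (c1 + c3)" using nz by (simp add: P_def field_simps)
    also have "P * (1/c3 + 1/c2) = c1 * (c2 + c3)" using nz by (simp add: P_def field_simps)
    finally show ?thesis by simp
  qed
  have T2: "P * T2 = \<gamma>"
  proof -
    have "P * T2 = b3 * (P * (1/c2) * (1/c1)) + b2 * (P * (1/c3) * (1/c1)) + b1 * (P * (1/c3) * (1/c2))"
      by (simp add: T2_def b1_def b2_def b3_def algebra_simps)
    also have "P * (1/c2) * (1/c1) = c3" using nz by (simp add: P_def)
    also have "P * (1/c3) * (1/c1) = c2" using nz by (simp add: P_def)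
    also have "P * (1/c3) * (1/c2) = c1" using nz by (simp add: P_def)
    finally show ?thesis by (simp add: g)
  qed
  have s: "S0 = b1 * c1\<^sup>2 + b2 * c2\<^sup>2 + b3 * c3\<^sup>2" "S1 = b1 * c1\<^sup>2 * (c2 + c3) + b2 * c2\<^sup>2 * (c1 + c3) + b3 * c3\<^sup>2 * (c1 + c2)" "S2 = P * \<gamma>"
    unfolding S0_def S1_def S2_def unfolding a g P_def by (simp_all add: algebra_simps power2_eq_square)
  show "v\<^sup>2 * (T2 * (1/c0)) = \<gamma> * u\<^sup>2" unfolding vv T2[symmetric] using nz by simp
  have "2 * (v\<^sup>2 * (T2 - T1 * (1/c0))) = 2 * u\<^sup>2 * (c0 * (P * T2) - P * T1)" unfolding vv using nz by (simp add: field_simps)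
  also have "\<dots> = \<gamma> * B + 2 * u\<^sup>2 * S0" unfolding T1 T2 s cB g by (simp add: algebra_simps power2_eq_square)
  finally show "2 * (v\<^sup>2 * (T2 - T1 * (1/c0))) = \<gamma> * B + 2 * u\<^sup>2 * S0" .
  have "2 * (v\<^sup>2 * (T0 * (1/c0) - T1)) = 2 * u\<^sup>2 * (P * T0 - c0 * (P * T1))" unfolding vv using nz by (simp add: field_simps)
  also have "P * T0 - c0 * (P * T1) = S0 * c0 - S1" unfolding T1 T0 s unfolding P_def using e2 by algebra
  finally show "2 * (v\<^sup>2 * (T0 * (1/c0) - T1)) = 2 * u\<^sup>2 * (S0 * c0 - S1)" .
  have "c0 * (P * T0) = P * \<gamma> - S1 * c0 - \<gamma> * (P - c0 * (c1*c2 + c1*c3 + c2*c3))" unfolding T0 s P_def g by algebra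
  then show "2 * (v\<^sup>2 * T0) = 2 * u\<^sup>2 * (S2 - S1 * c0) - \<gamma> * D"
    unfolding vv s cD P_def[symmetric] by algebra
  show "\<gamma> * v\<^sup>2 = u\<^sup>2 * S2 * c0" unfolding vv s by simp
qed

lemma closure_inverse:
  assumes sub: "\<And>\<tau>. \<tau> \<in> A \<Longrightarrow> 1 / \<tau> \<in> B'" and t: "\<tau> \<in> closure A" "\<tau> \<noteq> (0::complex)"
  shows "1 / \<tau> \<in> closure B'"
proof -
  obtain x where x: "\<And>n. x n \<in> A" "x \<longlonglongrightarrow> \<tau>" using t(1) unfolding closure_sequential by blast
  have "(\<lambda>n. 1 / x n) \<longlonglongrightarrow> 1 / \<tau>" using x(2) t(2) by (intro tendsto_intros)
  moreover have "\<forall>n. 1 / x n \<in> B'" using x(1) sub by simp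
  ultimately show ?thesis unfolding closure_sequential by (intro exI[of _ "\<lambda>n. 1 / x n"]) simp
qed

text \<open>In the condition for \<open>h2\<close>, one copy of \<open>logpot h2\<close> is expanded
  over sheets 1 and 2 of this curve and the other over sheets 1 and 2 of the swapped curve, that is,
  sheets 4 and 3. Sheets 1 and 4 cancel against the two constrained potentials, the linear and
  square root terms match the external field, and the difference of sheets 3 and 2 remains.\<close>

theorem equilibrium:
  "\<exists>h1 d1 r1 h2 p q h3 d3 r3. constrained_density \<alpha> h1 d1 r1 \<and> constrained_density \<beta> h3 d3 r3 \<and> band_density h2 p q
    \<and> constrained_EL h1 h2 r1 \<and> constrained_EL h3 h2 r3
    \<and> (\<exists>l. (\<forall>x\<ge>0. l \<le> logpot h1 x + logpot h3 x - 2 * logpot h2 x + \<gamma> * x - 2 * (\<alpha> + \<beta>) * sqrt x)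
        \<and> (\<forall>x. p \<le> x \<and> x \<le> q \<longrightarrow> logpot h1 x + logpot h3 x - 2 * logpot h2 x + \<gamma> * x - 2 * (\<alpha> + \<beta>) * sqrt x = l))"
proof -
  interpret sw: spectral_curve \<beta> \<alpha> \<gamma> v u D C B "1/c0" "1/c3" "1/c2" "1/c1" "a3/c3\<^sup>2" "a2/c2\<^sup>2" "a1/c1\<^sup>2" l k
    "laurent v D C B u" "resid (a3/c3\<^sup>2) (a2/c2\<^sup>2) (a1/c1\<^sup>2) (1/c3) (1/c2) (1/c1)" "laurent v D C B u"
    by (rule swap)
  have nz: "c0 \<noteq> 0" "c1 \<noteq> 0" "c2 \<noteq> 0" "c3 \<noteq> 0" using pos cpos by auto
  have cfs: "laurent v D C B u (1 / \<tau>) = f \<tau>" if "\<tau> \<noteq> 0" for \<tau> :: complex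
    using laurent_swap[OF that] by (simp add: f_def)
  have Im_inv: "Im (1 / \<tau>) = - Im \<tau> / (cmod \<tau>)\<^sup>2" for \<tau> by (simp add: Im_divide cmod_power2)
  \<comment> \<open>Inversion exchanges the half planes and the inside and outside of the circles:
    sheet 4 becomes sheet 1 of the swapped curve, and sheet 3 its sheet 2.\<close>
  have inc: "1 / \<tau> \<in> sw.Om 1" if "\<tau> \<in> Om 4" for \<tau>
  proof -
    have t: "Im \<tau> < 0" "cmod \<tau> < c3" "Im (f \<tau>) > 0" using that by (auto simp: Om_def reg_def)
    then have t0: "\<tau> \<noteq> 0" by auto
    then have "1 / c3 < cmod (1 / \<tau>)" using t(2) by (simp add: norm_divide frac_less2)
    moreover have "Im (1 / \<tau>) > 0" unfolding Im_inv using t t0 by (intro divide_pos_pos) auto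
    ultimately show ?thesis using t cfs[OF t0] by (simp add: sw.Om_def sw.reg_def)
  qed
  have inc': "1 / \<tau> \<in> sw.Om 2" if "\<tau> \<in> Om 3" for \<tau>
  proof -
    have t: "Im \<tau> > 0" "cmod \<tau> < c1" "Im (f \<tau>) > 0" using that by (auto simp: Om_def reg_def)
    then have t0: "\<tau> \<noteq> 0" by auto
    then have "1 / c1 < cmod (1 / \<tau>)" using t(2) by (simp add: norm_divide frac_less2)
    moreover have "Im (1 / \<tau>) < 0" unfolding Im_inv using t t0 by (intro divide_neg_pos) auto
    ultimately show ?thesis using t cfs[OF t0] by (simp add: sw.Om_def sw.reg_def)
  qed
  have b1: "sw.br 1 (of_real x) = 1 / br 4 (of_real x)" for x
  proof (rule sw.br_eq)
    show "1 / br 4 (of_real x) \<in> closure (sw.Om 1)" by (rule closure_inverse[OF inc]) (use br[of "of_real x" 4] in auto)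
    show "laurent v D C B u (1 / br 4 (of_real x)) = of_real x" using br[of "of_real x" 4] cfs by simp
  qed (use br[of "of_real x" 4] in auto)
  have b2: "sw.br 2 (of_real x) = 1 / br 3 (of_real x)" for x
  proof (rule sw.br_eq)
    show "1 / br 3 (of_real x) \<in> closure (sw.Om 2)" by (rule closure_inverse[OF inc']) (use br[of "of_real x" 3] in auto)
    show "laurent v D C B u (1 / br 3 (of_real x)) = of_real x" using br[of "of_real x" 3] cfs by simp
  qed (use br[of "of_real x" 3] in auto)
  have frs: "laurent v D C B u (1 / c) = fr c" if "c \<noteq> 0" for c using laurent_swap[OF that] by (simp add: fr_def)
  have pq: "sw.p = p" "sw.q = q" using frs[OF nz(3)] frs[of "-c0"] nz by (simp_all add: sw.p_def sw.q_def p_def q_def)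
  have PRs: "sw.PR (1 / \<tau>) = \<gamma> * Re (f \<tau>) - PR \<tau> - \<gamma> * C" if t: "\<tau> \<noteq> 0" for \<tau>
  proof -
    note K = swap_potential_coefficients
    define X1 X2 Y1 Y2 L where "X1 = Re (1 / \<tau>)" and "X2 = Re (1 / \<tau>\<^sup>2)" and "Y1 = Re \<tau>" and "Y2 = Re (\<tau>\<^sup>2)" and "L = ln (cmod \<tau>)"
    have e: "f \<tau> = of_real (u\<^sup>2) * \<tau>\<^sup>2 + of_real B * \<tau> + of_real C + of_real D * (1 / \<tau>) + of_real (v\<^sup>2) * (1 / \<tau>\<^sup>2)"
      by (simp add: f_def')
    have g: "Re (of_real F * X + of_real G * Y + of_real H + of_real I * Z + of_real J * W) = F * Re X + G * Re Y + H + I * Re Z + J * Re W"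
      for F G H I J X Y Z W by simp
    have F: "Re (f \<tau>) = u\<^sup>2 * Y2 + B * Y1 + C + D * X1 + v\<^sup>2 * X2" unfolding e g X1_def X2_def Y1_def Y2_def ..
    have i: "1 / (1 / \<tau>) = \<tau>" "1 / (1 / \<tau>)\<^sup>2 = \<tau>\<^sup>2" using t by (simp_all add: power_divide)
    have ln: "ln (cmod (1 / \<tau>)) = - L" using t by (simp add: norm_divide ln_div L_def)
    have "sw.PR (1 / \<tau>) = - (2 * (v\<^sup>2 * sw.S0)) * X1 + 2 * (v\<^sup>2 * (sw.S0 * (1/c0) - sw.S1)) * L
       + 2 * (v\<^sup>2 * (sw.S2 - sw.S1 * (1/c0))) * Y1 + v\<^sup>2 * (sw.S2 * (1/c0)) * Y2"
      unfolding sw.PR_def i ln X1_def[symmetric] Y1_def[symmetric] Y2_def[symmetric] by (simp add: algebra_simps)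
    also have "\<dots> = - (2 * u\<^sup>2 * (S2 - S1 * c0) - \<gamma> * D) * X1 + 2 * u\<^sup>2 * (S0 * c0 - S1) * L + (\<gamma> * B + 2 * u\<^sup>2 * S0) * Y1 + \<gamma> * u\<^sup>2 * Y2
       + (\<gamma> * v\<^sup>2 - u\<^sup>2 * S2 * c0) * X2"
      using K unfolding sw.S0_def sw.S1_def sw.S2_def by simp
    also have "\<dots> = \<gamma> * Re (f \<tau>) - PR \<tau> - \<gamma> * C"
      unfolding F PR_def X1_def[symmetric] X2_def[symmetric] Y1_def[symmetric] L_def[symmetric] by (simp add: algebra_simps)
    finally show ?thesis .
  qed
  have P4: "sw.PR (sw.br 1 (of_real x)) = \<gamma> * x - PR (br 4 (of_real x)) - \<gamma> * C" for x
    unfolding b1 using PRs[of "br 4 (of_real x)"] br[of "of_real x" 4] by simp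
  have P3: "sw.PR (sw.br 2 (of_real x)) = \<gamma> * x - PR (br 3 (of_real x)) - \<gamma> * C" for x
    unfolding b2 using PRs[of "br 3 (of_real x)"] br[of "of_real x" 3] by simp
  \<comment> \<open>Both curves produce the same middle measure: the swapped branch is \<gamma> - s
    on sheet 3, with imaginary part opposite to that of \<open>s\<close>.\<close>
  have hh: "sw.h2 = h2"
  proof
    fix x
    show "sw.h2 x = h2 x"
    proof (cases "p < x \<and> x < q")
      case True
      let ?t = "br 3 (of_real x)"
      have im: "Im ?t > 0" using br3_nonreal True by simp
      have t0: "?t \<noteq> 0" using im by auto
      have "Im (1 / ?t) \<noteq> 0" unfolding Im_inv using im t0 by simp
      then have ni: "1 / ?t \<noteq> of_real r" for r by (metis Im_complex_of_real)
      have "resid (a3/c3\<^sup>2) (a2/c2\<^sup>2) (a1/c1\<^sup>2) (1/c3) (1/c2) (1/c1) (1 / ?t) = of_real \<gamma> - s ?t"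
        unfolding s_def by (rule resid_swap[OF nz(2,3,4) t0 ni ni ni a_sum(2)])
      then have "Im (sw.xi 2 (of_real x)) = - Im (s ?t)" by (simp add: sw.xi_def b2)
      then show ?thesis using True h2_eq_br3[of x] by (simp add: sw.h2_def pq)
    qed (auto simp: sw.h2_def h2_def pq)
  qed
  obtain e1 where e1: "\<And>x. logpot h1 x = PR (br 1 (of_real x)) + 2 * \<alpha> * sqrt (max 0 x) + e1"
    using h1_potential by (auto simp: logpot_def)
  obtain e2 where e2: "\<And>x. logpot h2 x = PR (br 1 (of_real x)) + PR (br 2 (of_real x)) + e2"
    using h2_potential by (auto simp: logpot_def)
  obtain e3 where e3: "\<And>x. logpot sw.h1 x = sw.PR (sw.br 1 (of_real x)) + 2 * \<beta> * sqrt (max 0 x) + e3"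
    using sw.h1_potential by (auto simp: logpot_def)
  obtain e4 where e4: "\<And>x. logpot h2 x = sw.PR (sw.br 1 (of_real x)) + sw.PR (sw.br 2 (of_real x)) + e4"
    using sw.h2_potential unfolding hh by (auto simp: logpot_def)
  define c where "c = e1 + e3 - e2 - e4 + \<gamma> * C"
  have L: "logpot h1 x + logpot sw.h1 x - 2 * logpot h2 x + \<gamma> * x - 2 * (\<alpha> + \<beta>) * sqrt x = PR (br 3 (of_real x)) - PR (br 2 (of_real x)) + c" if "x \<ge> 0" for x
  proof -
    have m: "sqrt (max 0 x) = sqrt x" using that by simp
    have "2 * (\<alpha> + \<beta>) * sqrt x = 2 * \<alpha> * sqrt x + 2 * \<beta> * sqrt x" by (simp add: algebra_simps)
    then show ?thesis using e1[of x] e2[of x] e3[of x] e4[of x] P3[of x] unfolding m c_def by linarith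
  qed
  show ?thesis
  proof (intro exI conjI)
    show "constrained_density \<alpha> h1 d1 (- fr c1)" by (rule d1_constrained)
    show "constrained_density \<beta> sw.h1 sw.d1 (- laurent v D C B u (1/c3))" by (rule sw.d1_constrained)
    show "band_density h2 p q" by (rule h2_band)
    show "constrained_EL h1 h2 (- fr c1)" by (rule h1_EL)
    show "constrained_EL sw.h1 h2 (- laurent v D C B u (1/c3))" using sw.h1_EL unfolding hh .
    show "\<forall>x\<ge>0. c \<le> logpot h1 x + logpot sw.h1 x - 2 * logpot h2 x + \<gamma> * x - 2 * (\<alpha> + \<beta>) * sqrt x"
      using L EL2(2) by (metis add_le_cancel_right diff_ge_0_iff_ge add_0)
    show "\<forall>x. p \<le> x \<and> x \<le> q \<longrightarrow> logpot h1 x + logpot sw.h1 x - 2 * logpot h2 x + \<gamma> * x - 2 * (\<alpha> + \<beta>) * sqrt x = c"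
      using L EL2(1) p_nonneg by fastforce
  qed
qed

end

section \<open>Spectral curves for all parameters\<close>

text \<open>The ansatz is \<open>s = \<gamma> / (1 - \<tau>)\<close>. Relation \<open>sq\<close>
  with k = \<beta>^2 then forces f = ((1-\<tau>)/(\<gamma>\<tau>))^2 (\<alpha>^2 \<tau>^2 -
  \<gamma>\<tau> + \<beta>^2). Which of \<open>c1\<close>, \<open>c2\<close>, \<open>c3\<close>
  equals 1 is left open, so that the three orderings share one verification.\<close>

lemma spectral_curve_subcritical_aux:
  fixes \<alpha> \<beta> \<gamma> :: real
  assumes pos: "\<alpha> > 0" "\<beta> > 0" "\<gamma> > 0" "2 * \<alpha> * \<beta> < \<gamma>"
    and k: "c0 > 0" "c3 > 0" "c3 \<le> c2" "c2 \<le> c1" "c3 < c1"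
    and e: "2 * \<alpha>\<^sup>2 * (c0 - (c1 + c2 + c3) + 1) = - \<gamma>" "c1*c2 + c1*c3 + c2*c3 = c0 * (c1 + c2 + c3)" "\<alpha>\<^sup>2 * (c0 * (c1 * c2 * c3)) = \<beta>\<^sup>2"
    and e': "2 * \<alpha>\<^sup>2 * (c1*c2*c3 - c0 * (c1 + c2 + c3 - 1)) = - \<gamma>"
    and circ: "\<alpha> * c3\<^sup>2 \<le> \<beta>" "\<beta> \<le> \<alpha> * c1\<^sup>2"
    and q: "c1 = 1 \<or> \<alpha>\<^sup>2 * c1\<^sup>2 - \<gamma> * c1 + \<beta>\<^sup>2 \<le> 0" "c3 = 1 \<or> \<alpha>\<^sup>2 * c3\<^sup>2 - \<gamma> * c3 + \<beta>\<^sup>2 \<le> 0" "c2 = 1 \<or> \<alpha>\<^sup>2 * c2\<^sup>2 - \<gamma> * c2 + \<beta>\<^sup>2 \<ge> 0"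
    and a: "a1 = 0 \<or> a1 = \<gamma> \<and> c1 = 1" "a2 = 0 \<or> a2 = \<gamma> \<and> c2 = 1" "a3 = 0 \<or> a3 = \<gamma> \<and> c3 = 1" "a1 + a2 + a3 = \<gamma>"
  shows "spectral_curve \<alpha> \<beta> \<gamma> (\<alpha>/\<gamma>) (\<beta>/\<gamma>) (- (\<gamma> + 2 * \<alpha>\<^sup>2) / \<gamma>\<^sup>2) ((\<alpha>\<^sup>2 + 2 * \<gamma> + \<beta>\<^sup>2) / \<gamma>\<^sup>2) (- (\<gamma> + 2 * \<beta>\<^sup>2) / \<gamma>\<^sup>2) c0 c1 c2 c3 a1 a2 a3 (\<beta>\<^sup>2) (\<alpha>\<^sup>2)"
    (is "spectral_curve _ _ _ ?u ?v ?B ?C ?D _ _ _ _ _ _ _ _ _")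
proof -
  have F: "laurent ?u ?B ?C ?D ?v \<tau> = ((1 - \<tau>) / (of_real \<gamma> * \<tau>))\<^sup>2 * (of_real (\<alpha>\<^sup>2) * \<tau>\<^sup>2 - of_real \<gamma> * \<tau> + of_real (\<beta>\<^sup>2))"
    if t: "\<tau> \<noteq> 0" for \<tau> :: "'b::{real_field,field}"
  proof -
    define A G E where "A = (of_real (\<alpha>\<^sup>2) :: 'b)" and "G = (of_real \<gamma> :: 'b)" and "E = (of_real (\<beta>\<^sup>2) :: 'b)"
    have "laurent ?u ?B ?C ?D ?v \<tau> = (A / G\<^sup>2) * \<tau>\<^sup>2 + (- (G + 2 * A) / G\<^sup>2) * \<tau> + (A + 2 * G + E) / G\<^sup>2 + (- (G + 2 * E) / G\<^sup>2) / \<tau> + (E / G\<^sup>2) / \<tau>\<^sup>2"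
      by (simp add: laurent_def A_def G_def E_def power_divide)
    also have "\<dots> = (1 / G\<^sup>2) * (A * \<tau>\<^sup>2 - (G + 2 * A) * \<tau> + (A + 2 * G + E) - (G + 2 * E) / \<tau> + E / \<tau>\<^sup>2)"
      by (simp add: divide_inverse algebra_simps)
    also have "A * \<tau>\<^sup>2 - (G + 2 * A) * \<tau> + (A + 2 * G + E) - (G + 2 * E) / \<tau> + E / \<tau>\<^sup>2 = (1 - \<tau>)\<^sup>2 * (A * \<tau>\<^sup>2 - G * \<tau> + E) / \<tau>\<^sup>2"
      using t by (simp add: field_simps power2_eq_square)
    finally have "laurent ?u ?B ?C ?D ?v \<tau> = (1 - \<tau>)\<^sup>2 * (A * \<tau>\<^sup>2 - G * \<tau> + E) / (G * \<tau>)\<^sup>2"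
      by (simp add: power_mult_distrib)
    then have "laurent ?u ?B ?C ?D ?v \<tau> = ((1 - \<tau>) / (G * \<tau>))\<^sup>2 * (A * \<tau>\<^sup>2 - G * \<tau> + E)" by (simp add: power_divide)
    then show ?thesis unfolding A_def G_def E_def .
  qed
  have FR: "laurent ?u ?B ?C ?D ?v t = ((1 - t) / (\<gamma> * t))\<^sup>2 * (\<alpha>\<^sup>2 * t\<^sup>2 - \<gamma> * t + \<beta>\<^sup>2)" if "t \<noteq> 0" for t :: real
    using F[OF that] by simp
  have le0: "laurent ?u ?B ?C ?D ?v c \<le> 0" if "c > 0" "c = 1 \<or> \<alpha>\<^sup>2 * c\<^sup>2 - \<gamma> * c + \<beta>\<^sup>2 \<le> 0" for c
  proof -
    have "c \<noteq> 0" using that by simp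
    show ?thesis unfolding FR[OF \<open>c \<noteq> 0\<close>] using that(2) by (auto intro: mult_nonneg_nonpos)
  qed
  have ge0: "laurent ?u ?B ?C ?D ?v c \<ge> 0" if "c > 0" "c = 1 \<or> \<alpha>\<^sup>2 * c\<^sup>2 - \<gamma> * c + \<beta>\<^sup>2 \<ge> 0" for c
  proof -
    have "c \<noteq> 0" using that by simp
    show ?thesis unfolding FR[OF \<open>c \<noteq> 0\<close>] using that(2) by (auto intro: mult_nonneg_nonneg)
  qed
  have eq0: "laurent ?u ?B ?C ?D ?v (1::real) = 0" unfolding FR[OF one_neq_zero] by simp
  have R: "resid a1 a2 a3 c1 c2 c3 \<tau> = of_real \<gamma> / (1 - \<tau>)" for \<tau> :: complex
    using a pos by (auto simp: resid_def)
  have one: "(1::complex) \<noteq> \<tau>" if "\<tau> \<noteq> of_real c1" "\<tau> \<noteq> of_real c2" "\<tau> \<noteq> of_real c3" for \<tau>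
    using that a pos by auto
  have g: "c1 > 0" "c2 > 0" using k by auto
  have uu: "?u\<^sup>2 = \<alpha>\<^sup>2 / \<gamma>\<^sup>2" "?v\<^sup>2 = \<beta>\<^sup>2 / \<gamma>\<^sup>2" by (simp_all add: power_divide)
  show ?thesis
  proof (unfold_locales)
    have "- (\<gamma> + 2 * \<alpha>\<^sup>2) = 2 * \<alpha>\<^sup>2 * (c0 - c1 - c2 - c3)" using e(1) by (simp add: algebra_simps)
    then show "?B = 2 * ?u\<^sup>2 * (c0 - c1 - c2 - c3)" unfolding uu by simp
    have "- (\<gamma> + 2 * \<beta>\<^sup>2) = 2 * \<alpha>\<^sup>2 * (c1*c2*c3 - c0 * (c1*c2 + c1*c3 + c2*c3))"
      using e e' unfolding e(3)[symmetric] by algebra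
    then show "?D = 2 * ?u\<^sup>2 * (c1*c2*c3 - c0 * (c1*c2 + c1*c3 + c2*c3))" unfolding uu by simp
    show "c1*c2 + c1*c3 + c2*c3 = c0 * (c1 + c2 + c3)" by (rule e(2))
    show "?v\<^sup>2 = ?u\<^sup>2 * c0 * c1 * c2 * c3" unfolding uu e(3)[symmetric] by (simp add: mult.assoc)
    show "?u * c3\<^sup>2 \<le> ?v" "?v \<le> ?u * c1\<^sup>2" using circ pos by (simp_all add: divide_right_mono)
    show "laurent ?u ?B ?C ?D ?v c1 \<le> 0" by (rule le0[OF g(1) q(1)])
    show "laurent ?u ?B ?C ?D ?v c3 \<le> 0" by (rule le0[OF k(2) q(2)])
    show "0 \<le> laurent ?u ?B ?C ?D ?v c2" by (rule ge0[OF g(2) q(3)])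
    show "0 < laurent ?u ?B ?C ?D ?v t" if t: "t < 0" for t :: real
    proof -
      have t0: "t \<noteq> 0" "1 - t \<noteq> 0" "\<gamma> * t \<noteq> 0" using t pos by auto
      then have "((1 - t) / (\<gamma> * t))\<^sup>2 > 0" by (intro zero_less_power2[THEN iffD2]) simp
      moreover have "\<gamma> * t < 0" using t pos by (simp add: mult_pos_neg)
      moreover have "\<alpha>\<^sup>2 * t\<^sup>2 \<ge> 0" "\<beta>\<^sup>2 \<ge> 0" by auto
      ultimately show ?thesis unfolding FR[OF t0(1)] by (intro mult_pos_pos) linarith+
    qed
    show "a1 + a2 + a3 = \<alpha> / ?u" using a(4) pos by simp
    show "a1 / c1 + a2 / c2 + a3 / c3 = \<gamma>" "a1 / c1\<^sup>2 + a2 / c2\<^sup>2 + a3 / c3\<^sup>2 = \<beta> / ?v" using a pos by auto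
    show "0 < a1 \<Longrightarrow> laurent ?u ?B ?C ?D ?v c1 = 0" "0 < a2 \<Longrightarrow> laurent ?u ?B ?C ?D ?v c2 = 0" "0 < a3 \<Longrightarrow> laurent ?u ?B ?C ?D ?v c3 = 0"
      using a eq0 by auto
    fix \<tau> :: complex assume t: "\<tau> \<noteq> 0" "\<tau> \<noteq> of_real c1" "\<tau> \<noteq> of_real c2" "\<tau> \<noteq> of_real c3"
    note n = one[OF t(2,3,4)]
    have g0: "complex_of_real \<gamma> \<noteq> 0" using pos by simp
    have s1: "(of_real \<gamma> / (1 - \<tau>))\<^sup>2 * ((1 - \<tau>) / (of_real \<gamma> * \<tau>))\<^sup>2 = 1 / \<tau>\<^sup>2"
      using g0 n by (simp add: power_mult_distrib[symmetric]) (simp add: power_divide)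
    have s2: "(of_real \<gamma> - of_real \<gamma> / (1 - \<tau>))\<^sup>2 * ((1 - \<tau>) / (of_real \<gamma> * \<tau>))\<^sup>2 = 1"
    proof -
      have "of_real \<gamma> - of_real \<gamma> / (1 - \<tau>) = - of_real \<gamma> * \<tau> / (1 - \<tau>)" using n by (simp add: field_simps)
      then have "(of_real \<gamma> - of_real \<gamma> / (1 - \<tau>)) * ((1 - \<tau>) / (of_real \<gamma> * \<tau>)) = -1" using n g0 t(1) by simp
      then show ?thesis by (simp add: power_mult_distrib[symmetric])
    qed
    show "(resid a1 a2 a3 c1 c2 c3 \<tau>)\<^sup>2 * laurent ?u ?B ?C ?D ?v \<tau> = of_real (\<alpha>\<^sup>2) - of_real (\<alpha> / ?u) / \<tau> + of_real (\<beta>\<^sup>2) / \<tau>\<^sup>2"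
      unfolding R F[OF t(1)] mult.assoc[symmetric] s1 using t(1) pos by (simp add: field_simps power2_eq_square)
    show "(of_real \<gamma> - resid a1 a2 a3 c1 c2 c3 \<tau>)\<^sup>2 * laurent ?u ?B ?C ?D ?v \<tau> = of_real (\<beta>\<^sup>2) - of_real (\<beta> / ?v) * \<tau> + of_real (\<alpha>\<^sup>2) * \<tau>\<^sup>2"
      unfolding R F[OF t(1)] mult.assoc[symmetric] s2 using t(1) pos by simp
  qed (use pos k g a in auto)
qed

text \<open>The cubic \<open>K\<close> is what remains of the numerator of f' after removing the
  factor \<tau> - 1; its roots \<open>k1\<close>, \<open>k3\<close> and \<open>-c0\<close> are the
  other critical points. The position of 1 relative to k3 < k1 decides which critical point carries
  the pole.\<close>

lemma spectral_curve_subcritical: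
  fixes \<alpha> \<beta> \<gamma> :: real
  assumes pos: "\<alpha> > 0" "\<beta> > 0" "\<gamma> > 0" "2 * \<alpha> * \<beta> < \<gamma>"
  shows "\<exists>u v B C D c0 c1 c2 c3 a1 a2 a3 k l. spectral_curve \<alpha> \<beta> \<gamma> u v B C D c0 c1 c2 c3 a1 a2 a3 k l"
proof -
  define K where "K x = 2 * \<alpha>\<^sup>2 * x^3 - \<gamma> * x\<^sup>2 - \<gamma> * x + 2 * \<beta>\<^sup>2" for x
  \<comment> \<open>Minimum point of the quadratic factor of f. There \<open>K\<close> is negative
    exactly because 2\<alpha>\<beta> < \<gamma>, so \<open>m0\<close> separates the two positive
    roots of \<open>K\<close>.\<close>
  define m0 where "m0 = \<gamma> / (2 * \<alpha>\<^sup>2)"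
  have m0: "m0 > 0" "2 * \<alpha>\<^sup>2 * m0 = \<gamma>" using pos by (auto simp: m0_def)
  have "K m0 = (2 * \<alpha>\<^sup>2 * m0) * m0\<^sup>2 - \<gamma> * m0\<^sup>2 - \<gamma> * m0 + 2 * \<beta>\<^sup>2" by (simp add: K_def power2_eq_square power3_eq_cube)
  then have Km0: "K m0 = 2 * \<beta>\<^sup>2 - \<gamma> * m0" unfolding m0(2) by simp
  have "K m0 * (2 * \<alpha>\<^sup>2) = (2 * \<alpha> * \<beta>)\<^sup>2 - \<gamma>\<^sup>2" 
  proof -
    have "K m0 * (2 * \<alpha>\<^sup>2) = 4 * \<alpha>\<^sup>2 * \<beta>\<^sup>2 - \<gamma> * (2 * \<alpha>\<^sup>2 * m0)" unfolding Km0 by (simp add: algebra_simps)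
    then show ?thesis unfolding m0(2) by (simp add: power2_eq_square)
  qed
  also have "\<dots> < 0" using pos by (simp add: power_strict_mono)
  finally have Kneg: "K m0 < 0" using pos by (simp add: mult_less_0_iff)
  \<comment> \<open>Large enough for K > 0: both \<open>x1 > 1\<close> and \<alpha>^2 x1 \<ge>
    \<gamma> are used to absorb the two negative terms into the cubic one.\<close>
  define x1 where "x1 = 1 + \<gamma> / \<alpha>\<^sup>2"
  have ga: "\<gamma> / \<alpha>\<^sup>2 > 0" using pos by simp
  have x1: "x1 > 1" "x1 > m0" "\<alpha>\<^sup>2 * x1 \<ge> \<gamma>"
  proof -
    show "x1 > 1" using ga by (simp add: x1_def)
    have "m0 = (\<gamma> / \<alpha>\<^sup>2) / 2" by (simp add: m0_def)
    then show "x1 > m0" using ga by (simp add: x1_def)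
    show "\<alpha>\<^sup>2 * x1 \<ge> \<gamma>" using pos by (simp add: x1_def distrib_left)
  qed
  have Kpos: "K x1 > 0"
  proof -
    have "\<gamma> * x1 \<le> \<gamma> * x1\<^sup>2" using x1 pos by (intro mult_left_mono) (auto simp: power2_eq_square)
    moreover have "\<gamma> * x1\<^sup>2 \<le> \<alpha>\<^sup>2 * x1 * x1\<^sup>2" using x1 by (intro mult_right_mono) auto
    moreover have "\<alpha>\<^sup>2 * x1 * x1\<^sup>2 = \<alpha>\<^sup>2 * x1^3" by (simp add: power2_eq_square power3_eq_cube)
    moreover have "\<beta>\<^sup>2 > 0" using pos by simp
    ultimately show ?thesis unfolding K_def by linarith
  qed
  have K0: "K 0 > 0" using pos by (simp add: K_def)
  have cont: "isCont K x" for x unfolding K_def[abs_def] by (intro continuous_intros)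
  obtain k3 where k3: "0 \<le> k3" "k3 \<le> m0" "K k3 = 0" using IVT2[of K m0 0 0] Kneg K0 m0 cont by auto
  obtain k1 where k1: "m0 \<le> k1" "k1 \<le> x1" "K k1 = 0" using IVT[of K m0 0 x1] Kneg Kpos x1 cont by auto
  have kk: "0 < k3" "k3 < m0" "m0 < k1" using k3 k1 K0 Kneg by (auto simp: order_less_le)
  define c0 where "c0 = k1 + k3 - m0"
  have e1: "2 * \<alpha>\<^sup>2 * (c0 - k1 - k3) = - \<gamma>" using m0(2) by (simp add: c0_def algebra_simps)
  have "(k1 - k3) * (2 * \<alpha>\<^sup>2 * (k1\<^sup>2 + k1 * k3 + k3\<^sup>2) - \<gamma> * (k1 + k3) - \<gamma>) = K k1 - K k3" unfolding K_def by algebra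
  then have qd: "2 * \<alpha>\<^sup>2 * (k1\<^sup>2 + k1 * k3 + k3\<^sup>2) - \<gamma> * (k1 + k3) - \<gamma> = 0" using k1 k3 kk by simp
  have e2: "2 * \<alpha>\<^sup>2 * (k1 * k3 - c0 * (k1 + k3)) = - \<gamma>" using e1 qd by algebra
  have e3: "\<alpha>\<^sup>2 * (c0 * (k1 * k3)) = \<beta>\<^sup>2"
  proof -
    have "2 * (\<alpha>\<^sup>2 * (c0 * (k1 * k3))) = 2 * \<beta>\<^sup>2" using k1(3) e1 e2 unfolding K_def by algebra
    then show ?thesis by simp
  qed
  have "c0 * (k1 * k3) > 0" using e3 pos by (metis zero_less_mult_pos zero_less_power)
  moreover have kk0: "k1 * k3 > 0" using kk m0 by simp
  ultimately have c0: "c0 > 0" by (metis zero_less_mult_pos2)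
  have fac: "K x = 2 * \<alpha>\<^sup>2 * ((x - k1) * (x - k3) * (x + c0))" for x
    using e1 e2 e3 unfolding K_def by algebra
  \<comment> \<open>The radius at which the circle condition becomes an equality. \<open>K\<close>
    factorises there and is negative, which puts \<sigma> between \<open>k3\<close> and
    \<open>k1\<close> and yields both inequalities of \<open>circ\<close>.\<close>
  define \<sigma> where "\<sigma> = sqrt (\<beta> / \<alpha>)"
  have sg: "\<sigma> > 0" "\<alpha> * \<sigma>\<^sup>2 = \<beta>" using pos by (auto simp: \<sigma>_def)
  have "K \<sigma> = \<sigma> * (1 + \<sigma>) * (2 * \<alpha> * \<beta> - \<gamma>)" unfolding K_def sg(2)[symmetric] by (simp add: algebra_simps power2_eq_square power3_eq_cube)
  also have "\<dots> < 0" using sg pos by (intro mult_pos_neg mult_pos_pos) auto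
  finally have "(\<alpha>\<^sup>2 * (\<sigma> + c0)) * ((\<sigma> - k1) * (\<sigma> - k3)) < 0" unfolding fac by (simp add: algebra_simps)
  moreover have "\<alpha>\<^sup>2 * (\<sigma> + c0) > 0" using sg c0 pos by simp
  moreover have "Y < 0" if "X * Y < 0" "X > 0" for X Y :: real using that by (simp add: mult_less_0_iff)
  ultimately have "(\<sigma> - k1) * (\<sigma> - k3) < 0" by blast
  then have "\<sigma> - k1 < 0 \<and> 0 < \<sigma> - k3" using kk by (auto simp only: mult_less_0_iff)
  then have sk: "k3 < \<sigma>" "\<sigma> < k1" by auto
  have m3: "\<alpha> * k3\<^sup>2 \<le> \<beta>" unfolding sg(2)[symmetric] using sk kk pos by (intro mult_left_mono power_mono) auto
  have m1: "\<beta> \<le> \<alpha> * k1\<^sup>2" unfolding sg(2)[symmetric] using sk sg pos by (intro mult_left_mono power_mono) auto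
  \<comment> \<open>At a root of \<open>K\<close> the sign of the quadratic factor, hence of a
    nonzero critical value of f, is that of (1 - x)(x - m0). This supplies the hypotheses
    \<open>vals\<close>.\<close>
  have quad: "2 * (\<alpha>\<^sup>2 * x\<^sup>2 - \<gamma> * x + \<beta>\<^sup>2) = 2 * \<alpha>\<^sup>2 * x * ((1 - x) * (x - m0))" if "K x = 0" for x
  proof -
    have "2 * (\<alpha>\<^sup>2 * x\<^sup>2 - \<gamma> * x + \<beta>\<^sup>2) = x * ((1 - x) * (2 * \<alpha>\<^sup>2 * x - \<gamma>)) + K x" unfolding K_def by algebra
    also have "2 * \<alpha>\<^sup>2 * x - \<gamma> = 2 * \<alpha>\<^sup>2 * (x - m0)" unfolding right_diff_distrib m0(2) ..
    finally show ?thesis using that by simp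
  qed
  have half: "2 * y \<le> 0 \<longleftrightarrow> y \<le> 0" "0 \<le> 2 * y \<longleftrightarrow> 0 \<le> y" for y :: real by auto
  have q1: "\<alpha>\<^sup>2 * k1\<^sup>2 - \<gamma> * k1 + \<beta>\<^sup>2 \<le> 0" if "1 \<le> k1"
  proof -
    have "2 * \<alpha>\<^sup>2 * k1 * ((1 - k1) * (k1 - m0)) \<le> 0" using that kk m0 by (intro mult_nonneg_nonpos mult_nonpos_nonneg mult_nonneg_nonneg) auto
    then show ?thesis unfolding quad[OF k1(3), symmetric] by (simp only: half)
  qed
  have q1': "\<alpha>\<^sup>2 * k1\<^sup>2 - \<gamma> * k1 + \<beta>\<^sup>2 \<ge> 0" if "k1 \<le> 1"
  proof -
    have "2 * \<alpha>\<^sup>2 * k1 * ((1 - k1) * (k1 - m0)) \<ge> 0" using that kk m0 by (intro mult_nonneg_nonneg) auto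
    then show ?thesis unfolding quad[OF k1(3), symmetric] by (simp only: half)
  qed
  have q3: "\<alpha>\<^sup>2 * k3\<^sup>2 - \<gamma> * k3 + \<beta>\<^sup>2 \<le> 0" if "k3 \<le> 1"
  proof -
    have "2 * \<alpha>\<^sup>2 * k3 * ((1 - k3) * (k3 - m0)) \<le> 0" using that kk m0 by (intro mult_nonneg_nonpos mult_nonneg_nonneg) auto
    then show ?thesis unfolding quad[OF k3(3), symmetric] by (simp only: half)
  qed
  have q3': "\<alpha>\<^sup>2 * k3\<^sup>2 - \<gamma> * k3 + \<beta>\<^sup>2 \<ge> 0" if "1 \<le> k3"
  proof -
    have "2 * \<alpha>\<^sup>2 * k3 * ((1 - k3) * (k3 - m0)) \<ge> 0" using that kk m0 by (intro mult_nonneg_nonneg mult_nonpos_nonpos) auto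
    then show ?thesis unfolding quad[OF k3(3), symmetric] by (simp only: half)
  qed
  have E2: "k1 * k3 + k1 + k3 = c0 * (1 + k1 + k3)"
  proof -
    have "\<alpha>\<^sup>2 * (k1 * k3 - c0 * (k1 + k3)) = \<alpha>\<^sup>2 * (c0 - k1 - k3)" using e1 e2 by linarith
    then have "k1 * k3 - c0 * (k1 + k3) = c0 - k1 - k3" using pos by simp
    then show ?thesis by (simp add: algebra_simps)
  qed
  let ?S = "spectral_curve \<alpha> \<beta> \<gamma> (\<alpha>/\<gamma>) (\<beta>/\<gamma>) (- (\<gamma> + 2 * \<alpha>\<^sup>2) / \<gamma>\<^sup>2) ((\<alpha>\<^sup>2 + 2 * \<gamma> + \<beta>\<^sup>2) / \<gamma>\<^sup>2) (- (\<gamma> + 2 * \<beta>\<^sup>2) / \<gamma>\<^sup>2) c0"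
  consider "k1 \<le> 1" | "k3 \<le> 1" "1 \<le> k1" | "1 \<le> k3" by linarith
  then have "\<exists>c1 c2 c3 a1 a2 a3. ?S c1 c2 c3 a1 a2 a3 (\<beta>\<^sup>2) (\<alpha>\<^sup>2)"
  proof cases
    case 1
    have m: "\<beta> \<le> \<alpha> * 1\<^sup>2"
    proof -
      have "k1\<^sup>2 \<le> 1\<^sup>2" using 1 kk m0 by (intro power_mono) auto
      then have "\<alpha> * k1\<^sup>2 \<le> \<alpha> * 1\<^sup>2" using pos by (intro mult_left_mono) auto
      then show ?thesis using m1 by linarith
    qed
    have "?S 1 k1 k3 \<gamma> 0 0 (\<beta>\<^sup>2) (\<alpha>\<^sup>2)"
      by (rule spectral_curve_subcritical_aux) (use pos c0 kk 1 m m3 q1' q3 e1 e2 e3 E2 in \<open>simp_all add: algebra_simps\<close>)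
    then show ?thesis by blast
  next
    case 2
    have "?S k1 1 k3 0 \<gamma> 0 (\<beta>\<^sup>2) (\<alpha>\<^sup>2)"
      by (rule spectral_curve_subcritical_aux) (use pos c0 kk 2 m1 m3 q1 q3 e1 e2 e3 E2 in \<open>simp_all add: algebra_simps\<close>)
    then show ?thesis by blast
  next
    case 3
    have m: "\<alpha> * 1\<^sup>2 \<le> \<beta>"
    proof -
      have "1\<^sup>2 \<le> k3\<^sup>2" using 3 by (intro power_mono) auto
      then have "\<alpha> * 1\<^sup>2 \<le> \<alpha> * k3\<^sup>2" using pos by (intro mult_left_mono) auto
      then show ?thesis using m3 by linarith
    qed
    have "?S k1 k3 1 0 0 \<gamma> (\<beta>\<^sup>2) (\<alpha>\<^sup>2)"
      by (rule spectral_curve_subcritical_aux) (use pos c0 kk 3 m m1 q1 q3' e1 e2 e3 E2 in \<open>simp_all add: algebra_simps\<close>)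
    then show ?thesis by blast
  qed
  then show ?thesis by blast
qed

text \<open>Here f is the square of u(\<tau>-c1)(\<tau>-c3)/\<tau> with c1 c3 = 1, so
  \<open>sq\<close> and \<open>sq'\<close> reduce to identities linear in \<open>s\<close>, such as
  s times that function being r/\<tau> - \<alpha>. The critical values at \<open>c1\<close> and
  \<open>c3\<close> are 0 and the one at 1 is positive: both slacks extend to 0 and the band stays
  away from it.\<close>

lemma spectral_curve_supercritical:
  fixes \<alpha> \<beta> \<gamma> :: real
  assumes pos: "\<alpha> > 0" "\<beta> > 0" "\<gamma> > 0" "\<gamma> \<le> 2 * \<alpha> * \<beta>" and M: "(\<alpha> + \<beta>)\<^sup>2 > 2 * \<gamma>"
  shows "\<exists>u v B C D c0 c1 c2 c3 a1 a2 a3 k l. spectral_curve \<alpha> \<beta> \<gamma> u v B C D c0 c1 c2 c3 a1 a2 a3 k l"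
proof -
  define r where "r = sqrt (\<gamma> / 2)"
  have r: "r > 0" "\<gamma> = 2 * r\<^sup>2" using pos by (simp_all add: r_def)
  \<comment> \<open>Value of c1 + c3, dictated by the identity for a1/c1^2 + a3/c3^2, which turns
    into r m - \<alpha> = \<beta>. The hypothesis \<open>M\<close> says m > 2, so that
    \<open>c1\<close> and \<open>c3\<close> are real and distinct.\<close>
  define m where "m = (\<alpha> + \<beta>) / r"
  have mr: "r * m = \<alpha> + \<beta>" using r by (simp add: m_def)
  have "(2 * r)\<^sup>2 < (\<alpha> + \<beta>)\<^sup>2" using M unfolding r(2) by (simp add: power_mult_distrib)
  then have "2 * r < \<alpha> + \<beta>" using pos r by (meson add_pos_pos less_imp_le power_less_imp_less_base)
  then have m2: "m > 2" using r by (simp add: m_def less_divide_eq)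
  define w where "w = sqrt (m\<^sup>2 - 4)"
  have "m\<^sup>2 > 2\<^sup>2" using m2 by (intro power_strict_mono) auto
  then have w: "w > 0" "w\<^sup>2 = m\<^sup>2 - 4" by (auto simp: w_def)
  define c1 c3 where "c1 = (m + w) / 2" and "c3 = (m - w) / 2"
  have sum: "c1 + c3 = m" unfolding c1_def c3_def add_divide_distrib[symmetric] by simp
  have pr: "c1 * c3 = 1" using w(2) by (simp add: c1_def c3_def algebra_simps power2_eq_square)
  have c13: "c3 < c1" using w by (simp add: c1_def c3_def)
  have cp: "c1 > 0" "c3 > 0"
  proof -
    show "c1 > 0" using w m2 by (simp add: c1_def)
    then show "c3 > 0" using pr by (metis zero_less_mult_pos zero_less_one)
  qed
  have c1g: "c1 > 1" and c3l: "c3 < 1"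
  proof -
    show "c1 > 1" using m2 w by (simp add: c1_def)
    then have "1 * c3 < c1 * c3" using cp(2) by (rule mult_strict_right_mono)
    then show "c3 < 1" using pr by simp
  qed
  define u where "u = 1 / (2 * r)"
  have u: "u > 0" "2 * r * u = 1" using r by (simp_all add: u_def)
  define a1 a3 where "a1 = 2 * r * (\<alpha> * c1 - r) / (c1 - c3)" and "a3 = 2 * r * (r - \<alpha> * c3) / (c1 - c3)"
  \<comment> \<open>The product equals \<alpha>\<beta> - r^2, whose sign is the condition \<gamma>
    \<le> 2\<alpha>\<beta>. As the two factors have positive sum, both are nonnegative, and so are
    the weights.\<close>
  have kq: "(\<alpha> * c1 - r) * (r - \<alpha> * c3) \<ge> 0"
  proof -
    have "(\<alpha> * c1 - r) * (r - \<alpha> * c3) = \<alpha> * (r * (c1 + c3)) - r\<^sup>2 - \<alpha>\<^sup>2 * (c1 * c3)" by (simp add: algebra_simps power2_eq_square)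
    also have "\<dots> = \<alpha> * \<beta> - r\<^sup>2" unfolding sum pr mr by (simp add: algebra_simps power2_eq_square)
    finally show ?thesis using pos(4) r(2) by simp
  qed
  have a0: "a1 \<ge> 0" "a3 \<ge> 0"
  proof -
    have lt: "\<alpha> * c3 < \<alpha> * c1" using c13 pos by simp
    then have "\<alpha> * c1 - r \<ge> 0 \<and> r - \<alpha> * c3 \<ge> 0" using kq by (auto simp: zero_le_mult_iff)
    then show "a1 \<ge> 0" "a3 \<ge> 0" using r c13 by (auto simp: a1_def a3_def)
  qed
  let ?B = "- (2 * m * u\<^sup>2)" and ?C = "u\<^sup>2 * (2 + m\<^sup>2)"
  have L: "laurent u ?B ?C ?B u \<tau> = (of_real u * ((\<tau> - of_real c1) * (\<tau> - of_real c3)) / \<tau>)\<^sup>2"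
    if t: "\<tau> \<noteq> 0" for \<tau> :: "'b::{real_field,field}"
  proof -
    have q: "(\<tau> - of_real c1) * (\<tau> - of_real c3) = \<tau>\<^sup>2 - of_real m * \<tau> + 1"
      unfolding sum[symmetric] using arg_cong[OF pr, of "of_real :: real \<Rightarrow> 'b"] by (simp add: algebra_simps power2_eq_square)
    show ?thesis unfolding q laurent_def using t by (simp add: field_simps power2_eq_square)
  qed
  have Lr: "laurent u ?B ?C ?B u t = (u * ((t - c1) * (t - c3)) / t)\<^sup>2" if "t \<noteq> 0" for t :: real
    using L[OF that] by simp
  have S: "resid a1 0 a3 c1 1 c3 \<tau> = of_real (2 * r) * (of_real r - of_real \<alpha> * \<tau>) / ((\<tau> - of_real c1) * (\<tau> - of_real c3))"
    if t: "\<tau> \<noteq> of_real c1" "\<tau> \<noteq> of_real c3" for \<tau> :: "'b::{real_field,field}"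
  proof -
    have d: "of_real c1 - of_real c3 \<noteq> (0::'b)" using c13 by simp
    have n: "of_real c1 - \<tau> \<noteq> 0" "of_real c3 - \<tau> \<noteq> 0" "\<tau> - of_real c1 \<noteq> 0" "\<tau> - of_real c3 \<noteq> 0" using t by auto
    have "(of_real \<alpha> * of_real c1 - of_real r) * (of_real c3 - \<tau>) + (of_real r - of_real \<alpha> * of_real c3) * (of_real c1 - \<tau>) = (of_real c1 - of_real c3) * (of_real r - of_real \<alpha> * \<tau>)"
      by (simp add: algebra_simps)
    then have "(of_real \<alpha> * of_real c1 - of_real r) / (of_real c1 - \<tau>) + (of_real r - of_real \<alpha> * of_real c3) / (of_real c3 - \<tau>)
      = (of_real c1 - of_real c3) * (of_real r - of_real \<alpha> * \<tau>) / ((of_real c1 - \<tau>) * (of_real c3 - \<tau>))"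
      using n by (simp add: add_frac_eq)
    also have "(of_real c1 - \<tau>) * (of_real c3 - \<tau>) = (\<tau> - of_real c1) * (\<tau> - of_real c3)" by (simp add: algebra_simps)
    finally have A: "(of_real \<alpha> * of_real c1 - of_real r) / (of_real c1 - \<tau>) + (of_real r - of_real \<alpha> * of_real c3) / (of_real c3 - \<tau>)
      = (of_real c1 - of_real c3) * (of_real r - of_real \<alpha> * \<tau>) / ((\<tau> - of_real c1) * (\<tau> - of_real c3))" .
    have "resid a1 0 a3 c1 1 c3 \<tau> = (of_real (2 * r) / (of_real c1 - of_real c3)) * ((of_real \<alpha> * of_real c1 - of_real r) / (of_real c1 - \<tau>) + (of_real r - of_real \<alpha> * of_real c3) / (of_real c3 - \<tau>))"
      by (simp add: resid_def a1_def a3_def distrib_left)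
    then show ?thesis unfolding A using d by simp
  qed
  have s0: "a1 / c1 + 0 / 1 + a3 / c3 = \<gamma>"
    using S[of "0::real"] cp pr r(2) by (simp add: resid_def power2_eq_square)
  have "spectral_curve \<alpha> \<beta> \<gamma> u u ?B ?C ?B 1 c1 1 c3 a1 0 a3 (r\<^sup>2) (r\<^sup>2)"
  proof (unfold_locales)
    show "?B = 2 * u\<^sup>2 * (1 - c1 - 1 - c3)" unfolding sum[symmetric] by (simp add: algebra_simps)
    show "c1 * 1 + c1 * c3 + 1 * c3 = 1 * (c1 + 1 + c3)" unfolding pr by simp
    show "?B = 2 * u\<^sup>2 * (c1 * 1 * c3 - 1 * (c1 * 1 + c1 * c3 + 1 * c3))" unfolding sum[symmetric] using pr by (simp add: algebra_simps)
    show "u\<^sup>2 = u\<^sup>2 * 1 * c1 * 1 * c3" using pr by (simp add: mult.assoc)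
    show "u * c3\<^sup>2 \<le> u" "u \<le> u * c1\<^sup>2" using u c1g c3l cp by (simp_all add: power_le_one)
    show "laurent u ?B ?C ?B u c1 \<le> 0" "laurent u ?B ?C ?B u c3 \<le> 0"
      "0 \<le> laurent u ?B ?C ?B u (1::real)"
      "0 < a1 \<Longrightarrow> laurent u ?B ?C ?B u c1 = 0"
      "0 < a3 \<Longrightarrow> laurent u ?B ?C ?B u c3 = 0"
      using cp by (simp_all add: Lr)
    show "0 < laurent u ?B ?C ?B u t" if "t < 0" for t :: real
    proof -
      have "t \<noteq> 0" "u * ((t - c1) * (t - c3)) / t \<noteq> 0" using that u cp by auto
      then show ?thesis unfolding Lr[OF \<open>t \<noteq> 0\<close>] by (intro zero_less_power2[THEN iffD2])
    qed
    have "a1 + a3 = 2 * r * (\<alpha> * (c1 - c3)) / (c1 - c3)" by (simp add: a1_def a3_def add_divide_distrib[symmetric] algebra_simps)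
    also have "\<dots> = 2 * r * \<alpha>" using c13 by simp
    also have "\<dots> = \<alpha> / u" using r by (simp add: u_def)
    finally have a13: "a1 + a3 = \<alpha> / u" .
    then show "a1 + 0 + a3 = \<alpha> / u" by simp
    show "a1 / c1 + 0 / 1 + a3 / c3 = \<gamma>" by (rule s0)
    show "a1 / c1\<^sup>2 + 0 / 1\<^sup>2 + a3 / c3\<^sup>2 = \<beta> / u"
    proof -
      have i: "1 / c1 = c3" "1 / c3 = c1" using pr cp by (simp_all add: field_simps)
      have ii: "a1 / c1 = a1 * (1 / c1)" "a3 / c3 = a3 * (1 / c3)" "a1 / c1\<^sup>2 = a1 * (1 / c1)\<^sup>2" "a3 / c3\<^sup>2 = a3 * (1 / c3)\<^sup>2"
        by (simp_all add: power_divide)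
      have "a1 / c1 = a1 * c3" "a3 / c3 = a3 * c1" using ii(1,2) unfolding i by simp_all
      then have g: "a1 * c3 + a3 * c1 = \<gamma>" using s0 by simp
      have j: "a1 / c1\<^sup>2 = a1 * c3\<^sup>2" "a3 / c3\<^sup>2 = a3 * c1\<^sup>2" using ii(3,4) unfolding i by simp_all
      have "a1 * c3\<^sup>2 + a3 * c1\<^sup>2 = (c1 + c3) * (a1 * c3 + a3 * c1) - (c1 * c3) * (a1 + a3)" by (simp add: algebra_simps power2_eq_square)
      also have "\<dots> = m * \<gamma> - 2 * r * \<alpha>" unfolding sum pr g using a13 r by (simp add: u_def)
      also have "\<dots> = 2 * r * (r * m) - 2 * r * \<alpha>" unfolding r(2) by (simp add: power2_eq_square)
      also have "\<dots> = \<beta> / u" unfolding mr u_def using r by (simp add: algebra_simps)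
      finally show ?thesis unfolding j by simp
    qed
    fix \<tau> :: complex assume t: "\<tau> \<noteq> 0" "\<tau> \<noteq> of_real c1" "\<tau> \<noteq> of_real 1" "\<tau> \<noteq> of_real c3"
    let ?q = "(\<tau> - of_real c1) * (\<tau> - of_real c3)"
    have q0: "?q \<noteq> 0" using t by simp
    have gen: "X * N / Q * (U * Q / T) = (X * U) * N / T" if "Q \<noteq> 0" for X N Q U T :: complex using that by simp
    have ru: "complex_of_real (2 * r) * of_real u = 1" unfolding of_real_mult[symmetric] u(2) by simp
    have "resid a1 0 a3 c1 1 c3 \<tau> * (of_real u * ?q / \<tau>) = (complex_of_real (2 * r) * of_real u) * (of_real r - of_real \<alpha> * \<tau>) / \<tau>"
      unfolding S[OF t(2,4)] by (rule gen[OF q0])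
    then have A: "resid a1 0 a3 c1 1 c3 \<tau> * (of_real u * ?q / \<tau>) = of_real r / \<tau> - of_real \<alpha>" unfolding ru using t(1) by (simp add: field_simps)
    have gr: "\<alpha> / u = 2 * \<alpha> * r" "\<beta> / u = 2 * \<beta> * r" using r by (simp_all add: u_def)
    show "(resid a1 0 a3 c1 1 c3 \<tau>)\<^sup>2 * laurent u ?B ?C ?B u \<tau> = of_real (\<alpha>\<^sup>2) - of_real (\<alpha> / u) / \<tau> + of_real (r\<^sup>2) / \<tau>\<^sup>2"
      unfolding L[OF t(1)] power_mult_distrib[symmetric] A gr by (simp add: power2_eq_square algebra_simps)
    have gu: "complex_of_real \<gamma> * (of_real u * ?q / \<tau>) = of_real r * (\<tau> - of_real m + 1 / \<tau>)"
    proof -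
      have "\<gamma> * u = r * (2 * r * u)" unfolding r(2) by (simp add: power2_eq_square)
      then have "\<gamma> * u = r" unfolding u(2) by simp
      then have "complex_of_real \<gamma> * of_real u = of_real r" by (metis of_real_mult)
      moreover have "?q / \<tau> = \<tau> - of_real m + 1 / \<tau>"
        unfolding sum[symmetric] using arg_cong[OF pr, of complex_of_real] t(1) by (simp add: field_simps)
      ultimately show ?thesis by (metis mult.assoc times_divide_eq_right)
    qed
    have rm: "complex_of_real r * of_real m = of_real \<alpha> + of_real \<beta>" using mr by (metis of_real_add of_real_mult)
    have "(of_real \<gamma> - resid a1 0 a3 c1 1 c3 \<tau>) * (of_real u * ?q / \<tau>) = of_real r * (\<tau> - of_real m + 1 / \<tau>) - (of_real r / \<tau> - of_real \<alpha>)"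
      unfolding left_diff_distrib[of "of_real \<gamma>"] A gu ..
    also have "\<dots> = of_real r * \<tau> - of_real \<beta>" using rm by (simp add: algebra_simps)
    finally have A': "(of_real \<gamma> - resid a1 0 a3 c1 1 c3 \<tau>) * (of_real u * ?q / \<tau>) = of_real r * \<tau> - of_real \<beta>" .
    show "(of_real \<gamma> - resid a1 0 a3 c1 1 c3 \<tau>)\<^sup>2 * laurent u ?B ?C ?B u \<tau> = of_real (\<beta>\<^sup>2) - of_real (\<beta> / u) * \<tau> + of_real (r\<^sup>2) * \<tau>\<^sup>2"
      unfolding L[OF t(1)] power_mult_distrib[symmetric] A' gr by (simp add: power2_eq_square algebra_simps)
  qed (use pos u cp c1g c3l c13 a0 in auto)
  then show ?thesis by blast
qed

text \<open>The preceding curve with \<open>c1\<close> and \<open>c3\<close> merged at 1. The two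
  separating circles coincide, which is the situation \<open>degen\<close> is about; on |\<tau>| = 1
  the expression (1-\<tau>)^2/\<tau> = 2 Re \<tau> - 2 is real, so its square is
  nonnegative.\<close>

lemma spectral_curve_double_critical:
  fixes \<alpha> :: real
  assumes pos: "\<alpha> > 0"
  shows "\<exists>u v B C D c0 c1 c2 c3 a1 a2 a3 k l. spectral_curve \<alpha> \<alpha> (2 * \<alpha>\<^sup>2) u v B C D c0 c1 c2 c3 a1 a2 a3 k l"
proof -
  define u where "u = 1 / (2 * \<alpha>)"
  have u: "u > 0" "2 * \<alpha> * u = 1" using pos by (simp_all add: u_def)
  have L: "laurent u (- (4 * u\<^sup>2)) (6 * u\<^sup>2) (- (4 * u\<^sup>2)) u \<tau> = (of_real u * (1 - \<tau>)\<^sup>2 / \<tau>)\<^sup>2" if "\<tau> \<noteq> 0" for \<tau> :: "'b::{real_field,field}"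
    unfolding laurent_def using that by (simp add: field_simps power2_eq_square)
  have Lr: "laurent u (- (4 * u\<^sup>2)) (6 * u\<^sup>2) (- (4 * u\<^sup>2)) u t = (u * (1 - t)\<^sup>2 / t)\<^sup>2" if "t \<noteq> 0" for t :: real
    using L[OF that] by simp
  have "spectral_curve \<alpha> \<alpha> (2 * \<alpha>\<^sup>2) u u (- (4 * u\<^sup>2)) (6 * u\<^sup>2) (- (4 * u\<^sup>2)) 1 1 1 1 (2 * \<alpha>\<^sup>2) 0 0 (\<alpha>\<^sup>2) (\<alpha>\<^sup>2)"
  proof (unfold_locales)
    show "0 < laurent u (- (4 * u\<^sup>2)) (6 * u\<^sup>2) (- (4 * u\<^sup>2)) u t" if "t < 0" for t :: real
    proof -
      have "t \<noteq> 0" "u * (1 - t)\<^sup>2 / t \<noteq> 0" using that u by auto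
      then show ?thesis unfolding Lr[OF \<open>t \<noteq> 0\<close>] by (intro zero_less_power2[THEN iffD2])
    qed
    show "laurent u (- (4 * u\<^sup>2)) (6 * u\<^sup>2) (- (4 * u\<^sup>2)) u (1::real) \<le> 0" unfolding Lr[OF one_neq_zero] by simp
    show "0 \<le> laurent u (- (4 * u\<^sup>2)) (6 * u\<^sup>2) (- (4 * u\<^sup>2)) u (1::real)" "laurent u (- (4 * u\<^sup>2)) (6 * u\<^sup>2) (- (4 * u\<^sup>2)) u (1::real) = 0" unfolding Lr[OF one_neq_zero] by simp_all
    have au: "\<alpha> / u = 2 * \<alpha>\<^sup>2" using pos by (simp add: u_def power2_eq_square)
    then show "2 * \<alpha>\<^sup>2 + 0 + 0 = \<alpha> / u" "2 * \<alpha>\<^sup>2 / 1\<^sup>2 + 0 / 1\<^sup>2 + 0 / 1\<^sup>2 = \<alpha> / u" by simp_all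
    show "0 \<le> Re (laurent u (- (4 * u\<^sup>2)) (6 * u\<^sup>2) (- (4 * u\<^sup>2)) u \<tau>)" if t: "cmod \<tau> = 1" for \<tau>
    proof -
      have n: "(Re \<tau>)\<^sup>2 + (Im \<tau>)\<^sup>2 = 1" using t by (metis cmod_power2 one_power2)
      then have "\<tau> * cnj \<tau> = 1" using t by (simp add: complex_norm_square[symmetric])
      then have i: "1 / \<tau> = cnj \<tau>" by (metis div_by_1 mult_zero_left nonzero_mult_div_cancel_left times_divide_eq_right zero_neq_one)
      have t0: "\<tau> \<noteq> 0" using t by auto
      have "of_real u * (1 - \<tau>)\<^sup>2 / \<tau> = of_real u * (1 / \<tau> - 2 + \<tau>)" using t0 by (simp add: field_simps power2_eq_square)
      also have "\<dots> = of_real (u * (2 * Re \<tau> - 2))" unfolding i by (simp add: complex_eq_iff)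
      finally show ?thesis unfolding L[OF t0] by (simp flip: of_real_power)
    qed
    fix \<tau> :: complex assume t: "\<tau> \<noteq> 0" "\<tau> \<noteq> of_real 1" "\<tau> \<noteq> of_real 1" "\<tau> \<noteq> of_real 1"
    then have n: "1 - \<tau> \<noteq> 0" by simp
    have R: "resid (2 * \<alpha>\<^sup>2) 0 0 1 1 1 \<tau> = 2 * of_real \<alpha> * of_real \<alpha> / (1 - \<tau>)" by (simp add: resid_def power2_eq_square)
    have ua: "2 * of_real \<alpha> * complex_of_real u = 1" using arg_cong[OF u(2), of complex_of_real] by simp
    have "resid (2 * \<alpha>\<^sup>2) 0 0 1 1 1 \<tau> * (of_real u * (1 - \<tau>)\<^sup>2 / \<tau>) = (2 * of_real \<alpha> * complex_of_real u) * (of_real \<alpha> * (1 - \<tau>) / \<tau>)"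
      unfolding R using n t(1) by (simp add: field_simps power2_eq_square)
    then have A: "resid (2 * \<alpha>\<^sup>2) 0 0 1 1 1 \<tau> * (of_real u * (1 - \<tau>)\<^sup>2 / \<tau>) = of_real \<alpha> / \<tau> - of_real \<alpha>"
      unfolding ua using t(1) by (simp add: field_simps)
    show "(resid (2 * \<alpha>\<^sup>2) 0 0 1 1 1 \<tau>)\<^sup>2 * laurent u (- (4 * u\<^sup>2)) (6 * u\<^sup>2) (- (4 * u\<^sup>2)) u \<tau> = of_real (\<alpha>\<^sup>2) - of_real (\<alpha> / u) / \<tau> + of_real (\<alpha>\<^sup>2) / \<tau>\<^sup>2"
      unfolding L[OF t(1)] power_mult_distrib[symmetric] A au by (simp add: power2_eq_square algebra_simps)
    have E: "complex_of_real (2 * \<alpha>\<^sup>2) - resid (2 * \<alpha>\<^sup>2) 0 0 1 1 1 \<tau> = - (2 * of_real \<alpha> * of_real \<alpha> * \<tau> / (1 - \<tau>))"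
      unfolding R using n by (simp add: field_simps power2_eq_square)
    have "(complex_of_real (2 * \<alpha>\<^sup>2) - resid (2 * \<alpha>\<^sup>2) 0 0 1 1 1 \<tau>) * (of_real u * (1 - \<tau>)\<^sup>2 / \<tau>) = - ((2 * of_real \<alpha> * complex_of_real u) * (of_real \<alpha> * (1 - \<tau>)))"
      unfolding E using n t(1) by (simp add: field_simps power2_eq_square)
    then have A': "(complex_of_real (2 * \<alpha>\<^sup>2) - resid (2 * \<alpha>\<^sup>2) 0 0 1 1 1 \<tau>) * (of_real u * (1 - \<tau>)\<^sup>2 / \<tau>) = of_real \<alpha> * \<tau> - of_real \<alpha>"
      unfolding ua by (simp add: algebra_simps)
    show "(complex_of_real (2 * \<alpha>\<^sup>2) - resid (2 * \<alpha>\<^sup>2) 0 0 1 1 1 \<tau>)\<^sup>2 * laurent u (- (4 * u\<^sup>2)) (6 * u\<^sup>2) (- (4 * u\<^sup>2)) u \<tau> = of_real (\<alpha>\<^sup>2) - of_real (\<alpha> / u) * \<tau> + of_real (\<alpha>\<^sup>2) * \<tau>\<^sup>2"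
      unfolding L[OF t(1)] power_mult_distrib[symmetric] A' au by (simp add: power2_eq_square algebra_simps)
  qed (use pos u in auto)
  then show ?thesis by blast
qed

theorem spectral_curve_exists:
  fixes \<alpha> \<beta> \<gamma> :: real
  assumes "\<alpha> > 0" "\<beta> > 0" "\<gamma> > 0"
  shows "\<exists>u v B C D c0 c1 c2 c3 a1 a2 a3 k l. spectral_curve \<alpha> \<beta> \<gamma> u v B C D c0 c1 c2 c3 a1 a2 a3 k l"
proof -
  consider "2 * \<alpha> * \<beta> < \<gamma>" | "\<gamma> \<le> 2 * \<alpha> * \<beta>" "(\<alpha> + \<beta>)\<^sup>2 > 2 * \<gamma>" | "\<gamma> \<le> 2 * \<alpha> * \<beta>" "(\<alpha> + \<beta>)\<^sup>2 \<le> 2 * \<gamma>" by linarith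
  then show ?thesis
  proof cases
    case 1 then show ?thesis using spectral_curve_subcritical assms by blast
  next
    case 2 then show ?thesis using spectral_curve_supercritical assms by blast
  next
    \<comment> \<open>The two inequalities pinch: (\<alpha>+\<beta>)^2 \<le> 2\<gamma> \<le>
      4\<alpha>\<beta> forces \<alpha> = \<beta> and then \<gamma> = 2\<alpha>^2.\<close>
    case 3
    have "(\<alpha> - \<beta>)\<^sup>2 = (\<alpha> + \<beta>)\<^sup>2 - 4 * \<alpha> * \<beta>" by (simp add: power2_eq_square algebra_simps)
    then have "(\<alpha> - \<beta>)\<^sup>2 \<le> 0" using 3 by simp
    then have "\<alpha> = \<beta>" by simp
    moreover have "\<gamma> = 2 * \<alpha>\<^sup>2" using 3 calculation by (simp add: power2_eq_square algebra_simps)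
    ultimately show ?thesis using spectral_curve_double_critical[OF assms(1)] by simp
  qed
qed

section \<open>From the Euler--Lagrange conditions to the unique minimizer\<close>

abbreviation dmeas :: "(real \<Rightarrow> real) \<Rightarrow> real measure" where
  "dmeas h \<equiv> density lborel (\<lambda>x. ennreal (h x))"

lemma emeasure_dmeas: "h \<in> borel_measurable borel \<Longrightarrow> A \<in> sets borel \<Longrightarrow> emeasure (dmeas h) A = (\<integral>\<^sup>+x. ennreal (h x) * indicator A x \<partial>lborel)"
  by (subst emeasure_density) auto

text \<open>A ball about a point of the closure contains an interval inside S on which h > 0, and
  such an interval cannot be null; a ball that avoids the closure carries no mass.\<close>

lemma supp_of_dmeas:
  assumes [measurable]: "h \<in> borel_measurable borel" and S: "open S" "\<And>x. x \<in> S \<Longrightarrow> h x > 0" "\<And>x. x \<notin> closure S \<Longrightarrow> h x = 0"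
  shows "supp_of (emeasure (dmeas h)) = closure S"
proof (intro set_eqI iffI)
  fix x assume x: "x \<in> supp_of (emeasure (dmeas h))"
  show "x \<in> closure S"
  proof (rule ccontr)
    assume "x \<notin> closure S"
    then obtain e where e: "e > 0" "ball x e \<subseteq> - closure S" using open_contains_ball[of "- closure S"] by auto
    have z: "ennreal (h y) * indicator (ball x e) y = 0" for y
      using S(3)[of y] e(2) by (auto simp: indicator_def)
    then have "emeasure (dmeas h) (ball x e) = 0"
      by (simp only: emeasure_dmeas[OF assms(1)] z borel_open open_ball nn_integral_const) simp
    then show False using x e(1) by (auto simp: supp_of_def)
  qed
next
  fix x assume x: "x \<in> closure S"
  show "x \<in> supp_of (emeasure (dmeas h))" unfolding supp_of_def
  proof (intro CollectI allI impI)
    fix e :: real assume "e > 0"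
    then obtain y where y: "y \<in> S" "dist y x < e" using x by (meson closure_approachable)
    have "open (S \<inter> ball x e)" using S(1) by auto
    moreover have "y \<in> S \<inter> ball x e" using y by (simp add: dist_commute)
    ultimately obtain d where d: "d > 0" "ball y d \<subseteq> S \<inter> ball x e" using open_contains_ball by metis
    have "emeasure (dmeas h) (ball x e) \<noteq> 0"
    proof
      assume "emeasure (dmeas h) (ball x e) = 0"
      then have "(\<integral>\<^sup>+z. ennreal (h z) * indicator (ball x e) z \<partial>lborel) = 0"
        unfolding emeasure_dmeas[OF assms(1) borel_open[OF open_ball]] .
      then have "AE z in lborel. ennreal (h z) * indicator (ball x e) z = 0"
        by (rule nn_integral_0_iff_AE[THEN iffD1, rotated]) (unfold ball_eq_greaterThanLessThan, measurable)
      then have "AE z in lborel. z \<notin> ball y d"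
      proof eventually_elim
        case (elim z)
        show ?case
        proof
          assume "z \<in> ball y d"
          then have "z \<in> S" "z \<in> ball x e" using d(2) by auto
          then show False using elim S(2)[of z] by (simp add: indicator_def)
        qed
      qed
      then have "emeasure lborel {y - d <..< y + d} = 0"
        unfolding ball_eq_greaterThanLessThan by (subst (asm) AE_iff_measurable[OF _ refl]) (auto simp: greaterThanLessThan_def greaterThan_def lessThan_def Int_def)
      then show False using d(1) by simp
    qed
    then show "emeasure (dmeas h) (ball x e) > 0" using zero_less_iff_neq_zero by blast
  qed
qed

lemma measure_cond:
  assumes "borel_meas \<nu>" "emeasure \<nu> UNIV = ennreal m" "m \<ge> 0"
  shows "sets \<nu> = sets borel" "space \<nu> = UNIV" "finite_measure \<nu>" "measure \<nu> UNIV = m"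
proof -
  show s: "sets \<nu> = sets borel" using assms(1) by (simp add: borel_meas_def)
  show sp: "space \<nu> = UNIV" using sets_eq_imp_space_eq[OF s] by simp
  show "finite_measure \<nu>" by (rule finite_measureI) (simp add: sp assms)
  show "measure \<nu> UNIV = m" using assms by (simp add: measure_def)
qed

lemma dmeas_ln_integrable:
  assumes [measurable]: "h \<in> borel_measurable borel" and h: "\<And>y. 0 \<le> h y" "\<And>y. h y \<le> K * wt y"
  shows "integrable (dmeas h) (\<lambda>x. ln (1 + \<bar>x\<bar>))"
proof -
  have "integrable lborel (\<lambda>x. h x *\<^sub>R ln (1 + \<bar>x\<bar>))"
  proof (rule Bochner_Integration.integrable_bound)
    show "integrable lborel (\<lambda>x. K * (ln (1 + \<bar>x\<bar>) * wt x))" using wt_ln_integrable by (rule integrable_mult_right)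
    show "AE x in lborel. norm (h x *\<^sub>R ln (1 + \<bar>x\<bar>)) \<le> norm (K * (ln (1 + \<bar>x\<bar>) * wt x))"
    proof (rule AE_I2)
      fix x :: real
      have "h x * ln (1 + \<bar>x\<bar>) \<le> K * wt x * ln (1 + \<bar>x\<bar>)" using h(2) by (intro mult_right_mono) auto
      moreover have "h x * ln (1 + \<bar>x\<bar>) \<ge> 0" using h(1) by simp
      ultimately show "norm (h x *\<^sub>R ln (1 + \<bar>x\<bar>)) \<le> norm (K * (ln (1 + \<bar>x\<bar>) * wt x))" by (simp add: mult_ac)
    qed
  qed measurable
  then show ?thesis using h(1) by (subst integrable_density) auto
qed

lemma rho_split:
  assumes cd: "constrained_density c h d r" and A: "A \<in> sets borel"
  shows "emeasure (rho c) A = emeasure (dmeas h) A + emeasure (dmeas d) A"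
proof -
  have [measurable]: "h \<in> borel_measurable borel" "d \<in> borel_measurable borel" using cd by (auto simp: constrained_density_def)
  have e: "ennreal (indicator {..0} x * (c / pi) * \<bar>x\<bar> powr (-1/2)) = ennreal (h x) + ennreal (d x)" for x
  proof -
    consider "x < 0" | "x = 0" | "x > 0" by linarith
    then have "indicator {..0} x * (c / pi) * \<bar>x\<bar> powr (-1/2) = h x + d x"
    proof cases
      case 1
      have "\<bar>x\<bar> powr (-1/2) = 1 / sqrt \<bar>x\<bar>" using 1 by (simp add: powr_minus_divide powr_half_sqrt)
      moreover have "h x + d x = c / (pi * sqrt \<bar>x\<bar>)" using cd 1 by (simp add: constrained_density_def)
      ultimately show ?thesis using 1 by simp
    qed (use cd in \<open>auto simp: constrained_density_def\<close>)
    moreover have "h x \<ge> 0" "d x \<ge> 0" using cd by (auto simp: constrained_density_def)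
    ultimately show ?thesis by simp
  qed
  have "emeasure (rho c) A = (\<integral>\<^sup>+x. (ennreal (h x) + ennreal (d x)) * indicator A x \<partial>lborel)"
    unfolding rho_def e using A by (subst emeasure_density) auto
  also have "\<dots> = (\<integral>\<^sup>+x. ennreal (h x) * indicator A x + ennreal (d x) * indicator A x \<partial>lborel)" by (simp add: distrib_right)
  also have "\<dots> = emeasure (dmeas h) A + emeasure (dmeas d) A" using A by (simp add: nn_integral_add emeasure_dmeas)
  finally show ?thesis .
qed

text \<open>The set function rho - \<mu> is a difference of extended nonnegative reals. Since rho
  splits as \<mu> plus the slack and \<mu> is finite, it is a genuine measure even on sets where rho
  is infinite; on nonmeasurable sets every term is 0.\<close>

lemma constrained_measure:
  assumes cd: "constrained_density c h d r"
  shows "cond_neg (rho c) (dmeas h)" "supp_of (emeasure (dmeas h)) = {..0}"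
    "(\<lambda>A. emeasure (rho c) A - emeasure (dmeas h) A) = emeasure (dmeas d)" "supp_of (emeasure (dmeas d)) = {..-r}"
    "is_density d (emeasure (dmeas d))"
proof -
  have m[measurable]: "h \<in> borel_measurable borel" "d \<in> borel_measurable borel" using cd by (auto simp: constrained_density_def)
  obtain K where K: "\<And>x. h x \<le> K * wt x" using cd by (auto simp: constrained_density_def)
  have nn: "\<And>x. 0 \<le> h x" using cd by (simp add: constrained_density_def)
  note F = finite_measure_density_wt[OF m(1) nn K]
  have mass: "emeasure (dmeas h) UNIV = ennreal (1/2)"
  proof -
    have "(\<integral>x. h x \<partial>lborel) = 1/2" using cd unfolding constrained_density_def by blast
    then show ?thesis using F(3) by (simp only:)
  qed
  show "cond_neg (rho c) (dmeas h)" unfolding cond_neg_def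
  proof (intro conjI ballI)
    show "borel_meas (dmeas h)" by (simp add: borel_meas_def)
    have z: "ennreal (h x) * indicator {0<..} x = 0" for x using cd by (auto simp: constrained_density_def indicator_def)
    show "emeasure (dmeas h) {0<..} = 0" by (simp only: emeasure_dmeas[OF m(1) borel_open[OF open_greaterThan]] z nn_integral_const) simp
    show "emeasure (dmeas h) UNIV = ennreal (1/2)" by (rule mass)
    show "emeasure (dmeas h) A \<le> emeasure (rho c) A" if "A \<in> sets borel" for A using rho_split[OF cd that] by simp
  qed
  have "supp_of (emeasure (dmeas h)) = closure {..<0}"
    by (rule supp_of_dmeas) (use cd in \<open>auto simp: constrained_density_def\<close>)
  then show "supp_of (emeasure (dmeas h)) = {..0}" by simp
  have "supp_of (emeasure (dmeas d)) = closure {..<-r}"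
    by (rule supp_of_dmeas) (use cd in \<open>auto simp: constrained_density_def\<close>)
  then show "supp_of (emeasure (dmeas d)) = {..-r}" by simp
  show "(\<lambda>A. emeasure (rho c) A - emeasure (dmeas h) A) = emeasure (dmeas d)"
  proof
    fix A
    show "emeasure (rho c) A - emeasure (dmeas h) A = emeasure (dmeas d) A"
    proof (cases "A \<in> sets borel")
      case True
      have "emeasure (dmeas h) A \<noteq> top" using finite_measure.emeasure_finite[OF F(2)] by simp
      then show ?thesis unfolding rho_split[OF cd True] by simp
    next
      case False
      then have "A \<notin> sets (rho c)" "A \<notin> sets (dmeas d)" "A \<notin> sets (dmeas h)" by (simp_all add: rho_def)
      then have "emeasure (rho c) A = 0" "emeasure (dmeas d) A = 0" "emeasure (dmeas h) A = 0" by (auto intro: emeasure_notin_sets)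
      then show ?thesis by simp
    qed
  qed
  show "is_density d (emeasure (dmeas d))" unfolding is_density_def
    using cd by (auto simp: constrained_density_def emeasure_dmeas)
qed

lemma band_measure:
  assumes bd: "band_density h p q"
  shows "cond_pos (dmeas h)" "supp_of (emeasure (dmeas h)) = {p..q}" "is_density h (emeasure (dmeas h))"
    "AE x in dmeas h. p \<le> x \<and> x \<le> q"
proof -
  have m[measurable]: "h \<in> borel_measurable borel" using bd by (auto simp: band_density_def)
  obtain K where K: "\<And>x. h x \<le> K * wt x" using bd by (auto simp: band_density_def)
  have nn: "\<And>x. 0 \<le> h x" using bd by (simp add: band_density_def)
  note F = finite_measure_density_wt[OF m nn K]
  have pq: "0 \<le> p" "p < q" using bd by (auto simp: band_density_def)
  have out: "h x = 0" if "x \<le> p \<or> q \<le> x" for x using bd that unfolding band_density_def by blast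
  show "cond_pos (dmeas h)" unfolding cond_pos_def
  proof (intro conjI)
    show "borel_meas (dmeas h)" by (simp add: borel_meas_def)
    have z: "ennreal (h x) * indicator {..<0} x = 0" for x using out[of x] pq by (auto simp: indicator_def)
    show "emeasure (dmeas h) {..<0} = 0" by (simp only: emeasure_dmeas[OF m borel_open[OF open_lessThan]] z nn_integral_const) simp
    show "emeasure (dmeas h) UNIV = 1" using F(3) bd by (simp add: band_density_def)
  qed
  have "supp_of (emeasure (dmeas h)) = closure {p<..<q}"
    by (rule supp_of_dmeas) (use bd pq in \<open>auto simp: band_density_def\<close>)
  then show "supp_of (emeasure (dmeas h)) = {p..q}" using pq by simp
  show "is_density h (emeasure (dmeas h))" unfolding is_density_def using nn by (auto simp: emeasure_dmeas)
  show "AE x in dmeas h. p \<le> x \<and> x \<le> q"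
  proof (subst AE_density)
    show "AE x in lborel. 0 < ennreal (h x) \<longrightarrow> p \<le> x \<and> x \<le> q"
    proof (rule AE_I2)
      fix x show "0 < ennreal (h x) \<longrightarrow> p \<le> x \<and> x \<le> q" using out[of x] by (cases "x \<le> p \<or> q \<le> x") auto
    qed
  qed measurable
qed

text \<open>Bathtub principle: under a cap, mass should first fill the region where \<open>L\<close>
  is below \<open>l\<close>. That region lies in (-r, 0], where d = 0 and \<open>h\<close> is the
  cap itself, so no admissible \<nu> integrates l - L to more than \<open>h\<close> does. Elsewhere
  on the negative axis L = l, and the total masses agree.\<close>

lemma constrained_linear:
  fixes L :: "real \<Rightarrow> real"
  assumes cd: "constrained_density c h d r" and \<nu>: "cond_neg (rho c) \<nu>"
    and L: "\<And>x. x \<le> 0 \<Longrightarrow> L x \<le> l" "\<And>x. x \<le> -r \<Longrightarrow> L x = l"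
    and i: "integrable \<nu> L" "integrable (dmeas h) L"
  shows "(\<integral>x. L x \<partial>dmeas h) \<le> (\<integral>x. L x \<partial>\<nu>)"
proof -
  have cn: "cond_neg (rho c) \<mu> \<Longrightarrow> borel_meas \<mu> \<and> emeasure \<mu> UNIV = ennreal (1/2) \<and> emeasure \<mu> {0<..} = 0" for \<mu>
    by (simp add: cond_neg_def)
  note cmu = constrained_measure(1)[OF cd]
  note N = measure_cond[of \<nu> "1/2"] and M = measure_cond[of "dmeas h" "1/2"]
  have sn: "sets \<nu> = sets borel" and fn: "finite_measure \<nu>" and mn: "measure \<nu> UNIV = 1/2" and spn: "space \<nu> = UNIV" using N cn[OF \<nu>] by auto
  have fm: "finite_measure (dmeas h)" and mm: "measure (dmeas h) UNIV = 1/2" using M cn[OF cmu] by auto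
  have [measurable]: "h \<in> borel_measurable borel" "d \<in> borel_measurable borel" using cd by (auto simp: constrained_density_def)
  have [measurable]: "L \<in> borel_measurable borel" using borel_measurable_integrable[OF i(2)] by simp
  define I where "I = {-r<..0}"
  \<comment> \<open>On the negative half line this agrees with l - L, which vanishes at and left of
    -r. The cut makes it nonnegative everywhere, so it can be integrated against the infinite
    measure \<open>rho c\<close>.\<close>
  define g where "g x = (l - L x) * indicator I x" for x
  have [measurable]: "g \<in> borel_measurable borel" unfolding g_def[abs_def] I_def by measurable
  have gnn: "g x \<ge> 0" for x using L(1)[of x] by (auto simp: g_def I_def indicator_def)
  have ev: "AE x in \<mu>. l - L x = g x" if "cond_neg (rho c) \<mu>" for \<mu>
  proof (rule AE_I)
    show "{x \<in> space \<mu>. l - L x \<noteq> g x} \<subseteq> {0<..}" using L(2) by (auto simp: g_def I_def indicator_def not_less not_le)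
    show "emeasure \<mu> {0<..} = 0" using cn[OF that] by simp
    show "{0<..} \<in> sets \<mu>" using cn[OF that] by (simp add: borel_meas_def)
  qed
  have gi: "integrable \<mu> g" "(\<integral>x. g x \<partial>\<mu>) = l * (1/2) - (\<integral>x. L x \<partial>\<mu>)" if \<mu>: "cond_neg (rho c) \<mu>" and iL: "integrable \<mu> L" for \<mu>
  proof -
    have [measurable_cong]: "sets \<mu> = sets borel" using cn[OF \<mu>] by (simp add: borel_meas_def)
    have f: "finite_measure \<mu>" "measure \<mu> UNIV = 1/2" "space \<mu> = UNIV" using measure_cond[of \<mu> "1/2"] cn[OF \<mu>] by auto
    have il: "integrable \<mu> (\<lambda>x. l - L x)" using finite_measure.integrable_const[OF f(1)] iL by (intro Bochner_Integration.integrable_diff)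
    show "integrable \<mu> g" using integrable_cong_AE[OF _ _ ev[OF \<mu>]] il by simp
    have "(\<integral>x. g x \<partial>\<mu>) = (\<integral>x. l - L x \<partial>\<mu>)" using integral_cong_AE[OF _ _ ev[OF \<mu>]] by simp
    also have "\<dots> = (\<integral>x. l \<partial>\<mu>) - (\<integral>x. L x \<partial>\<mu>)" using finite_measure.integrable_const[OF f(1)] iL by (intro Bochner_Integration.integral_diff)
    finally show "(\<integral>x. g x \<partial>\<mu>) = l * (1/2) - (\<integral>x. L x \<partial>\<mu>)" using f by simp
  qed
  have "(\<integral>\<^sup>+x. ennreal (g x) \<partial>\<nu>) \<le> (\<integral>\<^sup>+x. ennreal (g x) \<partial>dmeas h)"
  proof -
    have "\<nu> \<le> rho c"
    proof (subst le_measure)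
      show "sets \<nu> = sets (rho c)" by (simp add: sn rho_def)
      show "\<forall>A\<in>sets \<nu>. emeasure \<nu> A \<le> emeasure (rho c) A" using \<nu> sn by (simp add: cond_neg_def)
    qed
    then have "(\<integral>\<^sup>+x. ennreal (g x) \<partial>\<nu>) \<le> (\<integral>\<^sup>+x. ennreal (g x) \<partial>rho c)"
      by (intro nn_integral_mono_measure) (auto simp: sn rho_def)
    also have "rho c = dmeas (\<lambda>x. indicator {..0} x * (c / pi) * \<bar>x\<bar> powr (-1/2))" by (simp add: rho_def)
    also have "(\<integral>\<^sup>+x. ennreal (g x) \<partial>\<dots>) = (\<integral>\<^sup>+x. ennreal (indicator {..0} x * (c / pi) * \<bar>x\<bar> powr (-1/2)) * ennreal (g x) \<partial>lborel)"
      by (subst nn_integral_density) auto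
    also have "\<dots> = (\<integral>\<^sup>+x. ennreal (h x) * ennreal (g x) \<partial>lborel)"
    proof (rule nn_integral_cong_AE)
      have "AE x in lborel. x \<noteq> (0::real)" by (rule AE_lborel_singleton)
      then show "AE x in lborel. ennreal (indicator {..0} x * (c / pi) * \<bar>x\<bar> powr (-1/2)) * ennreal (g x) = ennreal (h x) * ennreal (g x)"
      proof eventually_elim
        case (elim x)
        show ?case
        proof (cases "x \<in> I")
          case True
          then have x: "x < 0" "-r \<le> x" using elim by (auto simp: I_def)
          have "\<bar>x\<bar> powr (-1/2) = 1 / sqrt \<bar>x\<bar>" using x by (simp add: powr_minus_divide powr_half_sqrt)
          moreover have "h x + d x = c / (pi * sqrt \<bar>x\<bar>)" "d x = 0" using cd x by (auto simp: constrained_density_def)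
          ultimately show ?thesis using x by simp
        qed (simp add: g_def)
      qed
    qed
    also have "\<dots> = (\<integral>\<^sup>+x. ennreal (g x) \<partial>dmeas h)" by (subst nn_integral_density) auto
    finally show ?thesis .
  qed
  then have "ennreal (\<integral>x. g x \<partial>\<nu>) \<le> ennreal (\<integral>x. g x \<partial>dmeas h)"
    using nn_integral_eq_integral[OF gi(1)[OF \<nu> i(1)]] nn_integral_eq_integral[OF gi(1)[OF cmu i(2)]] gnn by simp
  moreover have "(\<integral>x. g x \<partial>dmeas h) \<ge> 0" by (rule Bochner_Integration.integral_nonneg) (rule gnn)
  ultimately have "(\<integral>x. g x \<partial>\<nu>) \<le> (\<integral>x. g x \<partial>dmeas h)" by (simp add: ennreal_le_iff)
  then show ?thesis unfolding gi(2)[OF \<nu> i(1)] gi(2)[OF cmu i(2)] by simp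
qed

lemma band_linear:
  fixes L :: "real \<Rightarrow> real"
  assumes bd: "band_density h p q" and \<nu>: "cond_pos \<nu>"
    and L: "\<And>x. x \<ge> 0 \<Longrightarrow> l \<le> L x" "\<And>x. p \<le> x \<Longrightarrow> x \<le> q \<Longrightarrow> L x = l"
    and i: "integrable \<nu> L" "integrable (dmeas h) L"
  shows "(\<integral>x. L x \<partial>dmeas h) \<le> (\<integral>x. L x \<partial>\<nu>)"
proof -
  have N: "borel_meas \<nu>" "emeasure \<nu> UNIV = ennreal 1" "emeasure \<nu> {..<0} = 0" using \<nu> by (auto simp: cond_pos_def)
  have M: "borel_meas (dmeas h)" "emeasure (dmeas h) UNIV = ennreal 1" using band_measure(1)[OF bd] by (auto simp: cond_pos_def)
  note N' = measure_cond[OF N(1,2)] and M' = measure_cond[OF M]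
  have "AE x in \<nu>. l \<le> L x"
  proof (rule AE_I)
    show "{x \<in> space \<nu>. \<not> l \<le> L x} \<subseteq> {..<0}" using L(1) by (auto simp: not_less[symmetric])
    show "emeasure \<nu> {..<0} = 0" by (rule N(3))
    show "{..<0} \<in> sets \<nu>" using N'(1) by simp
  qed
  then have "(\<integral>x. l \<partial>\<nu>) \<le> (\<integral>x. L x \<partial>\<nu>)"
    using i(1) finite_measure.integrable_const[OF N'(3)] by (intro integral_mono_AE) auto
  moreover have "(\<integral>x. L x \<partial>dmeas h) = (\<integral>x. l \<partial>dmeas h)"
  proof (rule integral_cong_AE)
    show "AE x in dmeas h. L x = l" using band_measure(4)[OF bd] by eventually_elim (use L(2) in auto)
  qed (use borel_measurable_integrable[OF i(2)] in auto)
  ultimately show ?thesis using N'(2,4) M'(4) by simp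
qed

text \<open>Expansion about the candidate: the energy of a competitor exceeds that of the candidate
  by the positive definite form of the differences plus three linear terms. The integrands of the
  latter are the Euler--Lagrange functions, so \<open>constrained_linear\<close> and
  \<open>band_linear\<close> make each of them nonnegative.\<close>

lemma energy_difference:
  fixes a b t :: real
  assumes c1: "constrained_density \<alpha> h1 d1 r1" and c3: "constrained_density \<beta> h3 d3 r3" and bd: "band_density h2 p q"
    and EL1: "constrained_EL h1 h2 r1" and EL3: "constrained_EL h3 h2 r3"
    and EL2: "\<And>x. x \<ge> 0 \<Longrightarrow> l \<le> logpot h1 x + logpot h3 x - 2 * logpot h2 x + extV a b t x"
      "\<And>x. p \<le> x \<Longrightarrow> x \<le> q \<Longrightarrow> logpot h1 x + logpot h3 x - 2 * logpot h2 x + extV a b t x = l"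
    and rho: "rho1 a t = rho \<alpha>" "rho3 b t = rho \<beta>" and ab: "a > 0" "b > 0" "0 < t" "t < 1"
  shows "admissible a b t (dmeas h1) (dmeas h2) (dmeas h3)"
    "admissible a b t \<nu>1 \<nu>2 \<nu>3 \<Longrightarrow> energy a b t (dmeas h1) (dmeas h2) (dmeas h3) \<le> energy a b t \<nu>1 \<nu>2 \<nu>3"
    "admissible a b t \<nu>1 \<nu>2 \<nu>3 \<Longrightarrow> energy a b t \<nu>1 \<nu>2 \<nu>3 \<le> energy a b t (dmeas h1) (dmeas h2) (dmeas h3)
      \<Longrightarrow> \<nu>1 = dmeas h1 \<and> \<nu>2 = dmeas h2 \<and> \<nu>3 = dmeas h3"
proof -
  let ?m1 = "dmeas h1" and ?m2 = "dmeas h2" and ?m3 = "dmeas h3" and ?V = "extV a b t"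
  have hm: "h1 \<in> borel_measurable borel" "h2 \<in> borel_measurable borel" "h3 \<in> borel_measurable borel"
    using c1 c3 bd by (auto simp: constrained_density_def band_density_def)
  have nn: "\<And>x. 0 \<le> h1 x" "\<And>x. 0 \<le> h2 x" "\<And>x. 0 \<le> h3 x"
    using c1 c3 bd by (auto simp: constrained_density_def band_density_def)
  obtain K1 where K1: "\<And>x. h1 x \<le> K1 * wt x" using c1 by (auto simp: constrained_density_def)
  obtain K2 where K2: "\<And>x. h2 x \<le> K2 * wt x" using bd by (auto simp: band_density_def)
  obtain K3 where K3: "\<And>x. h3 x \<le> K3 * wt x" using c3 by (auto simp: constrained_density_def)
  have pot1: "log_finite \<nu> ?m1" "log_finite ?m1 \<nu>" "integrable \<nu> (logpot h1)" "logI \<nu> ?m1 = - (\<integral>x. logpot h1 x \<partial>\<nu>)" "logI ?m1 \<nu> = - (\<integral>x. logpot h1 x \<partial>\<nu>)"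
    if "finite_measure \<nu>" "sets \<nu> = sets borel" "integrable \<nu> (\<lambda>x. ln (1 + \<bar>x\<bar>))" for \<nu>
    using log_finite_density[OF hm(1) nn(1) K1 that] unfolding logpot_def[abs_def] by auto
  have pot2: "log_finite \<nu> ?m2" "log_finite ?m2 \<nu>" "integrable \<nu> (logpot h2)" "logI \<nu> ?m2 = - (\<integral>x. logpot h2 x \<partial>\<nu>)" "logI ?m2 \<nu> = - (\<integral>x. logpot h2 x \<partial>\<nu>)"
    if "finite_measure \<nu>" "sets \<nu> = sets borel" "integrable \<nu> (\<lambda>x. ln (1 + \<bar>x\<bar>))" for \<nu>
    using log_finite_density[OF hm(2) nn(2) K2 that] unfolding logpot_def[abs_def] by auto
  have pot3: "log_finite \<nu> ?m3" "log_finite ?m3 \<nu>" "integrable \<nu> (logpot h3)" "logI \<nu> ?m3 = - (\<integral>x. logpot h3 x \<partial>\<nu>)" "logI ?m3 \<nu> = - (\<integral>x. logpot h3 x \<partial>\<nu>)"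
    if "finite_measure \<nu>" "sets \<nu> = sets borel" "integrable \<nu> (\<lambda>x. ln (1 + \<bar>x\<bar>))" for \<nu>
    using log_finite_density[OF hm(3) nn(3) K3 that] unfolding logpot_def[abs_def] by auto
  have good: "finite_measure ?m1 \<and> sets ?m1 = sets borel \<and> integrable ?m1 (\<lambda>x. ln (1 + \<bar>x\<bar>))"
    "finite_measure ?m2 \<and> sets ?m2 = sets borel \<and> integrable ?m2 (\<lambda>x. ln (1 + \<bar>x\<bar>))"
    "finite_measure ?m3 \<and> sets ?m3 = sets borel \<and> integrable ?m3 (\<lambda>x. ln (1 + \<bar>x\<bar>))"
    using finite_measure_density_wt(2)[OF hm(1) nn(1) K1] dmeas_ln_integrable[OF hm(1) nn(1) K1]
      finite_measure_density_wt(2)[OF hm(2) nn(2) K2] dmeas_ln_integrable[OF hm(2) nn(2) K2]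
      finite_measure_density_wt(2)[OF hm(3) nn(3) K3] dmeas_ln_integrable[OF hm(3) nn(3) K3] by auto
  note g1 = good(1)[THEN conjunct1] good(1)[THEN conjunct2, THEN conjunct1] good(1)[THEN conjunct2, THEN conjunct2]
    and g2 = good(2)[THEN conjunct1] good(2)[THEN conjunct2, THEN conjunct1] good(2)[THEN conjunct2, THEN conjunct2]
    and g3 = good(3)[THEN conjunct1] good(3)[THEN conjunct2, THEN conjunct1] good(3)[THEN conjunct2, THEN conjunct2]
  have Vm: "?V \<in> borel_measurable borel" unfolding extV_def[abs_def] by measurable
  have Vi: "integrable ?m2 ?V"
  proof (rule finite_measure.integrable_const_bound)
    show "finite_measure ?m2" using good by simp
    show "AE x in ?m2. norm (?V x) \<le> q / (t * (1 - t)) + 2 * sqrt (a * q) / t + 2 * sqrt (b * q) / (1 - t)"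
      using band_measure(4)[OF bd]
    proof eventually_elim
      case (elim x)
      have x: "0 \<le> x" "x \<le> q" using elim bd by (auto simp: band_density_def)
      have n: "0 \<le> x / (t * (1 - t))" "0 \<le> 2 * sqrt (a * x) / t" "0 \<le> 2 * sqrt (b * x) / (1 - t)" using x ab by auto
      have m: "x / (t * (1 - t)) \<le> q / (t * (1 - t))" "2 * sqrt (a * x) / t \<le> 2 * sqrt (a * q) / t" "2 * sqrt (b * x) / (1 - t) \<le> 2 * sqrt (b * q) / (1 - t)"
        using x ab by (auto intro!: divide_right_mono)
      show ?case unfolding extV_def real_norm_def using n m by (simp only: abs_le_iff) argo
    qed
    show "?V \<in> borel_measurable ?m2" using Vm by simp
  qed
  show adm: "admissible a b t ?m1 ?m2 ?m3"
    unfolding admissible_def finite_energy_def rho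
  proof (intro conjI)
    show "cond_neg (rho \<alpha>) ?m1" by (rule constrained_measure(1)[OF c1])
    show "cond_pos ?m2" by (rule band_measure(1)[OF bd])
    show "cond_neg (rho \<beta>) ?m3" by (rule constrained_measure(1)[OF c3])
  qed (rule pot1(1)[OF g1] pot2(1)[OF g2] pot3(1)[OF g3] pot2(1)[OF g1] pot3(1)[OF g2] Vi)+
  \<comment> \<open>\<open>Q\<close> is the quadratic form; its sign gives minimality and its
    vanishing gives uniqueness.\<close>
  have main: "\<exists>Q. Q \<ge> 0 \<and> energy a b t ?m1 ?m2 ?m3 + Q \<le> energy a b t \<nu>1 \<nu>2 \<nu>3 \<and> (Q = 0 \<longrightarrow> \<nu>1 = ?m1 \<and> \<nu>2 = ?m2 \<and> \<nu>3 = ?m3)"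
    if ad: "admissible a b t \<nu>1 \<nu>2 \<nu>3" for \<nu>1 \<nu>2 \<nu>3
  proof -
    have n: "cond_neg (rho \<alpha>) \<nu>1" "cond_pos \<nu>2" "cond_neg (rho \<beta>) \<nu>3" and fe: "finite_energy a b t \<nu>1 \<nu>2 \<nu>3"
      using ad unfolding admissible_def rho by auto
    have lf: "log_finite \<nu>1 \<nu>1" "log_finite \<nu>2 \<nu>2" "log_finite \<nu>3 \<nu>3" "log_finite \<nu>1 \<nu>2" "log_finite \<nu>2 \<nu>3" "integrable \<nu>2 ?V"
      using fe by (auto simp: finite_energy_def)
    have e: "emeasure \<nu>1 UNIV = ennreal (1/2)" "emeasure \<nu>2 UNIV = ennreal 1" "emeasure \<nu>3 UNIV = ennreal (1/2)"
      "borel_meas \<nu>1" "borel_meas \<nu>2" "borel_meas \<nu>3" using n by (auto simp: cond_neg_def cond_pos_def)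
    have e': "emeasure ?m1 UNIV = ennreal (1/2)" "emeasure ?m2 UNIV = ennreal 1" "emeasure ?m3 UNIV = ennreal (1/2)"
      "borel_meas ?m1" "borel_meas ?m2" "borel_meas ?m3"
      using constrained_measure(1)[OF c1] constrained_measure(1)[OF c3] band_measure(1)[OF bd] by (auto simp: cond_neg_def cond_pos_def)
    have mc: "sets \<nu>1 = sets borel" "finite_measure \<nu>1" "measure \<nu>1 UNIV = 1/2"
      "sets \<nu>2 = sets borel" "finite_measure \<nu>2" "measure \<nu>2 UNIV = 1"
      "sets \<nu>3 = sets borel" "finite_measure \<nu>3" "measure \<nu>3 UNIV = 1/2"
      using measure_cond[OF e(4) e(1)] measure_cond[OF e(5) e(2)] measure_cond[OF e(6) e(3)] by auto
    have mc': "measure ?m1 UNIV = 1/2" "measure ?m2 UNIV = 1" "measure ?m3 UNIV = 1/2"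
      using measure_cond[OF e'(4) e'(1)] measure_cond[OF e'(5) e'(2)] measure_cond[OF e'(6) e'(3)] by auto
    \<comment> \<open>Finite self-energy and positive mass give the competitors a logarithmic
      moment, from which finiteness of their mixed energies with the candidate follows.\<close>
    have ln: "integrable \<nu>1 (\<lambda>x. ln (1 + \<bar>x\<bar>))" "integrable \<nu>2 (\<lambda>x. ln (1 + \<bar>x\<bar>))" "integrable \<nu>3 (\<lambda>x. ln (1 + \<bar>x\<bar>))"
      using log_integrable_of_log_finite[OF mc(2,1) _ lf(1)] log_integrable_of_log_finite[OF mc(5,4) _ lf(2)]
        log_integrable_of_log_finite[OF mc(8,7) _ lf(3)] e by auto
    note n1 = mc(2,1) ln(1) and n2 = mc(5,4) ln(2) and n3 = mc(8,7) ln(3)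
    define Q where "Q = (logI \<nu>1 \<nu>1 - 2 * logI \<nu>1 ?m1 + logI ?m1 ?m1) + (logI \<nu>2 \<nu>2 - 2 * logI \<nu>2 ?m2 + logI ?m2 ?m2)
     + (logI \<nu>3 \<nu>3 - 2 * logI \<nu>3 ?m3 + logI ?m3 ?m3)
     - (logI \<nu>1 \<nu>2 - logI \<nu>1 ?m2 - logI ?m1 \<nu>2 + logI ?m1 ?m2)
     - (logI \<nu>2 \<nu>3 - logI \<nu>2 ?m3 - logI ?m2 \<nu>3 + logI ?m2 ?m3)"
    have ms: "measure \<nu>1 UNIV = measure ?m1 UNIV" "measure \<nu>2 UNIV = measure ?m2 UNIV" "measure \<nu>3 UNIV = measure ?m3 UNIV"
      using mc mc' by simp_all
    note PD = energy_form_posdef[OF g1(1) g2(1) g3(1) n1(1) n2(1) n3(1) g1(2) g2(2) g3(2) n1(2) n2(2) n3(2) ms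
      lf(1) pot1(1)[OF n1] pot1(1)[OF g1] lf(2) pot2(1)[OF n2] pot2(1)[OF g2] lf(3) pot3(1)[OF n3] pot3(1)[OF g3]
      lf(4) pot2(1)[OF n1] pot1(2)[OF n2] pot2(1)[OF g1] lf(5) pot3(1)[OF n2] pot2(2)[OF n3] pot3(1)[OF g2], folded Q_def]
    obtain l1 where l1: "\<And>x. x \<le> 0 \<Longrightarrow> logpot h2 x - 2 * logpot h1 x \<le> l1" "\<And>x. x \<le> -r1 \<Longrightarrow> logpot h2 x - 2 * logpot h1 x = l1"
      using EL1 unfolding constrained_EL_def by blast
    obtain l3 where l3: "\<And>x. x \<le> 0 \<Longrightarrow> logpot h2 x - 2 * logpot h3 x \<le> l3" "\<And>x. x \<le> -r3 \<Longrightarrow> logpot h2 x - 2 * logpot h3 x = l3"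
      using EL3 unfolding constrained_EL_def by blast
    note ip1 = pot1(3)[OF n1] pot1(3)[OF g1] pot2(3)[OF n1] pot2(3)[OF g1]
    note ip3 = pot3(3)[OF n3] pot3(3)[OF g3] pot2(3)[OF n3] pot2(3)[OF g3]
    note ip2 = pot1(3)[OF n2] pot1(3)[OF g2] pot2(3)[OF n2] pot2(3)[OF g2] pot3(3)[OF n2] pot3(3)[OF g2]
    have B1: "(\<integral>x. logpot h2 x - 2 * logpot h1 x \<partial>?m1) \<le> (\<integral>x. logpot h2 x - 2 * logpot h1 x \<partial>\<nu>1)"
      using ip1 by (intro constrained_linear[OF c1 n(1) l1]) auto
    have B3: "(\<integral>x. logpot h2 x - 2 * logpot h3 x \<partial>?m3) \<le> (\<integral>x. logpot h2 x - 2 * logpot h3 x \<partial>\<nu>3)"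
      using ip3 by (intro constrained_linear[OF c3 n(3) l3]) auto
    have B2: "(\<integral>x. logpot h1 x + logpot h3 x - 2 * logpot h2 x + ?V x \<partial>?m2) \<le> (\<integral>x. logpot h1 x + logpot h3 x - 2 * logpot h2 x + ?V x \<partial>\<nu>2)"
      using ip2 Vi lf(6) by (intro band_linear[OF bd n(2) EL2]) auto
    have s1: "(\<integral>x. logpot h2 x - 2 * logpot h1 x \<partial>\<nu>) = (\<integral>x. logpot h2 x \<partial>\<nu>) - 2 * (\<integral>x. logpot h1 x \<partial>\<nu>)"
      if "integrable \<nu> (logpot h1)" "integrable \<nu> (logpot h2)" for \<nu> using that by simp
    have s3: "(\<integral>x. logpot h2 x - 2 * logpot h3 x \<partial>\<nu>) = (\<integral>x. logpot h2 x \<partial>\<nu>) - 2 * (\<integral>x. logpot h3 x \<partial>\<nu>)"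
      if "integrable \<nu> (logpot h3)" "integrable \<nu> (logpot h2)" for \<nu> using that by simp
    have s2: "(\<integral>x. logpot h1 x + logpot h3 x - 2 * logpot h2 x + ?V x \<partial>\<nu>) = (\<integral>x. logpot h1 x \<partial>\<nu>) + (\<integral>x. logpot h3 x \<partial>\<nu>) - 2 * (\<integral>x. logpot h2 x \<partial>\<nu>) + (\<integral>x. ?V x \<partial>\<nu>)"
      if "integrable \<nu> (logpot h1)" "integrable \<nu> (logpot h2)" "integrable \<nu> (logpot h3)" "integrable \<nu> ?V" for \<nu> using that by simp
    note B1' = B1[unfolded s1[OF ip1(1,3)] s1[OF ip1(2,4)]] and B3' = B3[unfolded s3[OF ip3(1,3)] s3[OF ip3(2,4)]]
      and B2' = B2[unfolded s2[OF ip2(1,3,5) lf(6)] s2[OF ip2(2,4,6) Vi]]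
    have sym: "logI ?m1 ?m2 = - (\<integral>x. logpot h2 x \<partial>?m1)" "logI ?m1 ?m2 = - (\<integral>x. logpot h1 x \<partial>?m2)"
      "logI ?m2 ?m3 = - (\<integral>x. logpot h3 x \<partial>?m2)" "logI ?m2 ?m3 = - (\<integral>x. logpot h2 x \<partial>?m3)"
      using pot2(4)[OF g1] pot1(5)[OF g2] pot3(4)[OF g2] pot2(5)[OF g3] by auto
    have cross: "logI \<nu>1 ?m1 = - (\<integral>x. logpot h1 x \<partial>\<nu>1)" "logI \<nu>2 ?m2 = - (\<integral>x. logpot h2 x \<partial>\<nu>2)" "logI \<nu>3 ?m3 = - (\<integral>x. logpot h3 x \<partial>\<nu>3)"
      "logI \<nu>1 ?m2 = - (\<integral>x. logpot h2 x \<partial>\<nu>1)" "logI ?m1 \<nu>2 = - (\<integral>x. logpot h1 x \<partial>\<nu>2)"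
      "logI \<nu>2 ?m3 = - (\<integral>x. logpot h3 x \<partial>\<nu>2)" "logI ?m2 \<nu>3 = - (\<integral>x. logpot h2 x \<partial>\<nu>3)"
      "logI ?m1 ?m1 = - (\<integral>x. logpot h1 x \<partial>?m1)" "logI ?m2 ?m2 = - (\<integral>x. logpot h2 x \<partial>?m2)" "logI ?m3 ?m3 = - (\<integral>x. logpot h3 x \<partial>?m3)"
      using pot1(4)[OF n1] pot2(4)[OF n2] pot3(4)[OF n3] pot2(4)[OF n1] pot1(5)[OF n2] pot3(4)[OF n2] pot2(5)[OF n3] pot1(4)[OF g1] pot2(4)[OF g2] pot3(4)[OF g3] by auto
    have "energy a b t ?m1 ?m2 ?m3 + Q \<le> energy a b t \<nu>1 \<nu>2 \<nu>3"
      using B1' B2' B3' sym unfolding energy_def Q_def cross by argo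
    moreover have "Q = 0 \<longrightarrow> \<nu>1 = ?m1 \<and> \<nu>2 = ?m2 \<and> \<nu>3 = ?m3" using PD(2) by (rule impI)
    ultimately show ?thesis using PD(1) by (intro exI[of _ Q] conjI)
  qed
  show "energy a b t ?m1 ?m2 ?m3 \<le> energy a b t \<nu>1 \<nu>2 \<nu>3" if "admissible a b t \<nu>1 \<nu>2 \<nu>3"
    using main[OF that] by fastforce
  show "\<nu>1 = ?m1 \<and> \<nu>2 = ?m2 \<and> \<nu>3 = ?m3" if ad: "admissible a b t \<nu>1 \<nu>2 \<nu>3" and le: "energy a b t \<nu>1 \<nu>2 \<nu>3 \<le> energy a b t ?m1 ?m2 ?m3"
  proof -
    obtain Q where Q: "Q \<ge> 0" "energy a b t ?m1 ?m2 ?m3 + Q \<le> energy a b t \<nu>1 \<nu>2 \<nu>3" "Q = 0 \<longrightarrow> \<nu>1 = ?m1 \<and> \<nu>2 = ?m2 \<and> \<nu>3 = ?m3"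
      using main[OF ad] by blast
    have "Q = 0" using Q(1,2) le by linarith
    then show ?thesis using Q(3) by blast
  qed
qed

theorem theorem2p1:
  fixes a b t :: real
  assumes "a > 0" and "b > 0" and "0 < t" and "t < 1"
  shows "\<exists>\<mu>1 \<mu>2 \<mu>3.
    is_minimizer a b t \<mu>1 \<mu>2 \<mu>3 \<and>
    (\<forall>\<nu>1 \<nu>2 \<nu>3. is_minimizer a b t \<nu>1 \<nu>2 \<nu>3 \<longrightarrow> \<nu>1 = \<mu>1 \<and> \<nu>2 = \<mu>2 \<and> \<nu>3 = \<mu>3) \<and>
    \<comment> \<open>(a)\<close>
    supp_of (emeasure \<mu>1) = {..0} \<and>
    (\<exists>r1 \<ge> 0. supp_of (\<lambda>A. emeasure (rho1 a t) A - emeasure \<mu>1 A) = {..-r1} \<and>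
       (r1 > 0 \<longrightarrow> (\<exists>g c. c > 0 \<and> is_density g (\<lambda>A. emeasure (rho1 a t) A - emeasure \<mu>1 A) \<and>
           ((\<lambda>x. g x / sqrt (- r1 - x)) \<longlongrightarrow> c) (at_left (- r1))))) \<and>
    \<comment> \<open>(b)\<close>
    (\<exists>p q. 0 \<le> p \<and> p < q \<and> supp_of (emeasure \<mu>2) = {p..q} \<and>
       (\<exists>h. is_density h (emeasure \<mu>2) \<and> real_analytic_on h {p<..<q} \<and>
          (\<exists>c > 0. ((\<lambda>x. h x / sqrt (q - x)) \<longlongrightarrow> c) (at_left q)) \<and>
          (p > 0 \<longrightarrow> (\<exists>c > 0. ((\<lambda>x. h x / sqrt (x - p)) \<longlongrightarrow> c) (at_right p))))) \<and>
    \<comment> \<open>(c)\<close>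
    supp_of (emeasure \<mu>3) = {..0} \<and>
    (\<exists>r3 \<ge> 0. supp_of (\<lambda>A. emeasure (rho3 b t) A - emeasure \<mu>3 A) = {..-r3} \<and>
       (r3 > 0 \<longrightarrow> (\<exists>g c. c > 0 \<and> is_density g (\<lambda>A. emeasure (rho3 b t) A - emeasure \<mu>3 A) \<and>
           ((\<lambda>x. g x / sqrt (- r3 - x)) \<longlongrightarrow> c) (at_left (- r3)))))"
proof -
  \<comment> \<open>In these parameters the constraints are \<open>rho \<alpha>\<close> and
    \<open>rho \<beta>\<close>, and the external field is \<gamma> x - 2(\<alpha>+\<beta>) sqrt x;
    the curve depends on a, b and t only through them.\<close>
  define \<alpha> \<beta> \<gamma> where "\<alpha> = sqrt a / t" and "\<beta> = sqrt b / (1 - t)" and "\<gamma> = 1 / (t * (1 - t))"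
  have pos: "\<alpha> > 0" "\<beta> > 0" "\<gamma> > 0" using assms by (auto simp: \<alpha>_def \<beta>_def \<gamma>_def)
  obtain u v B C D c0 c1 c2 c3 a1 a2 a3 k l where sc: "spectral_curve \<alpha> \<beta> \<gamma> u v B C D c0 c1 c2 c3 a1 a2 a3 k l"
    using spectral_curve_exists[OF pos] by blast
  obtain h1 d1 r1 h2 p q h3 d3 r3 l where H: "constrained_density \<alpha> h1 d1 r1" "constrained_density \<beta> h3 d3 r3" "band_density h2 p q"
      "constrained_EL h1 h2 r1" "constrained_EL h3 h2 r3"
    and EL: "\<And>x. x \<ge> 0 \<Longrightarrow> l \<le> logpot h1 x + logpot h3 x - 2 * logpot h2 x + \<gamma> * x - 2 * (\<alpha> + \<beta>) * sqrt x"
      "\<And>x. p \<le> x \<Longrightarrow> x \<le> q \<Longrightarrow> logpot h1 x + logpot h3 x - 2 * logpot h2 x + \<gamma> * x - 2 * (\<alpha> + \<beta>) * sqrt x = l"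
    using spectral_curve.equilibrium[OF sc] by blast
  have V: "extV a b t x = \<gamma> * x - 2 * (\<alpha> + \<beta>) * sqrt x" for x
    by (simp add: extV_def \<alpha>_def \<beta>_def \<gamma>_def real_sqrt_mult algebra_simps)
  have rho: "rho1 a t = rho \<alpha>" "rho3 b t = rho \<beta>" by (simp_all add: rho1_def rho3_def \<alpha>_def \<beta>_def)
  have EL': "l \<le> logpot h1 x + logpot h3 x - 2 * logpot h2 x + extV a b t x" if "x \<ge> 0" for x
    using EL(1)[OF that] unfolding V by simp
  have EL'': "logpot h1 x + logpot h3 x - 2 * logpot h2 x + extV a b t x = l" if "p \<le> x" "x \<le> q" for x
    using EL(2)[OF that] unfolding V by simp
  note E = energy_difference[OF H EL' EL'' rho assms]
  have min: "is_minimizer a b t (dmeas h1) (dmeas h2) (dmeas h3)" unfolding is_minimizer_def using E(1,2) by blast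
  have uniq: "\<nu>1 = dmeas h1 \<and> \<nu>2 = dmeas h2 \<and> \<nu>3 = dmeas h3" if "is_minimizer a b t \<nu>1 \<nu>2 \<nu>3" for \<nu>1 \<nu>2 \<nu>3
    using that E(1) unfolding is_minimizer_def by (intro E(3)) blast+
  have one: "\<exists>r\<ge>0. supp_of (\<lambda>A. emeasure (rho c) A - emeasure (dmeas h) A) = {..-r} \<and>
       (r > 0 \<longrightarrow> (\<exists>g c'. c' > 0 \<and> is_density g (\<lambda>A. emeasure (rho c) A - emeasure (dmeas h) A) \<and>
           ((\<lambda>x. g x / sqrt (- r - x)) \<longlongrightarrow> c') (at_left (- r))))"
    if "constrained_density c h d r" for c h d r
    unfolding constrained_measure(3)[OF that] using constrained_measure(4,5)[OF that] that unfolding constrained_density_def by blast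
  have two: "0 \<le> p \<and> p < q \<and> supp_of (emeasure (dmeas h2)) = {p..q} \<and>
       (\<exists>h. is_density h (emeasure (dmeas h2)) \<and> real_analytic_on h {p<..<q} \<and>
          (\<exists>c > 0. ((\<lambda>x. h x / sqrt (q - x)) \<longlongrightarrow> c) (at_left q)) \<and>
          (p > 0 \<longrightarrow> (\<exists>c > 0. ((\<lambda>x. h x / sqrt (x - p)) \<longlongrightarrow> c) (at_right p))))"
    using H(3) band_measure(2,3)[OF H(3)] unfolding band_density_def by blast
  show ?thesis unfolding rho
  proof (rule exI[of _ "dmeas h1"], rule exI[of _ "dmeas h2"], rule exI[of _ "dmeas h3"], intro conjI)
    show "is_minimizer a b t (dmeas h1) (dmeas h2) (dmeas h3)" by (rule min)
    show "\<forall>\<nu>1 \<nu>2 \<nu>3. is_minimizer a b t \<nu>1 \<nu>2 \<nu>3 \<longrightarrow> \<nu>1 = dmeas h1 \<and> \<nu>2 = dmeas h2 \<and> \<nu>3 = dmeas h3"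
      by (intro allI impI) (rule uniq)
    show "supp_of (emeasure (dmeas h1)) = {..0}" "supp_of (emeasure (dmeas h3)) = {..0}"
      by (rule constrained_measure(2)[OF H(1)], rule constrained_measure(2)[OF H(2)])
  qed (rule one[OF H(1)], (rule exI[of _ p], rule exI[of _ q], rule two), rule one[OF H(2)])
qed

end
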